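(* Let $\Omega\subset\mathbb{R}^N$ ($N>1$) be a bounded domain with $C^2$ boundary. For $i=1,2$ let $p_i\in C^1(\overline{\Omega})$ with $1<p_i^-\le p_i^+<N$, let $r_i,q_i,s_i\in L^\infty(\Omega)$ with $\operatorname{ess\,inf}_\Omega r_i,\operatorname{ess\,inf}_\Omega q_i,\operatorname{ess\,inf}_\Omega s_i\ge 1$, and let $\alpha_i,\gamma_i\in L^\infty(\Omega)$ with $\alpha_i,\gamma_i\ge 0$ a.e. in $\Omega$. Let $f_1,f_2,g_1,g_2:\overline{\Omega}\times\mathbb{R}\times\mathbb{R}\to\mathbb{R}$ be continuous. Suppose $(\underline{u}_1,\overline{u}_1)$, $(\underline{u}_2,\overline{u}_2)$ form a sub-supersolution of the system $$-\mathcal{A}(x,|v|_{L^{r_1(x)}})\Delta_{p_1(x)}u=f_1(x,u,v)|v|_{L^{q_1(x)}}^{\alpha_1(x)}+g_1(x,u,v)|v|_{L^{s_1(x)}}^{\gamma_1(x)}\ \text{in }\Omega,$$ $$-\mathcal{A}(x,|u|_{L^{r_2(x)}})\Delta_{p_2(x)}v=f_2(x,u,v)|u|_{L^{q_2(x)}}^{\alpha_2(x)}+g_2(x,u,v)|u|_{L^{s_2(x)}}^{\gamma_2(x)}\ \text{in }\Omega,\qquad u=v=0\ \text{on }\partial\Omega,$$ (in the sense defined in the context) with $\underline{u}_i>0$ a.e. in $\Omega$, $i=1,2$. Suppose $f_i(x,t,s),g_i(x,t,s)\ge 0$ for all $(x,t,s)\in\overline{\Omega}\times[0,|\overline{u}_1|_{L^\infty}]\times[0,|\overline{u}_2|_{L^\infty}]$,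 $i=1,2$, and that $\mathcal{A}:\overline{\Omega}\times(0,\infty)\to\mathbb{R}$ is continuous with $\mathcal{A}(x,t)>0$ on $\overline{\Omega}\times[\underline{\sigma},\overline{\sigma}]$, where $\underline{w}:=\min\{\underline{u}_1,\underline{u}_2\}$, $\overline{w}:=\max\{\overline{u}_1,\overline{u}_2\}$, $\underline{\sigma}:=\min\{|\underline{w}|_{L^{r_1(x)}},|\underline{w}|_{L^{r_2(x)}}\}$ and $\overline{\sigma}:=\max\{|\overline{w}|_{L^{r_1(x)}},|\overline{w}|_{L^{r_2(x)}}\}$. Then the system has a weak positive solution $(u_1,u_2)$ with $\underline{u}_i\le u_i\le\overline{u}_i$ a.e. in $\Omega$, $i=1,2$.
   Context: For $m\in L^\infty(\Omega)$, $m^+=\operatorname{ess\,sup}_\Omega m$, $m^-=\operatorname{ess\,inf}_\Omega m$. For measurable $m\ge1$, $L^{m(x)}(\Omega)$ is the variable exponent Lebesgue space with Luxemburg norm $|u|_{L^{m(x)}}=\inf\{\lambda>0:\int_\Omega|u/\lambda|^{m(x)}\le1\}$; $W^{1,p(x)}(\Omega)$ is the corresponding Sobolev space and $W_0^{1,p(x)}(\Omega)$ the closure of $C_0^\infty(\Omega)$ in it. $\Delta_{p(x)}u=\operatorname{div}(|\nabla u|^{p(x)-2}\nabla u)$. For measurable $u\le v$, $[u,v]$ denotes the set of measurable $w$ with $u\le w\le v$ a.e. A weak solution is a pair $(u_1,u_2)$ with $u_i\in W_0^{1,p_i(x)}(\Omega)\cap L^\infty(\Omega)$ and, for $i,j\in\{1,2\}$,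 $i\ne j$, and all $\varphi\in W_0^{1,p_i(x)}(\Omega)$: $\int_\Omega|\nabla u_i|^{p_i(x)-2}\nabla u_i\nabla\varphi=\int_\Omega\frac{f_i(x,u_1,u_2)|u_j|_{L^{q_i(x)}}^{\alpha_i(x)}+g_i(x,u_1,u_2)|u_j|_{L^{s_i(x)}}^{\gamma_i(x)}}{\mathcal{A}(x,|u_j|_{L^{r_i(x)}})}\varphi$. It is positive if $u_1,u_2>0$ in $\Omega$. Set $\tilde f_1(x,t,s)=f_1(x,t,s)$, $\tilde g_1(x,t,s)=g_1(x,t,s)$, $\tilde f_2(x,t,s)=f_2(x,s,t)$, $\tilde g_2(x,t,s)=g_2(x,s,t)$. The pairs $(\underline{u}_i,\overline{u}_i)$, $i=1,2$, form a sub-supersolution if $\underline{u}_i\in W_0^{1,p_i(x)}(\Omega)\cap L^\infty(\Omega)$, $\overline{u}_i\in W^{1,p_i(x)}(\Omega)\cap L^\infty(\Omega)$, $\underline{u}_i\le\overline{u}_i$, $\underline{u}_i=0\le\overline{u}_i$ on $\partial\Omega$, and for $i\ne j$, all $\varphi\in W_0^{1,p_i(x)}(\Omega)$ with $\varphi\ge0$ and all $w\in[\underline{u}_j,\overline{u}_j]$: $\int_\Omega|\nabla\underline{u}_i|^{p_i(x)-2}\nabla\underline{u}_i\nabla\varphi\le\int_\Omega\frac{\tilde f_i(x,\underline{u}_i,w)|\underline{u}_j|_{L^{q_i(x)}}^{\alpha_i(x)}+\tilde g_i(x,\underline{u}_i,w)|\underline{u}_j|_{L^{s_i(x)}}^{\gamma_i(x)}}{\mathcal{A}(x,|w|_{L^{r_i(x)}})}\varphi$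 and $\int_\Omega|\nabla\overline{u}_i|^{p_i(x)-2}\nabla\overline{u}_i\nabla\varphi\ge\int_\Omega\frac{\tilde f_i(x,\overline{u}_i,w)|\overline{u}_j|_{L^{q_i(x)}}^{\alpha_i(x)}+\tilde g_i(x,\overline{u}_i,w)|\overline{u}_j|_{L^{s_i(x)}}^{\gamma_i(x)}}{\mathcal{A}(x,|w|_{L^{r_i(x)}})}\varphi$. *)

theory Defs
  imports "HOL-Analysis.Analysis"
begin

definition pd :: "(real^'n \<Rightarrow> real) \<Rightarrow> 'n \<Rightarrow> real^'n \<Rightarrow> real" where
  "pd f j x = deriv (\<lambda>t. f (x + t *\<^sub>R axis j 1)) 0"

fun Ck_on :: "nat \<Rightarrow> (real^'n) set \<Rightarrow> (real^'n \<Rightarrow> real) \<Rightarrow> bool" where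
  "Ck_on 0 U f = continuous_on U f"
| "Ck_on (Suc k) U f =
     (continuous_on U f \<and>
      (\<forall>j. \<forall>x\<in>U. (\<lambda>t. f (x + t *\<^sub>R axis j 1)) differentiable (at 0)) \<and>
      (\<forall>j. Ck_on k U (pd f j)))"

definition C1_closure :: "(real^'n) set \<Rightarrow> (real^'n \<Rightarrow> real) \<Rightarrow> bool" where
  "C1_closure \<Omega> p \<longleftrightarrow> Ck_on 1 \<Omega> p \<and> continuous_on (closure \<Omega>) p \<and>
     (\<forall>j. \<exists>g. continuous_on (closure \<Omega>) g \<and> (\<forall>x\<in>\<Omega>. g x = pd p j x))"

definition C2_domain :: "(real^'n) set \<Rightarrow> bool" where
  "C2_domain \<Omega> \<longleftrightarrow> open \<Omega> \<and> connected \<Omega> \<and> \<Omega> \<noteq> {} \<and> bounded \<Omega> \<and>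
     (\<forall>x0\<in>frontier \<Omega>. \<exists>U \<psi>. open U \<and> x0 \<in> U \<and> Ck_on 2 U \<psi> \<and>
        (\<forall>x\<in>U. \<exists>j. pd \<psi> j x \<noteq> 0) \<and> \<Omega> \<inter> U = {x\<in>U. \<psi> x < 0})"

definition test_fun :: "(real^'n) set \<Rightarrow> (real^'n \<Rightarrow> real) \<Rightarrow> bool" where
  "test_fun \<Omega> \<phi> \<longleftrightarrow> (\<forall>k. Ck_on k UNIV \<phi>) \<and>
     compact (closure {x. \<phi> x \<noteq> 0}) \<and> closure {x. \<phi> x \<noteq> 0} \<subseteq> \<Omega>"

definition ess_sup :: "(real^'n) set \<Rightarrow> (real^'n \<Rightarrow> real) \<Rightarrow> real" where
  "ess_sup \<Omega> m = Inf {C. AE x in lebesgue_on \<Omega>. m x \<le> C}"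

definition ess_inf :: "(real^'n) set \<Rightarrow> (real^'n \<Rightarrow> real) \<Rightarrow> real" where
  "ess_inf \<Omega> m = Sup {c. AE x in lebesgue_on \<Omega>. c \<le> m x}"

definition Linf :: "(real^'n) set \<Rightarrow> (real^'n \<Rightarrow> real) set" where
  "Linf \<Omega> = {u. u \<in> borel_measurable (lebesgue_on \<Omega>) \<and>
                  (\<exists>C. AE x in lebesgue_on \<Omega>. \<bar>u x\<bar> \<le> C)}"

definition Linf_norm :: "(real^'n) set \<Rightarrow> (real^'n \<Rightarrow> real) \<Rightarrow> real" where
  "Linf_norm \<Omega> u = ess_sup \<Omega> (\<lambda>x. \<bar>u x\<bar>)"

definition modular :: "(real^'n) set \<Rightarrow> (real^'n \<Rightarrow> real) \<Rightarrow> (real^'n \<Rightarrow> real) \<Rightarrow> ennreal" where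
  "modular \<Omega> m u = (\<integral>\<^sup>+ x. ennreal (\<bar>u x\<bar> powr m x) \<partial>lebesgue_on \<Omega>)"

definition lux :: "(real^'n) set \<Rightarrow> (real^'n \<Rightarrow> real) \<Rightarrow> (real^'n \<Rightarrow> real) \<Rightarrow> real" where
  "lux \<Omega> m u = Inf {c. c > 0 \<and> modular \<Omega> m (\<lambda>x. u x / c) \<le> 1}"

definition Lvar :: "(real^'n) set \<Rightarrow> (real^'n \<Rightarrow> real) \<Rightarrow> (real^'n \<Rightarrow> real) set" where
  "Lvar \<Omega> m = {u. u \<in> borel_measurable (lebesgue_on \<Omega>) \<and>
                  (\<exists>c>0. modular \<Omega> m (\<lambda>x. u x / c) \<le> 1)}"

definition loc_integrable :: "(real^'n) set \<Rightarrow> (real^'n \<Rightarrow> real) \<Rightarrow> bool" where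
  "loc_integrable \<Omega> u \<longleftrightarrow> (\<forall>K. compact K \<and> K \<subseteq> \<Omega> \<longrightarrow> integrable (lebesgue_on K) u)"

definition weak_grad :: "(real^'n) set \<Rightarrow> (real^'n \<Rightarrow> real) \<Rightarrow> (real^'n \<Rightarrow> real^'n) \<Rightarrow> bool" where
  "weak_grad \<Omega> u G \<longleftrightarrow> loc_integrable \<Omega> u \<and> (\<forall>j. loc_integrable \<Omega> (\<lambda>x. G x $ j)) \<and>
     (\<forall>\<phi> j. test_fun \<Omega> \<phi> \<longrightarrow>
        (\<integral>x. u x * pd \<phi> j x \<partial>lebesgue_on \<Omega>) = - (\<integral>x. G x $ j * \<phi> x \<partial>lebesgue_on \<Omega>))"

definition wgrad :: "(real^'n) set \<Rightarrow> (real^'n \<Rightarrow> real) \<Rightarrow> real^'n \<Rightarrow> real^'n" where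
  "wgrad \<Omega> u = (SOME G. weak_grad \<Omega> u G)"

definition W1 :: "(real^'n) set \<Rightarrow> (real^'n \<Rightarrow> real) \<Rightarrow> (real^'n \<Rightarrow> real) set" where
  "W1 \<Omega> p = {u. u \<in> Lvar \<Omega> p \<and>
      (\<exists>G. weak_grad \<Omega> u G \<and> (\<lambda>x. norm (G x)) \<in> Lvar \<Omega> p)}"

definition W1_norm :: "(real^'n) set \<Rightarrow> (real^'n \<Rightarrow> real) \<Rightarrow> (real^'n \<Rightarrow> real) \<Rightarrow> real" where
  "W1_norm \<Omega> p u = lux \<Omega> p u + lux \<Omega> p (\<lambda>x. norm (wgrad \<Omega> u x))"

definition W10 :: "(real^'n) set \<Rightarrow> (real^'n \<Rightarrow> real) \<Rightarrow> (real^'n \<Rightarrow> real) set" where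
  "W10 \<Omega> p = {u. u \<in> W1 \<Omega> p \<and>
      (\<exists>\<phi>s. (\<forall>k. test_fun \<Omega> (\<phi>s k)) \<and>
            (\<lambda>k. W1_norm \<Omega> p (\<lambda>x. \<phi>s k x - u x)) \<longlonglongrightarrow> 0)}"

definition ival :: "(real^'n) set \<Rightarrow> (real^'n \<Rightarrow> real) \<Rightarrow> (real^'n \<Rightarrow> real) \<Rightarrow> (real^'n \<Rightarrow> real) set" where
  "ival \<Omega> lo hi = {w. w \<in> borel_measurable (lebesgue_on \<Omega>) \<and>
                     (AE x in lebesgue_on \<Omega>. lo x \<le> w x \<and> w x \<le> hi x)}"

definition plap_form :: "(real^'n) set \<Rightarrow> (real^'n \<Rightarrow> real) \<Rightarrow> (real^'n \<Rightarrow> real) \<Rightarrow> (real^'n \<Rightarrow> real) \<Rightarrow> real" where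
  "plap_form \<Omega> p u \<phi> = (\<integral>x. norm (wgrad \<Omega> u x) powr (p x - 2) * (wgrad \<Omega> u x \<bullet> wgrad \<Omega> \<phi> x) \<partial>lebesgue_on \<Omega>)"

text \<open>Right-hand side integral, with F, G the already evaluated nonlinearities,
  v the function whose norms appear, and w the function in the argument of A.\<close>
definition rhs_form :: "(real^'n) set \<Rightarrow> (real^'n \<Rightarrow> real) \<Rightarrow> (real^'n \<Rightarrow> real) \<Rightarrow> (real^'n \<Rightarrow> real)
   \<Rightarrow> (real^'n \<Rightarrow> real) \<Rightarrow> (real^'n \<Rightarrow> real) \<Rightarrow> (real^'n \<Rightarrow> real \<Rightarrow> real)
   \<Rightarrow> (real^'n \<Rightarrow> real) \<Rightarrow> (real^'n \<Rightarrow> real) \<Rightarrow> (real^'n \<Rightarrow> real) \<Rightarrow> (real^'n \<Rightarrow> real) \<Rightarrow> (real^'n \<Rightarrow> real) \<Rightarrow> real" where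
  "rhs_form \<Omega> q r s \<alpha> \<gamma> A F G v w \<phi> =
     (\<integral>x. (F x * lux \<Omega> q v powr \<alpha> x + G x * lux \<Omega> s v powr \<gamma> x) / A x (lux \<Omega> r w) * \<phi> x
        \<partial>lebesgue_on \<Omega>)"

definition weak_solution where
  "weak_solution \<Omega> p1 p2 q1 q2 r1 r2 s1 s2 \<alpha>1 \<alpha>2 \<gamma>1 \<gamma>2 f1 f2 g1 g2 A u1 u2 \<longleftrightarrow>
     u1 \<in> W10 \<Omega> p1 \<inter> Linf \<Omega> \<and> u2 \<in> W10 \<Omega> p2 \<inter> Linf \<Omega> \<and>
     (\<forall>\<phi>\<in>W10 \<Omega> p1. plap_form \<Omega> p1 u1 \<phi> =
        rhs_form \<Omega> q1 r1 s1 \<alpha>1 \<gamma>1 A (\<lambda>x. f1 x (u1 x) (u2 x)) (\<lambda>x. g1 x (u1 x) (u2 x)) u2 u2 \<phi>) \<and>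
     (\<forall>\<phi>\<in>W10 \<Omega> p2. plap_form \<Omega> p2 u2 \<phi> =
        rhs_form \<Omega> q2 r2 s2 \<alpha>2 \<gamma>2 A (\<lambda>x. f2 x (u1 x) (u2 x)) (\<lambda>x. g2 x (u1 x) (u2 x)) u1 u1 \<phi>)"

definition sub_ineq where
  "sub_ineq \<Omega> p q r s \<alpha> \<gamma> ft gt A ulo vlo vhi \<longleftrightarrow>
     (\<forall>\<phi>\<in>W10 \<Omega> p. (AE x in lebesgue_on \<Omega>. 0 \<le> \<phi> x) \<longrightarrow>
       (\<forall>w\<in>ival \<Omega> vlo vhi. plap_form \<Omega> p ulo \<phi> \<le>
          rhs_form \<Omega> q r s \<alpha> \<gamma> A (\<lambda>x. ft x (ulo x) (w x)) (\<lambda>x. gt x (ulo x) (w x)) vlo w \<phi>))"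

definition super_ineq where
  "super_ineq \<Omega> p q r s \<alpha> \<gamma> ft gt A uhi vhi vlo \<longleftrightarrow>
     (\<forall>\<phi>\<in>W10 \<Omega> p. (AE x in lebesgue_on \<Omega>. 0 \<le> \<phi> x) \<longrightarrow>
       (\<forall>w\<in>ival \<Omega> vlo vhi. plap_form \<Omega> p uhi \<phi> \<ge>
          rhs_form \<Omega> q r s \<alpha> \<gamma> A (\<lambda>x. ft x (uhi x) (w x)) (\<lambda>x. gt x (uhi x) (w x)) vhi w \<phi>))"

text \<open>Sub-supersolution pair.  "0 \<le> uhi on the boundary" is understood in the trace sense:
  the negative part of uhi lies in W_0^{1,p}.\<close>
definition sub_super where
  "sub_super \<Omega> p1 p2 q1 q2 r1 r2 s1 s2 \<alpha>1 \<alpha>2 \<gamma>1 \<gamma>2 f1 f2 g1 g2 A lo1 hi1 lo2 hi2 \<longleftrightarrow>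
     lo1 \<in> W10 \<Omega> p1 \<inter> Linf \<Omega> \<and> lo2 \<in> W10 \<Omega> p2 \<inter> Linf \<Omega> \<and>
     hi1 \<in> W1 \<Omega> p1 \<inter> Linf \<Omega> \<and> hi2 \<in> W1 \<Omega> p2 \<inter> Linf \<Omega> \<and>
     (AE x in lebesgue_on \<Omega>. lo1 x \<le> hi1 x) \<and> (AE x in lebesgue_on \<Omega>. lo2 x \<le> hi2 x) \<and>
     (\<lambda>x. max 0 (- hi1 x)) \<in> W10 \<Omega> p1 \<and> (\<lambda>x. max 0 (- hi2 x)) \<in> W10 \<Omega> p2 \<and>
     sub_ineq \<Omega> p1 q1 r1 s1 \<alpha>1 \<gamma>1 f1 g1 A lo1 lo2 hi2 \<and>
     super_ineq \<Omega> p1 q1 r1 s1 \<alpha>1 \<gamma>1 f1 g1 A hi1 hi2 lo2 \<and>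
     sub_ineq \<Omega> p2 q2 r2 s2 \<alpha>2 \<gamma>2 (\<lambda>x t s. f2 x s t) (\<lambda>x t s. g2 x s t) A lo2 lo1 hi1 \<and>
     super_ineq \<Omega> p2 q2 r2 s2 \<alpha>2 \<gamma>2 (\<lambda>x t s. f2 x s t) (\<lambda>x t s. g2 x s t) A hi2 hi1 lo1"

end

theory Submission
  imports Defs "HOL-Library.Diagonal_Subsequence"
begin

text \<open>Freeze the right-hand side of each equation at arguments truncated to the order interval between sub- and
  supersolution, so that it becomes bounded, and minimise the resulting \<open>p(x)\<close>-energy over the functions of
  \<open>W10\<close> bounded by a constant \<open>R\<close>. Uniform convexity makes the minimiser unique and continuous in the
  right-hand side with respect to the \<open>L1\<close> norm. If the arguments are replaced by their averages over the cells of a grid,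
  Brouwer's theorem gives a coupled pair of minimisers, and a translation estimate for functions of \<open>W10\<close> yields
  enough compactness to let the mesh size tend to \<open>0\<close>. Monotonicity of the Luxemburg norms, \<open>f, g \<ge> 0\<close> and \<open>A > 0\<close>
  allow testing with \<open>(lo - u)\<^sup>+\<close> and \<open>(u - hi)\<^sup>+\<close>, hence \<open>lo \<le> u \<le> hi\<close>; then neither the truncation nor the
  bound \<open>R\<close> is active and the minimisers solve the system. That \<open>(u - hi)\<^sup>+\<close> lies in \<open>W10\<close> although \<open>hi\<close> is only in
  \<open>W1\<close> rests on the density of test functions among compactly supported functions of \<open>W1\<close>, which holds because
  a \<open>C1\<close> exponent is log-Hoelder continuous.\<close>

text \<open>What replaces it is that the inequalities for \<open>lo\<close> and \<open>hi\<close>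
  hold for every \<open>w\<close> in the order interval of the other unknown. With \<open>w\<close>
  equal to that unknown, \<open>A\<close> and the second argument of \<open>f\<close>,
  \<open>g\<close> are the same as in the equation; only the norms in the numerator are frozen at
  \<open>lo\<close> or \<open>hi\<close>. Hence comparison needs monotonicity of the Luxemburg norms
  and signs, nothing else. The bound \<open>\<bar>u\<bar> \<le> R\<close> makes the linear part of
  the energy bounded, so that the energy controls gradients without an embedding theorem. Uniform
  convexity turns minimising sequences into Cauchy sequences, so weak topologies never enter.
  Convergence is measured by modulars: for bounded exponents this is equivalent to norm convergence,
  and the modular satisfies a triangle inequality with factor \<open>2 powr P\<close>.\<close>

abbreviation (input) seq_tendsto :: "(nat => 'a::topological_space) => 'a => bool" (infix "---->" 60) where
  "X ----> L == X \<longlonglongrightarrow> L"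

section \<open>Brouwer's theorem on cubes and translations of integrable functions\<close>

lemma bounded_diagonal_subsequence:
  fixes a :: "nat => nat => real"
  assumes "!!k i. \<bar>a k i\<bar> <= B i"
  obtains r where "strict_mono r" "!!i. convergent (%k. a (r k) i)"
proof -
  interpret subseqs "%i s. convergent (%k. a (s k) i)"
  proof
    fix i and s :: "nat => nat"
    have "bounded (range (%k. a (s k) i))"
      using assms by (auto simp: bounded_iff)
    then obtain l r where "strict_mono r" "((%k. a (s k) i) \<circ> r) ----> l"
      using bounded_imp_convergent_subsequence by blast
    then show "\<exists>r'. strict_mono r' & convergent (%k. a ((s \<circ> r') k) i)"
      by (auto simp: convergent_def o_def)
  qed
  have "convergent (%k. a (diagseq k) i)" for i
  proof -
    have "convergent (%k. a ((diagseq \<circ> (+) (Suc i)) k) i)"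
    proof (rule diagseq_holds)
      fix r s :: "nat => nat" and n
      assume "strict_mono r" "convergent (%k. a (s k) n)"
      then have "convergent ((%k. a (s k) n) \<circ> r)"
        by (intro convergent_subseq_convergent)
      then show "convergent (%k. a ((s \<circ> r) k) n)" by (simp add: o_def)
    qed
    then have "convergent (%k. a (diagseq (k + Suc i)) i)"
      by (simp add: add.commute)
    then show ?thesis
      using convergent_ignore_initial_segment[of "%k. a (diagseq k) i" "Suc i"] by simp
  qed
  with subseq_diagseq show ?thesis by (rule that)
qed

text \<open>Kuhn's combinatorial lemma on finer and finer grids gives cells that contain, for each
  coordinate, one point moved up and one moved down by \<Phi>; continuity at a limit of the cells
  gives equality. Points are functions on the naturals with \<open>n\<close> relevant coordinates,
  because the dimension will be twice the number of grid cells and so cannot be a type.\<close>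

lemma brouwer_cube_nat:
  fixes \<Phi> :: "(nat => real) => nat => real"
  assumes into: "!!c i. (\<forall>i<n. c i \<in> {0..1}) ==> i < n ==> \<Phi> c i \<in> {0..1}"
    and cont: "!!C c i. (\<forall>k. \<forall>i<n. C k i \<in> {0..1}) ==> (\<forall>i<n. (%k. C k i) ----> c i) ==> i < n
                 ==> (%k. \<Phi> (C k) i) ----> \<Phi> c i"
  obtains c where "\<forall>i<n. c i \<in> {0..1}" "\<forall>i<n. \<Phi> c i = c i"
proof -
  define X where "X m x = (%i. real (x i) / real (Suc m))" for m and x :: "nat => nat"
  \<comment> \<open>The values on the faces are those that \<open>kuhn_lemma\<close> demands. They
    agree with the sign of \<open>\<Phi> - id\<close> there because \<Phi> maps into the unit cube;
    \<open>lab0\<close> and \<open>lab1\<close> express this.\<close>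
  define label where "label m x i = (if x i = 0 then 0 else if x i = Suc m then 1
      else if \<Phi> (X m x) i >= X m x i then 0 else (1::nat))" for m x i
  have X01: "\<forall>i<n. X m x i \<in> {0..1}" if "\<forall>i<n. x i <= Suc m" for m x
    using that by (auto simp: X_def divide_simps)
  have lab0: "\<Phi> (X m x) i >= X m x i" if "\<forall>i<n. x i <= Suc m" "i < n" "label m x i = 0" for m x i
    using that into[OF X01[OF that(1)] that(2)] by (auto simp: label_def X_def split: if_splits)
  have lab1: "\<Phi> (X m x) i <= X m x i" if "\<forall>i<n. x i <= Suc m" "i < n" "label m x i = 1" for m x i
    using that into[OF X01[OF that(1)] that(2)] by (auto simp: label_def X_def split: if_splits)
  have "\<exists>q. (\<forall>i<n. q i < Suc m) & (\<forall>i<n. \<exists>r s. (\<forall>j<n. q j <= r j & r j <= q j + 1) \<and>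
      (\<forall>j<n. q j <= s j & s j <= q j + 1) & label m r i = 0 & label m s i = 1)" for m
  proof -
    obtain q where q: "\<forall>i<n. q i < Suc m"
      "\<forall>i<n. \<exists>r s. (\<forall>j<n. q j <= r j & r j <= q j + 1) \<and>
        (\<forall>j<n. q j <= s j & s j <= q j + 1) & label m r i ~= label m s i"
      by (rule kuhn_lemma[of "Suc m" n "label m"]) (auto simp: label_def)
    have "\<exists>r s. (\<forall>j<n. q j <= r j & r j <= q j + 1) \<and>
      (\<forall>j<n. q j <= s j & s j <= q j + 1) & label m r i = 0 & label m s i = 1" if "i < n" for i
    proof -
      obtain r s where rs: "\<forall>j<n. q j <= r j & r j <= q j + 1"
        "\<forall>j<n. q j <= s j & s j <= q j + 1" "label m r i ~= label m s i"
        using q(2)[rule_format, OF \<open>i < n\<close>] by blast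
      have "label m x i = 0 \<or> label m x i = 1" for x by (auto simp: label_def)
      then have "label m r i = 0 & label m s i = 1 \<or> label m s i = 0 & label m r i = 1"
        using rs(3) by metis
      with rs(1,2) show ?thesis by blast
    qed
    with q(1) show ?thesis by blast
  qed
  then obtain Q where Q': "!!m. (\<forall>i<n. Q m i < Suc m) & (\<forall>i<n. \<exists>r s. (\<forall>j<n. Q m j <= r j & r j <= Q m j + 1) \<and>
      (\<forall>j<n. Q m j <= s j & s j <= Q m j + 1) & label m r i = 0 & label m s i = 1)"
    by metis
  then have Q: "!!m i. i < n ==> Q m i < Suc m" by blast
  from Q' have "\<forall>m i. \<exists>r s. i < n --> (\<forall>j<n. Q m j <= r j & r j <= Q m j + 1) \<and>
      (\<forall>j<n. Q m j <= s j & s j <= Q m j + 1) & label m r i = 0 & label m s i = 1"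
    by blast
  then obtain R S where
        R: "!!m i j. i < n ==> j < n ==> Q m j <= R m i j & R m i j <= Q m j + 1"
    and S: "!!m i j. i < n ==> j < n ==> Q m j <= S m i j & S m i j <= Q m j + 1"
    and L: "!!m i. i < n ==> label m (R m i) i = 0" "!!m i. i < n ==> label m (S m i) i = 1"
    by metis
  \<comment> \<open>Only the base corners of the Kuhn cells are made convergent. The other corners
    differ from them by at most \<open>1 / Suc m\<close> in each coordinate and inherit the limit
    (\<open>near\<close>).\<close>
  define a where "a m i = (if i < n then X m (Q m) i else 0)" for m i
  have "\<bar>a m i\<bar> <= 1" for m i
    using Q[of i m] by (cases "i < n") (auto simp: a_def X_def divide_simps)
  then obtain \<sigma> where \<sigma>: "strict_mono \<sigma>" "!!i. convergent (%k. a (\<sigma> k) i)"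
    using bounded_diagonal_subsequence[of a "%_. 1"] by blast
  define c where "c i = lim (%k. a (\<sigma> k) i)" for i
  have ac: "(%k. a (\<sigma> k) i) ----> c i" for i
    unfolding c_def using \<sigma>(2) by (simp add: convergent_LIMSEQ_iff)
  have inv0: "(%k. 1 / real (Suc (\<sigma> k))) ----> 0"
    using LIMSEQ_subseq_LIMSEQ[OF LIMSEQ_Suc[OF lim_1_over_n] \<sigma>(1)] by (simp add: o_def)
  have near: "(%k. X (\<sigma> k) (T (\<sigma> k) i) j) ----> c j"
    if T: "!!m. Q m j <= T m i j & T m i j <= Q m j + 1" and "j < n"
    for T :: "nat => nat => nat => nat" and i j
  proof (rule tendsto_sandwich)
    show "(%k. a (\<sigma> k) j) ----> c j" by (rule ac)
    show "(%k. a (\<sigma> k) j + 1 / real (Suc (\<sigma> k))) ----> c j"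
      using tendsto_add[OF ac inv0] by simp
    show "\<forall>\<^sub>F k in sequentially. a (\<sigma> k) j <= X (\<sigma> k) (T (\<sigma> k) i) j"
      using T \<open>j < n\<close> by (auto simp: a_def X_def divide_right_mono)
    have "X m (T m i) j <= a m j + 1 / real (Suc m)" for m
      using T[of m] \<open>j < n\<close> by (auto simp: a_def X_def divide_simps)
    then show "\<forall>\<^sub>F k in sequentially. X (\<sigma> k) (T (\<sigma> k) i) j <= a (\<sigma> k) j + 1 / real (Suc (\<sigma> k))"
      by auto
  qed
  have grid: "\<forall>j<n. T m i j <= Suc m" if "!!m j. j < n ==> Q m j <= T m i j & T m i j <= Q m j + 1"
    for T :: "nat => nat => nat => nat" and m i
  proof safe
    fix j assume "j < n"
    then show "T m i j <= Suc m"
      using that[of j m] Q[of j m] by simp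
  qed
  have "\<Phi> c i = c i" if "i < n" for i
  proof (rule antisym)
    have 1: "(%k. \<Phi> (X (\<sigma> k) (R (\<sigma> k) i)) i) ----> \<Phi> c i"
      using R[OF that] near grid X01 by (intro cont that) (auto simp del: atLeastAtMost_iff)
    show "c i <= \<Phi> c i"
    proof (rule LIMSEQ_le[OF near[of i R i] 1])
      show "\<exists>N. \<forall>k\<ge>N. X (\<sigma> k) (R (\<sigma> k) i) i <= \<Phi> (X (\<sigma> k) (R (\<sigma> k) i)) i"
        using lab0 grid[of R i] R[OF that] L(1) that by blast
    qed (use that R in auto)
    have 2: "(%k. \<Phi> (X (\<sigma> k) (S (\<sigma> k) i)) i) ----> \<Phi> c i"
      using S[OF that] near grid X01 by (intro cont that) (auto simp del: atLeastAtMost_iff)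
    show "\<Phi> c i <= c i"
    proof (rule LIMSEQ_le[OF 2 near[of i S i]])
      show "\<exists>N. \<forall>k\<ge>N. \<Phi> (X (\<sigma> k) (S (\<sigma> k) i)) i <= X (\<sigma> k) (S (\<sigma> k) i) i"
        using lab1 grid[of S i] S[OF that] L(2) that by blast
    qed (use that S in auto)
  qed
  moreover have "c i \<in> {0..1}" if "i < n" for i
  proof -
    have "!!k. 0 <= a (\<sigma> k) i" "!!k. a (\<sigma> k) i <= 1"
      using Q[OF that] that by (auto simp: a_def X_def divide_simps intro: less_imp_le simp flip: of_nat_Suc)
    then show ?thesis
      using ac[of i] LIMSEQ_le_const LIMSEQ_le_const2 by (metis atLeastAtMost_iff)
  qed
  ultimately show ?thesis using that by blast
qed

lemma brouwer_symmetric_cube: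
  fixes \<Phi> :: "(nat => real) => nat => real"
  assumes "M > 0"
    and into: "!!c i. (\<forall>i<n. \<bar>c i\<bar> <= M) ==> i < n ==> \<bar>\<Phi> c i\<bar> <= M"
    and cont: "!!C c i. (\<forall>k. \<forall>i<n. \<bar>C k i\<bar> <= M) ==> (\<forall>i<n. (%k. C k i) ----> c i) ==> i < n
                 ==> (%k. \<Phi> (C k) i) ----> \<Phi> c i"
  obtains c where "\<forall>i<n. \<bar>c i\<bar> <= M" "\<forall>i<n. \<Phi> c i = c i"
proof -
  define e where "e c = (%j. (2 * c j - 1) * M)" for c :: "nat => real"
  have eM: "\<bar>e c i\<bar> <= M" if "c i \<in> {0..1}" for c i
    using that \<open>M > 0\<close> mult_right_mono[of "\<bar>2 * c i - 1\<bar>" 1 M] by (auto simp: e_def abs_mult)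
  obtain c where c: "\<forall>i<n. c i \<in> {0..1}" "\<forall>i<n. (\<Phi> (e c) i / M + 1) / 2 = c i"
  proof (rule brouwer_cube_nat[of n "%c i. (\<Phi> (e c) i / M + 1) / 2"])
    fix c i assume "\<forall>i<n. c i \<in> {0..1::real}" "i < n"
    then have "\<bar>\<Phi> (e c) i\<bar> <= M" using eM by (intro into) auto
    then show "(\<Phi> (e c) i / M + 1) / 2 \<in> {0..1}"
      using \<open>M > 0\<close> by (auto simp: divide_simps abs_le_iff)
  next
    fix C :: "nat => nat => real" and c i
    assume C: "\<forall>k. \<forall>i<n. C k i \<in> {0..1}" "\<forall>i<n. (%k. C k i) ----> c i" "i < n"
    have "(%k. \<Phi> (e (C k)) i) ----> \<Phi> (e c) i"
      using C eM by (intro cont) (auto simp: e_def intro!: tendsto_intros)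
    then show "(%k. (\<Phi> (e (C k)) i / M + 1) / 2) ----> (\<Phi> (e c) i / M + 1) / 2"
      using \<open>M > 0\<close> by (intro tendsto_intros) auto
  qed
  have "\<Phi> (e c) i = e c i" if "i < n" for i
  proof -
    have "\<Phi> (e c) i / M = 2 * c i - 1" using c(2) that by (auto simp: field_simps)
    then show ?thesis using \<open>M > 0\<close> by (simp add: e_def field_simps)
  qed
  with c(1) eM show ?thesis using that[of "e c"] by blast
qed

section \<open>Continuity of translations in L1\<close>

lemma nn_integral_lborel_translate:
  fixes f :: "'a::euclidean_space => ennreal"
  assumes [measurable]: "f \<in> borel_measurable borel"
  shows "(\<integral>\<^sup>+x. f (x + z) \<partial>lborel) = (\<integral>\<^sup>+x. f x \<partial>lborel)"
proof -
  have "(\<integral>\<^sup>+x. f x \<partial>lborel) = (\<integral>\<^sup>+x. f x \<partial>distr lborel borel ((+) z))"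
    by (simp add: lborel_distr_plus)
  also have "... = (\<integral>\<^sup>+x. f (x + z) \<partial>lborel)"
    by (subst nn_integral_distr) (auto simp: add.commute)
  finally show ?thesis by simp
qed

lemma integrable_lborel_translate:
  fixes f :: "'a::euclidean_space => 'b::{banach, second_countable_topology}"
  assumes "integrable lborel f"
  shows "integrable lborel (%x. f (x + z))"
proof -
  have "integrable (distr lborel borel ((+) z)) f" using assms by (simp add: lborel_distr_plus)
  then show ?thesis by (subst (asm) integrable_distr_eq) (use assms in \<open>auto simp: add.commute\<close>)
qed

lemma integral_lborel_translate:
  fixes f :: "'a::euclidean_space => 'b::{banach, second_countable_topology}"
  assumes [measurable]: "f \<in> borel_measurable borel"
  shows "(LINT x|lborel. f (x + z)) = (LINT x|lborel. f x)"
proof -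
  have "(LINT x|lborel. f x) = (\<integral>x. f x \<partial>distr lborel borel ((+) z))"
    by (simp add: lborel_distr_plus)
  also have "... = (LINT x|lborel. f (x + z))"
    by (subst integral_distr) (auto simp: add.commute)
  finally show ?thesis by simp
qed

text \<open>The L1 modulus of continuity. Mollification errors and cell-average errors are both
  bounded by its values at small \<open>z\<close>, through
  \<open>L1_kernel_estimate\<close>.\<close>

definition L1_shift :: "('a::euclidean_space => real) => 'a => real" where
  "L1_shift h z = (LINT x|lborel. \<bar>h (x + z) - h x\<bar>)"

lemma L1_shift_triangle:
  assumes [simp]: "integrable lborel f" "integrable lborel g" "integrable lborel h"
    and le: "!!x y. \<bar>h x - h y\<bar> <= \<bar>f x - f y\<bar> + \<bar>g x - g y\<bar>"
  shows "L1_shift h z <= L1_shift f z + L1_shift g z"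
proof -
  note [simp] = integrable_lborel_translate
  have "L1_shift h z <= (LINT x|lborel. \<bar>f (x + z) - f x\<bar> + \<bar>g (x + z) - g x\<bar>)"
    unfolding L1_shift_def by (intro integral_mono) (auto simp: le)
  then show ?thesis by (simp add: L1_shift_def)
qed

lemma L1_shift_le_norm:
  assumes [simp]: "integrable lborel f"
  shows "L1_shift f z <= 2 * (LINT x|lborel. \<bar>f x\<bar>)"
proof -
  note [simp] = integrable_lborel_translate
  have "L1_shift f z <= (LINT x|lborel. \<bar>f (x + z)\<bar> + \<bar>f x\<bar>)"
    unfolding L1_shift_def by (intro integral_mono) auto
  also have "... = (LINT x|lborel. \<bar>f (x + z)\<bar>) + (LINT x|lborel. \<bar>f x\<bar>)"
    by (simp add: integral_add)
  also have "... = 2 * (LINT x|lborel. \<bar>f x\<bar>)"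
    using integral_lborel_translate[of "%x. \<bar>f x\<bar>" z] borel_measurable_integrable[OF assms] by simp
  finally show ?thesis .
qed

text \<open>\<open>U\<close> and its translate have the same measure, so the L1 difference is twice
  its one-sided part. That part is dominated by the indicator of \<open>U\<close> and tends to zero
  pointwise because \<open>U\<close> is open.\<close>

lemma L1_shift_indicator_tendsto:
  fixes U :: "'a::euclidean_space set"
  assumes "open U" and fin: "emeasure lborel U < \<infinity>" and Z: "Z ----> 0"
  shows "(%k. L1_shift (indicator U) (Z k)) ----> (0::real)"
proof -
  let ?i = "indicator U :: 'a => real"
  have [measurable]: "U \<in> sets borel" using assms by auto
  have int: "integrable lborel ?i" using fin by auto
  note int' = integrable_lborel_translate[OF int]
  have eq: "L1_shift ?i z = 2 * (LINT x|lborel. max 0 (?i x - ?i (x + z)))" for z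
  proof -
    have "(LINT x|lborel. ?i (x + z) - ?i x) = 0"
      using int int' integral_lborel_translate[of ?i z] by (subst Bochner_Integration.integral_diff) auto
    moreover have "L1_shift ?i z = (LINT x|lborel. 2 * max 0 (?i x - ?i (x + z)) + (?i (x + z) - ?i x))"
      unfolding L1_shift_def by (intro Bochner_Integration.integral_cong) (auto simp: indicator_def)
    ultimately show ?thesis
      using int int' by (subst (asm) Bochner_Integration.integral_add)
        (auto intro!: integrable_max)
  qed
  have "(%k. \<integral>x. max 0 (?i x - ?i (x + Z k)) \<partial>lborel) ----> (\<integral>x. 0 \<partial>(lborel::'a measure))"
  proof (rule integral_dominated_convergence[where w="?i" and f="%_. 0" and s="%k x. max 0 (?i x - ?i (x + Z k))"])
    show "AE x in lborel. (%k. max 0 (?i x - ?i (x + Z k))) ----> 0"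
    proof (rule AE_I2)
      fix x :: 'a
      show "(%k. max 0 (?i x - ?i (x + Z k))) ----> 0"
      proof (cases "x \<in> U")
        case True
        have "(%k. x + Z k) ----> x + 0" by (intro tendsto_intros Z)
        then have "\<forall>\<^sub>F k in sequentially. x + Z k \<in> U"
          using True \<open>open U\<close> by (intro topological_tendstoD) auto
        then have "\<forall>\<^sub>F k in sequentially. max 0 (?i x - ?i (x + Z k)) = 0"
          by eventually_elim (auto simp: indicator_def)
        then show ?thesis by (rule tendsto_eventually)
      qed (auto simp: indicator_def intro!: tendsto_eventually)
    qed
  qed (use int in \<open>auto simp: indicator_def\<close>)
  then show ?thesis using tendsto_mult_left[of _ 0 sequentially 2] by (simp add: eq)
qed

lemma L1_shift_approx_tendsto:
  fixes h :: "'a::euclidean_space => real"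
  assumes h: "integrable lborel h"
    and approx: "!!e. e > 0 ==> \<exists>g. integrable lborel g & (LINT x|lborel. \<bar>h x - g x\<bar>) < e \<and>
      (%k. L1_shift g (Z k)) ----> 0"
  shows "(%k. L1_shift h (Z k)) ----> 0"
proof (rule LIMSEQ_I)
  fix e :: real assume "e > 0"
  then obtain g where g: "integrable lborel g" "(LINT x|lborel. \<bar>h x - g x\<bar>) < e / 4"
    "(%k. L1_shift g (Z k)) ----> 0"
    using approx[of "e / 4"] by auto
  obtain N where N: "!!k. k >= N ==> \<bar>L1_shift g (Z k)\<bar> < e / 2"
    using LIMSEQ_D[OF g(3), of "e / 2"] \<open>e > 0\<close> by auto
  have "norm (L1_shift h (Z k) - 0) < e" if "k >= N" for k
  proof -
    have "L1_shift h (Z k) <= L1_shift g (Z k) + L1_shift (%x. h x - g x) (Z k)"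
      using g(1) h by (intro L1_shift_triangle) auto
    also have "L1_shift (%x. h x - g x) (Z k) <= 2 * (LINT x|lborel. \<bar>h x - g x\<bar>)"
      using g(1) h by (intro L1_shift_le_norm) auto
    finally have "L1_shift h (Z k) < e" using N[OF that] g(2) by auto
    moreover have "L1_shift h (Z k) >= 0" by (auto simp: L1_shift_def)
    ultimately show ?thesis by auto
  qed
  then show "\<exists>N. \<forall>k\<ge>N. norm (L1_shift h (Z k) - 0) < e" by blast
qed

text \<open>A density argument: outer regularity reduces indicators of Borel sets to open sets,
  where the translation is understood pointwise, and \<open>L1_shift_approx_tendsto\<close> carries
  the property to L1 limits.\<close>

lemma L1_shift_tendsto_0:
  fixes h :: "'a::euclidean_space => real"
  assumes "integrable lborel h" and Z: "Z ----> 0"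
  shows "(%k. L1_shift h (Z k)) ----> 0"
  using assms(1)
proof (induction rule: integrable_induct)
  case (base A c)
  have [measurable]: "A \<in> sets borel" using base by simp
  show ?case
  proof (rule L1_shift_approx_tendsto)
    show "integrable lborel (%x. indicator A x *\<^sub>R c)" using base by auto
    fix e :: real assume "e > 0"
    define d where "d = e / (\<bar>c\<bar> + 1)"
    have "d > 0" using \<open>e > 0\<close> by (auto simp: d_def)
    obtain U where U: "open U" "A \<subseteq> U" "(U - A) \<in> lmeasurable" "emeasure lebesgue (U - A) < ennreal d"
      using sets_lebesgue_outer_open[of A d] \<open>d > 0\<close> by auto
    have [measurable]: "U \<in> sets borel" using U by auto
    have UA: "emeasure lborel (U - A) < ennreal d" using U(4) by simp
    have "emeasure lborel U = emeasure lborel A + emeasure lborel (U - A)"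
      using U(2) by (subst plus_emeasure) (auto simp: Un_absorb1)
    also have "... < \<infinity>" using base UA by (auto simp: less_top[symmetric])
    finally have fin: "emeasure lborel U < \<infinity>" .
    have iU: "integrable lborel (%x. c * indicator U x)" using fin by auto
    have "(LINT x|lborel. \<bar>indicator A x *\<^sub>R c - c * indicator U x\<bar>) = (LINT x|lborel. \<bar>c\<bar> * indicator (U - A) x)"
      using U(2) by (intro Bochner_Integration.integral_cong) (auto simp: indicator_def)
    also have "... = \<bar>c\<bar> * measure lborel (U - A)" by simp
    also have "... <= \<bar>c\<bar> * d"
      using UA \<open>d > 0\<close> by (intro mult_left_mono) (auto simp: measure_def enn2real_leI less_imp_le)
    also have "... < e" using \<open>e > 0\<close> by (auto simp: d_def divide_simps)
    finally have 1: "(LINT x|lborel. \<bar>indicator A x *\<^sub>R c - c * indicator U x\<bar>) < e" .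
    have "L1_shift (%x. c * indicator U x) z = \<bar>c\<bar> * L1_shift (indicator U) z" for z
      by (simp add: L1_shift_def flip: right_diff_distrib' add: abs_mult)
    then have "(%k. L1_shift (%x. c * indicator U x) (Z k)) ----> 0"
      using tendsto_mult_left[OF L1_shift_indicator_tendsto[OF U(1) fin Z], of "\<bar>c\<bar>"] by simp
    with 1 iU show "\<exists>g. integrable lborel g & (LINT x|lborel. \<bar>indicator A x *\<^sub>R c - g x\<bar>) < e \<and>
      (%k. L1_shift g (Z k)) ----> 0" by blast
  qed
next
  case (add f g)
  have "!!k. L1_shift (%x. f x + g x) (Z k) <= L1_shift f (Z k) + L1_shift g (Z k)"
    using add.hyps by (intro L1_shift_triangle) auto
  moreover have "!!k. L1_shift (%x. f x + g x) (Z k) >= 0" by (auto simp: L1_shift_def)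
  moreover have "(%k. L1_shift f (Z k) + L1_shift g (Z k)) ----> 0"
    using tendsto_add[OF add.IH] by simp
  ultimately show ?case
    using tendsto_sandwich[OF _ _ tendsto_const] by (metis (mono_tags, lifting) always_eventually)
next
  case (lim f s)
  show ?case
  proof (rule L1_shift_approx_tendsto)
    show "integrable lborel f" by fact
    fix e :: real assume "e > 0"
    have "(%i. \<integral>x. \<bar>f x - s i x\<bar> \<partial>lborel) ----> (\<integral>x. 0 \<partial>(lborel::'a measure))"
    proof (rule integral_dominated_convergence[where w="%x. 3 * \<bar>f x\<bar>" and f="%_. 0" and s="%i x. \<bar>f x - s i x\<bar>"])
      show "AE x in lborel. (%i. \<bar>f x - s i x\<bar>) ----> 0"
      proof (rule AE_I2)
        fix x :: 'a
        have "(%i. f x - s i x) ----> f x - f x" using lim.hyps(2)[of x] by (intro tendsto_intros) auto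
        then show "(%i. \<bar>f x - s i x\<bar>) ----> 0" by (simp add: tendsto_rabs_zero_iff)
      qed
      show "AE x in lborel. norm \<bar>f x - s i x\<bar> <= 3 * \<bar>f x\<bar>" for i
      proof (rule AE_I2)
        fix x :: 'a
        show "norm \<bar>f x - s i x\<bar> <= 3 * \<bar>f x\<bar>" using lim.hyps(3)[of x i] by auto
      qed
    qed (use lim.hyps borel_measurable_integrable in auto)
    then have "(%i. \<integral>x. \<bar>f x - s i x\<bar> \<partial>lborel) ----> 0" by simp
    then have "\<forall>\<^sub>F i in sequentially. (LINT x|lborel. \<bar>f x - s i x\<bar>) < e"
      using \<open>e > 0\<close> by (rule order_tendstoD)
    then obtain i where "(LINT x|lborel. \<bar>f x - s i x\<bar>) < e" using eventually_happens' by force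
    with lim.IH[of i] lim.hyps(1)[of i]
    show "\<exists>g. integrable lborel g & (LINT x|lborel. \<bar>f x - g x\<bar>) < e & (%k. L1_shift g (Z k)) ----> 0"
      by blast
  qed
qed

text \<open>Fubini after the substitution \<open>y = x + z\<close>. The bound \<open>S\<close> is
  requested only where \<kappa> does not vanish, so a kernel of small support calls for small
  translations only. Both mollifiers and cell averages are of this kind.\<close>

lemma L1_kernel_estimate:
  fixes h :: "'a::euclidean_space => real" and k :: "'a => 'a => ennreal"
  assumes [measurable]: "h \<in> borel_measurable borel" "(%(x, y). k x y) \<in> borel_measurable (borel \<Otimes>\<^sub>M borel)"
      "\<kappa> \<in> borel_measurable borel"
    and le: "!!x y. k x y <= \<kappa> (y - x)"
    and S: "!!z. \<kappa> z ~= 0 ==> (\<integral>\<^sup>+x. ennreal \<bar>h (x + z) - h x\<bar> \<partial>lborel) <= S"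
  shows "(\<integral>\<^sup>+x. \<integral>\<^sup>+y. k x y * ennreal \<bar>h y - h x\<bar> \<partial>lborel \<partial>lborel) <= (\<integral>\<^sup>+z. \<kappa> z \<partial>lborel) * S"
proof -
  have "(\<integral>\<^sup>+x. \<integral>\<^sup>+y. k x y * ennreal \<bar>h y - h x\<bar> \<partial>lborel \<partial>lborel)
     <= (\<integral>\<^sup>+x. \<integral>\<^sup>+y. \<kappa> (y - x) * ennreal \<bar>h y - h x\<bar> \<partial>lborel \<partial>lborel)"
    by (intro nn_integral_mono mult_right_mono le) auto
  also have "... = (\<integral>\<^sup>+x. \<integral>\<^sup>+z. \<kappa> z * ennreal \<bar>h (x + z) - h x\<bar> \<partial>lborel \<partial>lborel)"
  proof (rule nn_integral_cong)
    fix x :: 'a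
    show "(\<integral>\<^sup>+y. \<kappa> (y - x) * ennreal \<bar>h y - h x\<bar> \<partial>lborel) = (\<integral>\<^sup>+z. \<kappa> z * ennreal \<bar>h (x + z) - h x\<bar> \<partial>lborel)"
      using nn_integral_lborel_translate[of "%y. \<kappa> (y - x) * ennreal \<bar>h y - h x\<bar>" x]
      by (simp add: add.commute)
  qed
  also have "... = (\<integral>\<^sup>+z. \<integral>\<^sup>+x. \<kappa> z * ennreal \<bar>h (x + z) - h x\<bar> \<partial>lborel \<partial>lborel)"
    by (rule lborel_pair.Fubini') simp
  also have "... = (\<integral>\<^sup>+z. \<kappa> z * (\<integral>\<^sup>+x. ennreal \<bar>h (x + z) - h x\<bar> \<partial>lborel) \<partial>lborel)"
    by (intro nn_integral_cong nn_integral_cmult) simp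
  also have "... <= (\<integral>\<^sup>+z. \<kappa> z * S \<partial>lborel)"
  proof (rule nn_integral_mono)
    fix z show "\<kappa> z * (\<integral>\<^sup>+x. ennreal \<bar>h (x + z) - h x\<bar> \<partial>lborel) <= \<kappa> z * S"
      using S[of z] by (cases "\<kappa> z = 0") (auto intro: mult_left_mono)
  qed
  also have "... = (\<integral>\<^sup>+z. \<kappa> z \<partial>lborel) * S" by (rule nn_integral_multc) simp
  finally show ?thesis .
qed

section \<open>Test functions and convolution\<close>

text \<open>The integral runs over the whole space with Lebesgue measure: functions on \<Omega>
  enter after extension by zero, and in general they are only Lebesgue measurable. All smoothness
  comes from \<open>\<psi>\<close>.\<close>

definition conv :: "(real^'n => real) => (real^'n => real) => real^'n => real" where
  "conv h \<psi> x = (LINT y|lebesgue. h y * \<psi> (x - y))"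

lemma closed_subset_compact: "compact K ==> S \<subseteq> K ==> closed S ==> compact S"
  by (metis compact_Int_closed inf.absorb_iff2)

lemma pd_eqI:
  "((%t. f (x + t *\<^sub>R axis j 1)) has_real_derivative D) (at 0) ==> pd f j x = D"
  unfolding pd_def by (rule DERIV_imp_deriv)

lemma Ck_on_UNIV_SucI:
  assumes "continuous_on UNIV f"
    and d: "!!j x. ((%t. f (x + t *\<^sub>R axis j 1)) has_real_derivative D j x) (at 0)"
    and "!!j. Ck_on k UNIV (D j)"
  shows "Ck_on (Suc k) UNIV f"
proof -
  have "pd f j = D j" for j using pd_eqI[OF d] by auto
  with assms show ?thesis by (auto simp: real_differentiable_def)
qed

lemma Ck_on_SucD:
  assumes "Ck_on (Suc k) U f"
  shows "continuous_on U f" "Ck_on k U (pd f j)"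
    "x \<in> U ==> ((%t. f (x + t *\<^sub>R axis j 1)) has_real_derivative pd f j x) (at 0)"
  using assms by (auto simp: pd_def DERIV_deriv_iff_real_differentiable)

lemma Ck_on_mult_add:
  "Ck_on k UNIV f ==> Ck_on k UNIV g ==> Ck_on k UNIV (%x. a * f x + b * g x)"
proof (induction k arbitrary: f g)
  case 0 then show ?case by (auto intro!: continuous_intros)
next
  case (Suc k)
  show ?case
    by (rule Ck_on_UNIV_SucI[where D="%j x. a * pd f j x + b * pd g j x"])
      (use Suc Ck_on_SucD[OF Suc.prems(1)] Ck_on_SucD[OF Suc.prems(2)] in
        \<open>auto intro!: continuous_intros DERIV_add DERIV_cmult simp del: Ck_on.simps\<close>)
qed

lemma Ck_on_affine:
  "Ck_on k UNIV f ==> Ck_on k UNIV (%x. a * f (c *\<^sub>R x + v))"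
proof (induction k arbitrary: f a)
  case 0
  then show ?case by (auto intro!: continuous_intros continuous_on_compose2[of UNIV f])
next
  case (Suc k)
  note S = Ck_on_SucD[OF Suc.prems]
  show ?case
  proof (rule Ck_on_UNIV_SucI[where D="%j x. (a * c) * pd f j (c *\<^sub>R x + v)"])
    show "continuous_on UNIV (%x. a * f (c *\<^sub>R x + v))"
      using S(1) by (auto intro!: continuous_intros continuous_on_compose2[of UNIV f])
    show "Ck_on k UNIV (%x. a * c * pd f j (c *\<^sub>R x + v))" for j
      by (rule Suc.IH[OF S(2)])
    fix j and x :: "real^'a"
    have "((%t. f ((c *\<^sub>R x + v) + t *\<^sub>R axis j 1)) has_real_derivative pd f j (c *\<^sub>R x + v)) (at (c * 0))"
      using S(3)[of "c *\<^sub>R x + v" j] by simp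
    then have "((%t. f ((c *\<^sub>R x + v) + (c * t) *\<^sub>R axis j 1)) has_real_derivative pd f j (c *\<^sub>R x + v) * c) (at 0)"
      using DERIV_chain2[of "%t. f ((c *\<^sub>R x + v) + t *\<^sub>R axis j 1)" _ "%t. c * t" 0 c UNIV]
      by (auto intro!: derivative_eq_intros)
    then have "((%t. a * f ((c *\<^sub>R x + v) + (c * t) *\<^sub>R axis j 1)) has_real_derivative a * (pd f j (c *\<^sub>R x + v) * c)) (at 0)"
      by (rule DERIV_cmult)
    then show "((%t. a * f (c *\<^sub>R (x + t *\<^sub>R axis j 1) + v)) has_real_derivative a * c * pd f j (c *\<^sub>R x + v)) (at 0)"
      by (simp add: algebra_simps)
  qed
qed

context
  fixes \<Omega> :: "(real^'n) set" and \<phi> :: "real^'n => real"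
  assumes tf: "test_fun \<Omega> \<phi>"
begin

lemma test_fun_continuous: "continuous_on S \<phi>"
  using tf continuous_on_subset[of UNIV \<phi> S] by (auto simp: test_fun_def dest: spec[of _ 0])

lemma test_fun_measurable: "\<phi> \<in> borel_measurable borel"
  using test_fun_continuous[of UNIV] by (rule borel_measurable_continuous_onI)

lemma test_fun_has_pd:
  "((%t. \<phi> (x + t *\<^sub>R axis j 1)) has_real_derivative pd \<phi> j (x + s *\<^sub>R axis j 1)) (at s)"
proof -
  have "Ck_on (Suc 0) UNIV \<phi>" using tf by (auto simp: test_fun_def)
  from Ck_on_SucD(3)[OF this, of "x + s *\<^sub>R axis j 1" j]
  have "((%t. \<phi> (x + (t + s) *\<^sub>R axis j 1)) has_real_derivative pd \<phi> j (x + s *\<^sub>R axis j 1)) (at 0)"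
    by (simp add: algebra_simps)
  then show ?thesis using DERIV_shift[of "%t. \<phi> (x + t *\<^sub>R axis j 1)" _ 0 s] by simp
qed

lemma test_fun_pd_zero:
  assumes "x \<notin> closure {x. \<phi> x ~= 0}" shows "pd \<phi> j x = 0"
proof -
  have "open (- closure {x. \<phi> x ~= 0})" by auto
  moreover have "continuous_on UNIV (%t::real. x + t *\<^sub>R axis j 1)" by (intro continuous_intros)
  ultimately have "open ((%t::real. x + t *\<^sub>R axis j 1) -` (- closure {x. \<phi> x ~= 0}))"
    by (rule open_vimage)
  moreover have "0 \<in> ((%t::real. x + t *\<^sub>R axis j 1) -` (- closure {x. \<phi> x ~= 0}))"
    using assms by simp
  ultimately have "\<forall>\<^sub>F t in nhds 0. t \<in> ((%t::real. x + t *\<^sub>R axis j 1) -` (- closure {x. \<phi> x ~= 0}))"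
    by (rule eventually_nhds_in_open)
  then have "\<forall>\<^sub>F t in nhds 0. \<phi> (x + t *\<^sub>R axis j 1) = 0"
    by eventually_elim (use closure_subset[of "{x. \<phi> x ~= 0}"] in auto)
  then have "((%t. \<phi> (x + t *\<^sub>R axis j 1)) has_real_derivative 0) (at 0)"
    using DERIV_cong_ev[of 0 0 "%t. \<phi> (x + t *\<^sub>R axis j 1)" "%_. 0" 0 0] by simp
  then show ?thesis by (rule pd_eqI)
qed

lemma test_fun_zero: "x \<notin> \<Omega> ==> \<phi> x = 0"
  using tf closure_subset[of "{x. \<phi> x ~= 0}"] by (auto simp: test_fun_def)

lemma test_fun_support:
  obtains K where "compact K" "K \<subseteq> \<Omega>" "!!x. x \<notin> K ==> \<phi> x = 0" "!!x j. x \<notin> K ==> pd \<phi> j x = 0"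
proof
  show "compact (closure {x. \<phi> x ~= 0})" "closure {x. \<phi> x ~= 0} \<subseteq> \<Omega>"
    using tf by (auto simp: test_fun_def)
qed (use test_fun_pd_zero closure_subset[of "{x. \<phi> x ~= 0}"] in auto)

lemma test_fun_pd: "test_fun \<Omega> (pd \<phi> j)"
proof -
  have "{x. pd \<phi> j x ~= 0} \<subseteq> closure {x. \<phi> x ~= 0}"
    using test_fun_pd_zero by blast
  then have sub: "closure {x. pd \<phi> j x ~= 0} \<subseteq> closure {x. \<phi> x ~= 0}"
    by (simp add: closure_minimal)
  have "compact (closure {x. pd \<phi> j x ~= 0})"
    using tf sub closed_subset_compact unfolding test_fun_def by blast
  moreover have "Ck_on k UNIV (pd \<phi> j)" for k
    using tf Ck_on_SucD(2)[of k UNIV \<phi> j] by (simp only: test_fun_def)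
  ultimately show ?thesis using sub tf by (auto simp: test_fun_def)
qed

lemma test_fun_bounded: obtains B where "B > 0" "!!x. \<bar>\<phi> x\<bar> <= B"
proof -
  obtain K where K: "compact K" "!!x. x \<notin> K ==> \<phi> x = 0" using test_fun_support by metis
  have "bounded (\<phi> ` K)"
    using K(1) compact_continuous_image[OF test_fun_continuous K(1)] compact_imp_bounded by blast
  then obtain B where B: "B > 0" "!!x. x \<in> K ==> \<bar>\<phi> x\<bar> <= B"
    by (auto simp: bounded_pos)
  then have "\<bar>\<phi> x\<bar> <= B" for x using K(2)[of x] by (cases "x \<in> K") auto
  with B(1) show ?thesis by (rule that)
qed

lemma test_fun_integrable: "integrable lborel \<phi>"
proof -
  obtain K where K: "compact K" "!!x. x \<notin> K ==> \<phi> x = 0" using test_fun_support by metis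
  have "integrable lborel (%x. indicator K x *\<^sub>R \<phi> x)"
    using borel_integrable_compact[OF K(1) test_fun_continuous] .
  moreover have "(%x. indicator K x *\<^sub>R \<phi> x) = \<phi>" using K(2) by (force simp: indicator_def)
  ultimately show ?thesis by simp
qed

lemma test_fun_difference_quotient:
  obtains B where "B > 0" "!!x. \<bar>pd \<phi> j x\<bar> <= B" "!!x t. \<bar>\<phi> (x + t *\<^sub>R axis j 1) - \<phi> x\<bar> <= B * \<bar>t\<bar>"
proof -
  obtain B where B: "B > 0" "!!x. \<bar>pd \<phi> j x\<bar> <= B"
  proof -
    obtain K where K: "compact K" "!!x. x \<notin> K ==> pd \<phi> j x = 0" using test_fun_support by metis
    have "Ck_on 0 UNIV (pd \<phi> j)" using test_fun_pd by (auto simp only: test_fun_def)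
    then have "continuous_on K (pd \<phi> j)" using continuous_on_subset[of UNIV _ K] by auto
    then have "bounded (pd \<phi> j ` K)"
      using K(1) compact_continuous_image compact_imp_bounded by blast
    then obtain B where "B > 0" "!!x. x \<in> K ==> \<bar>pd \<phi> j x\<bar> <= B"
      by (auto simp: bounded_pos)
    with K(2) show ?thesis using that by (metis abs_zero less_imp_le)
  qed
  have "\<bar>\<phi> (x + t *\<^sub>R axis j 1) - \<phi> x\<bar> <= B * \<bar>t\<bar>" for x t
    using field_differentiable_bound[of UNIV "%t. \<phi> (x + t *\<^sub>R axis j 1)" "%t. pd \<phi> j (x + t *\<^sub>R axis j 1)" B t 0]
      test_fun_has_pd B(2) by (auto)
  with B show ?thesis by (rule that)
qed

end

lemma test_fun_mult_add:
  assumes "test_fun \<Omega> \<phi>" "test_fun \<Omega> \<psi>"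
  shows "test_fun \<Omega> (%x. a * \<phi> x + b * \<psi> x)"
    and "pd (%x. a * \<phi> x + b * \<psi> x) j x = a * pd \<phi> j x + b * pd \<psi> j x"
proof -
  have "{x. a * \<phi> x + b * \<psi> x ~= 0} \<subseteq> {x. \<phi> x ~= 0} \<union> {x. \<psi> x ~= 0}" by auto
  then have sub: "closure {x. a * \<phi> x + b * \<psi> x ~= 0} \<subseteq> closure {x. \<phi> x ~= 0} \<union> closure {x. \<psi> x ~= 0}"
    using closure_mono[of _ "{x. \<phi> x ~= 0} \<union> {x. \<psi> x ~= 0}"] by (simp only: closure_Un)
  moreover have "compact (closure {x. \<phi> x ~= 0} \<union> closure {x. \<psi> x ~= 0})"
    using assms by (auto simp: test_fun_def)
  ultimately have "compact (closure {x. a * \<phi> x + b * \<psi> x ~= 0})"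
    using sub closed_subset_compact closed_closure by blast
  with sub assms show "test_fun \<Omega> (%x. a * \<phi> x + b * \<psi> x)"
    using Ck_on_mult_add[of _ \<phi> \<psi> a b] by (auto simp: test_fun_def simp del: Ck_on.simps)
  show "pd (%x. a * \<phi> x + b * \<psi> x) j x = a * pd \<phi> j x + b * pd \<psi> j x"
    using test_fun_has_pd[OF assms(1), of x j 0] test_fun_has_pd[OF assms(2), of x j 0]
    by (intro pd_eqI DERIV_add DERIV_cmult) auto
qed

lemma test_fun_reflect:
  assumes "test_fun UNIV \<rho>" and "!!z. r < norm z ==> \<rho> z = 0" and "cball x r \<subseteq> \<Omega>"
  shows "test_fun \<Omega> (%y. \<rho> (x - y))" and "pd (%y. \<rho> (x - y)) j y = - pd \<rho> j (x - y)"
proof -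
  have "{y. \<rho> (x - y) ~= 0} \<subseteq> cball x r"
    using assms(2) by (auto simp: dist_norm) (meson linorder_not_less)
  then have sub: "closure {y. \<rho> (x - y) ~= 0} \<subseteq> cball x r" by (simp add: closure_minimal)
  then have "compact (closure {y. \<rho> (x - y) ~= 0})"
    using closed_subset_compact[OF compact_cball] closed_closure by blast
  moreover have "Ck_on k UNIV (%y. \<rho> (x - y))" for k
    using Ck_on_affine[of k \<rho> 1 "-1" x] assms(1) by (simp add: test_fun_def)
  ultimately show "test_fun \<Omega> (%y. \<rho> (x - y))"
    using sub assms(3) by (auto simp: test_fun_def)
  have "((%t. \<rho> ((x - y) + (- t) *\<^sub>R axis j 1)) has_real_derivative pd \<rho> j (x - y) * (-1)) (at 0)"
    using test_fun_has_pd[OF assms(1), of "x - y" j 0]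
    by (intro DERIV_chain2[of "%t. \<rho> ((x - y) + t *\<^sub>R axis j 1)" _ "%t. - t"])
       (auto intro!: derivative_eq_intros)
  then show "pd (%y. \<rho> (x - y)) j y = - pd \<rho> j (x - y)"
    by (intro pd_eqI) (simp add: algebra_simps)
qed

section \<open>Differentiation of convolutions\<close>

lemma integrable_conv:
  fixes h \<psi> :: "real^'n => real"
  assumes "integrable lebesgue h" "\<psi> \<in> borel_measurable borel" "!!x. \<bar>\<psi> x\<bar> <= B"
  shows "integrable lebesgue (%y. h y * \<psi> (x - y))"
proof (rule Bochner_Integration.integrable_bound)
  show "integrable lebesgue (%y. B * h y)" using assms(1) by simp
  have "(%y. \<psi> (x - y)) \<in> borel_measurable lborel" using assms(2) by simp
  then have "(%y. \<psi> (x - y)) \<in> borel_measurable lebesgue" by (rule measurable_completion)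
  then show "(%y. h y * \<psi> (x - y)) \<in> borel_measurable lebesgue"
    using borel_measurable_integrable[OF assms(1)] by simp
  have "B >= 0" using assms(3)[of 0] by simp
  then show "AE y in lebesgue. norm (h y * \<psi> (x - y)) <= norm (B * h y)"
    using assms(3) by (intro AE_I2) (simp add: abs_mult mult.commute[of B] mult_left_mono)
qed

lemma conv_continuous:
  fixes h \<psi> :: "real^'n => real"
  assumes h: "integrable lebesgue h" and \<psi>: "continuous_on UNIV \<psi>" and B: "!!x. \<bar>\<psi> x\<bar> <= B"
  shows "continuous_on UNIV (conv h \<psi>)"
proof (rule continuous_at_imp_continuous_on, safe)
  fix x :: "real^'n"
  have [measurable]: "\<psi> \<in> borel_measurable borel" using \<psi> by (rule borel_measurable_continuous_onI)
  show "isCont (conv h \<psi>) x"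
    unfolding continuous_at_sequentially
  proof safe
    fix X :: "nat => real^'n" assume X: "X ----> x"
    have "(%k. \<integral>y. h y * \<psi> (X k - y) \<partial>lebesgue) ----> (LINT y|lebesgue. h y * \<psi> (x - y))"
    proof (rule integral_dominated_convergence[where w="%y. B * \<bar>h y\<bar>"])
      show "AE y in lebesgue. (%k. h y * \<psi> (X k - y)) ----> h y * \<psi> (x - y)"
      proof (rule AE_I2)
        fix y
        have "(%k. X k - y) ----> x - y" by (intro tendsto_intros X)
        then have "(%k. \<psi> (X k - y)) ----> \<psi> (x - y)"
          using \<psi> by (intro continuous_on_tendsto_compose[OF \<psi>]) auto
        then show "(%k. h y * \<psi> (X k - y)) ----> h y * \<psi> (x - y)" by (intro tendsto_intros)
      qed
      show "AE y in lebesgue. norm (h y * \<psi> (X k - y)) <= B * \<bar>h y\<bar>" for k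
        using B by (intro AE_I2) (simp add: abs_mult mult.commute[of B] mult_left_mono)
    qed (use h integrable_conv[OF h _ B] borel_measurable_integrable in \<open>auto\<close>)
    then show "(conv h \<psi> \<circ> X) ----> conv h \<psi> x" by (simp add: o_def conv_def)
  qed
qed

text \<open>Difference quotients of a test function are uniformly bounded by
  \<open>test_fun_difference_quotient\<close>, so dominated convergence with majorant
  \<open>B' * \<bar>h\<bar>\<close> moves the derivative onto the kernel.\<close>

lemma conv_has_pd:
  assumes h: "integrable lebesgue h" and \<psi>: "test_fun UNIV \<psi>"
  shows "((%t. conv h \<psi> (x + t *\<^sub>R axis j 1)) has_real_derivative conv h (pd \<psi> j) x) (at 0)"
proof -
  obtain B where B: "B > 0" "!!x. \<bar>\<psi> x\<bar> <= B" using test_fun_bounded[OF \<psi>] by metis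
  obtain B' where B': "B' > 0" "!!x. \<bar>pd \<psi> j x\<bar> <= B'"
      "!!x t. \<bar>\<psi> (x + t *\<^sub>R axis j 1) - \<psi> x\<bar> <= B' * \<bar>t\<bar>"
    using test_fun_difference_quotient[OF \<psi>] by metis
  note [measurable] = test_fun_measurable[OF \<psi>] test_fun_measurable[OF test_fun_pd[OF \<psi>]]
  have int: "integrable lebesgue (%y. h y * \<psi> (z - y))" for z
    by (rule integrable_conv[OF h test_fun_measurable[OF \<psi>] B(2)])
  have int': "integrable lebesgue (%y. h y * pd \<psi> j (z - y))" for z
    by (rule integrable_conv[OF h test_fun_measurable[OF test_fun_pd[OF \<psi>]] B'(2)])
  have "((%t. (conv h \<psi> (x + t *\<^sub>R axis j 1) - conv h \<psi> x) / t) \<longlongrightarrow> conv h (pd \<psi> j) x) (at 0)"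
    unfolding tendsto_at_iff_sequentially
  proof safe
    fix T :: "nat => real" assume T0: "\<forall>k. T k \<in> UNIV - {0}" and T: "T ----> 0"
    have "(%k. \<integral>y. h y * ((\<psi> (x + T k *\<^sub>R axis j 1 - y) - \<psi> (x - y)) / T k) \<partial>lebesgue)
        ----> (LINT y|lebesgue. h y * pd \<psi> j (x - y))"
    proof (rule integral_dominated_convergence[where w="%y. B' * \<bar>h y\<bar>"])
      show "AE y in lebesgue. (%k. h y * ((\<psi> (x + T k *\<^sub>R axis j 1 - y) - \<psi> (x - y)) / T k))
          ----> h y * pd \<psi> j (x - y)"
      proof (rule AE_I2)
        fix y
        have "((%t. (\<psi> (x - y + t *\<^sub>R axis j 1) - \<psi> (x - y)) / t) \<longlongrightarrow> pd \<psi> j (x - y)) (at 0)"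
          using test_fun_has_pd[OF \<psi>, of "x - y" j 0] by (simp add: has_field_derivative_iff)
        then have "(%k. (\<psi> (x - y + T k *\<^sub>R axis j 1) - \<psi> (x - y)) / T k) ----> pd \<psi> j (x - y)"
          using T T0 by (simp add: tendsto_at_iff_sequentially o_def)
        then show "(%k. h y * ((\<psi> (x + T k *\<^sub>R axis j 1 - y) - \<psi> (x - y)) / T k)) ----> h y * pd \<psi> j (x - y)"
          by (intro tendsto_intros) (simp add: algebra_simps)
      qed
      show "AE y in lebesgue. norm (h y * ((\<psi> (x + T k *\<^sub>R axis j 1 - y) - \<psi> (x - y)) / T k)) <= B' * \<bar>h y\<bar>" for k
      proof (rule AE_I2)
        fix y
        have "T k ~= 0" using T0 by auto
        then have "\<bar>(\<psi> (x + T k *\<^sub>R axis j 1 - y) - \<psi> (x - y)) / T k\<bar> <= B'"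
          using B'(3)[of "x - y" "T k"] by (simp add: divide_simps algebra_simps)
        then show "norm (h y * ((\<psi> (x + T k *\<^sub>R axis j 1 - y) - \<psi> (x - y)) / T k)) <= B' * \<bar>h y\<bar>"
          by (simp only: real_norm_def abs_mult mult.commute[of B'] mult_left_mono abs_ge_zero)
      qed
      show "(%y. h y * ((\<psi> (x + T k *\<^sub>R axis j 1 - y) - \<psi> (x - y)) / T k)) \<in> borel_measurable lebesgue" for k
        using borel_measurable_integrable[OF int[of "x + T k *\<^sub>R axis j 1"]] borel_measurable_integrable[OF int[of x]]
        by (simp add: diff_divide_distrib right_diff_distrib)
    qed (use h borel_measurable_integrable[OF int'] in auto)
    moreover have "(LINT y|lebesgue. h y * ((\<psi> (x + T k *\<^sub>R axis j 1 - y) - \<psi> (x - y)) / T k))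
        = (conv h \<psi> (x + T k *\<^sub>R axis j 1) - conv h \<psi> x) / T k" for k
    proof -
      have "(LINT y|lebesgue. h y * ((\<psi> (x + T k *\<^sub>R axis j 1 - y) - \<psi> (x - y)) / T k))
         = (LINT y|lebesgue. (h y * \<psi> (x + T k *\<^sub>R axis j 1 - y) - h y * \<psi> (x - y)) / T k)"
        by (simp only: right_diff_distrib times_divide_eq_right)
      also have "... = (LINT y|lebesgue. h y * \<psi> (x + T k *\<^sub>R axis j 1 - y) - h y * \<psi> (x - y)) / T k"
        by (rule integral_divide_zero)
      also have "(LINT y|lebesgue. h y * \<psi> (x + T k *\<^sub>R axis j 1 - y) - h y * \<psi> (x - y))
         = conv h \<psi> (x + T k *\<^sub>R axis j 1) - conv h \<psi> x"
        unfolding conv_def by (rule Bochner_Integration.integral_diff[OF int int])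
      finally show ?thesis .
    qed
    ultimately show "((%t. (conv h \<psi> (x + t *\<^sub>R axis j 1) - conv h \<psi> x) / t) \<circ> T) ----> conv h (pd \<psi> j) x"
      by (simp only: o_def conv_def[of h "pd \<psi> j"])
  qed
  then show ?thesis by (simp add: has_field_derivative_iff)
qed

lemma pd_conv:
  assumes "integrable lebesgue h" "test_fun UNIV \<psi>"
  shows "pd (conv h \<psi>) j = conv h (pd \<psi> j)"
  using pd_eqI[OF conv_has_pd[OF assms]] by auto

lemma conv_continuous_test:
  assumes "integrable lebesgue h" "test_fun UNIV \<psi>"
  shows "continuous_on UNIV (conv h \<psi>)"
  using test_fun_bounded[OF assms(2)] conv_continuous[OF assms(1) test_fun_continuous[OF assms(2)]]
  by metis

lemma conv_smooth:
  "integrable lebesgue h ==> test_fun UNIV \<psi> ==> Ck_on k UNIV (conv h \<psi>)"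
proof (induction k arbitrary: \<psi>)
  case 0 then show ?case by (simp add: conv_continuous_test)
next
  case (Suc k)
  show ?case
    by (rule Ck_on_UNIV_SucI[OF conv_continuous_test[OF Suc.prems] conv_has_pd[OF Suc.prems]])
      (rule Suc.IH[OF Suc.prems(1) test_fun_pd[OF Suc.prems(2)]])
qed

text \<open>Difference quotients of \<open>f\<close> integrate to zero by translation invariance,
  and dominated convergence passes this on to the derivative. Applied to products it is integration
  by parts; no iterated integral is needed.\<close>

lemma integral_partial_derivative_eq_0:
  fixes f D :: "real^'n => real"
  assumes f: "continuous_on UNIV f" and D: "continuous_on UNIV D"
    and d: "!!x. ((%t. f (x + t *\<^sub>R axis j 1)) has_real_derivative D x) (at 0)"
    and K: "bounded K" "!!x. x \<notin> K ==> f x = 0" "!!x. x \<notin> K ==> D x = 0"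
  shows "(LINT x|lborel. D x) = 0"
proof -
  let ?e = "axis j 1 :: real^'n"
  obtain r where r: "r > 0" "!!x. x \<in> K ==> norm x <= r" using K(1) by (auto simp: bounded_pos)
  \<comment> \<open>The steps \<open>T k\<close> are at most 1, so this ball contains the supports
    of all translates and carries the majorant.\<close>
  let ?C = "cball 0 (r + 1) :: (real^'n) set"
  have int: "integrable lborel g" if "continuous_on UNIV g" "!!x. x \<notin> K ==> g x = 0" for g :: "real^'n => real"
  proof -
    have "integrable lborel (%x. indicator ?C x *\<^sub>R g x)"
      by (rule borel_integrable_compact[OF compact_cball continuous_on_subset[OF that(1) subset_UNIV]])
    moreover have "(%x. indicator ?C x *\<^sub>R g x) = g"
    proof
      fix x show "indicator ?C x *\<^sub>R g x = g x"
        using that(2)[of x] r(2)[of x] by (cases "x \<in> K") auto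
    qed
    ultimately show ?thesis by simp
  qed
  have "bounded (D ` ?C)"
    by (rule compact_imp_bounded[OF compact_continuous_image[OF continuous_on_subset[OF D subset_UNIV] compact_cball]])
  then obtain B where B0: "B > 0" "!!x. x \<in> ?C ==> \<bar>D x\<bar> <= B" by (auto simp: bounded_pos)
  have B: "\<bar>D x\<bar> <= B" for x
  proof (cases "x \<in> ?C")
    case False
    then have "x \<notin> K" using r(2)[of x] by auto
    then show ?thesis using K(3) B0(1) by simp
  qed (rule B0)
  have d': "((%t. f (x + t *\<^sub>R ?e)) has_real_derivative D (x + s *\<^sub>R ?e)) (at s)" for x s
    using d[of "x + s *\<^sub>R ?e"] DERIV_shift[of "%t. f (x + t *\<^sub>R ?e)" "D (x + s *\<^sub>R ?e)" 0 s]
    by (simp add: algebra_simps)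
  have lip: "\<bar>f (x + t *\<^sub>R ?e) - f x\<bar> <= B * \<bar>t\<bar>" for x t
    using field_differentiable_bound[of UNIV "%t. f (x + t *\<^sub>R ?e)" "%t. D (x + t *\<^sub>R ?e)" B t 0] d' B by auto
  define T where "T k = 1 / real (Suc k)" for k
  have "T = (%k. inverse (real (Suc k)))" by (auto simp: T_def inverse_eq_divide)
  then have T: "T ----> 0" "T k > 0" "T k <= 1" for k
    using LIMSEQ_inverse_real_of_nat by (auto simp: T_def divide_simps)
  have fT: "integrable lborel (%x. f (x + T k *\<^sub>R ?e))" for k
    using integrable_lborel_translate[OF int[OF f K(2)]] .
  have [measurable]: "f \<in> borel_measurable borel" "D \<in> borel_measurable borel"
    using f D by (auto intro: borel_measurable_continuous_onI)
  have "(%k. \<integral>x. (f (x + T k *\<^sub>R ?e) - f x) / T k \<partial>lborel) ----> (LINT x|lborel. D x)"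
  proof (rule integral_dominated_convergence[where w="%x. B * indicator ?C x"])
    have "emeasure lborel ?C < \<infinity>" by (rule emeasure_lborel_cball_finite)
    then show "integrable lborel (%x. B * indicator ?C x)"
      by (intro integrable_mult_right integrable_real_indicator) auto
    show "AE x in lborel. (%k. (f (x + T k *\<^sub>R ?e) - f x) / T k) ----> D x"
    proof (rule AE_I2)
      fix x
      have "((%t. (f (x + t *\<^sub>R ?e) - f x) / t) \<longlongrightarrow> D x) (at 0)"
        using d[of x] by (simp add: has_field_derivative_iff)
      moreover have "\<forall>k. T k \<in> UNIV - {0}" using T(2) by (auto simp: less_le)
      ultimately show "(%k. (f (x + T k *\<^sub>R ?e) - f x) / T k) ----> D x"
        using T(1) by (auto simp: tendsto_at_iff_sequentially o_def)
    qed
    show "AE x in lborel. norm ((f (x + T k *\<^sub>R ?e) - f x) / T k) <= B * indicator ?C x" for k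
    proof (rule AE_I2, goal_cases)
      case (1 x)
      show ?case
      proof (cases "x \<in> ?C")
        case True
        then show ?thesis using lip[of x "T k"] T(2)[of k] by (simp add: divide_simps)
      next
        case False
        have "norm (x + T k *\<^sub>R ?e) >= norm x - norm (T k *\<^sub>R ?e)" by (rule norm_diff_ineq)
        moreover have "norm (T k *\<^sub>R ?e) <= 1" using T(2,3)[of k] by (simp add: norm_axis_1)
        ultimately have "x \<notin> K" "x + T k *\<^sub>R ?e \<notin> K" using r(2)[of x] r(2)[of "x + T k *\<^sub>R ?e"] False by auto
        then show ?thesis using K(2) False by simp
      qed
    qed
  qed auto
  moreover have eq0: "(LINT x|lborel. (f (x + T k *\<^sub>R ?e) - f x) / T k) = 0" for k
    using fT[of k] int[OF f K(2)] integral_lborel_translate[of f "T k *\<^sub>R ?e"] by simp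
  ultimately have "(%k. 0) ----> (LINT x|lborel. D x)" by (simp only: eq0)
  then show ?thesis by (simp add: LIMSEQ_const_iff)
qed

section \<open>Mollifiers\<close>

text \<open>The derivative is an existential witness rather than \<open>deriv f\<close>, so that the
  closure lemmas can supply it explicitly in an induction on the order.\<close>

fun Ck_real :: "nat => (real => real) => bool" where
  "Ck_real 0 f = continuous_on UNIV f"
| "Ck_real (Suc k) f = (\<exists>f'. (\<forall>t. (f has_real_derivative f' t) (at t)) & Ck_real k f')"

lemma Ck_real_continuous: "Ck_real k f ==> continuous_on UNIV f"
  by (cases k) (auto, meson DERIV_isCont continuous_at_imp_continuous_on)

lemma Ck_real_SucI: "(!!t. (f has_real_derivative f' t) (at t)) ==> Ck_real k f' ==> Ck_real (Suc k) f"
  by auto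

lemma Ck_real_SucD: "Ck_real (Suc k) f ==> Ck_real k f"
proof (induction k arbitrary: f)
  case 0 then show ?case using Ck_real_continuous[of "Suc 0" f] by simp
next
  case (Suc k)
  then obtain f' where "\<forall>t. (f has_real_derivative f' t) (at t)" "Ck_real (Suc k) f'" by auto
  with Suc.IH[of f'] show ?case by auto
qed

lemma Ck_real_mult_add: "Ck_real k f ==> Ck_real k g ==> Ck_real k (%t. a * f t + b * g t)"
proof (induction k arbitrary: f g)
  case 0 then show ?case by (auto intro!: continuous_intros)
next
  case (Suc k)
  then obtain f' g' where 1: "!!t. (f has_real_derivative f' t) (at t)" "Ck_real k f'"
    "!!t. (g has_real_derivative g' t) (at t)" "Ck_real k g'" by auto
  have "((%t. a * f t + b * g t) has_real_derivative a * f' t + b * g' t) (at t)" for t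
    by (intro DERIV_add DERIV_cmult 1)
  moreover have "Ck_real k (%t. a * f' t + b * g' t)" using Suc.IH 1 by blast
  ultimately show ?case by (rule Ck_real_SucI)
qed

lemma Ck_real_mult: "Ck_real k f ==> Ck_real k g ==> Ck_real k (%t. f t * g t)"
proof (induction k arbitrary: f g)
  case 0 then show ?case by (auto intro!: continuous_intros)
next
  case (Suc k)
  then obtain f' g' where 1: "!!t. (f has_real_derivative f' t) (at t)" "Ck_real k f'"
    "!!t. (g has_real_derivative g' t) (at t)" "Ck_real k g'" by auto
  have "((%t. f t * g t) has_real_derivative f' t * g t + g' t * f t) (at t)" for t
    by (rule DERIV_mult) (rule 1)+
  moreover have "Ck_real k (%t. f' t * g t + g' t * f t)"
    using Ck_real_mult_add[OF Suc.IH[OF 1(2) Ck_real_SucD[OF Suc.prems(2)]]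
        Suc.IH[OF 1(4) Ck_real_SucD[OF Suc.prems(1)]], of 1 1] by simp
  ultimately show ?case by (rule Ck_real_SucI)
qed

lemma Ck_real_affine: "Ck_real k f ==> Ck_real k (%t. a * f (c * t + d))"
proof (induction k arbitrary: f a)
  case 0
  then show ?case by (auto intro!: continuous_intros continuous_on_compose2[of UNIV f])
next
  case (Suc k)
  then obtain f' where 1: "!!t. (f has_real_derivative f' t) (at t)" "Ck_real k f'" by auto
  have "((%t. a * f (c * t + d)) has_real_derivative (a * c) * f' (c * t + d)) (at t)" for t
  proof -
    have "((%t. c * t + d) has_real_derivative c) (at t)" by (auto intro!: derivative_eq_intros)
    from DERIV_cmult[OF DERIV_chain2[OF 1(1) this], of a] show ?thesis
      by (simp only: mult_ac)
  qed
  then show ?case using Suc.IH[OF 1(2), of "a * c"] by (rule Ck_real_SucI)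
qed

text \<open>The flat function \<open>exp (- 1 / t)\<close> with the powers of \<open>1 / t\<close>
  that differentiation produces. Derivatives are linear combinations of members of the family, so
  smoothness follows by induction on the order with \<open>n\<close> arbitrary.\<close>

definition flat_exp :: "nat => real => real" where
  "flat_exp n t = (if t > 0 then (1 / t) ^ n * exp (- 1 / t) else 0)"

lemma flat_exp_tendsto_0: "(flat_exp n \<longlongrightarrow> 0) (at_right 0)"
proof -
  have "((%t. inverse t ^ n / exp (inverse t)) \<longlongrightarrow> 0) (at_right (0::real))"
    using filterlim_compose[OF tendsto_power_div_exp_0 filterlim_inverse_at_top_right] by simp
  moreover have "\<forall>\<^sub>F t in at_right (0::real). inverse t ^ n / exp (inverse t) = flat_exp n t"
    by (auto simp: eventually_at_filter flat_exp_def exp_minus inverse_eq_divide divide_simps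
        intro!: always_eventually)
  ultimately show ?thesis by (rule Lim_transform_eventually)
qed

lemma flat_exp_has_derivative:
  "(flat_exp n has_real_derivative - real n * flat_exp (Suc n) t + 1 * flat_exp (Suc (Suc n)) t) (at t)"
proof -
  consider "t > 0" | "t < 0" | "t = 0" by linarith
  then show ?thesis
  proof cases
    case 1
    have "((%t. (1 / t) ^ n * exp (- 1 / t)) has_real_derivative
        - real n * flat_exp (Suc n) t + 1 * flat_exp (Suc (Suc n)) t) (at t)"
      using 1 by (cases n) (auto intro!: derivative_eq_intros simp: flat_exp_def field_simps power2_eq_square,
          metis Suc_pred neq0_conv power_Suc)
    moreover have "\<forall>\<^sub>F s in nhds t. flat_exp n s = (1 / s) ^ n * exp (- 1 / s)"
      using eventually_nhds_in_open[of "{0<..}" t] 1 by (auto simp: flat_exp_def elim: eventually_mono)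
    ultimately show ?thesis by (subst DERIV_cong_ev) auto
  next
    case 2
    have "\<forall>\<^sub>F s in nhds t. flat_exp n s = 0"
      using eventually_nhds_in_open[of "{..<0}" t] 2 by (auto simp: flat_exp_def elim!: eventually_mono)
    moreover have "- real n * flat_exp (Suc n) t + 1 * flat_exp (Suc (Suc n)) t = 0"
      using 2 by (simp add: flat_exp_def)
    ultimately show ?thesis by (subst DERIV_cong_ev[of t t _ "%_. 0" _ 0]) auto
  next
    case 3
    have "((%s. (flat_exp n (0 + s) - flat_exp n 0) / s) \<longlongrightarrow> 0) (at 0)"
      unfolding filterlim_at_split
    proof
      have "\<forall>\<^sub>F s in at_left 0. 0 = (flat_exp n (0 + s) - flat_exp n 0) / s"
        by (auto simp: eventually_at_filter flat_exp_def intro!: always_eventually)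
      then show "((%s. (flat_exp n (0 + s) - flat_exp n 0) / s) \<longlongrightarrow> 0) (at_left 0)"
        by (rule Lim_transform_eventually[OF tendsto_const])
      have "\<forall>\<^sub>F s in at_right 0. flat_exp (Suc n) s = (flat_exp n (0 + s) - flat_exp n 0) / s"
        by (auto simp: eventually_at_filter flat_exp_def intro!: always_eventually)
      then show "((%s. (flat_exp n (0 + s) - flat_exp n 0) / s) \<longlongrightarrow> 0) (at_right 0)"
        by (rule Lim_transform_eventually[OF flat_exp_tendsto_0])
    qed
    then show ?thesis using 3 by (simp add: has_field_derivative_iff flat_exp_def)
  qed
qed

lemma Ck_real_flat_exp: "Ck_real k (flat_exp n)"
proof (induction k arbitrary: n)
  case 0
  show ?case using flat_exp_has_derivative by (auto intro!: continuous_at_imp_continuous_on DERIV_isCont)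
next
  case (Suc k)
  show ?case
    by (rule Ck_real_SucI[OF flat_exp_has_derivative Ck_real_mult_add[OF Suc Suc]])
qed

text \<open>On (-1, 1) this is the usual bump \<open>exp (- 2 / (1 - t\<^sup>2))\<close>, written as
  a product in order to reuse the calculus of \<open>flat_exp\<close>.\<close>

definition bump1 :: "real => real" where
  "bump1 t = flat_exp 0 (1 + t) * flat_exp 0 (1 - t)"

lemma Ck_real_bump1: "Ck_real k bump1"
  using Ck_real_mult[OF Ck_real_affine[OF Ck_real_flat_exp, of k 1 0 1 1]
      Ck_real_affine[OF Ck_real_flat_exp, of k 1 0 "-1" 1]]
  by (simp add: bump1_def[abs_def] add.commute)

lemma bump1_nonneg: "0 <= bump1 t" and bump1_zero: "1 <= \<bar>t\<bar> ==> bump1 t = 0"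
  and bump1_pos: "0 < bump1 0"
  by (auto simp: bump1_def flat_exp_def)

lemma prod_coordinate_shift:
  fixes x :: "real^'n"
  shows "(\<Prod>i\<in>UNIV. F i ((x + t *\<^sub>R axis j 1) $ i)) = F j (x $ j + t) * (\<Prod>i\<in>UNIV-{j}. F i (x $ i))"
proof -
  have "(\<Prod>i\<in>UNIV-{j}. F i ((x + t *\<^sub>R axis j 1) $ i)) = (\<Prod>i\<in>UNIV-{j}. F i (x $ i))"
    by (rule prod.cong) (auto simp: axis_def)
  then show ?thesis by (subst prod.remove[of UNIV j]) (auto simp: axis_def)
qed

text \<open>A partial derivative in direction \<open>j\<close> only replaces the factor
  \<open>F j\<close> by its derivative. The class of coordinate products is therefore stable, and
  induction on \<open>k\<close> with \<open>F\<close> arbitrary applies.\<close>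

lemma Ck_on_coordinate_prod:
  "(!!i. Ck_real k (F i)) ==> Ck_on k UNIV (%x::real^'n. \<Prod>i\<in>UNIV. F i (x $ i))"
proof (induction k arbitrary: F)
  case 0
  have "continuous_on UNIV (%x::real^'n. F i (x $ i))" for i
    using 0[of i] by (auto intro!: continuous_intros continuous_on_compose2[of UNIV "F i"])
  then show ?case by (auto intro!: continuous_intros)
next
  case (Suc k)
  then have "\<forall>i. \<exists>f'. (\<forall>t. (F i has_real_derivative f' t) (at t)) & Ck_real k f'" by simp
  then obtain F' where F': "!!i t. (F i has_real_derivative F' i t) (at t)" "!!i. Ck_real k (F' i)"
    by metis
  show ?case
  proof (rule Ck_on_UNIV_SucI[where D="%j x. \<Prod>i\<in>UNIV. (F(j := F' j)) i (x $ i)"])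
    have "continuous_on UNIV (%x::real^'n. F i (x $ i))" for i
      using Ck_real_continuous[OF Suc.prems, of i]
      by (auto intro!: continuous_intros continuous_on_compose2[of UNIV "F i"])
    then show "continuous_on UNIV (%x::real^'n. \<Prod>i\<in>UNIV. F i (x $ i))" by (intro continuous_intros)
    show "Ck_on k UNIV (%x. \<Prod>i\<in>UNIV. (F(j := F' j)) i (x $ i))" for j
      using Ck_real_SucD[OF Suc.prems] F'(2) by (intro Suc.IH) auto
    fix j and x :: "real^'n"
    have "((%t. F j (x $ j + t)) has_real_derivative F' j (x $ j)) (at 0)"
      using F'(1)[of j "x $ j"] DERIV_shift[of "F j" "F' j (x $ j)" 0 "x $ j"] by (simp add: add.commute)
    then have "((%t. F j (x $ j + t) * (\<Prod>i\<in>UNIV-{j}. F i (x $ i))) has_real_derivative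
        F' j (x $ j) * (\<Prod>i\<in>UNIV-{j}. F i (x $ i))) (at 0)"
      by (rule DERIV_cmult_right)
    moreover have "(\<Prod>i\<in>UNIV. (F(j := F' j)) i (x $ i)) = F' j (x $ j) * (\<Prod>i\<in>UNIV-{j}. F i (x $ i))"
      by (subst prod.remove[of UNIV j]) (auto intro!: prod.cong)
    ultimately show "((%t. \<Prod>i\<in>UNIV. F i ((x + t *\<^sub>R axis j 1) $ i)) has_real_derivative
        (\<Prod>i\<in>UNIV. (F(j := F' j)) i (x $ i))) (at 0)"
      by (simp only: prod_coordinate_shift)
  qed
qed

definition bump :: "real^'n => real" where
  "bump x = (\<Prod>i\<in>UNIV. bump1 (x $ i))"

lemma bump_nonneg: "0 <= bump x" by (auto simp: bump_def intro!: prod_nonneg bump1_nonneg)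

text \<open>Where \<open>bump\<close> is nonzero every coordinate is below 1 in absolute value, so
  the euclidean norm, which is at most the l1 norm, is at most the dimension.\<close>

lemma bump_zero:
  fixes x :: "real^'n"
  assumes "real CARD('n) < norm x" shows "bump x = 0"
proof -
  have "\<exists>i. 1 <= \<bar>x $ i\<bar>"
  proof (rule ccontr)
    assume "\<not> ?thesis"
    then have "(\<Sum>i\<in>UNIV. \<bar>x $ i\<bar>) <= (\<Sum>i\<in>(UNIV::'n set). 1)" by (intro sum_mono) (auto simp: not_le less_imp_le)
    with norm_le_l1_cart[of x] assms show False by simp
  qed
  then obtain i where "bump1 (x $ i) = 0" using bump1_zero by blast
  then show ?thesis by (auto simp: bump_def)
qed

lemma Ck_on_bump: "Ck_on k UNIV bump"
  using Ck_on_coordinate_prod[of k "%_. bump1"] Ck_real_bump1 by (simp add: bump_def[abs_def])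

lemma compact_support_of_zero_outside_ball:
  fixes f :: "'a::euclidean_space => real"
  assumes "!!x. r < norm x ==> f x = 0"
  shows "compact (closure {x. f x ~= 0})"
proof -
  have "{x. f x ~= 0} \<subseteq> cball 0 r" using assms by (auto simp: dist_norm) (meson linorder_not_less)
  then show ?thesis using bounded_subset[OF bounded_cball] by (simp add: compact_closure)
qed

lemma test_fun_bump: "test_fun UNIV bump"
  using Ck_on_bump compact_support_of_zero_outside_ball[OF bump_zero] by (auto simp: test_fun_def)

lemma integral_bump_pos: "0 < (LINT x|lborel. bump (x :: real^'n))"
proof -
  let ?b = "bump :: real^'n => real"
  have "(LINT x|lborel. ?b x) ~= 0"
  proof
    assume "(LINT x|lborel. ?b x) = 0"
    then have AE: "AE x in lborel. ?b x = 0"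
      using integral_nonneg_eq_0_iff_AE[OF test_fun_integrable[OF test_fun_bump]] bump_nonneg by auto
    have op: "open {x. ?b x ~= 0}"
      using open_Collect_neq[OF test_fun_continuous[OF test_fun_bump] continuous_on_const] .
    then have "{x. ?b x ~= 0} \<in> null_sets lborel"
      using AE by (subst AE_iff_null_sets) auto
    then have "negligible {x. ?b x ~= 0}" by (simp add: negligible_iff_null_sets null_sets_completionI)
    moreover have "?b 0 ~= 0" using bump1_pos by (auto simp: bump_def)
    ultimately show False using open_not_negligible[OF op] by blast
  qed
  moreover have "(LINT x|lborel. ?b x) >= 0" by (intro Bochner_Integration.integral_nonneg bump_nonneg)
  ultimately show ?thesis by linarith
qed

lemma integral_lborel_affine:
  fixes f :: "'a::euclidean_space => real"
  assumes [measurable]: "f \<in> borel_measurable borel" and "c ~= 0"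
  shows "(LINT x|lborel. f x) = \<bar>c\<bar> ^ DIM('a) * (LINT x|lborel. f (t + c *\<^sub>R x))"
proof -
  have "(LINT x|lborel. f x) = (\<integral>x. f x \<partial>density (distr lborel borel (%x. t + c *\<^sub>R x)) (%_. \<bar>c\<bar> ^ DIM('a)))"
    using lborel_affine[OF \<open>c ~= 0\<close>, of t] by simp
  then show ?thesis by (subst (asm) integral_density) (auto simp: integral_distr ennreal_power)
qed

lemma nn_integral_lborel_reflect:
  fixes f :: "'a::euclidean_space => ennreal"
  assumes [measurable]: "f \<in> borel_measurable borel"
  shows "(\<integral>\<^sup>+x. f (t - x) \<partial>lborel) = (\<integral>\<^sup>+x. f x \<partial>lborel)"
proof -
  have "(\<integral>\<^sup>+x. f x \<partial>lborel) = (\<integral>\<^sup>+x. f x \<partial>density (distr lborel borel (%x. t + (-1) *\<^sub>R x)) (%_. \<bar>-1::real\<bar> ^ DIM('a)))"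
    using lborel_affine[of "-1" t] by simp
  then show ?thesis by (subst (asm) nn_integral_density) (auto simp: nn_integral_distr)
qed

text \<open>The pointwise bound belongs to the notion: it limits the growth of mollified functions
  to a power of \<open>1 / \<epsilon>\<close>, which is what log-Hoelder continuity of the exponent
  can compensate.\<close>

definition mollifier :: "real => real => (real^'n => real) => bool" where
  "mollifier C \<epsilon> \<rho> \<longleftrightarrow> test_fun UNIV \<rho> & (\<forall>x. 0 <= \<rho> x & \<rho> x <= C / \<epsilon> ^ CARD('n)) \<and>
     (\<forall>x. \<epsilon> < norm x --> \<rho> x = 0) & (LINT x|lborel. \<rho> x) = 1"

lemma mollifier_exists:
  obtains C where "C >= 1" "!!e. 0 < e ==> \<exists>\<rho> :: real^'n => real. mollifier C e \<rho>"
proof -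
  let ?N = "CARD('n)"
  define I where "I = (\<integral>x. bump x \<partial>(lborel :: (real^'n) measure))"
  have I: "I > 0" unfolding I_def by (rule integral_bump_pos)
  note tf = test_fun_bump
  obtain B where B: "B > 0" "!!x :: real^'n. \<bar>bump x\<bar> <= B" using test_fun_bounded[OF tf] by metis
  define C where "C = max 1 (real ?N ^ ?N / I * B)"
  have "\<exists>\<rho> :: real^'n => real. mollifier C e \<rho>" if "0 < e" for e
  proof -
    define c where "c = real ?N / e"
    have c: "c > 0" using that by (simp add: c_def)
    define \<rho> :: "real^'n => real" where "\<rho> x = (c ^ ?N / I) * bump (c *\<^sub>R x + 0)" for x
    have zero: "\<rho> x = 0" if "e < norm x" for x
    proof -
      have "real ?N < norm (c *\<^sub>R x)" using that c \<open>0 < e\<close> by (simp add: c_def field_simps)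
      then show ?thesis by (simp add: \<rho>_def bump_zero)
    qed
    have "Ck_on k UNIV \<rho>" for k
      unfolding \<rho>_def[abs_def] by (intro Ck_on_affine Ck_on_bump)
    then have "test_fun UNIV \<rho>"
      using compact_support_of_zero_outside_ball[OF zero] by (auto simp: test_fun_def)
    moreover have "0 <= \<rho> x" for x using c I by (auto simp: \<rho>_def bump_nonneg)
    moreover have "\<rho> x <= C / e ^ ?N" for x
    proof -
      have "\<rho> x <= (c ^ ?N / I) * B"
        unfolding \<rho>_def using c I B(2)[of "c *\<^sub>R x + 0"] by (intro mult_left_mono) auto
      also have "... = (real ?N ^ ?N / I * B) / e ^ ?N" by (simp add: c_def power_divide)
      also have "... <= C / e ^ ?N" using that by (intro divide_right_mono) (auto simp: C_def)
      finally show ?thesis .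
    qed
    moreover have "(LINT x|lborel. \<rho> x) = 1"
    proof -
      have eqI: "I = c ^ ?N * (LINT x|lborel. bump (c *\<^sub>R x :: real^'n))"
        using integral_lborel_affine[OF test_fun_measurable[OF tf], of c 0] c by (simp add: I_def)
      have "(LINT x|lborel. \<rho> x) = c ^ ?N / I * (LINT x|lborel. bump (c *\<^sub>R x :: real^'n))"
        by (simp add: \<rho>_def)
      also have "... = I / I" by (simp add: eqI[symmetric])
      finally show ?thesis using I by simp
    qed
    ultimately show ?thesis using zero unfolding mollifier_def by blast
  qed
  moreover have "C >= 1" by (simp add: C_def)
  ultimately show ?thesis using that by blast
qed

lemma L1_shift_small:
  fixes h :: "'a::euclidean_space => real"
  assumes "integrable lborel h" "e > 0"
  obtains d where "d > 0" "!!z. norm z < d ==> L1_shift h z < e"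
proof -
  have "\<exists>d>0. \<forall>z. norm z < d --> L1_shift h z < e"
  proof (rule ccontr)
    assume "\<not> ?thesis"
    then have "\<forall>n. \<exists>z. norm z < inverse (real (Suc n)) & \<not> L1_shift h z < e" by auto
    then obtain Z where Z: "!!n. norm (Z n) < inverse (real (Suc n))" "!!n. \<not> L1_shift h (Z n) < e" by metis
    have "Z ----> 0"
      by (rule Lim_null_comparison[OF _ LIMSEQ_inverse_real_of_nat]) (intro always_eventually allI less_imp_le[OF Z(1)])
    then have "\<forall>\<^sub>F n in sequentially. L1_shift h (Z n) < e"
      using L1_shift_tendsto_0[OF assms(1)] order_tendstoD(2) assms(2) by blast
    with Z(2) show False by auto
  qed
  with that show ?thesis by blast
qed

lemma integrable_of_nn_integral_le:
  fixes f :: "'a => real"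
  assumes "f \<in> borel_measurable M" "(\<integral>\<^sup>+x. ennreal \<bar>f x\<bar> \<partial>M) <= ennreal e" "0 <= e"
  shows "integrable M f" "(LINT x|M. \<bar>f x\<bar>) <= e"
proof -
  show int: "integrable M f"
    using assms by (auto simp: integrable_iff_bounded intro: order_le_less_trans)
  have "ennreal (LINT x|M. \<bar>f x\<bar>) = (\<integral>\<^sup>+x. ennreal \<bar>f x\<bar> \<partial>M)"
    using int by (intro nn_integral_eq_integral[symmetric]) auto
  then have "ennreal (LINT x|M. \<bar>f x\<bar>) <= ennreal e" using assms(2) by (simp only:)
  then show "(LINT x|M. \<bar>f x\<bar>) <= e" using assms(3) ennreal_le_iff by blast
qed

lemma borel_representative:
  fixes h :: "'a::euclidean_space => real"
  assumes "integrable lebesgue h"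
  obtains h' where "integrable lborel h'" "h' \<in> borel_measurable borel" "AE x in lebesgue. h x = h' x"
proof -
  obtain h' where h': "h' \<in> borel_measurable lborel" "AE x in lborel. h x = h' x"
    using completion_ex_borel_measurable_real[of h lborel] assms by auto
  then have AE: "AE x in lebesgue. h x = h' x" by (auto intro: AE_completion)
  have "integrable lebesgue h'"
    using assms AE h' by (subst integrable_cong_AE[of h' _ h]) (auto intro: measurable_completion)
  then have "integrable lborel h'" using h'(1) by (simp add: integrable_completion)
  with AE h' show ?thesis using that by auto
qed

text \<open>As the kernel has mass one, \<open>conv h \<rho> x - h x\<close> is an average of
  \<open>h y - h x\<close>, and \<open>L1_kernel_estimate\<close> applies with \<kappa> the
  reflected mollifier.\<close>

lemma conv_mollifier_L1_estimate:
  fixes h :: "real^'n => real"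
  assumes [measurable]: "h \<in> borel_measurable borel" and h: "integrable lborel h" and \<rho>: "mollifier C e \<rho>"
    and S: "!!z. norm z <= e ==> L1_shift h z <= S" and "0 <= S"
  shows "(\<integral>\<^sup>+x. ennreal \<bar>conv h \<rho> x - h x\<bar> \<partial>lborel) <= ennreal S"
proof -
  have tf: "test_fun UNIV \<rho>" and \<rho>0: "!!x. 0 <= \<rho> x" and \<rho>z: "!!x. e < norm x ==> \<rho> x = 0"
    and \<rho>1: "(LINT x|lborel. \<rho> x) = 1"
    using \<rho> by (auto simp: mollifier_def)
  note [measurable] = test_fun_measurable[OF tf]
  obtain B where B: "!!x. \<bar>\<rho> x\<bar> <= B" using test_fun_bounded[OF tf] by metis
  have nn1: "(\<integral>\<^sup>+y. ennreal (\<rho> y) \<partial>lborel) = 1"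
    using nn_integral_eq_integral[OF test_fun_integrable[OF tf]] \<rho>0 \<rho>1 by simp
  have int\<rho>: "integrable lborel (%y. \<rho> (x - y))" "(LINT y|lborel. \<rho> (x - y)) = 1" for x
  proof -
    have nn: "(\<integral>\<^sup>+y. ennreal (\<rho> (x - y)) \<partial>lborel) = 1"
      using nn_integral_lborel_reflect[of "%y. ennreal (\<rho> y)" x] nn1 by simp
    then show "integrable lborel (%y. \<rho> (x - y))" using \<rho>0 by (simp add: integrable_iff_bounded)
    show "(LINT y|lborel. \<rho> (x - y)) = 1" using nn \<rho>0 by (simp add: integral_eq_nn_integral)
  qed
  have bd: "ennreal \<bar>conv h \<rho> x - h x\<bar> <= (\<integral>\<^sup>+y. ennreal (\<rho> (x - y)) * ennreal \<bar>h y - h x\<bar> \<partial>lborel)" for x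
  proof -
    have "integrable lebesgue (%y. h y * \<rho> (x - y))"
      using h by (intro integrable_conv[OF _ _ B]) (auto simp: integrable_completion)
    then have i: "integrable lborel (%y. h y * \<rho> (x - y))" by (simp add: integrable_completion)
    have "conv h \<rho> x = (LINT y|lborel. h y * \<rho> (x - y))" by (simp add: conv_def integral_completion)
    then have "conv h \<rho> x - h x = (LINT y|lborel. h y * \<rho> (x - y)) - (LINT y|lborel. h x * \<rho> (x - y))"
      using int\<rho>[of x] by simp
    also have "... = (LINT y|lborel. h y * \<rho> (x - y) - h x * \<rho> (x - y))"
      using i int\<rho>[of x] by (intro Bochner_Integration.integral_diff[symmetric]) auto
    finally have "conv h \<rho> x - h x = (LINT y|lborel. h y * \<rho> (x - y) - h x * \<rho> (x - y))" .
    moreover have "norm (LINT y|lborel. h y * \<rho> (x - y) - h x * \<rho> (x - y))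
        <= (\<integral>\<^sup>+y. norm (h y * \<rho> (x - y) - h x * \<rho> (x - y)) \<partial>lborel)"
      using i int\<rho>[of x] by (intro integral_norm_bound_ennreal) auto
    moreover have "ennreal (norm (h y * \<rho> (x - y) - h x * \<rho> (x - y))) = ennreal (\<rho> (x - y)) * ennreal \<bar>h y - h x\<bar>" for y
      using \<rho>0[of "x - y"] by (simp add: ennreal_mult[symmetric] abs_mult flip: left_diff_distrib add: mult.commute)
    ultimately show ?thesis by simp
  qed
  have "(\<integral>\<^sup>+x. ennreal \<bar>conv h \<rho> x - h x\<bar> \<partial>lborel) <=
      (\<integral>\<^sup>+x. \<integral>\<^sup>+y. ennreal (\<rho> (x - y)) * ennreal \<bar>h y - h x\<bar> \<partial>lborel \<partial>lborel)"
    by (intro nn_integral_mono bd)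
  also have "... <= (\<integral>\<^sup>+z. ennreal (\<rho> (0 - z)) \<partial>lborel) * ennreal S"
  proof (rule L1_kernel_estimate)
    fix z :: "real^'n" assume "ennreal (\<rho> (0 - z)) ~= 0"
    then have "norm z <= e" using \<rho>z[of "-z"] by (cases "e < norm z") auto
    then have "L1_shift h z <= S" by (rule S)
    moreover have "(\<integral>\<^sup>+x. ennreal \<bar>h (x + z) - h x\<bar> \<partial>lborel) = ennreal (L1_shift h z)"
      unfolding L1_shift_def using h integrable_lborel_translate[OF h] by (intro nn_integral_eq_integral) auto
    ultimately show "(\<integral>\<^sup>+x. ennreal \<bar>h (x + z) - h x\<bar> \<partial>lborel) <= ennreal S" by (simp add: ennreal_leI)
  qed (auto simp: algebra_simps)
  also have "(\<integral>\<^sup>+z. ennreal (\<rho> (0 - z)) \<partial>lborel) = 1"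
    using nn_integral_lborel_reflect[of "%y. ennreal (\<rho> y)" 0] nn1 by simp
  finally show ?thesis by simp
qed

lemma conv_AE_cong:
  assumes "AE x in lebesgue. h x = h' x" "h \<in> borel_measurable lebesgue" "h' \<in> borel_measurable lebesgue"
    "\<psi> \<in> borel_measurable borel"
  shows "conv h \<psi> = conv h' \<psi>"
proof
  fix x
  have "(%y. \<psi> (x - y)) \<in> borel_measurable lborel" using assms(4) by simp
  then have "(%y. \<psi> (x - y)) \<in> borel_measurable lebesgue" by (rule measurable_completion)
  with assms show "conv h \<psi> x = conv h' \<psi> x"
    unfolding conv_def by (intro integral_cong_AE) auto
qed

text \<open>The translation estimates concern Borel functions, so \<open>h\<close> is first replaced
  by a Borel representative; the convolution does not see the change.\<close>

lemma conv_mollifier: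
  fixes h :: "real^'n => real"
  assumes h: "integrable lebesgue h" and \<rho>: "!!k. mollifier C (\<epsilon> k) (\<rho> k)" and \<epsilon>: "\<epsilon> ----> 0"
  shows "integrable lebesgue (conv h (\<rho> k))" "(%k. \<integral>x. \<bar>conv h (\<rho> k) x - h x\<bar> \<partial>lebesgue) ----> 0"
proof -
  obtain h' where h': "integrable lborel h'" "h' \<in> borel_measurable borel" "AE x in lebesgue. h x = h' x"
    using borel_representative[OF h] .
  note [measurable] = h'(2)
  have tf: "test_fun UNIV (\<rho> k)" for k using \<rho> by (auto simp: mollifier_def)
  have cc: "conv h (\<rho> k) = conv h' (\<rho> k)" for k
    using h h' test_fun_measurable[OF tf[of k]] by (intro conv_AE_cong) (auto intro: measurable_completion)
  have [measurable]: "conv h' (\<rho> k) \<in> borel_measurable borel" for k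
    using conv_continuous_test[OF h tf[of k]] cc by (simp add: borel_measurable_continuous_onI)
  have est: "integrable lborel (%x. conv h' (\<rho> k) x - h' x)" "(LINT x|lborel. \<bar>conv h' (\<rho> k) x - h' x\<bar>) <= S"
    if "!!z. norm z <= \<epsilon> k ==> L1_shift h' z <= S" "0 <= S" for k S
    using integrable_of_nn_integral_le[OF _ conv_mollifier_L1_estimate[OF h'(2,1) \<rho> that]] that by auto
  have int: "integrable lborel (conv h' (\<rho> k))" for k
  proof -
    have "integrable lborel (%x. conv h' (\<rho> k) x - h' x)"
      using L1_shift_le_norm[OF h'(1)] by (intro est) auto
    from Bochner_Integration.integrable_add[OF this h'(1)] show ?thesis by simp
  qed
  then show "integrable lebesgue (conv h (\<rho> k))" by (simp add: cc integrable_completion)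
  have "(LINT x|lebesgue. \<bar>conv h (\<rho> k) x - h x\<bar>) = (LINT x|lborel. \<bar>conv h' (\<rho> k) x - h' x\<bar>)" for k
  proof -
    have "(LINT x|lebesgue. \<bar>conv h (\<rho> k) x - h x\<bar>) = (LINT x|lebesgue. \<bar>conv h' (\<rho> k) x - h' x\<bar>)"
    proof (rule integral_cong_AE)
      show "AE x in lebesgue. \<bar>conv h (\<rho> k) x - h x\<bar> = \<bar>conv h' (\<rho> k) x - h' x\<bar>"
        using h'(3) by eventually_elim (simp add: cc)
      have "conv h (\<rho> k) \<in> borel_measurable lebesgue"
        by (simp add: cc measurable_completion)
      then show "(%x. \<bar>conv h (\<rho> k) x - h x\<bar>) \<in> borel_measurable lebesgue" using h by auto
    qed (simp add: measurable_completion)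
    then show ?thesis by (simp add: integral_completion)
  qed
  moreover have "(%k. \<integral>x. \<bar>conv h' (\<rho> k) x - h' x\<bar> \<partial>lborel) ----> 0"
  proof (rule LIMSEQ_I)
    fix e :: real assume "e > 0"
    then obtain d where d: "d > 0" "!!z. norm z < d ==> L1_shift h' z < e / 2"
      using L1_shift_small[OF h'(1), of "e / 2"] by auto
    obtain N where N: "!!k. k >= N ==> norm (\<epsilon> k - 0) < d" using LIMSEQ_D[OF \<epsilon> d(1)] by blast
    have "norm ((LINT x|lborel. \<bar>conv h' (\<rho> k) x - h' x\<bar>) - 0) < e" if "k >= N" for k
    proof -
      have "L1_shift h' z <= e / 2" if "norm z <= \<epsilon> k" for z
      proof -
        have "norm z < d" using N[OF \<open>k >= N\<close>] that by auto
        then show ?thesis by (intro less_imp_le d(2))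
      qed
      then have "(LINT x|lborel. \<bar>conv h' (\<rho> k) x - h' x\<bar>) <= e / 2" using \<open>e > 0\<close> by (intro est) auto
      then show ?thesis using \<open>e > 0\<close> by auto
    qed
    then show "\<exists>N. \<forall>k\<ge>N. norm ((LINT x|lborel. \<bar>conv h' (\<rho> k) x - h' x\<bar>) - 0) < e" by blast
  qed
  ultimately show "(%k. \<integral>x. \<bar>conv h (\<rho> k) x - h x\<bar> \<partial>lebesgue) ----> 0" by simp
qed

section \<open>Weak gradients\<close>

abbreviation cgrad :: "(real^'n => real) => real^'n => real^'n" where
  "cgrad \<phi> x \<equiv> (\<chi> j. pd \<phi> j x)"

lemma borel_measurable_vecI:
  fixes G :: "'a => real^'n"
  assumes "!!j. (%x. G x $ j) \<in> borel_measurable M"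
  shows "G \<in> borel_measurable M"
  using assms by (subst borel_measurable_euclidean_space) (auto simp: Basis_vec_def inner_axis)

lemma borel_measurable_vec_nth [measurable (raw)]:
  fixes G :: "'a => real^'n"
  assumes "G \<in> borel_measurable M"
  shows "(%x. G x $ j) \<in> borel_measurable M"
proof -
  have "(%x. G x \<bullet> axis j 1) \<in> borel_measurable M" using assms by simp
  then show ?thesis by (simp add: inner_axis)
qed

lemma borel_measurable_lebesgue_on_AE:
  fixes f g :: "'a::euclidean_space => 'b::euclidean_space"
  assumes "f \<in> borel_measurable (lebesgue_on S)" "AE x in lebesgue_on S. f x = g x" "S \<in> sets lebesgue"
  shows "g \<in> borel_measurable (lebesgue_on S)"
proof -
  have "(%x. if x \<in> S then f x else 0) \<in> borel_measurable lebesgue"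
    using assms by (simp add: borel_measurable_if)
  moreover have "AE x in lebesgue. x \<in> S --> f x = g x"
    using assms by (simp add: AE_restrict_space_iff)
  then have "AE x in lebesgue. (if x \<in> S then f x else 0) = (if x \<in> S then g x else 0)"
    by eventually_elim auto
  ultimately have "(%x. if x \<in> S then g x else 0) \<in> borel_measurable lebesgue"
    by (rule borel_measurable_AE)
  then show ?thesis using assms by (simp add: borel_measurable_if)
qed

text \<open>The bounded factors may change with \<open>k\<close> and need not converge; only their
  common bound matters. The chain rule uses this with coefficients that depend on the
  mollification.\<close>

lemma tendsto_integral_mult_bounded:
  fixes u :: "nat => 'a => real"
  assumes u: "!!k. integrable M (u k)" and v: "integrable M v"
    and lim: "(%k. \<integral>x. \<bar>u k x - v x\<bar> \<partial>M) ----> 0"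
    and g: "!!k. g k \<in> borel_measurable M" "!!k. AE x in M. \<bar>g k x\<bar> <= B"
  shows "(%k. (LINT x|M. u k x * g k x) - (LINT x|M. v x * g k x)) ----> 0"
proof (rule Lim_null_comparison)
  have bd: "integrable M (%x. f x * g k x)" if f: "integrable M f" for f k
  proof (rule Bochner_Integration.integrable_bound)
    show "integrable M (%x. B * f x)" using f by simp
    show "AE x in M. norm (f x * g k x) <= norm (B * f x)"
      using g(2)[of k] by eventually_elim (simp add: abs_mult mult.commute[of B] mult_left_mono)
  qed (use f g(1) in auto)
  show "\<forall>\<^sub>F k in sequentially. norm ((LINT x|M. u k x * g k x) - (LINT x|M. v x * g k x)) <= B * (LINT x|M. \<bar>u k x - v x\<bar>)"
  proof (intro always_eventually allI)
    fix k
    have "(LINT x|M. u k x * g k x) - (LINT x|M. v x * g k x) = (LINT x|M. (u k x - v x) * g k x)"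
      using bd[OF u] bd[OF v] by (simp add: left_diff_distrib)
    also have "norm ... <= (LINT x|M. norm ((u k x - v x) * g k x))" by (rule integral_norm_bound)
    also have "... <= (LINT x|M. B * \<bar>u k x - v x\<bar>)"
    proof (rule integral_mono_AE)
      have "integrable M (%x. u k x - v x)" using u v by simp
      then show "integrable M (%x. norm ((u k x - v x) * g k x))" by (intro integrable_norm bd)
      show "AE x in M. norm ((u k x - v x) * g k x) <= B * \<bar>u k x - v x\<bar>"
        using g(2)[of k] by eventually_elim (simp add: abs_mult mult.commute[of B] mult_left_mono)
    qed (use u v in simp)
    also have "... = B * (LINT x|M. \<bar>u k x - v x\<bar>)" by simp
    finally show "norm ((LINT x|M. u k x * g k x) - (LINT x|M. v x * g k x)) <= B * (LINT x|M. \<bar>u k x - v x\<bar>)" .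
  qed
  show "(%k. B * (LINT x|M. \<bar>u k x - v x\<bar>)) ----> 0" using tendsto_mult_left[OF lim, of B] by simp
qed

lemma compact_in_open_nbhd:
  fixes K :: "'a::euclidean_space set"
  assumes "compact K" "open \<Omega>" "K \<subseteq> \<Omega>"
  obtains d K' where "d > 0" "compact K'" "K' \<subseteq> \<Omega>" "!!x. x \<in> K ==> cball x d \<subseteq> K'"
proof -
  obtain d where d: "d > 0" "(\<Union>x\<in>K. cball x d) \<subseteq> \<Omega>"
    using compact_subset_open_imp_cball_epsilon_subset[OF assms] by metis
  define K' where "K' = {x + y |x y. x \<in> K & y \<in> cball 0 d}"
  have eq: "K' = (\<Union>x\<in>K. cball x d)"
  proof (rule set_eqI)
    fix z :: 'a
    have "z \<in> cball x d \<longleftrightarrow> (\<exists>y\<in>cball 0 d. z = x + y)" for x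
      by (auto simp: dist_norm norm_minus_commute intro!: bexI[of _ "z - x"])
    then show "z \<in> K' \<longleftrightarrow> z \<in> (\<Union>x\<in>K. cball x d)" unfolding K'_def by blast
  qed
  have "compact K'" unfolding K'_def by (rule compact_sums[OF assms(1) compact_cball])
  with d eq show ?thesis using that[of d K'] by blast
qed

lemma sets_lebesgue_compact: "compact K ==> K \<in> sets lebesgue" for K :: "'a::euclidean_space set"
  using compact_imp_closed lmeasurable_compact fmeasurableD by blast

lemma sets_lebesgue_open: "open S ==> S \<in> sets lebesgue" for S :: "'a::euclidean_space set"
  by auto

lemma integrable_lebesgue_on_subset:
  fixes f :: "'a::euclidean_space => 'b::{banach, second_countable_topology}"
  assumes "integrable (lebesgue_on S) f" "S \<in> sets lebesgue" "T \<in> sets lebesgue" "T \<subseteq> S"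
  shows "integrable (lebesgue_on T) f"
proof -
  have "integrable lebesgue (%x. indicator T x *\<^sub>R (indicator S x *\<^sub>R f x))"
    using assms by (intro integrable_mult_indicator[OF _ integrable_restrict_space[THEN iffD1]]) auto
  moreover have "(%x. indicator T x *\<^sub>R (indicator S x *\<^sub>R f x)) = (%x. indicator T x *\<^sub>R f x)"
    using assms(4) by (auto simp: indicator_def fun_eq_iff)
  ultimately have "integrable lebesgue (%x. indicator T x *\<^sub>R f x)" by (simp only:)
  then show ?thesis using assms by (simp add: integrable_restrict_space)
qed

lemma AE_lebesgue_on_subset:
  assumes "AE x in lebesgue_on S. P x" "S \<in> sets lebesgue" "T \<in> sets lebesgue" "T \<subseteq> S"
  shows "AE x in lebesgue_on T. P x"
  using assms by (auto simp: AE_restrict_space_iff elim!: eventually_mono)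

lemma lebesgue_on_zero_outside:
  fixes f g :: "'a::euclidean_space => 'b::{banach, second_countable_topology}"
  assumes "S \<in> sets lebesgue" "!!x. x \<in> S ==> f x = g x" "!!x. x \<notin> S ==> g x = 0"
  shows "(LINT x|lebesgue_on S. f x) = (LINT x|lebesgue. g x)"
    and "integrable (lebesgue_on S) f \<longleftrightarrow> integrable lebesgue g"
proof -
  have "(%x. indicator S x *\<^sub>R f x) = g"
  proof
    fix x show "indicator S x *\<^sub>R f x = g x"
      using assms(2,3)[of x] by (cases "x \<in> S") auto
  qed
  then show "(LINT x|lebesgue_on S. f x) = (LINT x|lebesgue. g x)"
      and "integrable (lebesgue_on S) f \<longleftrightarrow> integrable lebesgue g"
    using assms(1) by (simp_all add: integral_restrict_space integrable_restrict_space)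
qed

lemma loc_integrableI: "integrable (lebesgue_on \<Omega>) u ==> open \<Omega> ==> loc_integrable \<Omega> u"
  unfolding loc_integrable_def
  using integrable_lebesgue_on_subset sets_lebesgue_compact sets_lebesgue_open by blast

lemma loc_integrableD:
  assumes "loc_integrable \<Omega> u" "compact K" "K \<subseteq> \<Omega>"
  shows "integrable lebesgue (%x. indicator K x * u x)"
  using assms sets_lebesgue_compact[of K] by (auto simp: loc_integrable_def integrable_restrict_space)

text \<open>Local integrability speaks about compact subsets only; an exhaustion of \<Omega> by
  compact sets assembles the measurability.\<close>

lemma loc_integrable_measurable:
  assumes "loc_integrable \<Omega> u" "open \<Omega>"
  shows "u \<in> borel_measurable (lebesgue_on \<Omega>)"
proof -
  obtain C where C: "!!n. compact (C n)" "!!n. C n \<subseteq> \<Omega>" "!!n. C n \<subseteq> interior (C (Suc n))" "\<Union> (range C) = \<Omega>"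
    using open_Union_compact_subsets[OF assms(2)] by metis
  have "incseq C"
    by (rule incseq_SucI) (use C(3) interior_subset in blast)
  then have mono: "C n \<subseteq> C m" if "n <= m" for n m
    using that by (simp add: incseq_def)
  show ?thesis
  proof (rule borel_measurable_LIMSEQ_real[where u="%n x. indicator (C n) x * u x"])
    fix x assume "x \<in> space (lebesgue_on \<Omega>)"
    then obtain n where n: "x \<in> C n" using C(4) by auto
    have "\<forall>\<^sub>F m in sequentially. indicator (C m) x * u x = u x"
      using eventually_ge_at_top[of n] by eventually_elim (use mono n in \<open>auto simp: indicator_def\<close>)
    then show "(%n. indicator (C n) x * u x) ----> u x" by (rule tendsto_eventually)
  next
    fix n
    have "(%x. indicator (C n) x * u x) \<in> borel_measurable lebesgue"
      using loc_integrableD[OF assms(1) C(1,2)] by (rule borel_measurable_integrable)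
    then show "(%x. indicator (C n) x * u x) \<in> borel_measurable (lebesgue_on \<Omega>)"
      by (rule measurable_restrict_space1)
  qed
qed

lemma loc_integrable_bound:
  assumes "loc_integrable \<Omega> u" "open \<Omega>" "v \<in> borel_measurable (lebesgue_on \<Omega>)"
    "AE x in lebesgue_on \<Omega>. \<bar>v x\<bar> <= \<bar>u x\<bar> + c"
  shows "loc_integrable \<Omega> v"
  unfolding loc_integrable_def
proof safe
  fix K assume K: "compact K" "K \<subseteq> \<Omega>"
  note s = sets_lebesgue_compact[OF K(1)] sets_lebesgue_open[OF assms(2)]
  have fin: "finite_measure (lebesgue_on K)" using K(1) lmeasurable_compact finite_measure_lebesgue_on by blast
  show "integrable (lebesgue_on K) v"
  proof (rule Bochner_Integration.integrable_bound)
    show "integrable (lebesgue_on K) (%x. \<bar>u x\<bar> + c)"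
      using assms(1) K
      by (intro Bochner_Integration.integrable_add integrable_abs finite_measure.integrable_const[OF fin])
        (auto simp: loc_integrable_def)
    show "v \<in> borel_measurable (lebesgue_on K)"
      by (rule measurable_restrict_mono[OF assms(3) K(2)])
    show "AE x in lebesgue_on K. norm (v x) <= norm (\<bar>u x\<bar> + c)"
      using AE_lebesgue_on_subset[OF assms(4) s(2,1) K(2)] by eventually_elim auto
  qed
qed

lemma integrable_loc_mult_test:
  assumes u: "loc_integrable \<Omega> u" and \<phi>: "test_fun \<Omega> \<phi>" and "open \<Omega>"
  shows "integrable (lebesgue_on \<Omega>) (%x. u x * \<phi> x)"
proof -
  obtain K where K: "compact K" "K \<subseteq> \<Omega>" "!!x. x \<notin> K ==> \<phi> x = 0" using test_fun_support[OF \<phi>] by metis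
  obtain B where B: "!!x. \<bar>\<phi> x\<bar> <= B" using test_fun_bounded[OF \<phi>] by metis
  have "integrable lebesgue (%x. (indicator K x * u x) * \<phi> (x - 0))"
  proof (rule Bochner_Integration.integrable_bound)
    show "integrable lebesgue (%x. B * (indicator K x * u x))" using loc_integrableD[OF u K(1,2)] by simp
    have "\<phi> \<in> borel_measurable lborel" using test_fun_measurable[OF \<phi>] by simp
    then have "\<phi> \<in> borel_measurable lebesgue" by (rule measurable_completion)
    then show "(%x. (indicator K x * u x) * \<phi> (x - 0)) \<in> borel_measurable lebesgue"
      using borel_measurable_integrable[OF loc_integrableD[OF u K(1,2)]] by simp
    have "B >= 0" using B[of 0] by simp
    then show "AE x in lebesgue. norm ((indicator K x * u x) * \<phi> (x - 0)) <= norm (B * (indicator K x * u x))"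
      using B by (intro AE_I2) (simp add: abs_mult mult.commute[of B] mult_left_mono)
  qed
  moreover have "integrable (lebesgue_on \<Omega>) (%x. u x * \<phi> x) \<longleftrightarrow> integrable lebesgue (%x. (indicator K x * u x) * \<phi> (x - 0))"
    by (rule lebesgue_on_zero_outside(2)) (use K(2,3) \<open>open \<Omega>\<close> in \<open>auto simp: indicator_def\<close>)
  ultimately show ?thesis by simp
qed

lemma weak_gradD:
  assumes "weak_grad \<Omega> u G"
  shows "loc_integrable \<Omega> u" "loc_integrable \<Omega> (%x. G x $ j)"
    "test_fun \<Omega> \<phi> ==> (LINT x|lebesgue_on \<Omega>. u x * pd \<phi> j x) = - (LINT x|lebesgue_on \<Omega>. G x $ j * \<phi> x)"
  using assms by (auto simp: weak_grad_def)

lemma weak_grad_measurable: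
  assumes "weak_grad \<Omega> u G" "open \<Omega>"
  shows "u \<in> borel_measurable (lebesgue_on \<Omega>)" "G \<in> borel_measurable (lebesgue_on \<Omega>)"
proof -
  show "u \<in> borel_measurable (lebesgue_on \<Omega>)"
    using loc_integrable_measurable weak_gradD(1)[OF assms(1)] assms(2) by blast
  have "(%x. G x $ j) \<in> borel_measurable (lebesgue_on \<Omega>)" for j
    using loc_integrable_measurable weak_gradD(2)[OF assms(1)] assms(2) by blast
  then show "G \<in> borel_measurable (lebesgue_on \<Omega>)" by (rule borel_measurable_vecI)
qed

text \<open>The reflected kernel \<open>y \<mapsto> \<rho> (x - y)\<close> is a legitimate test
  function as soon as its ball lies in \<Omega>. Cutting off with \<open>K\<close> is invisible at
  such \<open>x\<close> and makes the factors integrable over the whole space.\<close>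

lemma conv_pd_eq_conv_weak_grad:
  assumes G: "weak_grad \<Omega> u G" and "open \<Omega>" and K: "compact K" "K \<subseteq> \<Omega>" and \<rho>: "test_fun UNIV \<rho>"
    and \<rho>z: "!!z. r < norm z ==> \<rho> z = 0" and sub: "cball x r \<subseteq> K"
  shows "conv (%y. indicator K y * u y) (pd \<rho> j) x = conv (%y. indicator K y * G y $ j) \<rho> x"
proof -
  have "cball x r \<subseteq> \<Omega>" using sub K(2) by blast
  note t = test_fun_reflect[OF \<rho> \<rho>z this]
  have "{z. \<rho> z ~= 0} \<subseteq> cball 0 r" using \<rho>z by (auto simp: dist_norm) (meson linorder_not_less)
  then have "closure {z. \<rho> z ~= 0} \<subseteq> cball 0 r" by (simp add: closure_minimal)
  then have pz: "pd \<rho> j z = 0" if "r < norm z" for z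
    using that by (intro test_fun_pd_zero[OF \<rho>]) auto
  have out: "r < norm (x - y)" if "y \<notin> K" for y
  proof -
    have "y \<notin> cball x r" using that sub by blast
    then show ?thesis by (simp add: dist_norm)
  qed
  have s: "\<Omega> \<in> sets lebesgue" using \<open>open \<Omega>\<close> by auto
  have "(LINT y|lebesgue_on \<Omega>. u y * pd (%y. \<rho> (x - y)) j y) = - (LINT y|lebesgue_on \<Omega>. G y $ j * \<rho> (x - y))"
    by (rule weak_gradD(3)[OF G t(1)])
  then have "(LINT y|lebesgue_on \<Omega>. u y * pd \<rho> j (x - y)) = (LINT y|lebesgue_on \<Omega>. G y $ j * \<rho> (x - y))"
    by (simp add: t(2))
  moreover have "(LINT y|lebesgue_on \<Omega>. u y * pd \<rho> j (x - y)) = conv (%y. indicator K y * u y) (pd \<rho> j) x"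
    unfolding conv_def
    by (rule lebesgue_on_zero_outside(1)[OF s]) (use pz[OF out] K(2) in \<open>auto simp: indicator_def\<close>)
  moreover have "(LINT y|lebesgue_on \<Omega>. G y $ j * \<rho> (x - y)) = conv (%y. indicator K y * G y $ j) \<rho> x"
    unfolding conv_def
    by (rule lebesgue_on_zero_outside(1)[OF s]) (use \<rho>z[OF out] K(2) in \<open>auto simp: indicator_def\<close>)
  ultimately show ?thesis by simp
qed

text \<open>One constant is fixed for all scales, so that the sup bounds of the family
  \<open>moll\<close> differ only by the power of \<epsilon>. The dummy argument records the
  dimension, on which the constant depends.\<close>

definition moll_const :: "('n::finite) itself => real" where
  "moll_const _ = (SOME C. C >= 1 & (\<forall>\<epsilon>>0. \<exists>\<rho> :: real^'n => real. mollifier C \<epsilon> \<rho>))"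

definition moll :: "real => real^'n => real" where
  "moll \<epsilon> = (SOME \<rho>. mollifier (moll_const TYPE('n)) \<epsilon> \<rho>)"

lemma moll_const: "moll_const TYPE('n) >= 1"
  and moll: "e > 0 ==> mollifier (moll_const TYPE('n)) e (moll e :: real^'n => real)"
proof -
  have *: "moll_const TYPE('n) >= 1 & (\<forall>e>0. \<exists>\<rho> :: real^'n => real. mollifier (moll_const TYPE('n)) e \<rho>)"
    unfolding moll_const_def
    by (rule someI_ex) (rule mollifier_exists[where 'n='n], blast)
  then show "moll_const TYPE('n) >= 1" by blast
  assume "e > 0"
  with * show "mollifier (moll_const TYPE('n)) e (moll e :: real^'n => real)"
    unfolding moll_def by (metis someI_ex)
qed

lemma moll_props:
  assumes "e > 0"
  shows "test_fun UNIV (moll e :: real^'n => real)" "!!z :: real^'n. e < norm z ==> moll e z = 0"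
    "!!z :: real^'n. 0 <= moll e z" "!!z :: real^'n. moll e z <= moll_const TYPE('n) / e ^ CARD('n)"
    "(LINT z|lborel. moll e (z :: real^'n)) = 1"
  using moll[OF assms, where 'n='n] by (auto simp: mollifier_def)

lemma conv_moll:
  fixes h :: "real^'n => real"
  assumes h: "integrable lebesgue h" and e: "e ----> 0" "!!k. e k > 0"
  shows "integrable lebesgue (conv h (moll (e k)))" "(%k. \<integral>x. \<bar>conv h (moll (e k)) x - h x\<bar> \<partial>lebesgue) ----> 0"
  using conv_mollifier[OF h moll[OF e(2)] e(1)] by auto

lemma conv_moll_AE_subseq:
  fixes h :: "real^'n => real"
  assumes h: "integrable lebesgue h" and e: "e ----> 0" "!!k. e k > 0"
  obtains r where "strict_mono (r :: nat => nat)" "AE x in lebesgue. (%k. conv h (moll (e (r k))) x) ----> h x"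
proof -
  have "\<exists>r::nat\<Rightarrow>nat. strict_mono r & (AE x in lebesgue. (%k. conv h (moll (e (r k))) x - h x) ----> 0)"
    by (rule tendsto_L1_AE_subseq) (use conv_moll[OF h e] h in auto)
  then show ?thesis using that by (auto simp: LIM_zero_iff)
qed

text \<open>Testing with reflected mollifiers shows that the mollifications of \<open>g\<close>
  vanish at interior points of a compact set once the scale is small, while along a subsequence they
  converge to \<open>g\<close> almost everywhere.\<close>

lemma fundamental_lemma:
  assumes g: "loc_integrable \<Omega> g" and "open \<Omega>"
    and z: "!!\<phi>. test_fun \<Omega> \<phi> ==> (LINT x|lebesgue_on \<Omega>. g x * \<phi> x) = 0"
  shows "AE x in lebesgue_on \<Omega>. g x = 0"
proof -
  obtain C where C: "!!n. compact (C n)" "!!n. C n \<subseteq> \<Omega>" "!!n. C n \<subseteq> interior (C (Suc n))" "\<Union> (range C) = \<Omega>"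
    using open_Union_compact_subsets[OF assms(2)] by metis
  define \<epsilon> where "\<epsilon> k = inverse (real (Suc k))" for k
  have \<epsilon>: "\<epsilon> ----> 0" "!!k. \<epsilon> k > 0" unfolding \<epsilon>_def using LIMSEQ_inverse_real_of_nat by auto
  have s: "\<Omega> \<in> sets lebesgue" using \<open>open \<Omega>\<close> by auto
  have "AE x in lebesgue. x \<in> interior (C n) --> g x = 0" for n
  proof -
    let ?h = "%x. indicator (C n) x * g x"
    obtain r where r: "strict_mono (r :: nat => nat)" "AE x in lebesgue. (%k. conv ?h (moll (\<epsilon> (r k))) x) ----> ?h x"
      using conv_moll_AE_subseq[OF loc_integrableD[OF g C(1,2)] \<epsilon>] .
    from r(2) show ?thesis
    proof eventually_elim
      case (elim x)
      show "x \<in> interior (C n) --> g x = 0"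
      proof
        assume x: "x \<in> interior (C n)"
        then obtain e where e: "e > 0" "cball x e \<subseteq> C n" using mem_interior_cball by blast
        have "(%k. \<epsilon> (r k)) ----> 0" using LIMSEQ_subseq_LIMSEQ[OF \<epsilon>(1) r(1)] by (simp add: o_def)
        then have "\<forall>\<^sub>F k in sequentially. \<epsilon> (r k) < e" using e(1) by (rule order_tendstoD)
        then have "\<forall>\<^sub>F k in sequentially. conv ?h (moll (\<epsilon> (r k))) x = 0"
        proof eventually_elim
          case (elim k)
          then have sub: "cball x (\<epsilon> (r k)) \<subseteq> C n" using e(2) by auto
          note m = moll_props(1,2)[OF \<epsilon>(2)[of "r k"]]
          have out: "moll (\<epsilon> (r k)) (x - y) = 0" if "y \<notin> C n" for y
            using that sub by (intro m(2)) (auto simp: dist_norm subset_iff not_le[symmetric])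
          have "0 = (LINT y|lebesgue_on \<Omega>. g y * moll (\<epsilon> (r k)) (x - y))"
            using z[OF test_fun_reflect(1)[OF m(1) m(2), of "\<epsilon> (r k)" x \<Omega>]] sub C(2) by force
          also have "... = conv ?h (moll (\<epsilon> (r k))) x"
            unfolding conv_def
            by (rule lebesgue_on_zero_outside(1)[OF s]) (use out C(2)[of n] in \<open>auto simp: indicator_def\<close>)
          finally show ?case by simp
        qed
        then have "(%k. conv ?h (moll (\<epsilon> (r k))) x) ----> 0" by (rule tendsto_eventually)
        with elim have "?h x = 0" using LIMSEQ_unique by blast
        then show "g x = 0" using x interior_subset by (auto simp: indicator_def split: if_splits)
      qed
    qed
  qed
  then have "AE x in lebesgue. \<forall>n. x \<in> interior (C n) --> g x = 0" unfolding AE_all_countable by blast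
  then have "AE x in lebesgue. x \<in> \<Omega> --> g x = 0"
    by eventually_elim (use C(3,4) in blast)
  then show ?thesis using s by (simp add: AE_restrict_space_iff)
qed

lemma loc_integrable_AE_cong:
  assumes "loc_integrable \<Omega> u" "open \<Omega>" "AE x in lebesgue_on \<Omega>. u x = v x"
  shows "loc_integrable \<Omega> v"
proof (rule loc_integrable_bound[OF assms(1,2), of _ 0])
  show "v \<in> borel_measurable (lebesgue_on \<Omega>)"
    using borel_measurable_lebesgue_on_AE[OF loc_integrable_measurable[OF assms(1,2)] assms(3)] assms(2) by auto
  show "AE x in lebesgue_on \<Omega>. \<bar>v x\<bar> <= \<bar>u x\<bar> + 0" using assms(3) by eventually_elim auto
qed

lemma test_fun_measurable_on: "test_fun \<Omega> \<phi> ==> \<phi> \<in> borel_measurable (lebesgue_on S)"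
proof -
  assume "test_fun \<Omega> \<phi>"
  then have "\<phi> \<in> borel_measurable lborel" using test_fun_measurable by auto
  then have "\<phi> \<in> borel_measurable lebesgue" by (rule measurable_completion)
  then show ?thesis by (rule measurable_restrict_space1)
qed

lemma weak_grad_AE_cong:
  assumes "weak_grad \<Omega> u G" "open \<Omega>" "AE x in lebesgue_on \<Omega>. u x = v x" "AE x in lebesgue_on \<Omega>. G x = H x"
  shows "weak_grad \<Omega> v H"
proof -
  have G: "AE x in lebesgue_on \<Omega>. G x $ j = H x $ j" for j using assms(4) by eventually_elim simp
  note lu = weak_gradD(1)[OF assms(1)] and lG = weak_gradD(2)[OF assms(1)]
  have lv: "loc_integrable \<Omega> v" by (rule loc_integrable_AE_cong[OF lu assms(2,3)])
  have lH: "loc_integrable \<Omega> (%x. H x $ j)" for j by (rule loc_integrable_AE_cong[OF lG assms(2) G])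
  have "(LINT x|lebesgue_on \<Omega>. v x * pd \<phi> j x) = - (LINT x|lebesgue_on \<Omega>. H x $ j * \<phi> x)"
    if \<phi>: "test_fun \<Omega> \<phi>" for \<phi> j
  proof -
    have "(LINT x|lebesgue_on \<Omega>. v x * pd \<phi> j x) = (LINT x|lebesgue_on \<Omega>. u x * pd \<phi> j x)"
    proof (rule integral_cong_AE)
      show "AE x in lebesgue_on \<Omega>. v x * pd \<phi> j x = u x * pd \<phi> j x"
        using assms(3) by eventually_elim simp
    qed (use loc_integrable_measurable[OF lu assms(2)] loc_integrable_measurable[OF lv assms(2)]
          test_fun_measurable_on[OF test_fun_pd[OF \<phi>]] in auto)
    also have "... = - (LINT x|lebesgue_on \<Omega>. G x $ j * \<phi> x)" by (rule weak_gradD(3)[OF assms(1) \<phi>])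
    also have "(LINT x|lebesgue_on \<Omega>. G x $ j * \<phi> x) = (LINT x|lebesgue_on \<Omega>. H x $ j * \<phi> x)"
    proof (rule integral_cong_AE)
      show "AE x in lebesgue_on \<Omega>. G x $ j * \<phi> x = H x $ j * \<phi> x"
        using G[of j] by eventually_elim simp
    qed (use loc_integrable_measurable[OF lG assms(2)] loc_integrable_measurable[OF lH assms(2)]
          test_fun_measurable_on[OF \<phi>] in auto)
    finally show ?thesis .
  qed
  with lv lH show ?thesis by (auto simp: weak_grad_def)
qed

lemma loc_integrable_mult_add:
  "loc_integrable \<Omega> u ==> loc_integrable \<Omega> v ==> loc_integrable \<Omega> (%x. a * u x + b * v x)"
  by (auto simp: loc_integrable_def)

lemma weak_grad_mult_add:
  assumes u: "weak_grad \<Omega> u G" and v: "weak_grad \<Omega> v H" and "open \<Omega>"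
  shows "weak_grad \<Omega> (%x. a * u x + b * v x) (%x. a *\<^sub>R G x + b *\<^sub>R H x)"
  unfolding weak_grad_def
proof (intro conjI allI impI)
  show "loc_integrable \<Omega> (%x. a * u x + b * v x)"
    using u v by (intro loc_integrable_mult_add weak_gradD)
  show "loc_integrable \<Omega> (%x. (a *\<^sub>R G x + b *\<^sub>R H x) $ j)" for j
    using loc_integrable_mult_add[OF weak_gradD(2)[OF u] weak_gradD(2)[OF v], of a j b j] by simp
  fix \<phi> j assume \<phi>: "test_fun \<Omega> \<phi>"
  note i = integrable_loc_mult_test[OF _ _ \<open>open \<Omega>\<close>]
  have "(LINT x|lebesgue_on \<Omega>. (a * u x + b * v x) * pd \<phi> j x)
      = (LINT x|lebesgue_on \<Omega>. a * (u x * pd \<phi> j x) + b * (v x * pd \<phi> j x))"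
    by (simp add: algebra_simps)
  also have "... = a * (LINT x|lebesgue_on \<Omega>. u x * pd \<phi> j x) + b * (LINT x|lebesgue_on \<Omega>. v x * pd \<phi> j x)"
    using i[OF weak_gradD(1)[OF u] test_fun_pd[OF \<phi>]] i[OF weak_gradD(1)[OF v] test_fun_pd[OF \<phi>]] by simp
  also have "... = - (a * (LINT x|lebesgue_on \<Omega>. G x $ j * \<phi> x) + b * (LINT x|lebesgue_on \<Omega>. H x $ j * \<phi> x))"
    by (simp add: weak_gradD(3)[OF u \<phi>] weak_gradD(3)[OF v \<phi>])
  also have "a * (LINT x|lebesgue_on \<Omega>. G x $ j * \<phi> x) + b * (LINT x|lebesgue_on \<Omega>. H x $ j * \<phi> x)
      = (LINT x|lebesgue_on \<Omega>. a * (G x $ j * \<phi> x) + b * (H x $ j * \<phi> x))"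
    using i[OF weak_gradD(2)[OF u] \<phi>, of j] i[OF weak_gradD(2)[OF v] \<phi>, of j] by simp
  also have "... = (LINT x|lebesgue_on \<Omega>. (a *\<^sub>R G x + b *\<^sub>R H x) $ j * \<phi> x)"
    by (simp add: algebra_simps)
  finally show "(LINT x|lebesgue_on \<Omega>. (a * u x + b * v x) * pd \<phi> j x)
      = - (LINT x|lebesgue_on \<Omega>. (a *\<^sub>R G x + b *\<^sub>R H x) $ j * \<phi> x)" .
qed

lemma weak_grad_unique:
  assumes u: "weak_grad \<Omega> u G" and v: "weak_grad \<Omega> v H" and "open \<Omega>"
    and uv: "AE x in lebesgue_on \<Omega>. u x = v x"
  shows "AE x in lebesgue_on \<Omega>. G x = H x"
proof -
  have u': "weak_grad \<Omega> v G" by (rule weak_grad_AE_cong[OF u \<open>open \<Omega>\<close> uv]) simp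
  have "AE x in lebesgue_on \<Omega>. 1 * G x $ j + (-1) * H x $ j = 0" for j
  proof (rule fundamental_lemma)
    show "loc_integrable \<Omega> (%x. 1 * G x $ j + (-1) * H x $ j)"
      using u' v by (intro loc_integrable_mult_add weak_gradD)
    fix \<phi> assume \<phi>: "test_fun \<Omega> \<phi>"
    note i = integrable_loc_mult_test[OF _ \<phi> \<open>open \<Omega>\<close>]
    have "(LINT x|lebesgue_on \<Omega>. (1 * G x $ j + (-1) * H x $ j) * \<phi> x)
      = (LINT x|lebesgue_on \<Omega>. G x $ j * \<phi> x - H x $ j * \<phi> x)" by (simp add: algebra_simps)
    also have "... = (LINT x|lebesgue_on \<Omega>. G x $ j * \<phi> x) - (LINT x|lebesgue_on \<Omega>. H x $ j * \<phi> x)"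
      by (intro Bochner_Integration.integral_diff i weak_gradD(2)[OF u'] weak_gradD(2)[OF v])
    also have "... = 0" using weak_gradD(3)[OF u' \<phi>, of j] weak_gradD(3)[OF v \<phi>, of j] by simp
    finally show "(LINT x|lebesgue_on \<Omega>. (1 * G x $ j + (-1) * H x $ j) * \<phi> x) = 0" .
  qed fact
  then have "AE x in lebesgue_on \<Omega>. \<forall>j. 1 * G x $ j + (-1) * H x $ j = 0" by (simp add: AE_all_countable)
  then show ?thesis by eventually_elim (simp add: vec_eq_iff)
qed

lemma integrable_test_fun_on:
  assumes "test_fun \<Omega> \<phi>" "S \<in> sets lebesgue" shows "integrable (lebesgue_on S) \<phi>"
proof -
  have "integrable lebesgue \<phi>"
    using test_fun_integrable[OF assms(1)] test_fun_measurable[OF assms(1)] by (simp add: integrable_completion)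
  then show ?thesis
    using integrable_lebesgue_on_subset[of UNIV \<phi> S] assms(2) by (simp add: lebesgue_on_UNIV_eq)
qed

lemma weak_grad_test_fun:
  assumes \<phi>: "test_fun \<Omega> \<phi>" and "open \<Omega>"
  shows "weak_grad \<Omega> \<phi> (cgrad \<phi>)"
  unfolding weak_grad_def
proof (intro conjI allI impI)
  have s: "\<Omega> \<in> sets lebesgue" using \<open>open \<Omega>\<close> by auto
  show l: "loc_integrable \<Omega> \<phi>" by (intro loc_integrableI integrable_test_fun_on[OF \<phi>] s \<open>open \<Omega>\<close>)
  have l': "loc_integrable \<Omega> (pd \<phi> j)" for j
    by (intro loc_integrableI integrable_test_fun_on[OF test_fun_pd[OF \<phi>]] s \<open>open \<Omega>\<close>)
  then show "loc_integrable \<Omega> (%x. cgrad \<phi> x $ j)" for j by simp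
  fix \<psi> j assume \<psi>: "test_fun \<Omega> \<psi>"
  have [measurable]: "\<phi> \<in> borel_measurable borel" "\<psi> \<in> borel_measurable borel"
    "pd \<phi> j \<in> borel_measurable borel" "pd \<psi> j \<in> borel_measurable borel"
    using \<phi> \<psi> by (auto intro: test_fun_measurable test_fun_pd)
  obtain K where K: "compact K" "!!x. x \<notin> K ==> \<phi> x = 0" "!!x j. x \<notin> K ==> pd \<phi> j x = 0"
    using test_fun_support[OF \<phi>] by metis
  have 0: "(LINT x|lborel. pd \<phi> j x * \<psi> x + pd \<psi> j x * \<phi> x) = 0"
  proof (rule integral_partial_derivative_eq_0[where K=K])
    show "continuous_on UNIV (%x. \<phi> x * \<psi> x)"
      by (intro continuous_intros test_fun_continuous[OF \<phi>] test_fun_continuous[OF \<psi>])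
    show "continuous_on UNIV (%x. pd \<phi> j x * \<psi> x + pd \<psi> j x * \<phi> x)"
      by (intro continuous_intros test_fun_continuous[OF \<phi>] test_fun_continuous[OF \<psi>]
          test_fun_continuous[OF test_fun_pd[OF \<phi>]] test_fun_continuous[OF test_fun_pd[OF \<psi>]])
    fix x
    show "((%t. \<phi> (x + t *\<^sub>R axis j 1) * \<psi> (x + t *\<^sub>R axis j 1)) has_real_derivative
        pd \<phi> j x * \<psi> x + pd \<psi> j x * \<phi> x) (at 0)"
      using DERIV_mult[OF test_fun_has_pd[OF \<phi>, of x j 0] test_fun_has_pd[OF \<psi>, of x j 0]] by simp
  qed (use K compact_imp_bounded in auto)
  have z: "x \<notin> \<Omega> ==> pd \<psi> j x * \<phi> x = 0" "x \<notin> \<Omega> ==> pd \<phi> j x * \<psi> x = 0" for x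
    using test_fun_zero[OF \<phi>, of x] test_fun_zero[OF \<psi>, of x] by auto
  have "integrable lebesgue (%x. pd \<phi> j x * \<psi> x)"
    using integrable_loc_mult_test[OF l' \<psi> \<open>open \<Omega>\<close>, of j]
      lebesgue_on_zero_outside(2)[OF s, of "%x. pd \<phi> j x * \<psi> x" "%x. pd \<phi> j x * \<psi> x"] z(2) by blast
  then have i1: "integrable lborel (%x. pd \<phi> j x * \<psi> x)" by (simp add: integrable_completion)
  have "integrable lebesgue (%x. pd \<psi> j x * \<phi> x)"
    using integrable_loc_mult_test[OF l test_fun_pd[OF \<psi>] \<open>open \<Omega>\<close>, of j]
      lebesgue_on_zero_outside(2)[OF s, of "%x. \<phi> x * pd \<psi> j x" "%x. pd \<psi> j x * \<phi> x"] z(1)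
    by (metis mult.commute)
  then have i2: "integrable lborel (%x. pd \<psi> j x * \<phi> x)" by (simp add: integrable_completion)
  have "(LINT x|lborel. pd \<phi> j x * \<psi> x) + (LINT x|lborel. pd \<psi> j x * \<phi> x) = 0"
    using 0 i1 i2 by simp
  then show "(LINT x|lebesgue_on \<Omega>. \<phi> x * pd \<psi> j x) = - (LINT x|lebesgue_on \<Omega>. cgrad \<phi> x $ j * \<psi> x)"
    using lebesgue_on_zero_outside(1)[OF s, of "%x. \<phi> x * pd \<psi> j x" "%x. pd \<psi> j x * \<phi> x"]
      lebesgue_on_zero_outside(1)[OF s, of "%x. cgrad \<phi> x $ j * \<psi> x" "%x. pd \<phi> j x * \<psi> x"] z
    by (simp add: integral_completion)
qed

lemma weak_grad_L1_limit:
  assumes w: "!!k. weak_grad \<Omega> (u k) (G k)" and "open \<Omega>"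
    and iu: "!!k. integrable (lebesgue_on \<Omega>) (u k)" "integrable (lebesgue_on \<Omega>) v"
    and iG: "!!k. integrable (lebesgue_on \<Omega>) (G k)" "integrable (lebesgue_on \<Omega>) H"
    and lu: "(%k. \<integral>x. \<bar>u k x - v x\<bar> \<partial>lebesgue_on \<Omega>) ----> 0"
    and lG: "(%k. \<integral>x. norm (G k x - H x) \<partial>lebesgue_on \<Omega>) ----> 0"
  shows "weak_grad \<Omega> v H"
  unfolding weak_grad_def
proof (intro conjI allI impI)
  have comp: "integrable (lebesgue_on \<Omega>) (%x. F x $ j)" if "integrable (lebesgue_on \<Omega>) F" for F :: "real^'a => real^'a" and j
    using that by (rule Bochner_Integration.integrable_bound)
      (use that borel_measurable_integrable in \<open>auto intro!: AE_I2 component_le_norm_cart borel_measurable_vec_nth\<close>)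
  show "loc_integrable \<Omega> v" by (intro loc_integrableI iu \<open>open \<Omega>\<close>)
  show "loc_integrable \<Omega> (%x. H x $ j)" for j by (intro loc_integrableI comp iG \<open>open \<Omega>\<close>)
  fix \<phi> j assume \<phi>: "test_fun \<Omega> \<phi>"
  obtain B where B: "!!x. \<bar>\<phi> x\<bar> <= B" using test_fun_bounded[OF \<phi>] by metis
  obtain B' where B': "!!x. \<bar>pd \<phi> j x\<bar> <= B'" using test_fun_bounded[OF test_fun_pd[OF \<phi>]] by metis
  have 1: "(%k. (LINT x|lebesgue_on \<Omega>. u k x * pd \<phi> j x) - (LINT x|lebesgue_on \<Omega>. v x * pd \<phi> j x)) ----> 0"
    by (rule tendsto_integral_mult_bounded[OF iu lu test_fun_measurable_on[OF test_fun_pd[OF \<phi>]], where B=B']) (simp add: B')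
  have "(%k. (LINT x|lebesgue_on \<Omega>. G k x $ j * \<phi> x) - (LINT x|lebesgue_on \<Omega>. H x $ j * \<phi> x)) ----> 0"
  proof (rule tendsto_integral_mult_bounded[OF comp[OF iG(1)] comp[OF iG(2)] _ test_fun_measurable_on[OF \<phi>], where B=B])
    show "(%k. \<integral>x. \<bar>G k x $ j - H x $ j\<bar> \<partial>lebesgue_on \<Omega>) ----> 0"
    proof (rule Lim_null_comparison[OF _ lG], intro always_eventually allI)
      fix k
      have i: "integrable (lebesgue_on \<Omega>) (%x. G k x - H x)" using iG by simp
      have "(LINT x|lebesgue_on \<Omega>. \<bar>(G k x - H x) $ j\<bar>) <= (LINT x|lebesgue_on \<Omega>. norm (G k x - H x))"
        using comp[OF i, of j] i by (intro integral_mono component_le_norm_cart integrable_abs integrable_norm)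
      then show "norm (LINT x|lebesgue_on \<Omega>. \<bar>G k x $ j - H x $ j\<bar>) <= (LINT x|lebesgue_on \<Omega>. norm (G k x - H x))"
        by simp
    qed
  qed (simp add: B)
  from tendsto_add[OF 1 this]
  have "(%k. - (LINT x|lebesgue_on \<Omega>. v x * pd \<phi> j x) - (LINT x|lebesgue_on \<Omega>. H x $ j * \<phi> x)) ----> 0"
    by (simp add: weak_gradD(3)[OF w \<phi>])
  then show "(LINT x|lebesgue_on \<Omega>. v x * pd \<phi> j x) = - (LINT x|lebesgue_on \<Omega>. H x $ j * \<phi> x)"
    by (simp add: LIMSEQ_const_iff)
qed

text \<open>Mollify \<open>u\<close> near the support of the test function, use the classical chain
  rule and pass to the limit. The conditions \<open>\<bar>\<eta>' t\<bar> <= 1\<close> and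
  \<open>\<eta> 0 = 0\<close> give \<open>\<bar>\<eta> t\<bar> <= \<bar>t\<bar>\<close>, which keeps
  everything locally integrable; continuity of \<open>\<eta>'\<close> gives pointwise convergence of
  the coefficients.\<close>

lemma weak_grad_chain:
  fixes \<eta> \<eta>' :: "real => real"
  assumes G: "weak_grad \<Omega> u G" and op: "open \<Omega>"
    and \<eta>: "!!t. (\<eta> has_real_derivative \<eta>' t) (at t)" "continuous_on UNIV \<eta>'" "!!t. \<bar>\<eta>' t\<bar> <= 1" "\<eta> 0 = 0"
  shows "weak_grad \<Omega> (%x. \<eta> (u x)) (%x. \<eta>' (u x) *\<^sub>R G x)"
proof -
  have s: "\<Omega> \<in> sets lebesgue" using op by auto
  have lip: "\<bar>\<eta> a - \<eta> b\<bar> <= \<bar>a - b\<bar>" for a b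
    using field_differentiable_bound[of UNIV \<eta> \<eta>' 1 a b] \<eta>(1,3) by auto
  have le: "\<bar>\<eta> a\<bar> <= \<bar>a\<bar>" for a using lip[of a 0] \<eta>(4) by simp
  have c\<eta>: "continuous_on UNIV \<eta>"
    using \<eta>(1) by (meson DERIV_isCont continuous_at_imp_continuous_on)
  have [measurable]: "\<eta> \<in> borel_measurable borel" "\<eta>' \<in> borel_measurable borel"
    using c\<eta> \<eta>(2) by (auto intro: borel_measurable_continuous_onI)
  note lu = weak_gradD(1)[OF G] and lG = weak_gradD(2)[OF G]
  note mu = loc_integrable_measurable[OF lu op] and mG = loc_integrable_measurable[OF lG op]
  show ?thesis
    unfolding weak_grad_def
  proof (intro conjI allI impI)
    show "loc_integrable \<Omega> (%x. \<eta> (u x))"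
      using mu le by (intro loc_integrable_bound[OF lu op, of _ 0]) auto
    show "loc_integrable \<Omega> (%x. (\<eta>' (u x) *\<^sub>R G x) $ j)" for j
    proof (rule loc_integrable_bound[OF lG[of j] op, of _ 0])
      show "(%x. (\<eta>' (u x) *\<^sub>R G x) $ j) \<in> borel_measurable (lebesgue_on \<Omega>)"
        using mu mG[of j] by simp
      show "AE x in lebesgue_on \<Omega>. \<bar>(\<eta>' (u x) *\<^sub>R G x) $ j\<bar> <= \<bar>G x $ j\<bar> + 0"
        using \<eta>(3) mult_right_mono[OF \<eta>(3), of "\<bar>G x $ j\<bar>" for x] by (intro AE_I2) (simp add: abs_mult)
    qed
    fix \<phi> j assume \<phi>: "test_fun \<Omega> \<phi>"
    obtain K where K: "compact K" "K \<subseteq> \<Omega>" "!!x. x \<notin> K ==> \<phi> x = 0" "!!x j. x \<notin> K ==> pd \<phi> j x = 0"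
      using test_fun_support[OF \<phi>] by metis
    obtain B where B: "!!x. \<bar>\<phi> x\<bar> <= B" using test_fun_bounded[OF \<phi>] by metis
    obtain B' where B': "!!x. \<bar>pd \<phi> j x\<bar> <= B'" using test_fun_bounded[OF test_fun_pd[OF \<phi>]] by metis
    obtain d K' where K': "d > 0" "compact K'" "K' \<subseteq> \<Omega>" "!!x. x \<in> K ==> cball x d \<subseteq> K'"
      using compact_in_open_nbhd[OF K(1) op K(2)] by metis
    have KK': "x \<in> K'" if "x \<in> K" for x
      using K'(4)[OF that] K'(1) by (auto simp: subset_iff dest!: spec[of _ x])
    define h where "h x = indicator K' x * u x" for x
    define H where "H x = indicator K' x * G x $ j" for x
    have ih: "integrable lebesgue h" unfolding h_def by (rule loc_integrableD[OF lu K'(2,3)])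
    have iH: "integrable lebesgue H" unfolding H_def by (rule loc_integrableD[OF lG K'(2,3)])
    \<comment> \<open>The scales stay below \<open>d\<close>, so that balls around points of the
      support \<open>K\<close> remain in \<open>K'\<close>, where the derivative of the
      mollification is the mollified gradient.\<close>
    define e' where "e' k = d * inverse (real (Suc k))" for k
    have e': "e' ----> 0" "!!k. e' k > 0" "!!k. e' k <= d"
      unfolding e'_def using tendsto_mult_left[OF LIMSEQ_inverse_real_of_nat, of d] K'(1)
      by (auto simp: field_simps)
    obtain r where r: "strict_mono (r :: nat => nat)" "AE x in lebesgue. (%k. conv h (moll (e' (r k))) x) ----> h x"
      using conv_moll_AE_subseq[OF ih e'(1,2)] .
    define e where "e k = e' (r k)" for k
    have e: "e ----> 0" "!!k. e k > 0" "!!k. e k <= d"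
      using LIMSEQ_subseq_LIMSEQ[OF e'(1) r(1)] e' by (auto simp: e_def[abs_def] o_def)
    define v where "v k = conv h (moll (e k))" for k
    define w where "w k = conv H (moll (e k))" for k
    have AEv: "AE x in lebesgue. (%k. v k x) ----> h x" using r(2) by (simp add: v_def e_def)
    have iv: "!!k. integrable lebesgue (v k)" "(%k. \<integral>x. \<bar>v k x - h x\<bar> \<partial>lebesgue) ----> 0"
      using conv_moll[OF ih e(1,2)] by (auto simp: v_def)
    have iw: "!!k. integrable lebesgue (w k)" "(%k. \<integral>x. \<bar>w k x - H x\<bar> \<partial>lebesgue) ----> 0"
      using conv_moll[OF iH e(1,2)] by (auto simp: w_def)
    note tf = moll_props(1)[OF e(2)]
    note m\<phi> = test_fun_measurable_on[OF \<phi>, where S=UNIV, unfolded lebesgue_on_UNIV_eq]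
      test_fun_measurable_on[OF test_fun_pd[OF \<phi>, of j], where S=UNIV, unfolded lebesgue_on_UNIV_eq]
    note mm = borel_measurable_integrable[OF ih] borel_measurable_integrable[OF iH]
      borel_measurable_integrable[OF iv(1)] borel_measurable_integrable[OF iw(1)] m\<phi>
    have i\<eta>: "integrable lebesgue (%x. \<eta> (f x))" if "integrable lebesgue f" for f :: "real^'a => real"
      by (rule Bochner_Integration.integrable_bound[OF that]) (use borel_measurable_integrable[OF that] le in auto)
    \<comment> \<open>Integration by parts for the smooth function \<open>v k\<close>. Off
      \<open>K\<close> all terms vanish with the test function, so the formula for the derivative of
      \<open>v k\<close> is needed on \<open>K\<close> only.\<close>
    have prod: "(LINT x|lebesgue. w k x * (\<eta>' (v k x) * \<phi> x)) = - (LINT x|lebesgue. \<eta> (v k x) * pd \<phi> j x)" for k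
    proof -
      let ?D = "%x. (\<eta>' (v k x) * conv h (pd (moll (e k)) j) x) * \<phi> x + pd \<phi> j x * \<eta> (v k x)"
      have cv: "continuous_on UNIV (v k)" unfolding v_def by (rule conv_continuous_test[OF ih tf])
      have cv': "continuous_on UNIV (conv h (pd (moll (e k)) j))" by (rule conv_continuous_test[OF ih test_fun_pd[OF tf]])
      have cD: "continuous_on UNIV ?D"
        by (intro continuous_intros cv' test_fun_continuous[OF \<phi>] test_fun_continuous[OF test_fun_pd[OF \<phi>]]
            continuous_on_compose2[OF \<eta>(2) cv] continuous_on_compose2[OF c\<eta> cv]) auto
      have "(LINT x|lborel. ?D x) = 0"
      proof (rule integral_partial_derivative_eq_0[where K=K])
        show "continuous_on UNIV (%x. \<eta> (v k x) * \<phi> x)"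
          by (intro continuous_intros test_fun_continuous[OF \<phi>] continuous_on_compose2[OF c\<eta> cv]) auto
        show "continuous_on UNIV ?D" by (rule cD)
        fix x
        have "((%t. v k (x + t *\<^sub>R axis j 1)) has_real_derivative conv h (pd (moll (e k)) j) x) (at 0)"
          unfolding v_def by (rule conv_has_pd[OF ih tf])
        from DERIV_chain2[OF \<eta>(1) this]
        have "((%t. \<eta> (v k (x + t *\<^sub>R axis j 1))) has_real_derivative \<eta>' (v k x) * conv h (pd (moll (e k)) j) x) (at 0)"
          by simp
        from DERIV_mult[OF this test_fun_has_pd[OF \<phi>, of x j 0]]
        show "((%t. \<eta> (v k (x + t *\<^sub>R axis j 1)) * \<phi> (x + t *\<^sub>R axis j 1)) has_real_derivative ?D x) (at 0)"
          by simp
      qed (use K compact_imp_bounded in auto)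
      then have "(LINT x|lebesgue. ?D x) = 0"
        using cD borel_measurable_continuous_onI[of ?D] by (subst integral_completion) auto
      moreover have "?D x = w k x * (\<eta>' (v k x) * \<phi> x) + \<eta> (v k x) * pd \<phi> j x" for x
      proof (cases "x \<in> K")
        case True
        then have "cball x (e k) \<subseteq> K'" using K'(4)[OF True] e(3)[of k] by auto
        from conv_pd_eq_conv_weak_grad[OF G op K'(2,3) tf moll_props(2)[OF e(2)] this, where j=j]
        show ?thesis by (simp add: w_def H_def[abs_def] h_def[abs_def] mult_ac)
      qed (use K(3,4) in simp)
      moreover have "integrable lebesgue (%x. w k x * (\<eta>' (v k x) * \<phi> x))"
      proof (rule Bochner_Integration.integrable_bound)
        show "integrable lebesgue (%x. B * w k x)" using iw by simp
        show "AE x in lebesgue. norm (w k x * (\<eta>' (v k x) * \<phi> x)) <= norm (B * w k x)"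
        proof (rule AE_I2)
          fix x
          have "\<bar>\<eta>' (v k x)\<bar> * \<bar>\<phi> x\<bar> <= 1 * B" using \<eta>(3) B by (intro mult_mono) auto
          moreover have "0 <= B" using B[of x] by simp
          ultimately show "norm (w k x * (\<eta>' (v k x) * \<phi> x)) <= norm (B * w k x)"
            by (simp add: abs_mult mult.commute[of B] mult_left_mono)
        qed
      qed (use mm in simp)
      moreover have "integrable lebesgue (%x. \<eta> (v k x) * pd \<phi> j x)"
      proof (rule Bochner_Integration.integrable_bound)
        show "integrable lebesgue (%x. B' * \<eta> (v k x))" using i\<eta>[OF iv(1)] by simp
        show "AE x in lebesgue. norm (\<eta> (v k x) * pd \<phi> j x) <= norm (B' * \<eta> (v k x))"
        proof (rule AE_I2, goal_cases)
          case (1 x)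
          have "0 <= B'" using B'[of x] by simp
          then show ?case
            using B' by (simp add: abs_mult mult.commute[of B'] mult_left_mono)
        qed
      qed (use mm in simp)
      ultimately show ?thesis by simp
    qed
    have 1: "(%k. \<integral>x. \<eta> (v k x) * pd \<phi> j x \<partial>lebesgue) ----> (LINT x|lebesgue. \<eta> (h x) * pd \<phi> j x)"
    proof -
      have "(%k. \<integral>x. \<bar>\<eta> (v k x) - \<eta> (h x)\<bar> \<partial>lebesgue) ----> 0"
      proof (rule Lim_null_comparison[OF _ iv(2)], intro always_eventually allI)
        fix k
        have "(LINT x|lebesgue. \<bar>\<eta> (v k x) - \<eta> (h x)\<bar>) <= (LINT x|lebesgue. \<bar>v k x - h x\<bar>)"
          using i\<eta>[OF iv(1)] i\<eta>[OF ih] iv(1) ih lip by (intro integral_mono) auto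
        then show "norm (LINT x|lebesgue. \<bar>\<eta> (v k x) - \<eta> (h x)\<bar>) <= (LINT x|lebesgue. \<bar>v k x - h x\<bar>)" by simp
      qed
      from tendsto_integral_mult_bounded[OF i\<eta>[OF iv(1)] i\<eta>[OF ih] this m\<phi>(2), of B'] B'
      show ?thesis by (simp add: LIM_zero_iff)
    qed
    have 2: "(%k. \<integral>x. w k x * (\<eta>' (v k x) * \<phi> x) \<partial>lebesgue) ----> (LINT x|lebesgue. H x * (\<eta>' (h x) * \<phi> x))"
    proof -
      have bd: "\<bar>\<eta>' a * \<phi> x\<bar> <= B" for a x
        using mult_mono[OF \<eta>(3)[of a] B[of x]] by (simp add: abs_mult)
      \<comment> \<open>The gradients are exchanged first, while the coefficients still depend on
        \<open>k\<close>; afterwards the coefficients converge almost everywhere against the fixed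
        function \<open>H\<close>.\<close>
      have a: "(%k. (LINT x|lebesgue. w k x * (\<eta>' (v k x) * \<phi> x)) - (LINT x|lebesgue. H x * (\<eta>' (v k x) * \<phi> x))) ----> 0"
        by (rule tendsto_integral_mult_bounded[OF iw(1) iH iw(2), where B=B]) (use mm bd in auto)
      have b: "(%k. \<integral>x. H x * (\<eta>' (v k x) * \<phi> x) \<partial>lebesgue) ----> (LINT x|lebesgue. H x * (\<eta>' (h x) * \<phi> x))"
      proof (rule integral_dominated_convergence[where w="%x. B * \<bar>H x\<bar>"])
        show "AE x in lebesgue. (%k. H x * (\<eta>' (v k x) * \<phi> x)) ----> H x * (\<eta>' (h x) * \<phi> x)"
          using AEv
        proof eventually_elim
          case (elim x)
          have "(%k. \<eta>' (v k x)) ----> \<eta>' (h x)"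
            by (rule continuous_on_tendsto_compose[OF \<eta>(2) elim]) auto
          then show ?case by (intro tendsto_intros)
        qed
        show "AE x in lebesgue. norm (H x * (\<eta>' (v k x) * \<phi> x)) <= B * \<bar>H x\<bar>" for k
          using bd by (intro AE_I2) (simp add: abs_mult[of "H _"] mult.commute[of B] mult_left_mono)
      qed (use mm iH in auto)
      show ?thesis using tendsto_add[OF a b] by simp
    qed
    have "(LINT x|lebesgue. H x * (\<eta>' (h x) * \<phi> x)) = - (LINT x|lebesgue. \<eta> (h x) * pd \<phi> j x)"
      using LIMSEQ_unique[OF 2[unfolded prod] tendsto_minus[OF 1]] .
    moreover have "(LINT x|lebesgue_on \<Omega>. \<eta> (u x) * pd \<phi> j x) = (LINT x|lebesgue. \<eta> (h x) * pd \<phi> j x)"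
    proof (rule lebesgue_on_zero_outside(1)[OF s])
      fix x show "\<eta> (u x) * pd \<phi> j x = \<eta> (h x) * pd \<phi> j x"
        using K(4)[of x] KK'[of x] by (cases "x \<in> K") (auto simp: h_def)
    qed (use K(2,4) in auto)
    moreover have "(LINT x|lebesgue_on \<Omega>. (\<eta>' (u x) *\<^sub>R G x) $ j * \<phi> x) = (LINT x|lebesgue. H x * (\<eta>' (h x) * \<phi> x))"
    proof (rule lebesgue_on_zero_outside(1)[OF s])
      fix x show "(\<eta>' (u x) *\<^sub>R G x) $ j * \<phi> x = H x * (\<eta>' (h x) * \<phi> x)"
        using K(3)[of x] KK'[of x] by (cases "x \<in> K") (auto simp: h_def H_def)
    qed (use K(2,3) in auto)
    ultimately show "(LINT x|lebesgue_on \<Omega>. \<eta> (u x) * pd \<phi> j x) = - (LINT x|lebesgue_on \<Omega>. (\<eta>' (u x) *\<^sub>R G x) $ j * \<phi> x)"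
      by simp
  qed
qed

text \<open>For positive \<open>t\<close> the value equals
  \<open>t\<^sup>2 / (t + \<epsilon>)\<close>: a C1 function within \<epsilon> of the positive part,
  with slope in [0, 1) and slope zero at the origin.\<close>

definition pos_approx :: "real => real => real" where
  "pos_approx \<epsilon> t = (if t <= 0 then 0 else t - \<epsilon> + \<epsilon>\<^sup>2 / (t + \<epsilon>))"

definition pos_approx' :: "real => real => real" where
  "pos_approx' \<epsilon> t = 1 - (\<epsilon> / (max 0 t + \<epsilon>))\<^sup>2"

lemma pos_approx_derivative:
  assumes "e > 0"
  shows "(pos_approx e has_real_derivative pos_approx' e t) (at t)"
proof -
  have d: "((%t. t - e + e\<^sup>2 / (t + e)) has_real_derivative pos_approx' e t) (at t within S)" if "t >= 0" for S
    using that assms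
    by (auto intro!: derivative_eq_intros simp: pos_approx'_def power2_eq_square field_simps)
  consider "t < 0" | "t > 0" | "t = 0" by linarith
  then show ?thesis
  proof cases
    case 1
    have "\<forall>\<^sub>F s in nhds t. pos_approx e s = 0"
      using eventually_nhds_in_open[of "{..<0}" t] 1 by (auto simp: pos_approx_def elim!: eventually_mono)
    moreover have "pos_approx' e t = 0" using 1 assms by (simp add: pos_approx'_def)
    ultimately show ?thesis by (subst DERIV_cong_ev[of t t _ "%_. 0" _ 0]) auto
  next
    case 2
    have "\<forall>\<^sub>F s in nhds t. pos_approx e s = s - e + e\<^sup>2 / (s + e)"
      using eventually_nhds_in_open[of "{0<..}" t] 2 by (auto simp: pos_approx_def elim!: eventually_mono)
    then show ?thesis using d[of UNIV] 2 by (subst DERIV_cong_ev) auto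
  next
    case 3
    have "((%s. (pos_approx e (0 + s) - pos_approx e 0) / s) \<longlongrightarrow> 0) (at 0)"
    proof (rule Lim_null_comparison)
      have "norm ((pos_approx e (0 + s) - pos_approx e 0) / s) <= \<bar>s\<bar> / e" for s
      proof (cases "s <= 0")
        case False
        then have "(s - e + e\<^sup>2 / (s + e)) / s = s / (s + e)"
          using assms by (simp add: divide_simps) (simp add: power2_eq_square algebra_simps)
        also have "... <= s / e" using False assms by (intro divide_left_mono) auto
        finally show ?thesis using False assms \<open>(s - e + e\<^sup>2 / (s + e)) / s = s / (s + e)\<close>
          by (simp add: pos_approx_def)
      qed (use assms in \<open>simp add: pos_approx_def divide_nonpos_pos\<close>)
      then show "\<forall>\<^sub>F s in at 0. norm ((pos_approx e (0 + s) - pos_approx e 0) / s) <= \<bar>s\<bar> / e" by simp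
      show "((%s. \<bar>s\<bar> / e) \<longlongrightarrow> 0) (at 0)" using assms by (auto intro!: tendsto_eq_intros)
    qed
    moreover have "pos_approx' e t = 0" using 3 assms by (simp add: pos_approx'_def)
    ultimately show ?thesis using 3 by (simp add: has_field_derivative_iff)
  qed
qed

lemma pos_approx_props:
  assumes "e > 0"
  shows "continuous_on UNIV (pos_approx' e)" "\<bar>pos_approx' e t\<bar> <= 1" "pos_approx e 0 = 0"
    "\<bar>pos_approx e t - max 0 t\<bar> <= e" "\<bar>pos_approx e s - pos_approx e t\<bar> <= \<bar>s - t\<bar>"
proof -
  show "continuous_on UNIV (pos_approx' e)"
    unfolding pos_approx'_def[abs_def] using assms by (auto intro!: continuous_intros simp: add_nonneg_eq_0_iff)
  have "0 <= e / (max 0 t + e)" "e / (max 0 t + e) <= 1" for t using assms by (auto simp: divide_simps)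
  then have "0 <= (e / (max 0 t + e))\<^sup>2" "(e / (max 0 t + e))\<^sup>2 <= 1" for t by (auto simp: power_le_one)
  then show bd: "\<bar>pos_approx' e t\<bar> <= 1" for t by (auto simp: pos_approx'_def)
  show "\<bar>pos_approx e s - pos_approx e t\<bar> <= \<bar>s - t\<bar>"
    using field_differentiable_bound[of UNIV "pos_approx e" "pos_approx' e" 1 s t] pos_approx_derivative[OF assms] bd by auto
  show "pos_approx e 0 = 0" by (simp add: pos_approx_def)
  show "\<bar>pos_approx e t - max 0 t\<bar> <= e"
  proof (cases "t <= 0")
    case False
    then have "0 <= e\<^sup>2 / (t + e)" "e\<^sup>2 / (t + e) <= e"
      using assms by (auto simp: divide_simps power2_eq_square)
    then show ?thesis using False by (auto simp: pos_approx_def)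
  qed (use assms in \<open>auto simp: pos_approx_def\<close>)
qed

section \<open>The \<open>p\<close>-Laplacian and modulars with variable exponent\<close>

text \<open>The strict Bernoulli inequality comes from the mean value theorem and is rescaled with
  \<open>y = s / m\<close>. For \<open>m = 0\<close> the convention that powers of 0 are 0 leaves
  \<open>0 < s powr p\<close>.\<close>

lemma powr_tangent:
  fixes p s m :: real
  assumes "1 < p" "0 <= s" "0 <= m"
  shows "m powr p + p * m powr (p - 1) * (s - m) <= s powr p"
    and "s ~= m ==> m powr p + p * m powr (p - 1) * (s - m) < s powr p"
proof -
  have bern: "1 + p * (y - 1) < y powr p" if "0 <= y" "y ~= 1" for y
  proof (cases "y = 0")
    case False
    then have "y > 0" using that by simp
    have d: "((%y. y powr p) has_real_derivative p * x powr (p - 1)) (at x)" if "x > 0" for x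
      using that by (auto intro!: derivative_eq_intros)
    show ?thesis
    proof (cases "y < 1")
      case True
      obtain z where z: "y < z" "z < 1" "1 powr p - y powr p = (1 - y) * (p * z powr (p - 1))"
        using MVT2[OF True, of "%y. y powr p" "%x. p * x powr (p - 1)"] d \<open>y > 0\<close> by force
      have "z powr (p - 1) < 1 powr (p - 1)"
        using z \<open>y > 0\<close> assms(1) by (intro powr_less_mono2) auto
      then have "(1 - y) * (p * z powr (p - 1)) < (1 - y) * (p * 1)"
        using True assms(1) by (intro mult_strict_left_mono) auto
      then show ?thesis using z(3) by (simp add: algebra_simps)
    next
      case False
      then have "1 < y" using that by simp
      obtain z where z: "1 < z" "z < y" "y powr p - 1 powr p = (y - 1) * (p * z powr (p - 1))"
        using MVT2[OF \<open>1 < y\<close>, of "%y. y powr p" "%x. p * x powr (p - 1)"] d by force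
      have "1 powr (p - 1) < z powr (p - 1)"
        using z assms(1) by (intro powr_less_mono2) auto
      then have "(y - 1) * (p * 1) < (y - 1) * (p * z powr (p - 1))"
        using \<open>1 < y\<close> assms(1) by (intro mult_strict_left_mono) auto
      then show ?thesis using z(3) by (simp add: algebra_simps)
    qed
  qed (use assms in simp)
  have strict: "m powr p + p * m powr (p - 1) * (s - m) < s powr p" if "s ~= m"
  proof (cases "m = 0")
    case False
    then have "m > 0" using assms by simp
    have "m powr p * (1 + p * (s / m - 1)) < m powr p * (s / m) powr p"
      using bern[of "s / m"] that \<open>m > 0\<close> assms by (intro mult_strict_left_mono) auto
    moreover have "m powr p * (s / m) powr p = s powr p"
      using \<open>m > 0\<close> assms by (simp add: powr_divide)
    moreover have "m powr p * (1 + p * (s / m - 1)) = m powr p + p * m powr (p - 1) * (s - m)"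
      using \<open>m > 0\<close> by (simp add: powr_diff field_simps)
    ultimately show ?thesis by simp
  qed (use that assms in simp)
  then show "s ~= m ==> m powr p + p * m powr (p - 1) * (s - m) < s powr p" .
  show "m powr p + p * m powr (p - 1) * (s - m) <= s powr p"
    using strict by (cases "s = m") auto
qed

lemma powr_add_le:
  fixes a b p P :: real
  assumes "0 <= a" "0 <= b" "0 <= p" "p <= P"
  shows "(a + b) powr p <= 2 powr P * (a powr p + b powr p)"
proof -
  have "(a + b) powr p <= (2 * max a b) powr p" using assms by (intro powr_mono2) auto
  also have "... = 2 powr p * max a b powr p" by (rule powr_mult)
  also have "... <= 2 powr P * (a powr p + b powr p)"
    using assms by (intro mult_mono powr_mono) (auto simp: max_def)
  finally show ?thesis .
qed

lemma powr_max_le: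
  fixes a p P :: real
  assumes "0 <= p" "p <= P" shows "\<bar>a\<bar> powr p <= max 1 \<bar>a\<bar> powr P"
proof -
  have "\<bar>a\<bar> powr p <= max 1 \<bar>a\<bar> powr p" using assms by (intro powr_mono2) auto
  also have "... <= max 1 \<bar>a\<bar> powr P" using assms by (intro powr_mono) auto
  finally show ?thesis .
qed

text \<open>A substitute for Hoelder's inequality: after integration, a small modular forces a small
  L1 norm, with constants that depend on the exponent only through its upper bound
  \<open>P\<close>.\<close>

lemma le_delta_plus_powr:
  fixes a d p P :: real
  assumes "0 <= a" "0 < d" "d <= 1" "1 <= p" "p <= P"
  shows "a <= d + d powr (1 - P) * a powr p"
proof (cases "a <= d")
  case False
  have "a = a powr (1 - p) * a powr p" using False assms by (simp flip: powr_add)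
  also have "... <= d powr (1 - P) * a powr p"
  proof (rule mult_right_mono)
    have "a powr (1 - p) <= d powr (1 - p)" using False assms by (intro powr_mono2') auto
    also have "... <= d powr (1 - P)" using assms by (intro powr_mono') auto
    finally show "a powr (1 - p) <= d powr (1 - P)" .
  qed simp
  finally show ?thesis using assms by linarith
qed (use assms in \<open>simp add: add_increasing2\<close>)

lemma half_mult_cancel: "0 < K ==> e / (2 * K) * K = e / 2" for e K :: real
  by simp

text \<open>Young's inequality without conjugate exponents, by comparing \<open>b\<close> with
  \<open>d * a\<close>. The factor \<open>d powr (1 - P)\<close> is independent of \<open>p\<close>,
  as is necessary when \<open>p\<close> varies from point to point.\<close>

lemma young_delta:
  fixes a b d p P :: real
  assumes "0 <= a" "0 <= b" "0 < d" "d <= 1" "1 < p" "p <= P"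
  shows "a powr (p - 1) * b <= d * a powr p + d powr (1 - P) * b powr p"
proof (cases "b <= d * a")
  case True
  have "a powr (p - 1) * b <= a powr (p - 1) * (d * a)" using True by (intro mult_left_mono) auto
  also have "... = d * a powr p"
    using assms by (cases "a = 0") (simp_all add: powr_diff)
  finally show ?thesis using assms by (simp add: add_increasing2)
next
  case False
  then have "b > 0" using assms by (smt (verit) mult_nonneg_nonneg)
  have "a powr (p - 1) * b <= (b / d) powr (p - 1) * b"
    using False assms by (intro mult_right_mono powr_mono2) (auto simp: field_simps)
  also have "... = d powr (1 - p) * b powr p"
    using \<open>b > 0\<close> assms by (simp add: powr_divide powr_diff powr_minus field_simps)
  also have "... <= d powr (1 - P) * b powr p"
    using assms by (intro mult_right_mono powr_mono') auto
  finally show ?thesis using assms by (simp add: add_increasing)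
qed

section \<open>The p-Laplace vector field and uniform convexity\<close>

definition plap :: "real => 'b::real_inner => 'b" where
  "plap p a = norm a powr (p - 2) *\<^sub>R a"

lemma plap_inner_self: "plap p a \<bullet> a = norm a powr p"
proof (cases "a = 0")
  case False
  then have "plap p a \<bullet> a = norm a powr (p - 2) * norm a powr 2" by (simp add: plap_def dot_square_norm)
  also have "... = norm a powr p" by (simp only: powr_add[symmetric]) simp
  finally show ?thesis .
qed (simp add: plap_def)

lemma norm_plap: "norm (plap p a) = norm a powr (p - 1)"
  by (cases "a = 0") (simp_all add: plap_def powr_diff powr_numeral power2_eq_square)

lemma plap_inner_le: "\<bar>plap p a \<bullet> b\<bar> <= norm a powr (p - 1) * norm b"
  using Cauchy_Schwarz_ineq2[of "plap p a" b] by (simp add: norm_plap)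

text \<open>The subgradient inequality at \<open>w\<close> for the power of the norm; Cauchy-Schwarz
  reduces it to the scalar tangent line of \<open>powr_tangent\<close>.\<close>

lemma plap_convex:
  assumes "1 < p"
  shows "norm w powr p - norm a powr p <= p * (plap p w \<bullet> (w - a))"
proof -
  have "p * (norm w powr (p - 1) * (norm a - norm w)) <= norm a powr p - norm w powr p"
    using powr_tangent(1)[OF assms, of "norm a" "norm w"] by (simp add: mult.assoc)
  moreover have "norm w powr p - norm w powr (p - 1) * norm a <= plap p w \<bullet> (w - a)"
    using plap_inner_le[of p w a] by (simp add: inner_diff_right plap_inner_self)
  moreover have "norm w powr (p - 1) * norm w = norm w powr p"
    by (cases "w = 0") (simp_all add: powr_diff)
  ultimately show ?thesis
    using assms mult_left_mono[of "norm w powr p - norm w powr (p - 1) * norm a" "plap p w \<bullet> (w - a)" p]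
    by (simp add: algebra_simps)
qed

text \<open>If the norms differ, Cauchy-Schwarz leaves the strictly increasing scalar function
  \<open>t powr (p - 1)\<close>; if they agree, the difference of the fields is a multiple of
  \<open>a - b\<close>, with a positive factor unless both vanish.\<close>

lemma plap_monotone:
  assumes "1 < p"
  shows "0 <= (plap p a - plap p b) \<bullet> (a - b)" and "a ~= b ==> 0 < (plap p a - plap p b) \<bullet> (a - b)"
proof -
  have pm: "norm w powr (p - 1) * norm w = norm w powr p" for w :: 'a
    by (cases "w = 0") (simp_all add: powr_diff)
  have "norm a powr (p - 1) * (norm a - norm b) + norm b powr (p - 1) * (norm b - norm a)
      <= (plap p a - plap p b) \<bullet> (a - b)"
    using plap_inner_le[of p a b] plap_inner_le[of p b a]
    by (simp add: inner_diff_right inner_diff_left plap_inner_self right_diff_distrib pm)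
  then have le: "(norm a powr (p - 1) - norm b powr (p - 1)) * (norm a - norm b) <= (plap p a - plap p b) \<bullet> (a - b)"
    by (simp add: algebra_simps)
  have pos: "0 < (norm a powr (p - 1) - norm b powr (p - 1)) * (norm a - norm b)" if "norm a ~= norm b"
  proof (cases "norm a < norm b")
    case True
    then have "norm a powr (p - 1) < norm b powr (p - 1)" using assms by (intro powr_less_mono2) auto
    with True show ?thesis by (intro mult_neg_neg) auto
  next
    case False
    with that have "norm b < norm a" by simp
    then have "norm b powr (p - 1) < norm a powr (p - 1)" using assms by (intro powr_less_mono2) auto
    with \<open>norm b < norm a\<close> show ?thesis by (intro mult_pos_pos) auto
  qed
  show strict: "0 < (plap p a - plap p b) \<bullet> (a - b)" if "a ~= b"
  proof (cases "norm a = norm b")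
    case True
    then have "a ~= 0" using that by auto
    have "(plap p a - plap p b) \<bullet> (a - b) = norm a powr (p - 2) * ((a - b) \<bullet> (a - b))"
      using True by (simp add: plap_def inner_diff_left inner_diff_right algebra_simps)
    moreover have "0 < (a - b) \<bullet> (a - b)" using that by simp
    ultimately show ?thesis using \<open>a ~= 0\<close> by simp
  next
    case False
    with pos le show ?thesis by linarith
  qed
  show "0 <= (plap p a - plap p b) \<bullet> (a - b)"
    using strict by (cases "a = b") auto
qed

text \<open>At \<open>a = 0\<close> the factor \<open>norm a powr (p - 2)\<close> can be unbounded
  nearby, so continuity there is read off from \<open>norm_plap\<close>.\<close>

lemma plap_tendsto:
  assumes "1 < p" "(f \<longlongrightarrow> a) F"
  shows "((%t. plap p (f t)) \<longlongrightarrow> plap p a) F"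
proof (cases "a = 0")
  case True
  have "((%t. norm (f t) powr (p - 1)) \<longlongrightarrow> 0) F"
    using assms True by (intro tendsto_zero_powrI[OF _ tendsto_const] tendsto_norm_zero) auto
  then have "((%t. plap p (f t)) \<longlongrightarrow> 0) F"
    by (rule tendsto_norm_zero_cancel[OF Lim_null_comparison[rotated]]) (simp add: norm_plap)
  then show ?thesis using True by (simp add: plap_def)
next
  case False
  then show ?thesis unfolding plap_def
    using assms by (intro tendsto_intros) auto
qed

text \<open>The defect in midpoint convexity. It mediates between energies and distances: the energy
  excess of two near minimisers bounds its integral, and it dominates
  \<open>norm (a - b) powr p\<close> unless \<open>a\<close> and \<open>b\<close> are relatively
  close.\<close>

definition convexity_gap :: "real => 'b::real_inner => 'b => real" where
  "convexity_gap p a b = (norm a powr p + norm b powr p) / 2 - norm ((1/2) *\<^sub>R (a + b)) powr p"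

lemma convexity_gap_pos:
  assumes "1 < p" "a ~= b"
  shows "0 < convexity_gap p a b"
proof (cases "norm a = norm b")
  case True
  have "norm (a + b) ^ 2 + norm (a - b) ^ 2 = 2 * norm a ^ 2 + 2 * norm b ^ 2"
    by (simp add: power2_norm_eq_inner inner_add_left inner_add_right inner_diff_left inner_diff_right)
  then have "norm (a + b) ^ 2 + norm (a - b) ^ 2 = (2 * norm a) ^ 2" using True by (simp add: power_mult_distrib)
  moreover have "0 < norm (a - b) ^ 2" using assms by simp
  ultimately have "norm (a + b) ^ 2 < (2 * norm a) ^ 2" by linarith
  then have "norm (a + b) < 2 * norm a" by (rule power2_less_imp_less) simp
  then have "norm ((1/2) *\<^sub>R (a + b)) powr p < norm a powr p"
    using assms by (intro powr_less_mono2) auto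
  then show ?thesis using True by (simp add: convexity_gap_def)
next
  case False
  let ?m = "(norm a + norm b) / 2"
  have "?m powr p + p * ?m powr (p - 1) * (norm a - ?m) < norm a powr p"
    using False by (intro powr_tangent(2) assms) auto
  moreover have "?m powr p + p * ?m powr (p - 1) * (norm b - ?m) < norm b powr p"
    using False by (intro powr_tangent(2) assms) auto
  moreover have "p * ?m powr (p - 1) * (norm a - ?m) + p * ?m powr (p - 1) * (norm b - ?m) = 0"
    by (simp add: algebra_simps add_divide_distrib)
  moreover have "norm ((1/2) *\<^sub>R (a + b)) powr p <= ?m powr p"
    using assms norm_triangle_ineq[of a b] by (intro powr_mono2) auto
  ultimately show ?thesis unfolding convexity_gap_def by argo
qed

lemma convexity_gap_nonneg: "1 < p ==> 0 <= convexity_gap p a b"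
  using convexity_gap_pos[of p a b] by (cases "a = b") (auto simp: convexity_gap_def simp flip: scaleR_2)

text \<open>By homogeneity one may assume \<open>norm a + norm b = 1\<close>. The remaining pairs,
  together with the exponents in \<open>{pm..P}\<close>, form a compact set on which the gap is
  continuous and positive; its minimum is the constant, uniform in \<open>p\<close>.\<close>

lemma uniform_convexity:
  fixes pm P \<delta> :: real
  assumes "1 < pm" "pm <= P" "0 < \<delta>" "\<delta> <= 1"
  obtains c where "0 < c"
    "!!p (a::'b::euclidean_space) b. pm <= p ==> p <= P ==> \<delta> * (norm a + norm b) <= norm (a - b) ==>
       c * (norm a + norm b) powr p <= convexity_gap p a b"
proof -
  let ?K = "{pm..P} \<times> {z :: 'b \<times> 'b. norm (fst z) + norm (snd z) = 1 & \<delta> <= norm (fst z - snd z)}"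
  let ?g = "%(p, z :: 'b \<times> 'b). convexity_gap p (fst z) (snd z)"
  have "closed {z :: 'b \<times> 'b. norm (fst z) + norm (snd z) = 1 & \<delta> <= norm (fst z - snd z)}"
    by (intro closed_Collect_conj closed_Collect_eq closed_Collect_le continuous_intros)
  moreover have "bounded {z :: 'b \<times> 'b. norm (fst z) + norm (snd z) = 1 & \<delta> <= norm (fst z - snd z)}"
  proof (rule boundedI)
    fix z :: "'b \<times> 'b" assume "z \<in> {z. norm (fst z) + norm (snd z) = 1 & \<delta> <= norm (fst z - snd z)}"
    then show "norm z <= 1" using norm_Pair_le[of "fst z" "snd z"] by simp
  qed
  ultimately have K: "compact ?K" by (intro compact_Times compact_Icc) (simp add: compact_eq_bounded_closed)
  have cont: "continuous_on ?K ?g"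
    unfolding convexity_gap_def case_prod_unfold
    by (intro continuous_intros continuous_on_powr') (use assms(1) in auto)
  have "\<exists>c>0. \<forall>z\<in>?K. c <= ?g z"
  proof (cases "?K = {}")
    case False
    obtain z0 where z0: "z0 \<in> ?K" "!!z. z \<in> ?K ==> ?g z0 <= ?g z"
      using continuous_attains_inf[OF K False cont] by blast
    have "0 < ?g z0"
      using z0(1) assms by (auto simp: case_prod_unfold intro!: convexity_gap_pos)
    with z0(2) show ?thesis by blast
  qed (auto intro: exI[of _ 1])
  then obtain c where c: "c > 0" "!!z. z \<in> ?K ==> c <= ?g z" by blast
  have "c * (norm a + norm b) powr p <= convexity_gap p a b"
    if p: "pm <= p" "p <= P" and d: "\<delta> * (norm a + norm b) <= norm (a - b)" for p and a b :: 'b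
  proof (cases "norm a + norm b = 0")
    case True
    then have "a = 0" "b = 0" by (auto simp: add_nonneg_eq_0_iff)
    then show ?thesis by (simp add: convexity_gap_def)
  next
    case False
    define s where "s = norm a + norm b"
    have s: "s > 0" using False by (simp add: s_def add_nonneg_pos less_le)
    have hom: "convexity_gap p (t *\<^sub>R a) (t *\<^sub>R b) = t powr p * convexity_gap p a b" if "t >= 0" for t
    proof -
      have "(1/2) *\<^sub>R (t *\<^sub>R a + t *\<^sub>R b) = t *\<^sub>R ((1/2) *\<^sub>R (a + b))" by (simp add: algebra_simps)
      then show ?thesis
        using that by (simp only: convexity_gap_def norm_scaleR powr_mult abs_ge_zero norm_ge_zero abs_of_nonneg)
          (simp add: algebra_simps add_divide_distrib)
    qed
    have "(p, inverse s *\<^sub>R a, inverse s *\<^sub>R b) \<in> ?K"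
    proof -
      have "norm (inverse s *\<^sub>R a) + norm (inverse s *\<^sub>R b) = inverse s * s"
        using s by (simp add: s_def distrib_left)
      moreover have "norm (inverse s *\<^sub>R a - inverse s *\<^sub>R b) = inverse s * norm (a - b)"
        using s by (simp flip: scaleR_diff_right)
      moreover have "\<delta> <= inverse s * norm (a - b)" using d s by (simp add: s_def field_simps)
      ultimately show ?thesis using p s by simp
    qed
    then have "c <= convexity_gap p (inverse s *\<^sub>R a) (inverse s *\<^sub>R b)" using c(2) by fastforce
    also have "... = inverse s powr p * convexity_gap p a b" using s by (intro hom) simp
    finally have "s powr p * c <= s powr p * (inverse s powr p * convexity_gap p a b)"
      by (intro mult_left_mono) auto
    also have "... = convexity_gap p a b" using s by (simp flip: mult.assoc powr_mult)
    finally show ?thesis by (simp add: s_def mult.commute)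
  qed
  with c(1) show ?thesis using that by blast
qed

text \<open>The bounds on \<open>p\<close> hold at every point of the space, as a continuous
  exponent permits, so the pointwise estimates for the exponent have no exceptional sets.\<close>

locale var_exponent = finite_measure M for M :: "'a measure" +
  fixes p :: "'a => real" and pm P :: real
  assumes p_measurable [measurable]: "p \<in> borel_measurable M"
    and pm: "1 < pm" and p_bounds: "!!x. x \<in> space M ==> pm <= p x & p x <= P" and pmP: "pm <= P"
begin

lemma P_gt1: "1 < P" using pm pmP by simp

definition Lp :: "('a => 'b::euclidean_space) => bool" where
  "Lp f \<longleftrightarrow> f \<in> borel_measurable M & integrable M (%x. norm (f x) powr p x)"

text \<open>The modular, which is neither homogeneous nor subadditive; the triangle inequality with
  factor \<open>2 powr P\<close> in \<open>mo_triangle\<close> is enough for limits and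
  completeness.\<close>

definition mo :: "('a => 'b::euclidean_space) => real" where
  "mo f = (LINT x|M. norm (f x) powr p x)"

lemma Lp_measurable [measurable_dest]: "Lp f ==> f \<in> borel_measurable M"
  and Lp_integrable_powr: "Lp f ==> integrable M (%x. norm (f x) powr p x)"
  by (auto simp: Lp_def)

lemma mo_nonneg: "0 <= mo f" by (simp add: mo_def)

lemma p_ge1: "x \<in> space M ==> 1 < p x" and p_le: "x \<in> space M ==> p x <= P"
  using p_bounds[of x] pm by auto

lemma Lp_dominated:
  fixes f :: "'a => 'b::euclidean_space"
  assumes [measurable]: "f \<in> borel_measurable M" and g: "integrable M g"
    and le: "AE x in M. norm (f x) powr p x <= g x"
  shows "Lp f" "mo f <= (LINT x|M. g x)"
proof -
  have "integrable M (%x. norm (f x) powr p x)"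
    by (rule Bochner_Integration.integrable_bound[OF g]) (use le in auto)
  then show "Lp f" by (simp add: Lp_def)
  then show "mo f <= (LINT x|M. g x)"
    unfolding mo_def using le g by (intro integral_mono_AE) (auto dest: Lp_integrable_powr)
qed

lemma Lp_le:
  fixes f :: "'a => 'b::euclidean_space" and g :: "'a => 'c::euclidean_space"
  assumes "f \<in> borel_measurable M" "Lp g" "AE x in M. norm (f x) <= norm (g x)"
  shows "Lp f" "mo f <= mo g"
proof -
  have "AE x in M. norm (f x) powr p x <= norm (g x) powr p x"
    using assms(3) by (rule AE_mp) (auto intro!: AE_I2 powr_mono2 intro: order.trans[OF zero_le_one less_imp_le[OF p_ge1]])
  from Lp_dominated[OF assms(1) Lp_integrable_powr[OF assms(2)] this]
  show "Lp f" "mo f <= mo g" by (auto simp: mo_def)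
qed

lemma Lp_AE_cong:
  assumes "Lp f" "g \<in> borel_measurable M" "AE x in M. f x = g x"
  shows "Lp g" "mo g = mo f"
proof -
  have 1: "AE x in M. norm (g x) <= norm (f x)" "AE x in M. norm (f x) <= norm (g x)"
    using assms(3) by (auto elim!: eventually_mono)
  show g: "Lp g" using Lp_le(1)[OF assms(2,1) 1(1)] .
  show "mo g = mo f"
    using Lp_le(2)[OF assms(2,1) 1(1)] Lp_le(2)[OF Lp_measurable[OF assms(1)] g 1(2)] by simp
qed

lemma Lp_bounded:
  fixes f :: "'a => 'b::euclidean_space"
  assumes "f \<in> borel_measurable M" "AE x in M. norm (f x) <= C"
  shows "Lp f"
proof (rule Lp_dominated(1)[OF assms(1)])
  show "integrable M (%x. max 1 \<bar>C\<bar> powr P)" by simp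
  show "AE x in M. norm (f x) powr p x <= max 1 \<bar>C\<bar> powr P"
    using assms(2)
  proof (rule AE_mp, intro AE_I2 impI)
    fix x assume x: "x \<in> space M" "norm (f x) <= C"
    have "norm (f x) powr p x <= \<bar>C\<bar> powr p x" using x p_ge1[OF x(1)] by (intro powr_mono2) auto
    also have "... <= max 1 \<bar>C\<bar> powr P" using p_bounds[OF x(1)] pm by (intro powr_max_le) auto
    finally show "norm (f x) powr p x <= max 1 \<bar>C\<bar> powr P" .
  qed
qed

lemma Lp_add:
  fixes f g :: "'a => 'b::euclidean_space"
  assumes "Lp f" "Lp g"
  shows "Lp (%x. f x + g x)" "mo (%x. f x + g x) <= 2 powr P * (mo f + mo g)"
proof -
  have m: "(%x. f x + g x) \<in> borel_measurable M" using assms by (auto dest: Lp_measurable)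
  have i: "integrable M (%x. 2 powr P * (norm (f x) powr p x + norm (g x) powr p x))"
    using assms by (auto dest: Lp_integrable_powr)
  have "AE x in M. norm (f x + g x) powr p x <= 2 powr P * (norm (f x) powr p x + norm (g x) powr p x)"
  proof (rule AE_I2, goal_cases)
    case x: (1 x)
    have "norm (f x + g x) powr p x <= (norm (f x) + norm (g x)) powr p x"
      using p_ge1[OF x] by (intro powr_mono2 norm_triangle_ineq) auto
    also have "... <= 2 powr P * (norm (f x) powr p x + norm (g x) powr p x)"
      using p_ge1[OF x] p_le[OF x] by (intro powr_add_le) auto
    finally show ?case .
  qed
  from Lp_dominated[OF m i this]
  show "Lp (%x. f x + g x)" "mo (%x. f x + g x) <= 2 powr P * (mo f + mo g)"
    using assms by (auto simp: mo_def Lp_integrable_powr)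
qed

lemma Lp_scaleR:
  fixes f :: "'a => 'b::euclidean_space"
  assumes "Lp f"
  shows "Lp (%x. c *\<^sub>R f x)" "mo (%x. c *\<^sub>R f x) <= max 1 \<bar>c\<bar> powr P * mo f"
proof -
  have m: "(%x. c *\<^sub>R f x) \<in> borel_measurable M" using assms by (auto dest: Lp_measurable)
  have i: "integrable M (%x. max 1 \<bar>c\<bar> powr P * norm (f x) powr p x)"
    using assms by (auto dest: Lp_integrable_powr)
  have "AE x in M. norm (c *\<^sub>R f x) powr p x <= max 1 \<bar>c\<bar> powr P * norm (f x) powr p x"
  proof (rule AE_I2, goal_cases)
    case x: (1 x)
    have "norm (c *\<^sub>R f x) powr p x = \<bar>c\<bar> powr p x * norm (f x) powr p x" by (simp add: powr_mult)
    also have "... <= max 1 \<bar>c\<bar> powr P * norm (f x) powr p x"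
      using p_bounds[OF x] pm by (intro mult_right_mono powr_max_le) auto
    finally show ?case .
  qed
  from Lp_dominated[OF m i this]
  show "Lp (%x. c *\<^sub>R f x)" "mo (%x. c *\<^sub>R f x) <= max 1 \<bar>c\<bar> powr P * mo f"
    by (auto simp: mo_def)
qed

lemma Lp_diff:
  fixes f g :: "'a => 'b::euclidean_space"
  assumes "Lp f" "Lp g"
  shows "Lp (%x. f x - g x)" "mo (%x. f x - g x) <= 2 powr P * (mo f + mo g)"
  using Lp_add[OF assms(1) Lp_scaleR(1)[OF assms(2), of "-1"]] Lp_scaleR(2)[OF assms(2), of "-1"]
  by (auto simp: mo_def)

lemma mo_triangle:
  assumes "Lp f" "Lp g" "Lp h"
  shows "mo (%x. f x - h x) <= 2 powr P * (mo (%x. f x - g x) + mo (%x. g x - h x))"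
  using Lp_add(2)[OF Lp_diff(1)[OF assms(1,2)] Lp_diff(1)[OF assms(2,3)]] by simp

text \<open>The parameter \<open>d\<close> is kept free: the first term is made small by
  \<open>d\<close>, the second by the modular. This is the embedding into L1 on which all later
  passages from modulars to integrals rest.\<close>

lemma Lp_integrable:
  fixes f :: "'a => 'b::euclidean_space"
  assumes "Lp f"
  shows "integrable M f"
    and "0 < d ==> d <= 1 ==> (LINT x|M. norm (f x)) <= d * measure M (space M) + d powr (1 - P) * mo f"
proof -
  have le: "AE x in M. norm (f x) <= d + d powr (1 - P) * norm (f x) powr p x" if "0 < d" "d <= 1" for d
  proof (rule AE_I2, goal_cases)
    case x: (1 x)
    show ?case
      using p_ge1[OF x] p_le[OF x] that by (intro le_delta_plus_powr) auto
  qed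
  have i: "integrable M (%x. d + d powr (1 - P) * norm (f x) powr p x)" for d
    using Lp_integrable_powr[OF assms] by simp
  show int: "integrable M f"
  proof (rule Bochner_Integration.integrable_bound[OF i[of 1]])
    show "f \<in> borel_measurable M" using assms by (rule Lp_measurable)
    show "AE x in M. norm (f x) <= norm (1 + 1 powr (1 - P) * norm (f x) powr p x)"
      using le[of 1] by simp
  qed
  assume "0 < d" "d <= 1"
  then have "(LINT x|M. norm (f x)) <= (LINT x|M. d + d powr (1 - P) * norm (f x) powr p x)"
    using int i le by (intro integral_mono_AE) auto
  also have "... = d * measure M (space M) + d powr (1 - P) * mo f"
    using Lp_integrable_powr[OF assms] by (simp add: mo_def mult.commute)
  finally show "(LINT x|M. norm (f x)) <= d * measure M (space M) + d powr (1 - P) * mo f" .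
qed

lemma integral_norm_small:
  assumes "0 < e"
  obtains d where "0 < d" "!!f :: 'a => 'b::euclidean_space. Lp f ==> mo f < d ==> (LINT x|M. norm (f x)) < e"
proof -
  \<comment> \<open>This parameter is fixed first and brings the constant part below
    \<open>e / 2\<close>; the threshold \<open>d\<close> for the modular then has to beat the factor
    \<open>\<delta> powr (1 - P)\<close>. Adding 1 to the measure avoids division by zero.\<close>
  define \<delta> where "\<delta> = min 1 (e / (2 * (measure M (space M) + 1)))"
  have m: "measure M (space M) + 1 > 0" by (simp add: add_nonneg_pos)
  have \<delta>: "0 < \<delta>" "\<delta> <= 1" "\<delta> * measure M (space M) <= e / 2"
  proof -
    show "0 < \<delta>" "\<delta> <= 1" using assms m by (auto simp: \<delta>_def)
    have "\<delta> * measure M (space M) <= (e / (2 * (measure M (space M) + 1))) * (measure M (space M) + 1)"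
      using assms m by (intro mult_mono) (auto simp: \<delta>_def)
    also have "... = e / 2" by (rule half_mult_cancel[OF m])
    finally show "\<delta> * measure M (space M) <= e / 2" .
  qed
  define d where "d = e / (2 * \<delta> powr (1 - P))"
  have "d > 0" using assms \<delta>(1) by (simp add: d_def)
  moreover have "(LINT x|M. norm (f x)) < e" if "Lp f" "mo f < d" for f :: "'a => 'b"
  proof -
    have "\<delta> powr (1 - P) * mo f < \<delta> powr (1 - P) * d" using that \<delta>(1) by simp
    also have "... = e / 2" using \<delta>(1) by (simp add: d_def)
    finally show ?thesis using Lp_integrable(2)[OF that(1) \<delta>(1,2)] \<delta>(3) by linarith
  qed
  ultimately show ?thesis by (rule that)
qed

lemma mo_tendsto_0_L1:
  assumes "!!k. Lp (F k)" "(%k. mo (F k)) ----> 0"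
  shows "(%k. \<integral>x. norm (F k x) \<partial>M) ----> 0"
proof (rule LIMSEQ_I)
  fix e :: real assume "0 < e"
  then obtain d where d: "0 < d" "!!f :: 'a => 'b. Lp f ==> mo f < d ==> (LINT x|M. norm (f x)) < e"
    using integral_norm_small by metis
  obtain N where "!!k. k >= N ==> norm (mo (F k) - 0) < d" using LIMSEQ_D[OF assms(2) d(1)] by blast
  then have "norm ((LINT x|M. norm (F k x)) - 0) < e" if "k >= N" for k
    using that d(2)[OF assms(1)] by (simp add: mo_nonneg)
  then show "\<exists>N. \<forall>k\<ge>N. norm ((LINT x|M. norm (F k x)) - 0) < e" by blast
qed

lemma mo_tendsto_AE_subseq:
  assumes "!!k. Lp (F k)" "Lp f" "(%k. mo (%x. F k x - f x)) ----> 0"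
  obtains r :: "nat => nat" where "strict_mono r" "AE x in M. (%k. F (r k) x) ----> f x"
proof -
  have "\<exists>r::nat\<Rightarrow>nat. strict_mono r & (AE x in M. (%k. F (r k) x - f x) ----> 0)"
    using assms by (intro tendsto_L1_AE_subseq Lp_integrable(1) mo_tendsto_0_L1 Lp_diff)
  then show ?thesis using that by (auto simp: LIM_zero_iff)
qed

text \<open>A converse to the L1 embedding, for bounded functions: all but one power of the norm
  goes into the constant. It turns the L1 Poincare inequality into a statement about
  modulars.\<close>

lemma mo_le_of_bounded:
  fixes f :: "'a => 'b::euclidean_space"
  assumes m: "f \<in> borel_measurable M" and C: "AE x in M. norm (f x) <= C"
  shows "mo f <= max 1 \<bar>C\<bar> powr P * (LINT x|M. norm (f x))"
proof -
  have i: "integrable M (%x. max 1 \<bar>C\<bar> powr P * norm (f x))"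
    using Lp_integrable(1)[OF Lp_bounded[OF m C]] by simp
  have "AE x in M. norm (f x) powr p x <= max 1 \<bar>C\<bar> powr P * norm (f x)"
    using C
  proof (rule AE_mp, intro AE_I2 impI)
    fix x assume x: "x \<in> space M" "norm (f x) <= C"
    have "norm (f x) powr p x = norm (f x) powr (p x - 1) * norm (f x)"
      by (cases "f x = 0") (simp_all add: powr_diff)
    also have "... <= max 1 \<bar>C\<bar> powr P * norm (f x)"
    proof (rule mult_right_mono)
      have "norm (f x) powr (p x - 1) <= \<bar>C\<bar> powr (p x - 1)"
        using x p_ge1[OF x(1)] by (intro powr_mono2) auto
      also have "... <= max 1 \<bar>C\<bar> powr P" using p_ge1[OF x(1)] p_le[OF x(1)] by (intro powr_max_le) auto
      finally show "norm (f x) powr (p x - 1) <= max 1 \<bar>C\<bar> powr P" .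
    qed simp
    finally show "norm (f x) powr p x <= max 1 \<bar>C\<bar> powr P * norm (f x)" .
  qed
  from Lp_dominated(2)[OF m i this] show ?thesis by simp
qed

lemma mo_dominated_convergence:
  fixes F :: "nat => 'a => 'b::euclidean_space" and g :: "'a => 'c::euclidean_space"
  assumes m: "!!k. F k \<in> borel_measurable M" and g: "Lp g" and le: "!!k. AE x in M. norm (F k x) <= norm (g x)"
    and lim: "AE x in M. (%k. F k x) ----> 0"
  shows "(%k. mo (F k)) ----> 0"
proof -
  have "(%k. \<integral>x. norm (F k x) powr p x \<partial>M) ----> (LINT x|M. 0)"
  proof (rule integral_dominated_convergence[where w="%x. norm (g x) powr p x" and f="%_. 0" and s="%k x. norm (F k x) powr p x"])
    show "integrable M (%x. norm (g x) powr p x)" using g by (rule Lp_integrable_powr)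
    show "AE x in M. (%k. norm (F k x) powr p x) ----> 0"
      using lim
    proof (rule AE_mp, intro AE_I2 impI)
      fix x assume "x \<in> space M" "(%k. F k x) ----> 0"
      then show "(%k. norm (F k x) powr p x) ----> 0"
        using p_ge1[of x] by (intro tendsto_zero_powrI[OF _ tendsto_const] tendsto_norm_zero) auto
    qed
    show "AE x in M. norm (norm (F k x) powr p x) <= norm (g x) powr p x" for k
      using le[of k]
    proof (rule AE_mp, intro AE_I2 impI)
      fix x assume "x \<in> space M" "norm (F k x) <= norm (g x)"
      then show "norm (norm (F k x) powr p x) <= norm (g x) powr p x"
        using p_ge1[of x] by (auto intro!: powr_mono2)
    qed
  qed (use m in simp_all)
  then show ?thesis by (simp add: mo_def)
qed

text \<open>Riesz-Fischer: the L1 embedding yields a subsequence that converges almost everywhere,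
  and Fatou's lemma transfers the Cauchy estimate to its limit.\<close>

lemma Lp_complete:
  fixes F :: "nat => 'a => 'b::euclidean_space"
  assumes F: "!!k. Lp (F k)" and C: "!!e. 0 < e ==> \<exists>N. \<forall>m\<ge>N. \<forall>n\<ge>N. mo (%x. F m x - F n x) < e"
  obtains f where "Lp f" "(%k. mo (%x. F k x - f x)) ----> 0"
proof -
  have "\<exists>N. \<forall>i\<ge>N. \<forall>j\<ge>N. (LINT x|M. norm (F i x - F j x)) < e" if "0 < e" for e :: real
  proof -
    obtain d where d: "0 < d" "!!f :: 'a => 'b. Lp f ==> mo f < d ==> (LINT x|M. norm (f x)) < e"
      using integral_norm_small[OF \<open>0 < e\<close>] by metis
    with C[OF d(1)] Lp_diff(1)[OF F F] show ?thesis by blast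
  qed
  then obtain r where r: "strict_mono (r :: nat => nat)" "AE x in M. Cauchy (%i. F (r i) x)"
    using cauchy_L1_AE_cauchy_subseq[of M F] Lp_integrable(1)[OF F] by metis
  define f where "f x = lim (%i. F (r i) x)" for x
  have [measurable]: "F k \<in> borel_measurable M" for k using F by (rule Lp_measurable)
  have fm[measurable]: "f \<in> borel_measurable M" unfolding f_def[abs_def] by measurable
  have conv: "AE x in M. (%i. F (r i) x) ----> f x"
    using r(2) by eventually_elim (simp add: f_def convergent_LIMSEQ_iff Cauchy_convergent_iff)
  have est: "(\<integral>\<^sup>+x. ennreal (norm (F k x - f x) powr p x) \<partial>M) <= ennreal e"
    if "0 < e" and N: "!!m n. m >= N ==> n >= N ==> mo (%x. F m x - F n x) < e" and "k >= N" for e N k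
  proof -
    have "(\<integral>\<^sup>+x. ennreal (norm (F k x - f x) powr p x) \<partial>M)
        = (\<integral>\<^sup>+x. liminf (%i. ennreal (norm (F k x - F (r i) x) powr p x)) \<partial>M)"
    proof (rule nn_integral_cong_AE)
      show "AE x in M. ennreal (norm (F k x - f x) powr p x) = liminf (%i. ennreal (norm (F k x - F (r i) x) powr p x))"
        using conv
      proof (rule AE_mp, intro AE_I2 impI)
        fix x assume x: "x \<in> space M" and l: "(%i. F (r i) x) ----> f x"
        have "(%i. norm (F k x - F (r i) x) powr p x) ----> norm (F k x - f x) powr p x"
          using l p_ge1[OF x] by (intro tendsto_powr' tendsto_intros) auto
        then have "(%i. ennreal (norm (F k x - F (r i) x) powr p x)) ----> ennreal (norm (F k x - f x) powr p x)"
          by (rule tendsto_ennrealI)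
        then show "ennreal (norm (F k x - f x) powr p x) = liminf (%i. ennreal (norm (F k x - F (r i) x) powr p x))"
          by (intro lim_imp_Liminf[symmetric]) auto
      qed
    qed
    also have "... <= liminf (%i. \<integral>\<^sup>+x. ennreal (norm (F k x - F (r i) x) powr p x) \<partial>M)"
      by (intro nn_integral_liminf) simp
    also have "... <= ennreal e"
    proof (rule Liminf_le)
      have "(\<integral>\<^sup>+x. ennreal (norm (F k x - F (r i) x) powr p x) \<partial>M) <= ennreal e" if "i >= N" for i
      proof -
        have "r i >= N" using seq_suble[OF r(1), of i] that by simp
        then have "mo (%x. F k x - F (r i) x) <= e" using N[OF \<open>k >= N\<close>] by (simp add: less_imp_le)
        moreover have "(\<integral>\<^sup>+x. ennreal (norm (F k x - F (r i) x) powr p x) \<partial>M) = ennreal (mo (%x. F k x - F (r i) x))"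
          unfolding mo_def using Lp_integrable_powr[OF Lp_diff(1)[OF F F]] by (intro nn_integral_eq_integral) auto
        ultimately show ?thesis by (simp add: ennreal_leI)
      qed
      then show "\<forall>\<^sub>F i in sequentially. (\<integral>\<^sup>+x. ennreal (norm (F k x - F (r i) x) powr p x) \<partial>M) <= ennreal e"
        by (auto simp: eventually_sequentially)
    qed simp
    finally show ?thesis .
  qed
  have est': "Lp (%x. F k x - f x) & mo (%x. F k x - f x) <= e"
    if "0 < e" and N: "!!m n. m >= N ==> n >= N ==> mo (%x. F m x - F n x) < e" and "k >= N" for e N k
    using integrable_of_nn_integral_le[of "%x. norm (F k x - f x) powr p x" M e] est[OF that] that(1)
    by (simp add: Lp_def mo_def)
  obtain N1 where "!!m n. m >= N1 ==> n >= N1 ==> mo (%x. F m x - F n x) < 1" using C[of 1] by auto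
  then have "Lp (%x. F N1 x - f x)" using est'[of 1 N1 N1] by simp
  from Lp_diff(1)[OF F[of N1] this] have "Lp f" by simp
  moreover have "(%k. mo (%x. F k x - f x)) ----> 0"
  proof (rule LIMSEQ_I)
    fix e :: real assume "0 < e"
    then obtain N where "!!m n. m >= N ==> n >= N ==> mo (%x. F m x - F n x) < e / 2" using C[of "e / 2"] by auto
    with \<open>0 < e\<close> have "mo (%x. F k x - f x) <= e / 2" if "k >= N" for k using est'[of "e / 2" N k] that by simp
    then have "norm (mo (%x. F k x - f x) - 0) < e" if "k >= N" for k
      using that \<open>0 < e\<close> by (fastforce simp: mo_nonneg)
    then show "\<exists>N. \<forall>k\<ge>N. norm (mo (%x. F k x - f x) - 0) < e" by blast
  qed
  ultimately show ?thesis by (rule that)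
qed

lemma Lp_plap_integrable:
  fixes a b :: "'a => 'b::euclidean_space"
  assumes a: "Lp a" and b: "Lp b"
  shows "integrable M (%x. plap (p x) (a x) \<bullet> b x)"
    and "0 < d ==> d <= 1 ==> \<bar>\<integral>x. plap (p x) (a x) \<bullet> b x \<partial>M\<bar> <= d * mo a + d powr (1 - P) * mo b"
proof -
  have [measurable]: "a \<in> borel_measurable M" "b \<in> borel_measurable M" using a b by (auto dest: Lp_measurable)
  have m: "(%x. plap (p x) (a x) \<bullet> b x) \<in> borel_measurable M" unfolding plap_def by measurable
  have le: "AE x in M. norm (plap (p x) (a x) \<bullet> b x) <= d * norm (a x) powr p x + d powr (1 - P) * norm (b x) powr p x"
    if "0 < d" "d <= 1" for d
  proof (rule AE_I2, goal_cases)
    case x: (1 x)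
    have "norm (plap (p x) (a x) \<bullet> b x) <= norm (a x) powr (p x - 1) * norm (b x)"
      using plap_inner_le[of "p x" "a x" "b x"] by simp
    also have "... <= d * norm (a x) powr p x + d powr (1 - P) * norm (b x) powr p x"
      using that p_ge1[OF x] p_le[OF x] by (intro young_delta) auto
    finally show ?case .
  qed
  have i: "integrable M (%x. d * norm (a x) powr p x + d powr (1 - P) * norm (b x) powr p x)" for d
    using Lp_integrable_powr[OF a] Lp_integrable_powr[OF b] by simp
  show int: "integrable M (%x. plap (p x) (a x) \<bullet> b x)"
    by (rule Bochner_Integration.integrable_bound[OF i[of 1] m]) (use le[of 1] in simp)
  assume d: "0 < d" "d <= 1"
  have "\<bar>\<integral>x. plap (p x) (a x) \<bullet> b x \<partial>M\<bar> <= (LINT x|M. norm (plap (p x) (a x) \<bullet> b x))"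
    using integral_norm_bound[of M "%x. plap (p x) (a x) \<bullet> b x"] by simp
  also have "... <= (LINT x|M. d * norm (a x) powr p x + d powr (1 - P) * norm (b x) powr p x)"
    using int i le[OF d] by (intro integral_mono_AE) auto
  also have "... = d * mo a + d powr (1 - P) * mo b"
    using Lp_integrable_powr[OF a] Lp_integrable_powr[OF b] by (simp add: mo_def)
  finally show "\<bar>\<integral>x. plap (p x) (a x) \<bullet> b x \<partial>M\<bar> <= d * mo a + d powr (1 - P) * mo b" .
qed

text \<open>The weight \<open>d\<close> in Young's inequality is chosen against the fixed modular of
  \<open>a\<close>, so that only the modular of \<open>F k - f\<close> has to tend to zero.\<close>

lemma plap_integral_tendsto:
  fixes a :: "'a => 'b::euclidean_space"
  assumes a: "Lp a" and F: "!!k. Lp (F k)" and f: "Lp f" and lim: "(%k. mo (%x. F k x - f x)) ----> 0"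
  shows "(%k. \<integral>x. plap (p x) (a x) \<bullet> F k x \<partial>M) ----> (LINT x|M. plap (p x) (a x) \<bullet> f x)"
proof (rule LIMSEQ_I)
  fix e :: real assume "0 < e"
  define d where "d = min 1 (e / (2 * (mo a + 1)))"
  have ma: "mo a + 1 > 0" using mo_nonneg[of a] by simp
  have d: "0 < d" "d <= 1" "d * mo a <= e / 2"
  proof -
    show "0 < d" "d <= 1" using \<open>0 < e\<close> ma by (auto simp: d_def)
    have "d * mo a <= (e / (2 * (mo a + 1))) * (mo a + 1)"
      using \<open>0 < e\<close> ma mo_nonneg[of a] by (intro mult_mono) (auto simp: d_def)
    also have "... = e / 2" by (rule half_mult_cancel[OF ma])
    finally show "d * mo a <= e / 2" .
  qed
  have "0 < e / (2 * d powr (1 - P))" using \<open>0 < e\<close> d(1) by simp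
  from LIMSEQ_D[OF lim this] obtain N where
    N: "!!k. k >= N ==> mo (%x. F k x - f x) < e / (2 * d powr (1 - P))" by (auto simp: mo_nonneg)
  have "norm ((LINT x|M. plap (p x) (a x) \<bullet> F k x) - (LINT x|M. plap (p x) (a x) \<bullet> f x)) < e" if "k >= N" for k
  proof -
    have "(LINT x|M. plap (p x) (a x) \<bullet> F k x) - (LINT x|M. plap (p x) (a x) \<bullet> f x)
        = (LINT x|M. plap (p x) (a x) \<bullet> (F k x - f x))"
      using Lp_plap_integrable(1)[OF a F] Lp_plap_integrable(1)[OF a f] by (simp add: inner_diff_right)
    also have "\<bar>...\<bar> <= d * mo a + d powr (1 - P) * mo (%x. F k x - f x)"
      by (rule Lp_plap_integrable(2)[OF a Lp_diff(1)[OF F f] d(1,2)])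
    also have "d powr (1 - P) * mo (%x. F k x - f x) < d powr (1 - P) * (e / (2 * d powr (1 - P)))"
      using N[OF that] d(1) by (intro mult_strict_left_mono) auto
    also have "d powr (1 - P) * (e / (2 * d powr (1 - P))) = e / 2" using d(1) by simp
    finally show ?thesis using d(3) by simp
  qed
  then show "\<exists>N. \<forall>k\<ge>N. norm ((LINT x|M. plap (p x) (a x) \<bullet> F k x) - (LINT x|M. plap (p x) (a x) \<bullet> f x)) < e" by blast
qed

lemma gap_integrable:
  fixes a b :: "'a => 'b::euclidean_space"
  assumes a: "Lp a" and b: "Lp b"
  shows "integrable M (%x. convexity_gap (p x) (a x) (b x))"
  using Lp_integrable_powr[OF a] Lp_integrable_powr[OF b]
    Lp_integrable_powr[OF Lp_scaleR(1)[OF Lp_add(1)[OF a b], of "1/2"]]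
  unfolding convexity_gap_def by (intro Bochner_Integration.integrable_diff) auto

text \<open>At each point either \<open>a - b\<close> is comparable to
  \<open>norm a + norm b\<close> and uniform convexity applies, or it is relatively small and
  \<open>d powr p x <= d\<close> gives the first term. As \<open>c\<close> depends on
  \<open>d\<close>, the latter must be chosen before any energy tolerance.\<close>

lemma mo_diff_le_gap:
  assumes "0 < d" "d <= 1"
  obtains c where "0 < c" "!!a b :: 'a => 'b::euclidean_space. Lp a ==> Lp b ==>
    mo (%x. a x - b x) <= d * 2 powr P * (mo a + mo b) + c * (LINT x|M. convexity_gap (p x) (a x) (b x))"
proof -
  obtain c where c: "0 < c"
    "!!p (a::'b) b. pm <= p ==> p <= P ==> d * (norm a + norm b) <= norm (a - b) ==>
       c * (norm a + norm b) powr p <= convexity_gap p a b"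
    using uniform_convexity[OF pm pmP assms, where 'b='b] by metis
  have pw: "norm (a - b) powr p x <= d * 2 powr P * (norm a powr p x + norm b powr p x) + inverse c * convexity_gap (p x) a b"
    if x: "x \<in> space M" for x and a b :: 'b
  proof (cases "d * (norm a + norm b) <= norm (a - b)")
    case True
    have "norm (a - b) powr p x <= (norm a + norm b) powr p x"
      using p_ge1[OF x] norm_triangle_ineq4[of a b] by (intro powr_mono2) auto
    also have "... = inverse c * (c * (norm a + norm b) powr p x)" using c(1) by simp
    also have "... <= inverse c * convexity_gap (p x) a b"
      using c p_bounds[OF x] True by (intro mult_left_mono) auto
    finally show ?thesis using assms by (simp add: add_increasing)
  next
    case False
    then have "norm (a - b) powr p x <= (d * (norm a + norm b)) powr p x"
      using p_ge1[OF x] by (intro powr_mono2) auto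
    also have "... = d powr p x * (norm a + norm b) powr p x" by (rule powr_mult)
    also have "... <= d * (2 powr P * (norm a powr p x + norm b powr p x))"
    proof (intro mult_mono)
      show "d powr p x <= d" using powr_mono'[of 1 "p x" d] assms p_ge1[OF x] by simp
      show "(norm a + norm b) powr p x <= 2 powr P * (norm a powr p x + norm b powr p x)"
        using p_ge1[OF x] p_le[OF x] by (intro powr_add_le) auto
    qed (use assms in auto)
    finally show ?thesis using convexity_gap_nonneg[OF p_ge1[OF x], of a b] c(1)
      by (simp add: add_increasing2 mult.assoc)
  qed
  have "mo (%x. a x - b x) <= d * 2 powr P * (mo a + mo b) + inverse c * (LINT x|M. convexity_gap (p x) (a x) (b x))"
    if a: "Lp a" and b: "Lp b" for a b :: "'a => 'b"
  proof -
    have i: "integrable M (%x. d * 2 powr P * (norm (a x) powr p x + norm (b x) powr p x)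
        + inverse c * convexity_gap (p x) (a x) (b x))"
      using gap_integrable[OF a b] Lp_integrable_powr[OF a] Lp_integrable_powr[OF b] by simp
    have "mo (%x. a x - b x) <= (LINT x|M. d * 2 powr P * (norm (a x) powr p x + norm (b x) powr p x)
        + inverse c * convexity_gap (p x) (a x) (b x))"
      using Lp_measurable[OF Lp_diff(1)[OF a b]] pw by (intro Lp_dominated(2) i) auto
    also have "... = d * 2 powr P * (mo a + mo b) + inverse c * (LINT x|M. convexity_gap (p x) (a x) (b x))"
      using a b gap_integrable[OF a b] by (simp add: mo_def Lp_integrable_powr)
    finally show ?thesis .
  qed
  with c(1) show ?thesis using that[of "inverse c"] by simp
qed

end

section \<open>The space \<open>W10\<close>\<close>

lemma tendsto_0_subseq_principle:
  fixes a :: "nat => real"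
  assumes "!!r :: nat => nat. strict_mono r ==> \<exists>s :: nat => nat. strict_mono s & (%k. a (r (s k))) ----> 0"
  shows "a ----> 0"
proof (rule ccontr)
  assume "\<not> a ----> 0"
  then obtain e where e: "e > 0" "!!N. \<exists>n\<ge>N. e <= norm (a n - 0)"
    unfolding LIMSEQ_iff by (force simp: not_less)
  have "infinite {n. e <= \<bar>a n\<bar>}"
    unfolding infinite_nat_iff_unbounded_le using e(2) by auto
  then obtain r :: "nat => nat" where r: "strict_mono r" "!!n. r n \<in> {n. e <= \<bar>a n\<bar>}"
    using infinite_enumerate by blast
  obtain s :: "nat => nat" where "(%k. a (r (s k))) ----> 0" using assms[OF r(1)] by blast
  then have "\<forall>\<^sub>F k in sequentially. norm (a (r (s k)) - 0) < e"
    using e(1) by (auto simp: tendsto_iff dist_norm)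
  then obtain k where "norm (a (r (s k)) - 0) < e" using eventually_happens'[OF sequentially_bot] by blast
  then have "\<bar>a (r (s k))\<bar> < e" by simp
  with r(2)[of "s k"] show False by simp
qed

text \<open>The Lipschitz condition on compact sets is the form in which a C1 exponent enters; it
  supplies the log-Hoelder continuity that bounds mollifications in the modular.\<close>

locale sobolev = var_exponent "lebesgue_on \<Omega>" p pm P
  for \<Omega> :: "(real^'n) set" and p :: "real^'n => real" and pm P :: real +
  assumes open_\<Omega>: "open \<Omega>"
    and loc_lipschitz: "!!K. compact K ==> K \<subseteq> \<Omega> ==>
      \<exists>L d. 0 <= L & 0 < d & (\<forall>x\<in>K. \<forall>y\<in>K. dist x y <= d --> \<bar>p x - p y\<bar> <= L * dist x y)"
begin

abbreviation "M \<equiv> lebesgue_on \<Omega>"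

lemma \<Omega>_sets: "\<Omega> \<in> sets lebesgue" using open_\<Omega> by auto

lemma modular_eq_mo:
  fixes u :: "real^'n => real"
  assumes "Lp u" shows "modular \<Omega> p u = ennreal (mo u)"
  using Lp_integrable_powr[OF assms] unfolding modular_def mo_def real_norm_def
  by (intro nn_integral_eq_integral) auto

lemma Lp_of_modular:
  assumes "u \<in> borel_measurable M" "modular \<Omega> p u <= ennreal e" "0 <= e"
  shows "Lp u" "mo u <= e"
  using integrable_of_nn_integral_le[of "%x. \<bar>u x\<bar> powr p x" M e] assms
  by (auto simp: modular_def Lp_def mo_def)

lemma Lp_mult_const: "Lp u ==> Lp (%x. c * u x)" for u :: "real^'n => real"
  using Lp_scaleR(1)[of u c] by simp

lemma Lvar_iff_Lp: "u \<in> Lvar \<Omega> p \<longleftrightarrow> Lp u"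
proof
  assume "u \<in> Lvar \<Omega> p"
  then obtain c where c: "c > 0" "u \<in> borel_measurable M" "modular \<Omega> p (%x. u x / c) <= 1"
    by (auto simp: Lvar_def)
  then have "Lp (%x. u x / c)" using Lp_of_modular(1)[of "%x. u x / c" 1] by simp
  from Lp_mult_const[OF this, of c] show "Lp u" using c(1) by simp
next
  assume u: "Lp u"
  \<comment> \<open>Since \<open>p x >= 1\<close>, dividing the function by \<open>c >= 1\<close>
    divides the modular by at least \<open>c\<close>; a value above the modular therefore brings it
    below 1.\<close>
  define c where "c = max 1 (mo u)"
  have c: "c >= 1" "mo u <= c" by (auto simp: c_def)
  have L: "Lp (%x. u x / c)" using Lp_mult_const[OF u, of "1 / c"] by simp
  have "mo (%x. u x / c) <= (LINT x|M. \<bar>u x\<bar> powr p x / c)"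
  proof (rule Lp_dominated(2))
    show "AE x in M. norm (u x / c) powr p x <= \<bar>u x\<bar> powr p x / c"
    proof (rule AE_I2, goal_cases)
      case x: (1 x)
      have "c powr 1 <= c powr p x" using c p_ge1[OF x] by (intro powr_mono) auto
      then have "\<bar>u x\<bar> powr p x / c powr p x <= \<bar>u x\<bar> powr p x / c" using c by (intro divide_left_mono) auto
      then show ?case using c by (simp add: powr_divide abs_divide)
    qed
  qed (use Lp_integrable_powr[OF u] Lp_measurable[OF L] in auto)
  also have "... = mo u / c" by (simp add: mo_def)
  also have "... <= 1" using c by simp
  finally have "modular \<Omega> p (%x. u x / c) <= 1" using modular_eq_mo[OF L] by simp
  with c(1) show "u \<in> Lvar \<Omega> p" using Lp_measurable[OF u] by (auto simp: Lvar_def intro!: exI[of _ c])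
qed

lemma lux_nonneg: "Lp u ==> 0 <= lux \<Omega> p u"
  unfolding lux_def using Lvar_iff_Lp[of u] by (intro cInf_greatest) (auto simp: Lvar_def)

lemma lux_le:
  assumes u: "Lp u" and c: "0 < c" "c <= 1" "mo u <= c powr P"
  shows "lux \<Omega> p u <= c"
proof -
  have L: "Lp (%x. u x / c)" using Lp_mult_const[OF u, of "1 / c"] by simp
  have "mo (%x. u x / c) <= (LINT x|M. \<bar>u x\<bar> powr p x / c powr P)"
  proof (rule Lp_dominated(2))
    show "AE x in M. norm (u x / c) powr p x <= \<bar>u x\<bar> powr p x / c powr P"
    proof (rule AE_I2, goal_cases)
      case x: (1 x)
      have "c powr P <= c powr p x" using c p_le[OF x] by (intro powr_mono') auto
      then have "\<bar>u x\<bar> powr p x / c powr p x <= \<bar>u x\<bar> powr p x / c powr P" using c by (intro divide_left_mono) auto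
      then show ?case using c by (simp add: powr_divide abs_divide)
    qed
  qed (use Lp_integrable_powr[OF u] Lp_measurable[OF L] in auto)
  also have "... = mo u / c powr P" by (simp add: mo_def)
  also have "... <= 1" using c by simp
  finally have "modular \<Omega> p (%x. u x / c) <= 1" using modular_eq_mo[OF L] by simp
  then show ?thesis unfolding lux_def using c(1) by (intro cInf_lower bdd_belowI[of _ 0]) auto
qed

lemma mo_le_of_lux_less:
  assumes u: "Lp u" and c: "lux \<Omega> p u < c" "c <= 1"
  shows "mo u <= c"
proof -
  have "{c. c > 0 & modular \<Omega> p (%x. u x / c) <= 1} ~= {}"
    using Lvar_iff_Lp[of u] u by (auto simp: Lvar_def)
  then obtain b where b: "b < c" "0 < b" "modular \<Omega> p (%x. u x / b) <= 1"
    using cInf_lessD[OF _ c(1)[unfolded lux_def]] by blast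
  have L: "Lp (%x. u x / b)" "mo (%x. u x / b) <= 1"
    using Lp_of_modular[of "%x. u x / b" 1] b Lp_measurable[OF u] by auto
  have "mo u <= (LINT x|M. b * \<bar>u x / b\<bar> powr p x)"
  proof (rule Lp_dominated(2))
    show "AE x in M. norm (u x) powr p x <= b * \<bar>u x / b\<bar> powr p x"
    proof (rule AE_I2)
      fix x assume x: "x \<in> space M"
      have "b powr p x <= b powr 1" using b c p_ge1[OF x] by (intro powr_mono') auto
      then have "b powr p x * \<bar>u x / b\<bar> powr p x <= b * \<bar>u x / b\<bar> powr p x" using b by (intro mult_right_mono) auto
      moreover have "b powr p x * \<bar>u x / b\<bar> powr p x = \<bar>u x\<bar> powr p x" using b by (simp add: abs_divide powr_divide)
      ultimately show "norm (u x) powr p x <= b * \<bar>u x / b\<bar> powr p x" by simp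
    qed
  qed (use Lp_integrable_powr[OF L(1)] Lp_measurable[OF u] in auto)
  also have "... = b * mo (%x. u x / b)" by (simp add: mo_def)
  also have "... <= b * 1" using L(2) b by (intro mult_left_mono) auto
  finally show ?thesis using b by simp
qed

text \<open>For \<open>c <= 1\<close> the factor \<open>c powr p x\<close> lies between
  \<open>c powr P\<close> and \<open>c\<close>, so smallness of either quantity implies smallness of
  the other.\<close>

lemma lux_tendsto_0_iff:
  assumes F: "!!k. Lp (F k)"
  shows "(%k. lux \<Omega> p (F k)) ----> 0 \<longleftrightarrow> (%k. mo (F k)) ----> 0"
proof
  assume l: "(%k. lux \<Omega> p (F k)) ----> 0"
  show "(%k. mo (F k)) ----> 0"
  proof (rule LIMSEQ_I)
    fix e :: real assume "0 < e"
    then have "\<forall>\<^sub>F k in sequentially. lux \<Omega> p (F k) < min 1 (e / 2)" using l by (intro order_tendstoD) auto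
    then obtain N where N: "!!k. k >= N ==> lux \<Omega> p (F k) < min 1 (e / 2)" unfolding eventually_sequentially by blast
    have "mo (F k) <= min 1 (e / 2)" if "k >= N" for k by (rule mo_le_of_lux_less[OF F N[OF that]]) simp
    then have "norm (mo (F k) - 0) < e" if "k >= N" for k using that \<open>0 < e\<close> by (fastforce simp: mo_nonneg)
    then show "\<exists>N. \<forall>k\<ge>N. norm (mo (F k) - 0) < e" by blast
  qed
next
  assume l: "(%k. mo (F k)) ----> 0"
  show "(%k. lux \<Omega> p (F k)) ----> 0"
  proof (rule LIMSEQ_I)
    fix e :: real assume "0 < e"
    define c where "c = min 1 (e / 2)"
    have c: "0 < c" "c <= 1" "c < e" using \<open>0 < e\<close> by (auto simp: c_def)
    have "\<forall>\<^sub>F k in sequentially. mo (F k) < c powr P" using l c by (intro order_tendstoD) auto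
    then obtain N where "!!k. k >= N ==> mo (F k) < c powr P" by (auto simp: eventually_sequentially)
    then have "lux \<Omega> p (F k) <= c" if "k >= N" for k using that lux_le[OF F c(1,2)] by (simp add: less_imp_le)
    then have "norm (lux \<Omega> p (F k) - 0) < e" if "k >= N" for k using that c lux_nonneg[OF F] by fastforce
    then show "\<exists>N. \<forall>k\<ge>N. norm (lux \<Omega> p (F k) - 0) < e" by blast
  qed
qed

lemma lux_AE_cong:
  assumes "AE x in M. \<bar>u x\<bar> = \<bar>v x\<bar>" shows "lux \<Omega> q u = lux \<Omega> q v"
proof -
  have "modular \<Omega> q (%x. u x / c) = modular \<Omega> q (%x. v x / c)" for c
    unfolding modular_def using assms
    by (intro nn_integral_cong_AE) (auto elim!: eventually_mono simp: abs_divide)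
  then show ?thesis by (simp add: lux_def)
qed

text \<open>The gradient is an explicit second component, which avoids the arbitrary representative
  picked by \<open>wgrad\<close>, and the approximation is in the modular.\<close>

definition S0 :: "(real^'n => real) => (real^'n => real^'n) => bool" where
  "S0 u G \<longleftrightarrow> Lp u & Lp G & weak_grad \<Omega> u G & (\<exists>\<phi>. (\<forall>k. test_fun \<Omega> (\<phi> k)) \<and>
     (%k. mo (%x. \<phi> k x - u x)) ----> 0 & (%k. mo (%x. cgrad (\<phi> k) x - G x)) ----> 0)"

lemma S0D: "S0 u G ==> Lp u" "S0 u G ==> Lp G" "S0 u G ==> weak_grad \<Omega> u G"
  by (auto simp: S0_def)

lemma S0I:
  assumes "Lp u" "Lp G" "weak_grad \<Omega> u G" "!!k. test_fun \<Omega> (\<phi> k)"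
    "(%k. mo (%x. \<phi> k x - u x)) ----> 0" "(%k. mo (%x. cgrad (\<phi> k) x - G x)) ----> 0"
  shows "S0 u G"
  unfolding S0_def using assms by (intro conjI exI[of _ \<phi>] allI)

lemma S0E:
  assumes "S0 u G"
  obtains \<phi> where "\<forall>k. test_fun \<Omega> (\<phi> k)"
    "(%k. mo (%x. \<phi> k x - u x)) ----> 0" "(%k. mo (%x. cgrad (\<phi> k) x - G x)) ----> 0"
  using assms unfolding S0_def by (elim conjE exE) (rule that)

lemma cgrad_measurable: "test_fun \<Omega> \<phi> ==> cgrad \<phi> \<in> borel_measurable M"
  using test_fun_measurable_on[OF test_fun_pd] by (intro borel_measurable_vecI) auto

lemma Lp_test_fun:
  assumes "test_fun \<Omega> \<phi>" shows "Lp \<phi>" "Lp (cgrad \<phi>)"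
proof -
  obtain B where "!!x. \<bar>\<phi> x\<bar> <= B" using test_fun_bounded[OF assms] by metis
  then show "Lp \<phi>" using test_fun_measurable_on[OF assms] by (intro Lp_bounded[of _ B]) auto
  have "\<forall>j. \<exists>B. \<forall>x. \<bar>pd \<phi> j x\<bar> <= B" using test_fun_bounded[OF test_fun_pd[OF assms]] by metis
  then obtain B' where B': "!!j x. \<bar>pd \<phi> j x\<bar> <= B' j" by metis
  have "norm (cgrad \<phi> x) <= (\<Sum>j\<in>UNIV. B' j)" for x
    using norm_le_l1_cart[of "cgrad \<phi> x"] B' by (intro order.trans[OF norm_le_l1_cart] sum_mono) auto
  then show "Lp (cgrad \<phi>)" using cgrad_measurable[OF assms] by (intro Lp_bounded) auto
qed

lemma weak_grad_diff:
  assumes "weak_grad \<Omega> u G" "weak_grad \<Omega> v H"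
  shows "weak_grad \<Omega> (%x. u x - v x) (%x. G x - H x)"
  using weak_grad_mult_add[OF assms open_\<Omega>, of 1 "-1"] by simp

lemma W1_iff: "u \<in> W1 \<Omega> p \<longleftrightarrow> Lp u & (\<exists>G. weak_grad \<Omega> u G & Lp G)"
proof -
  have "(%x. norm (G x)) \<in> Lvar \<Omega> p \<longleftrightarrow> Lp G" if "weak_grad \<Omega> u G" for G
    using weak_grad_measurable(2)[OF that open_\<Omega>] by (auto simp: Lvar_iff_Lp Lp_def)
  then show ?thesis by (auto simp: W1_def Lvar_iff_Lp)
qed

lemma wgrad_AE:
  assumes "weak_grad \<Omega> u G" shows "AE x in M. wgrad \<Omega> u x = G x"
proof -
  have "weak_grad \<Omega> u (wgrad \<Omega> u)" unfolding wgrad_def using someI[of "weak_grad \<Omega> u" G] assms by blast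
  from weak_grad_unique[OF this assms open_\<Omega>] show ?thesis by simp
qed

text \<open>The gradient chosen by \<open>wgrad\<close> for \<open>\<phi> k - u\<close> agrees
  almost everywhere with the difference of the gradients (\<open>wgrad_AE\<close>), and
  \<open>lux_tendsto_0_iff\<close> trades norms for modulars.\<close>

lemma W10_iff: "u \<in> W10 \<Omega> p \<longleftrightarrow> (\<exists>G. S0 u G)"
proof -
  have eq: "(%k. W1_norm \<Omega> p (%x. \<phi> k x - u x)) ----> 0 \<longleftrightarrow>
     (%k. mo (%x. \<phi> k x - u x)) ----> 0 & (%k. mo (%x. cgrad (\<phi> k) x - G x)) ----> 0"
    if \<phi>: "!!k. test_fun \<Omega> (\<phi> k)" and u: "Lp u" and G: "weak_grad \<Omega> u G" "Lp G" for \<phi> G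
  proof -
    have L1: "Lp (%x. \<phi> k x - u x)" for k by (rule Lp_diff(1)[OF Lp_test_fun(1)[OF \<phi>] u])
    have L2: "Lp (%x. cgrad (\<phi> k) x - G x)" for k by (rule Lp_diff(1)[OF Lp_test_fun(2)[OF \<phi>] G(2)])
    have L2': "Lp (%x. norm (cgrad (\<phi> k) x - G x))" for k
      using measurable_compose[OF Lp_measurable[OF L2] borel_measurable_norm] Lp_integrable_powr[OF L2] by (simp add: Lp_def)
    have wd: "weak_grad \<Omega> (%x. \<phi> k x - u x) (%x. cgrad (\<phi> k) x - G x)" for k
      by (rule weak_grad_diff[OF weak_grad_test_fun[OF \<phi> open_\<Omega>] G(1)])
    have "lux \<Omega> p (%x. norm (wgrad \<Omega> (%x. \<phi> k x - u x) x)) = lux \<Omega> p (%x. norm (cgrad (\<phi> k) x - G x))" for k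
      using wgrad_AE[OF wd[of k]] by (intro lux_AE_cong) (auto elim!: eventually_mono)
    then have W: "W1_norm \<Omega> p (%x. \<phi> k x - u x) = lux \<Omega> p (%x. \<phi> k x - u x) + lux \<Omega> p (%x. norm (cgrad (\<phi> k) x - G x))" for k
      by (simp add: W1_norm_def)
    have "(%k. mo (%x. cgrad (\<phi> k) x - G x)) ----> 0 \<longleftrightarrow> (%k. mo (%x. norm (cgrad (\<phi> k) x - G x))) ----> 0"
      by (simp add: mo_def)
    then have iff: "(%k. mo (%x. cgrad (\<phi> k) x - G x)) ----> 0 \<longleftrightarrow> (%k. lux \<Omega> p (%x. norm (cgrad (\<phi> k) x - G x))) ----> 0"
      using lux_tendsto_0_iff[OF L2'] by simp
    show ?thesis
      unfolding iff lux_tendsto_0_iff[OF L1, symmetric] W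
    proof safe
      assume s: "(%k. lux \<Omega> p (%x. \<phi> k x - u x) + lux \<Omega> p (%x. norm (cgrad (\<phi> k) x - G x))) ----> 0"
      show "(%k. lux \<Omega> p (%x. \<phi> k x - u x)) ----> 0"
        by (rule Lim_null_comparison[OF _ s]) (use lux_nonneg[OF L1] lux_nonneg[OF L2'] in auto)
      show "(%k. lux \<Omega> p (%x. norm (cgrad (\<phi> k) x - G x))) ----> 0"
        by (rule Lim_null_comparison[OF _ s]) (use lux_nonneg[OF L1] lux_nonneg[OF L2'] in auto)
    next
      assume "(%k. lux \<Omega> p (%x. \<phi> k x - u x)) ----> 0" "(%k. lux \<Omega> p (%x. norm (cgrad (\<phi> k) x - G x))) ----> 0"
      from tendsto_add[OF this]
      show "(%k. lux \<Omega> p (%x. \<phi> k x - u x) + lux \<Omega> p (%x. norm (cgrad (\<phi> k) x - G x))) ----> 0" by simp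
    qed
  qed
  show ?thesis
  proof
    assume u: "u \<in> W10 \<Omega> p"
    then obtain \<phi> where \<phi>: "!!k. test_fun \<Omega> (\<phi> k)" "(%k. W1_norm \<Omega> p (%x. \<phi> k x - u x)) ----> 0"
      unfolding W10_def by auto
    from u have "u \<in> W1 \<Omega> p" by (simp add: W10_def)
    then obtain G where G: "Lp u" "weak_grad \<Omega> u G" "Lp G" unfolding W1_iff by auto
    have "S0 u G" using eq[OF \<phi>(1) G] \<phi>(2) by (intro S0I[OF G(1,3,2) \<phi>(1)]) auto
    then show "\<exists>G. S0 u G" by blast
  next
    assume "\<exists>G. S0 u G"
    then obtain G where S: "S0 u G" ..
    then obtain \<phi> where \<phi>': "\<forall>k. test_fun \<Omega> (\<phi> k)"
      "(%k. mo (%x. \<phi> k x - u x)) ----> 0" "(%k. mo (%x. cgrad (\<phi> k) x - G x)) ----> 0"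
      by (rule S0E)
      note \<phi> = \<phi>'(1)[rule_format] \<phi>'(2,3)
    have "u \<in> W1 \<Omega> p" unfolding W1_iff using S0D[OF S] by auto
    moreover have "(%k. W1_norm \<Omega> p (%x. \<phi> k x - u x)) ----> 0"
      using eq[OF \<phi>(1) S0D(1)[OF S] S0D(3)[OF S] S0D(2)[OF S]] \<phi>(2,3) by simp
    ultimately show "u \<in> W10 \<Omega> p" unfolding W10_def using \<phi>(1) by auto
  qed
qed

lemma S0_AE_cong:
  assumes S: "S0 u G" and uv: "AE x in M. u x = v x" "AE x in M. G x = H x"
  shows "S0 v H"
proof -
  have v: "Lp v" using Lp_AE_cong(1)[OF S0D(1)[OF S] borel_measurable_lebesgue_on_AE[OF Lp_measurable[OF S0D(1)[OF S]] uv(1) \<Omega>_sets] uv(1)] .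
  have H: "Lp H" using Lp_AE_cong(1)[OF S0D(2)[OF S] borel_measurable_lebesgue_on_AE[OF Lp_measurable[OF S0D(2)[OF S]] uv(2) \<Omega>_sets] uv(2)] .
  obtain \<phi> where \<phi>': "\<forall>k. test_fun \<Omega> (\<phi> k)"
      "(%k. mo (%x. \<phi> k x - u x)) ----> 0" "(%k. mo (%x. cgrad (\<phi> k) x - G x)) ----> 0"
    by (rule S0E[OF S])
    note \<phi> = \<phi>'(1)[rule_format] \<phi>'(2,3)
  have "mo (%x. \<phi> k x - v x) = mo (%x. \<phi> k x - u x)" for k
    using uv(1) by (intro Lp_AE_cong(2) Lp_diff Lp_measurable Lp_test_fun \<phi> v S0D[OF S]) (auto elim!: eventually_mono)
  moreover have "mo (%x. cgrad (\<phi> k) x - H x) = mo (%x. cgrad (\<phi> k) x - G x)" for k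
    using uv(2) by (intro Lp_AE_cong(2) Lp_diff Lp_measurable Lp_test_fun \<phi> H S0D[OF S]) (auto elim!: eventually_mono)
  ultimately show ?thesis
    using weak_grad_AE_cong[OF S0D(3)[OF S] open_\<Omega> uv] \<phi> by (intro S0I[OF v H _ \<phi>(1)]) auto
qed

lemma S0_test_fun: "test_fun \<Omega> \<phi> ==> S0 \<phi> (cgrad \<phi>)"
  using Lp_test_fun weak_grad_test_fun[OF _ open_\<Omega>]
  by (intro S0I[of _ _ "%_. \<phi>"]) (auto simp: mo_def)

lemma S0_mult_add:
  assumes u: "S0 u G" and v: "S0 v H"
  shows "S0 (%x. a * u x + b * v x) (%x. a *\<^sub>R G x + b *\<^sub>R H x)"
proof -
  obtain \<phi> where \<phi>': "\<forall>k. test_fun \<Omega> (\<phi> k)"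
      "(%k. mo (%x. \<phi> k x - u x)) ----> 0" "(%k. mo (%x. cgrad (\<phi> k) x - G x)) ----> 0"
    by (rule S0E[OF u])
    note \<phi> = \<phi>'(1)[rule_format] \<phi>'(2,3)
  obtain \<psi> where \<psi>': "\<forall>k. test_fun \<Omega> (\<psi> k)"
      "(%k. mo (%x. \<psi> k x - v x)) ----> 0" "(%k. mo (%x. cgrad (\<psi> k) x - H x)) ----> 0"
    by (rule S0E[OF v])
    note \<psi> = \<psi>'(1)[rule_format] \<psi>'(2,3)
  have lin: "(%k. mo (%x. (a *\<^sub>R E k x + b *\<^sub>R F k x) - (a *\<^sub>R e x + b *\<^sub>R f x))) ----> 0"
    if "!!k. Lp (E k)" "!!k. Lp (F k)" "Lp e" "Lp f"
      "(%k. mo (%x. E k x - e x)) ----> 0" "(%k. mo (%x. F k x - f x)) ----> 0"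
    for E F :: "nat => real^'n => 'c::euclidean_space" and e f
  proof (rule Lim_null_comparison)
    let ?A = "max 1 \<bar>a\<bar> powr P" and ?B = "max 1 \<bar>b\<bar> powr P"
    show "(%k. 2 powr P * (?A * mo (%x. E k x - e x) + ?B * mo (%x. F k x - f x))) ----> 0"
      using that(5,6) by (auto intro!: tendsto_eq_intros)
    have "mo (%x. (a *\<^sub>R E k x + b *\<^sub>R F k x) - (a *\<^sub>R e x + b *\<^sub>R f x))
       <= 2 powr P * (?A * mo (%x. E k x - e x) + ?B * mo (%x. F k x - f x))" for k
    proof -
      note L1 = Lp_diff(1)[OF that(1)[of k] that(3)] and L2 = Lp_diff(1)[OF that(2)[of k] that(4)]
      have "mo (%x. (a *\<^sub>R E k x + b *\<^sub>R F k x) - (a *\<^sub>R e x + b *\<^sub>R f x))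
        = mo (%x. a *\<^sub>R (E k x - e x) + b *\<^sub>R (F k x - f x))" by (simp add: algebra_simps)
      also have "... <= 2 powr P * (mo (%x. a *\<^sub>R (E k x - e x)) + mo (%x. b *\<^sub>R (F k x - f x)))"
        by (rule Lp_add(2)[OF Lp_scaleR(1)[OF L1] Lp_scaleR(1)[OF L2]])
      also have "... <= 2 powr P * (?A * mo (%x. E k x - e x) + ?B * mo (%x. F k x - f x))"
        by (intro mult_left_mono add_mono Lp_scaleR(2) L1 L2) simp
      finally show ?thesis .
    qed
    then show "\<forall>\<^sub>F k in sequentially. norm (mo (%x. (a *\<^sub>R E k x + b *\<^sub>R F k x) - (a *\<^sub>R e x + b *\<^sub>R f x)))
       <= 2 powr P * (?A * mo (%x. E k x - e x) + ?B * mo (%x. F k x - f x))" by (simp add: mo_nonneg)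
  qed
  have cg: "cgrad (%x. a * \<phi> k x + b * \<psi> k x) x = a *\<^sub>R cgrad (\<phi> k) x + b *\<^sub>R cgrad (\<psi> k) x" for k x
    by (simp add: vec_eq_iff test_fun_mult_add(2)[OF \<phi>(1) \<psi>(1)])
  have "Lp (%x. a * u x + b * v x)"
    using Lp_add(1)[OF Lp_scaleR(1)[OF S0D(1)[OF u], of a] Lp_scaleR(1)[OF S0D(1)[OF v], of b]] by simp
  moreover have "Lp (%x. a *\<^sub>R G x + b *\<^sub>R H x)"
    by (intro Lp_add Lp_scaleR S0D(2)[OF u] S0D(2)[OF v])
  moreover note weak_grad_mult_add[OF S0D(3)[OF u] S0D(3)[OF v] open_\<Omega>, of a b]
  moreover have "(%k. mo (%x. (a * \<phi> k x + b * \<psi> k x) - (a * u x + b * v x))) ----> 0"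
    using lin[OF Lp_test_fun(1)[OF \<phi>(1)] Lp_test_fun(1)[OF \<psi>(1)] S0D(1)[OF u] S0D(1)[OF v] \<phi>(2) \<psi>(2)] by simp
  moreover have "(%k. mo (%x. cgrad (%x. a * \<phi> k x + b * \<psi> k x) x - (a *\<^sub>R G x + b *\<^sub>R H x))) ----> 0"
    unfolding cg
    by (rule lin[OF Lp_test_fun(2)[OF \<phi>(1)] Lp_test_fun(2)[OF \<psi>(1)] S0D(2)[OF u] S0D(2)[OF v] \<phi>(3) \<psi>(3)])
  ultimately show ?thesis
    using test_fun_mult_add(1)[OF \<phi>(1) \<psi>(1)]
    by (intro S0I[of _ _ "%k x. a * \<phi> k x + b * \<psi> k x"])
qed

text \<open>A diagonal choice replaces each \<open>u k\<close> by a test function within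
  \<open>1 / Suc k\<close> in both modulars. That \<open>H\<close> is the weak gradient of
  \<open>v\<close> follows from convergence in L1.\<close>

lemma S0_limit:
  assumes S: "!!k. S0 (u k) (G k)" and v: "Lp v" "Lp H"
    and lim: "(%k. mo (%x. u k x - v x)) ----> 0" "(%k. mo (%x. G k x - H x)) ----> 0"
  shows "S0 v H"
proof -
  note Lu = S0D(1)[OF S] and LG = S0D(2)[OF S]
  have wg: "weak_grad \<Omega> v H"
  proof (rule weak_grad_L1_limit[OF S0D(3)[OF S] open_\<Omega>])
    show "(%k. \<integral>x. \<bar>u k x - v x\<bar> \<partial>M) ----> 0"
      using mo_tendsto_0_L1[OF Lp_diff(1)[OF Lu v(1)] lim(1)] by simp
    show "(%k. \<integral>x. norm (G k x - H x) \<partial>M) ----> 0"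
      by (rule mo_tendsto_0_L1[OF Lp_diff(1)[OF LG v(2)] lim(2)])
  qed (use Lp_integrable(1) Lu LG v in auto)
  have "\<exists>\<phi>. test_fun \<Omega> \<phi> & mo (%x. \<phi> x - u k x) < inverse (real (Suc k)) & mo (%x. cgrad \<phi> x - G k x) < inverse (real (Suc k))" for k
  proof -
    obtain \<phi> where \<phi>': "\<forall>i. test_fun \<Omega> (\<phi> i)"
      "(%i. mo (%x. \<phi> i x - u k x)) ----> 0" "(%i. mo (%x. cgrad (\<phi> i) x - G k x)) ----> 0"
      by (rule S0E[OF S[of k]])
    note \<phi> = \<phi>'(1)[rule_format] \<phi>'(2,3)
    have "0 < inverse (real (Suc k))" by simp
    then have "\<forall>\<^sub>F i in sequentially. mo (%x. \<phi> i x - u k x) < inverse (real (Suc k)) & mo (%x. cgrad (\<phi> i) x - G k x) < inverse (real (Suc k))"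
      using \<phi>(2,3) by (intro eventually_conj order_tendstoD(2)) auto
    from eventually_happens'[OF sequentially_bot this] \<phi>(1) show ?thesis by auto
  qed
  from choice[OF allI, OF this] obtain \<phi> where "\<forall>k. test_fun \<Omega> (\<phi> k) \<and>
    mo (%x. \<phi> k x - u k x) < inverse (real (Suc k)) & mo (%x. cgrad (\<phi> k) x - G k x) < inverse (real (Suc k))" ..
  then have \<phi>: "!!k. test_fun \<Omega> (\<phi> k)" "!!k. mo (%x. \<phi> k x - u k x) < inverse (real (Suc k))"
    "!!k. mo (%x. cgrad (\<phi> k) x - G k x) < inverse (real (Suc k))" by auto
  have tri: "(%k. mo (%x. E k x - e x)) ----> 0"
    if "!!k. Lp (E k)" "!!k. Lp (F k)" "Lp e" "!!k. mo (%x. E k x - F k x) < inverse (real (Suc k))"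
      "(%k. mo (%x. F k x - e x)) ----> 0" for E F :: "nat => real^'n => 'c::euclidean_space" and e
  proof (rule Lim_null_comparison)
    have "(%k. 2 powr P * (inverse (real (Suc k)) + mo (%x. F k x - e x))) ----> 2 powr P * (0 + 0)"
      by (intro tendsto_mult tendsto_const tendsto_add LIMSEQ_inverse_real_of_nat that(5))
    then show "(%k. 2 powr P * (inverse (real (Suc k)) + mo (%x. F k x - e x))) ----> 0" by simp
    have "mo (%x. E k x - e x) <= 2 powr P * (inverse (real (Suc k)) + mo (%x. F k x - e x))" for k
      using less_imp_le[OF that(4)[of k]]
      by (intro order.trans[OF mo_triangle[OF that(1,2,3)]] mult_left_mono add_mono) auto
    then show "\<forall>\<^sub>F k in sequentially. norm (mo (%x. E k x - e x)) <= 2 powr P * (inverse (real (Suc k)) + mo (%x. F k x - e x))"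
      by (simp add: mo_nonneg)
  qed
  show ?thesis
    by (rule S0I[OF v wg \<phi>(1) tri[OF Lp_test_fun(1)[OF \<phi>(1)] Lu v(1) \<phi>(2) lim(1)]
          tri[OF Lp_test_fun(2)[OF \<phi>(1)] LG v(2) \<phi>(3) lim(2)]])
qed

end

section \<open>Density of test functions\<close>

lemma moll_abs_le: "e > 0 ==> \<bar>moll e (z :: real^'n)\<bar> <= moll_const TYPE('n) / e ^ CARD('n)"
  using moll_props(3,4)[of e z] by simp

text \<open>Splitting at half of the mean replaces Jensen's inequality, which fails for a variable exponent.\<close>
lemma mean_powr_le:
  fixes F \<rho> q :: "'a => real"
  assumes int: "integrable M (%y. \<bar>F y\<bar> * \<rho> y)" "integrable M \<rho>" "integrable M (%y. \<bar>F y\<bar> powr q y * \<rho> y)"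
    and \<rho>: "!!y. 0 <= \<rho> y" "(LINT y|M. \<rho> y) = 1"
    and q: "!!y. \<rho> y ~= 0 ==> 1 <= q y & q y <= P" and "1 <= q0"
    and t: "t = (LINT y|M. \<bar>F y\<bar> * \<rho> y)" "1 <= t" "0 <= B"
    and B: "!!y. \<rho> y ~= 0 ==> t powr (q0 - q y) <= B"
  shows "t powr q0 <= 2 * 2 powr P * B * (LINT y|M. \<bar>F y\<bar> powr q y * \<rho> y)"
proof -
  have pw: "\<bar>F y\<bar> * \<rho> y <= t / 2 * \<rho> y + 2 powr P * B * t powr (1 - q0) * (\<bar>F y\<bar> powr q y * \<rho> y)" for y
  proof (cases "\<rho> y = 0 \<or> \<bar>F y\<bar> <= t / 2")
    case True
    then have "\<bar>F y\<bar> * \<rho> y <= t / 2 * \<rho> y" using \<rho>(1)[of y] mult_right_mono[of "\<bar>F y\<bar>" "t / 2" "\<rho> y"] by auto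
    then show ?thesis using \<rho>(1)[of y] t(3) by (simp add: add_increasing2)
  next
    case False
    then have F: "t / 2 < \<bar>F y\<bar>" and r: "\<rho> y ~= 0" by auto
    have "\<bar>F y\<bar> = \<bar>F y\<bar> powr (1 - q y) * \<bar>F y\<bar> powr q y" using F t by (simp flip: powr_add)
    also have "\<bar>F y\<bar> powr (1 - q y) <= (t / 2) powr (1 - q y)" using F t q[OF r] by (intro powr_mono2') auto
    \<comment> \<open>The exponent of \<open>t\<close> is split at \<open>q0\<close>, so that only
      the oscillation \<open>q0 - q y\<close> needs the bound \<open>B\<close>.\<close>
    also have "(t / 2) powr (1 - q y) = 2 powr (q y - 1) * (t powr (1 - q0) * t powr (q0 - q y))"
      using t by (simp add: powr_divide powr_diff flip: powr_add)
    also have "... <= 2 powr P * (t powr (1 - q0) * B)"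
      using q[OF r] B[OF r] t by (intro mult_mono powr_mono) auto
    finally have "\<bar>F y\<bar> <= 2 powr P * (t powr (1 - q0) * B) * \<bar>F y\<bar> powr q y" by (simp add: mult_right_mono)
    then have "\<bar>F y\<bar> * \<rho> y <= 2 powr P * (t powr (1 - q0) * B) * \<bar>F y\<bar> powr q y * \<rho> y" using \<rho>(1) by (intro mult_right_mono)
    also have "... <= t / 2 * \<rho> y + 2 powr P * B * t powr (1 - q0) * (\<bar>F y\<bar> powr q y * \<rho> y)"
      using \<rho>(1)[of y] t by (simp add: mult_ac)
    finally show ?thesis .
  qed
  let ?I = "LINT y|M. \<bar>F y\<bar> powr q y * \<rho> y"
  have "t = (LINT y|M. \<bar>F y\<bar> * \<rho> y)" by (rule t(1))
  also have "... <= (LINT y|M. t / 2 * \<rho> y + 2 powr P * B * t powr (1 - q0) * (\<bar>F y\<bar> powr q y * \<rho> y))"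
    by (rule integral_mono) (use int pw in auto)
  also have "... = t / 2 + 2 powr P * B * t powr (1 - q0) * ?I" using int \<rho>(2) by simp
  \<comment> \<open>The term \<open>t / 2\<close> is absorbed into the left-hand side, whence the
    additional factor 2.\<close>
  finally have "t <= 2 * 2 powr P * B * t powr (1 - q0) * ?I" by simp
  then have "t powr (q0 - 1) * t <= t powr (q0 - 1) * (2 * 2 powr P * B * t powr (1 - q0) * ?I)"
    by (intro mult_left_mono) auto
  moreover have "t powr (q0 - 1) * t = t powr q0" using t by (simp add: powr_diff)
  moreover have "t powr (q0 - 1) * t powr (1 - q0) = 1" using t by (simp flip: powr_add)
  then have "t powr (q0 - 1) * (2 * 2 powr P * B * t powr (1 - q0) * ?I) = 2 * 2 powr P * B * ?I"
    by (simp add: mult_ac)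
  ultimately show ?thesis by simp
qed

text \<open>The product \<open>e * ln (1 / e)\<close> is bounded: an oscillation of order
  \<open>e\<close> in the exponent compensates growth of order \<open>1 / e ^ N\<close> in the
  base.\<close>

lemma log_holder_bound:
  fixes A L e t s :: real
  assumes "1 <= t" "t <= A / e ^ N" "1 <= A" "0 < e" "e <= 1" "0 <= L" "s <= L * e"
  shows "t powr s <= exp (L * (ln A + real N))"
proof -
  have "t powr s <= t powr (L * e)" using assms by (intro powr_mono) auto
  also have "... <= (A / e ^ N) powr (L * e)" using assms by (intro powr_mono2) auto
  also have "... = exp (L * (e * ln A + real N * (e * ln (1 / e))))"
    using assms by (simp add: powr_def ln_div ln_realpow algebra_simps)
  also have "... <= exp (L * (ln A + real N))"
  proof -
    have "e * ln A <= 1 * ln A" using assms by (intro mult_right_mono) auto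
    moreover have "e * ln (1 / e) <= e * (1 / e)" using assms ln_bound[of "1 / e"] by (intro mult_left_mono) auto
    then have "real N * (e * ln (1 / e)) <= real N * 1" using assms by (intro mult_left_mono) auto
    ultimately show ?thesis using assms by (simp add: mult_left_mono)
  qed
  finally show ?thesis .
qed

context sobolev
begin

text \<open>The mollifications come without a fixed majorant. Instead \<open>key\<close> bounds
  their powers by a mollification of \<Phi>, the integrand of the modular of \<open>F\<close>, and
  this converges in L1. The integrand is therefore split into a part below a fixed integrable
  function and a part that tends to zero in L1.\<close>

lemma conv_moll_tendsto_mo:
  fixes F :: "real^'n => real"
  assumes F: "Lp F" and K: "compact K" "K \<subseteq> \<Omega>" and F0: "!!x. x \<notin> K ==> F x = 0"
    and e: "e ----> 0" "!!k. e k > 0"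
  shows "!!k. Lp (conv F (moll (e k)))" "(%k. mo (%x. conv F (moll (e k)) x - F x)) ----> 0"
proof -
  let ?N = "CARD('n)" and ?c = "%k. conv F (moll (e k))"
  define \<Phi> where "\<Phi> x = (if x \<in> \<Omega> then \<bar>F x\<bar> powr p x else 0)" for x
  let ?d = "%k x. \<bar>conv \<Phi> (moll (e k)) x - \<Phi> x\<bar>" and ?t = "%k x. \<integral>y. \<bar>F y\<bar> * moll (e k) (x - y) \<partial>lebesgue"
    and ?B = "%k. moll_const TYPE('n) / e k ^ ?N * (LINT y|lebesgue. \<bar>F y\<bar>)"
  have iF: "integrable lebesgue F"
    using Lp_integrable(1)[OF F] lebesgue_on_zero_outside(2)[OF \<Omega>_sets, of F F] F0 K(2) by blast
  have i\<Phi>: "integrable lebesgue \<Phi>"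
    using Lp_integrable_powr[OF F] lebesgue_on_zero_outside(2)[OF \<Omega>_sets, of "%x. norm (F x) powr p x" \<Phi>]
    by (auto simp: \<Phi>_def)
  note tf = moll_props(1)[OF e(2)]
  have Fm: "F \<in> borel_measurable lebesgue" using iF by simp
  have convm: "?c k \<in> borel_measurable M" for k
  proof -
    have "?c k \<in> borel_measurable lborel"
      using borel_measurable_continuous_onI[OF conv_continuous_test[OF iF tf[of k]]] by simp
    then have "?c k \<in> borel_measurable lebesgue" by (rule measurable_completion)
    then show ?thesis by (rule measurable_restrict_space1)
  qed
  have conv_le: "\<bar>?c k x\<bar> <= ?B k"
    and abs_int: "?t k x <= ?B k"
    and conv_abs: "\<bar>?c k x\<bar> <= ?t k x"
    and iabs: "integrable lebesgue (%y. \<bar>F y\<bar> * moll (e k) (x - y))" for k x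
  proof -
    note b = moll_abs_le[OF e(2)[of k]]
    show i: "integrable lebesgue (%y. \<bar>F y\<bar> * moll (e k) (x - y))"
      by (rule integrable_conv[OF _ test_fun_measurable[OF tf] b]) (use iF in auto)
    have "?t k x <= (LINT y|lebesgue. \<bar>F y\<bar> * (moll_const TYPE('n) / e k ^ ?N))"
      using i iF moll_props(4)[OF e(2)[of k]] by (intro integral_mono mult_left_mono) auto
    then show 1: "?t k x <= ?B k"
      by (simp add: mult.commute)
    show 2: "\<bar>?c k x\<bar> <= ?t k x"
      using integral_norm_bound[of lebesgue "%y. F y * moll (e k) (x - y)"]
      by (simp add: conv_def abs_mult abs_of_nonneg[OF moll_props(3)[OF e(2)[of k]]])
    from 1 2 show "\<bar>?c k x\<bar> <= ?B k" by simp
  qed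
  show Lconv: "!!k. Lp (?c k)"
    using convm conv_le by (intro Lp_bounded) auto
  obtain d K' where K': "d > 0" "compact K'" "K' \<subseteq> \<Omega>" "!!x. x \<in> K ==> cball x d \<subseteq> K'"
    using compact_in_open_nbhd[OF K(1) open_\<Omega> K(2)] by metis
  obtain L d' where L: "0 <= L" "0 < d'" "!!x y. x \<in> K' ==> y \<in> K' ==> dist x y <= d' ==> \<bar>p x - p y\<bar> <= L * dist x y"
    using loc_lipschitz[OF K'(2,3)] by metis
  define A where "A = max 1 (moll_const TYPE('n) * (LINT y|lebesgue. \<bar>F y\<bar>))"
  define B where "B = exp (L * (ln A + real ?N))"
  define C where "C = 2 * 2 powr P * B"
  have AB: "1 <= A" "0 <= B" "0 <= C" by (auto simp: A_def B_def C_def)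
  have key: "\<bar>?c k x\<bar> powr p x <= 1 + C * conv \<Phi> (moll (e k)) x"
    if x: "x \<in> \<Omega>" and k: "2 * e k <= d" "e k <= 1" "e k <= d'" for k x
  proof -
    let ?\<rho> = "%y. moll (e k) (x - y)"
    note \<rho> = moll_props(2-5)[OF e(2)[of k]]
    define t where "t = (LINT y|lebesgue. \<bar>F y\<bar> * ?\<rho> y)"
    have \<Phi>0: "0 <= conv \<Phi> (moll (e k)) x"
      unfolding conv_def by (intro Bochner_Integration.integral_nonneg mult_nonneg_nonneg \<rho>(2)) (simp add: \<Phi>_def)
    have le: "\<bar>?c k x\<bar> powr p x <= t powr p x"
      using conv_abs[of k x] p_ge1[of x] x by (intro powr_mono2) (auto simp: t_def)
    show ?thesis
    proof (cases "1 <= t")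
      case False
      have "0 <= t" unfolding t_def by (intro Bochner_Integration.integral_nonneg mult_nonneg_nonneg \<rho>(2)) simp
      with False have "t powr p x <= 1 powr p x" using p_ge1[of x] x by (intro powr_mono2) auto
      then show ?thesis using le AB \<Phi>0 by (simp add: add_increasing2)
    next
      case True
      \<comment> \<open>A nonzero mean forces the ball around \<open>x\<close> to meet
        \<open>K\<close>; then \<open>x\<close> and the points charged by the kernel lie in
        \<open>K'\<close>, where a Lipschitz bound for \<open>p\<close> is available.\<close>
      have "\<exists>y\<in>K. norm (x - y) <= e k"
      proof (rule ccontr)
        assume "\<not> ?thesis"
        then have z: "\<bar>F y\<bar> * ?\<rho> y = 0" for y using F0[of y] \<rho>(1)[of "x - y"] by (cases "y \<in> K") auto
        have "t = 0" unfolding t_def z by simp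
        then show False using True by simp
      qed
      then obtain y0 where y0: "y0 \<in> K" "norm (x - y0) <= e k" by blast
      have near: "y \<in> K' & dist x y <= e k" if "?\<rho> y ~= 0" for y
      proof -
        have 1: "norm (x - y) <= e k" using \<rho>(1)[of "x - y"] that by (meson not_le)
        then have "dist y0 y <= d" using y0(2) k(1) dist_triangle[of y0 y x] by (simp add: dist_norm norm_minus_commute)
        then show ?thesis using K'(4)[OF y0(1)] 1 by (auto simp: dist_norm)
      qed
      have xK': "x \<in> K'" using K'(4)[OF y0(1)] y0(2) k(1) e(2)[of k] by (auto simp: dist_norm norm_minus_commute subset_iff)
      have i\<rho>: "integrable lebesgue ?\<rho>"
      proof -
        have "cball x (e k) \<subseteq> UNIV" by simp
        from integrable_test_fun_on[OF test_fun_reflect(1)[OF tf \<rho>(1) this], of UNIV]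
        show ?thesis by (simp add: lebesgue_on_UNIV_eq)
      qed
      have "t powr p x <= 2 * 2 powr P * B * (LINT y|lebesgue. \<bar>F y\<bar> powr p y * ?\<rho> y)"
      proof (rule mean_powr_le[where M=lebesgue and F=F and \<rho>="?\<rho>"])
        have "(%y. \<bar>F y\<bar> powr p y * ?\<rho> y) = (%y. \<Phi> y * ?\<rho> y)"
          using near K'(3) by (auto simp: \<Phi>_def fun_eq_iff)
        then show "integrable lebesgue (%y. \<bar>F y\<bar> powr p y * ?\<rho> y)"
          using integrable_conv[OF i\<Phi> test_fun_measurable[OF tf] moll_abs_le[OF e(2)], of k x] by simp
        have "(LINT y|lebesgue. ?\<rho> y) = (LINT y|lborel. ?\<rho> y)"
          by (rule integral_completion, rule measurable_compose[OF _ test_fun_measurable[OF tf]]) simp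
        also have "... = (LINT y|lborel. moll (e k) (y :: real^'n))"
          using integral_lborel_affine[OF test_fun_measurable[OF tf[of k]], of "-1" x] by simp
        also have "... = 1" by (rule \<rho>(4))
        finally show "(LINT y|lebesgue. ?\<rho> y) = 1" .
        show "?\<rho> y ~= 0 ==> 1 <= p y & p y <= P" for y
          using near[of y] K'(3) p_ge1[of y] p_le[of y] by auto
        show "1 <= p x" using p_ge1[of x] x by simp
        show "?\<rho> y ~= 0 ==> t powr (p x - p y) <= B" for y
        proof -
          assume "?\<rho> y ~= 0"
          then have "p x - p y <= L * dist x y" "dist x y <= e k"
            using near[of y] L(3)[OF xK', of y] k(3) by auto
          then have "p x - p y <= L * e k" using L(1) by (meson mult_left_mono order_trans)
          moreover have "t <= A / e k ^ ?N"
          proof -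
            have "t <= (moll_const TYPE('n) * (LINT y|lebesgue. \<bar>F y\<bar>)) / e k ^ ?N" using abs_int[of k x] by (simp add: t_def)
            also have "... <= A / e k ^ ?N" using e(2)[of k] by (intro divide_right_mono) (auto simp: A_def)
            finally show ?thesis .
          qed
          ultimately show "t powr (p x - p y) <= B"
            unfolding B_def using True AB(1) e(2)[of k] k(2) L(1) by (intro log_holder_bound) auto
        qed
      qed (use iabs i\<rho> \<rho>(2) t_def True AB in auto)
      also have "(LINT y|lebesgue. \<bar>F y\<bar> powr p y * ?\<rho> y) = conv \<Phi> (moll (e k)) x"
        unfolding conv_def using near K'(3) by (intro Bochner_Integration.integral_cong) (auto simp: \<Phi>_def)
      finally show ?thesis using le by (simp add: C_def)
    qed
  qed
  let ?g = "%x. 2 powr P * (1 + C * \<Phi> x + \<Phi> x)"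
  let ?f = "%k x. \<bar>?c k x - F x\<bar> powr p x"
  have i\<Phi>': "integrable M \<Phi>" and iconv: "integrable M (%x. conv \<Phi> (moll (e k)) x - \<Phi> x)" for k
    using integrable_lebesgue_on_subset[of UNIV _ \<Omega>] i\<Phi> conv_moll(1)[OF i\<Phi> e, of k] \<Omega>_sets
    by (auto simp: lebesgue_on_UNIV_eq)
  have ig: "integrable M ?g" using i\<Phi>' by simp
  \<comment> \<open>Capping at \<open>?g\<close> isolates what dominated convergence can handle; the
    excess over \<open>?g\<close> is paid for by the L1 error of mollifying \<Phi>.\<close>
  have fle: "?f k x <= min (?f k x) (?g x) + 2 powr P * C * ?d k x"
    if x: "x \<in> \<Omega>" and k: "2 * e k <= d" "e k <= 1" "e k <= d'" for k x
  proof -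
    have "?f k x <= (\<bar>?c k x\<bar> + \<bar>F x\<bar>) powr p x" using p_ge1[of x] x by (intro powr_mono2) auto
    also have "... <= 2 powr P * (\<bar>?c k x\<bar> powr p x + \<bar>F x\<bar> powr p x)"
      using p_ge1[of x] p_le[of x] x by (intro powr_add_le) auto
    also have "... <= 2 powr P * ((1 + C * conv \<Phi> (moll (e k)) x) + \<Phi> x)"
      using key[OF that] x by (intro mult_left_mono add_mono) (auto simp: \<Phi>_def)
    also have "... = ?g x + 2 powr P * C * (conv \<Phi> (moll (e k)) x - \<Phi> x)" by (simp add: algebra_simps)
    also have "... <= ?g x + 2 powr P * C * ?d k x" using AB by (intro add_left_mono mult_left_mono) auto
    finally show ?thesis using AB by (simp add: min_def)
  qed
  have sm: "\<forall>\<^sub>F k in sequentially. 2 * e k <= d & e k <= 1 & e k <= d'"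
  proof -
    have "\<forall>\<^sub>F k in sequentially. e k < min (d / 2) (min 1 d')" using e(1) K'(1) L(2) by (intro order_tendstoD) auto
    then show ?thesis by eventually_elim auto
  qed
  show "(%k. mo (%x. ?c k x - F x)) ----> 0"
  proof (rule tendsto_0_subseq_principle)
    fix r :: "nat => nat" assume r: "strict_mono r"
    have er: "(%k. e (r k)) ----> 0" using LIMSEQ_subseq_LIMSEQ[OF e(1) r] by (simp add: o_def)
    obtain s where s: "strict_mono (s :: nat => nat)" "AE x in lebesgue. (%k. ?c (r (s k)) x) ----> F x"
      using conv_moll_AE_subseq[OF iF er e(2)] .
    have rs: "strict_mono (%k. r (s k))" using r s(1) by (simp add: strict_mono_def)
    have AE: "AE x in M. (%k. ?c (r (s k)) x) ----> F x"
      using s(2) \<Omega>_sets by (auto simp: AE_restrict_space_iff elim!: eventually_mono)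
    have fm: "?f k \<in> borel_measurable M" for k using Lp_measurable[OF Lp_diff(1)[OF Lconv F]] by measurable
    have "(%k. \<integral>x. min (?f (r (s k)) x) (?g x) \<partial>M) ----> (LINT x|M. 0)"
    proof (rule integral_dominated_convergence[where w="?g" and f="%_. 0" and s="%k x. min (?f (r (s k)) x) (?g x)"])
      show "AE x in M. (%k. min (?f (r (s k)) x) (?g x)) ----> 0"
        using AE
      proof (rule AE_mp, intro AE_I2 impI)
        fix x assume x: "x \<in> space M" "(%k. ?c (r (s k)) x) ----> F x"
        have "(%k. ?f (r (s k)) x) ----> 0"
          using x p_ge1[OF x(1)] by (intro tendsto_zero_powrI[OF _ tendsto_const] tendsto_rabs_zero) (auto simp: LIM_zero_iff)
        then have "(%k. min (?f (r (s k)) x) (?g x)) ----> min 0 (?g x)" by (intro tendsto_min tendsto_const)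
        then show "(%k. min (?f (r (s k)) x) (?g x)) ----> 0" using AB by (simp add: min_def \<Phi>_def)
      qed
      show "AE x in M. norm (min (?f (r (s k)) x) (?g x)) <= ?g x" for k
        using AB by (intro AE_I2) (auto simp: min_def \<Phi>_def)
    qed (use fm ig borel_measurable_integrable[OF ig] in auto)
    moreover have "(%k. \<integral>x. ?d (r (s k)) x \<partial>M) ----> 0"
    proof (rule Lim_null_comparison)
      show "(%k. \<integral>x. ?d (r (s k)) x \<partial>lebesgue) ----> 0"
        using LIMSEQ_subseq_LIMSEQ[OF conv_moll(2)[OF i\<Phi> e] rs] by (simp add: o_def)
      have "(LINT x|M. ?d k x) <= (LINT x|lebesgue. ?d k x)" for k
      proof -
        have i: "integrable lebesgue (%x. ?d k x)" using i\<Phi> conv_moll(1)[OF i\<Phi> e] by auto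
        have "(LINT x|M. ?d k x) = (LINT x|lebesgue. indicator \<Omega> x *\<^sub>R ?d k x)"
          using \<Omega>_sets by (intro integral_restrict_space) auto
        also have "... <= (LINT x|lebesgue. ?d k x)"
          by (intro integral_mono integrable_mult_indicator i \<Omega>_sets) (auto simp: indicator_def)
        finally show ?thesis .
      qed
      then show "\<forall>\<^sub>F k in sequentially. norm (LINT x|M. ?d (r (s k)) x)
          <= (LINT x|lebesgue. ?d (r (s k)) x)" by simp
    qed
    ultimately have lim: "(%k. (LINT x|M. min (?f (r (s k)) x) (?g x)) + 2 powr P * C * (LINT x|M. ?d (r (s k)) x)) ----> 0"
      by (auto intro!: tendsto_eq_intros)
    have "(%k. mo (%x. ?c (r (s k)) x - F x)) ----> 0"
    proof (rule Lim_null_comparison[OF _ lim])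
      have "\<forall>\<^sub>F k in sequentially. 2 * e (r (s k)) <= d & e (r (s k)) <= 1 & e (r (s k)) <= d'"
        using eventually_subseq[OF rs sm] by simp
      then show "\<forall>\<^sub>F k in sequentially. norm (mo (%x. ?c (r (s k)) x - F x))
        <= (LINT x|M. min (?f (r (s k)) x) (?g x)) + 2 powr P * C * (LINT x|M. ?d (r (s k)) x)"
      proof eventually_elim
        case (elim k)
        let ?k = "r (s k)"
        have i1: "integrable M (%x. min (?f ?k x) (?g x))"
          by (rule integrable_min) (use Lp_integrable_powr[OF Lp_diff(1)[OF Lconv F]] ig in auto)
        have i2: "integrable M (%x. 2 powr P * C * ?d ?k x)"
          using iconv[of ?k] by simp
        have "mo (%x. ?c ?k x - F x) <= (LINT x|M. min (?f ?k x) (?g x) + 2 powr P * C * ?d ?k x)"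
        proof (rule Lp_dominated(2)[OF Lp_measurable[OF Lp_diff(1)[OF Lconv F]] Bochner_Integration.integrable_add[OF i1 i2]])
          show "AE x in M. norm (?c ?k x - F x) powr p x
              <= min (?f ?k x) (?g x) + 2 powr P * C * ?d ?k x"
            unfolding real_norm_def by (rule AE_I2, rule fle) (use elim in auto)
        qed
        also have "... = (LINT x|M. min (?f ?k x) (?g x)) + 2 powr P * C * (LINT x|M. ?d ?k x)"
          using i1 i2 by (subst Bochner_Integration.integral_add) auto
        finally show ?case by (simp add: mo_nonneg)
      qed
    qed
    with s(1) show "\<exists>s. strict_mono s & (%k. mo (%x. ?c (r (s k)) x - F x)) ----> 0" by blast
  qed
qed

lemma Lp_component: "Lp G ==> Lp (%x. G x $ j)" for G :: "real^'n => real^'n"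
  by (rule Lp_le(1)[OF borel_measurable_vec_nth[OF Lp_measurable]]) (auto simp: component_le_norm_cart)

lemma mo_tendsto_componentwise:
  fixes V :: "nat => real^'n => real^'n"
  assumes L: "!!k j. Lp (%x. V k x $ j)" and lim: "!!j. (%k. mo (%x. V k x $ j)) ----> 0"
  shows "(%k. mo (V k)) ----> 0"
proof -
  have La: "Lp (%x. \<bar>V k x $ j\<bar>)" for k j using L[of k j] by (auto simp: Lp_def)
  have "(\<forall>k. Lp (%x. \<Sum>j\<in>A. \<bar>V k x $ j\<bar>)) & (%k. mo (%x. \<Sum>j\<in>A. \<bar>V k x $ j\<bar>)) ----> 0" if "finite A" for A
    using that
  proof induction
    case empty
    have "Lp (%x. 0 :: real)" by (rule Lp_bounded[of _ 0]) auto
    then show ?case by (simp add: mo_def)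
  next
    case (insert j A)
    then have IH: "!!k. Lp (%x. \<Sum>j\<in>A. \<bar>V k x $ j\<bar>)" "(%k. mo (%x. \<Sum>j\<in>A. \<bar>V k x $ j\<bar>)) ----> 0" by auto
    have lj: "(%k. mo (%x. \<bar>V k x $ j\<bar>)) ----> 0" using lim[of j] by (simp add: mo_def)
    have "(%k. mo (%x. \<bar>V k x $ j\<bar> + (\<Sum>j\<in>A. \<bar>V k x $ j\<bar>))) ----> 0"
    proof (rule Lim_null_comparison)
      show "(%k. 2 powr P * (mo (%x. \<bar>V k x $ j\<bar>) + mo (%x. \<Sum>j\<in>A. \<bar>V k x $ j\<bar>))) ----> 0"
        using IH(2) lj by (auto intro!: tendsto_eq_intros)
    qed (use Lp_add(2)[OF La IH(1)] in \<open>auto simp: mo_nonneg\<close>)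
    then show ?case using insert(1,2) Lp_add(1)[OF La IH(1)] by simp
  qed
  from this[of UNIV] have 1: "!!k. Lp (%x. \<Sum>j\<in>UNIV. \<bar>V k x $ j\<bar>)" "(%k. mo (%x. \<Sum>j\<in>UNIV. \<bar>V k x $ j\<bar>)) ----> 0" by auto
  show ?thesis
  proof (rule Lim_null_comparison[OF _ 1(2)], intro always_eventually allI)
    fix k
    have "mo (V k) <= mo (%x. \<Sum>j\<in>UNIV. \<bar>V k x $ j\<bar>)"
      using norm_le_l1_cart by (intro Lp_le(2) 1(1) borel_measurable_vecI Lp_measurable L) (auto simp: sum_nonneg)
    then show "norm (mo (V k)) <= mo (%x. \<Sum>j\<in>UNIV. \<bar>V k x $ j\<bar>)" by (simp add: mo_nonneg)
  qed
qed

text \<open>Mollify after setting \<open>v\<close> and \<open>G\<close> to zero off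
  \<open>K\<close>. Near \<open>K\<close> the gradient of the mollification is the mollified
  gradient; at points farther from \<open>K\<close> than the scale both vanish.\<close>

lemma S0_compact_support:
  assumes wg: "weak_grad \<Omega> v G" and Lv: "Lp v" "Lp G" and K: "compact K" "K \<subseteq> \<Omega>"
    and zero: "AE x in M. x \<notin> K --> v x = 0 & G x = 0"
  shows "S0 v G"
proof -
  define v0 where "v0 x = (if x \<in> K then v x else 0)" for x
  define G0 where "G0 x = (if x \<in> K then G x else 0)" for x
  have AE: "AE x in M. v x = v0 x" "AE x in M. G x = G0 x"
    using zero by (auto simp: v0_def G0_def elim!: eventually_mono)
  have L0: "Lp v0" "Lp G0"
    using Lp_AE_cong(1)[OF Lv(1) borel_measurable_lebesgue_on_AE[OF Lp_measurable[OF Lv(1)] AE(1) \<Omega>_sets] AE(1)]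
      Lp_AE_cong(1)[OF Lv(2) borel_measurable_lebesgue_on_AE[OF Lp_measurable[OF Lv(2)] AE(2) \<Omega>_sets] AE(2)] by auto
  have wg0: "weak_grad \<Omega> v0 G0" by (rule weak_grad_AE_cong[OF wg open_\<Omega> AE])
  obtain d K' where K': "d > 0" "compact K'" "K' \<subseteq> \<Omega>" "!!x. x \<in> K ==> cball x d \<subseteq> K'"
    using compact_in_open_nbhd[OF K(1) open_\<Omega> K(2)] by metis
  have KK': "K \<subseteq> K'" using K'(1,4) by (meson centre_in_cball less_imp_le subset_iff)
  \<comment> \<open>Half of \<open>d\<close>, because a point within \<open>e k\<close> of
    \<open>K\<close> must have its whole ball of radius \<open>e k\<close> inside
    \<open>K'\<close>.\<close>
  define e where "e k = d / 2 * inverse (real (Suc k))" for k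
  have e: "e ----> 0" "!!k. e k > 0" "!!k. 2 * e k <= d"
    unfolding e_def using tendsto_mult_left[OF LIMSEQ_inverse_real_of_nat, of "d / 2"] K'(1)
    by (auto simp: field_simps)
  note tf = moll_props(1)[OF e(2)] and mz = moll_props(2)[OF e(2)]
  have iv0: "integrable lebesgue v0"
  proof -
    have "v0 x = 0" if "x \<notin> \<Omega>" for x using that K(2) by (auto simp: v0_def)
    then show ?thesis using Lp_integrable(1)[OF L0(1)] lebesgue_on_zero_outside(2)[OF \<Omega>_sets, of v0 v0] by blast
  qed
  have far: "conv h \<psi> x = 0" if "!!y. y \<notin> K ==> h y = 0" "!!z. e k < norm z ==> \<psi> z = 0" "!!y. y \<in> K ==> e k < norm (x - y)"
    for h \<psi> :: "real^'n => real" and x k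
  proof -
    have z: "h y * \<psi> (x - y) = 0" for y using that by (cases "y \<in> K") auto
    show ?thesis unfolding conv_def z by simp
  qed
  have pz: "pd (moll (e k)) j z = 0" if "e k < norm z" for k j and z :: "real^'n"
  proof (rule test_fun_pd_zero[OF tf])
    have "{z :: real^'n. moll (e k) z ~= 0} \<subseteq> cball 0 (e k)"
    proof
      fix z :: "real^'n" assume "z \<in> {z. moll (e k) z ~= 0}"
      then show "z \<in> cball 0 (e k)" using mz[of k z] by (cases "e k < norm z") auto
    qed
    then have "closure {z :: real^'n. moll (e k) z ~= 0} \<subseteq> cball 0 (e k)" by (simp add: closure_minimal)
    then show "z \<notin> closure {z :: real^'n. moll (e k) z ~= 0}" using that by auto
  qed
  define \<phi> where "\<phi> k = conv v0 (moll (e k))" for k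
  have \<phi>: "test_fun \<Omega> (\<phi> k)" for k
  proof -
    have "x \<in> K'" if nz: "\<phi> k x ~= 0" for x
    proof -
      have "\<exists>y\<in>K. norm (x - y) <= e k"
        using far[of v0 k "moll (e k)" x] mz nz by (force simp: \<phi>_def v0_def not_less[symmetric])
      then obtain y where y: "y \<in> K" "norm (x - y) <= e k" by blast
      then have "x \<in> cball y d" using e(2,3)[of k] by (simp add: dist_norm norm_minus_commute)
      then show ?thesis using K'(4)[OF y(1)] by blast
    qed
    then have "{x. \<phi> k x ~= 0} \<subseteq> K'" by blast
    then have sub: "closure {x. \<phi> k x ~= 0} \<subseteq> K'" using compact_imp_closed[OF K'(2)] by (rule closure_minimal)
    then have "compact (closure {x. \<phi> k x ~= 0})" using closed_subset_compact[OF K'(2)] by blast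
    moreover have "Ck_on n UNIV (\<phi> k)" for n unfolding \<phi>_def by (rule conv_smooth[OF iv0 tf])
    ultimately show ?thesis using sub K'(3) unfolding test_fun_def by blast
  qed
  have cg: "pd (\<phi> k) j x = conv (%y. G0 y $ j) (moll (e k)) x" for k j x
  proof (cases "\<exists>y\<in>K. norm (x - y) <= e k")
    case True
    then obtain y where y: "y \<in> K" "norm (x - y) <= e k" by blast
    have "cball x (e k) \<subseteq> K'"
    proof
      fix z assume "z \<in> cball x (e k)"
      then have "dist y z <= d" using y(2) e(3)[of k] dist_triangle[of y z x] by (simp add: dist_norm norm_minus_commute)
      then show "z \<in> K'" using K'(4)[OF y(1)] by auto
    qed
    from conv_pd_eq_conv_weak_grad[OF wg0 open_\<Omega> K'(2,3) tf mz this]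
    have "conv (%y. indicator K' y * v0 y) (pd (moll (e k)) j) x = conv (%y. indicator K' y * G0 y $ j) (moll (e k)) x" .
    moreover have "(%y. indicator K' y * v0 y) = v0" "(%y. indicator K' y * G0 y $ j) = (%y. G0 y $ j)"
      using KK' by (auto simp: v0_def G0_def indicator_def fun_eq_iff)
    ultimately show ?thesis by (simp add: \<phi>_def pd_conv[OF iv0 tf])
  next
    case False
    then have "conv v0 (pd (moll (e k)) j) x = 0" "conv (%y. G0 y $ j) (moll (e k)) x = 0"
      using pz mz by (auto intro!: far simp: v0_def G0_def not_le)
    then show ?thesis by (simp add: \<phi>_def pd_conv[OF iv0 tf])
  qed
  have "S0 v0 G0"
  proof (rule S0I[OF L0 wg0 \<phi>])
    show "(%k. mo (%x. \<phi> k x - v0 x)) ----> 0"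
      unfolding \<phi>_def by (rule conv_moll_tendsto_mo(2)[OF L0(1) K _ e(1,2)]) (simp add: v0_def)
    show "(%k. mo (%x. cgrad (\<phi> k) x - G0 x)) ----> 0"
    proof (rule mo_tendsto_componentwise)
      fix j
      show "(%k. mo (%x. (cgrad (\<phi> k) x - G0 x) $ j)) ----> 0"
        using conv_moll_tendsto_mo(2)[OF Lp_component[OF L0(2)] K _ e(1,2), of j] by (simp add: cg G0_def)
    qed (intro Lp_component Lp_diff Lp_test_fun \<phi> L0)
  qed
  moreover have "AE x in M. v0 x = v x" using AE(1) by eventually_elim simp
  moreover have "AE x in M. G0 x = G x" using AE(2) by eventually_elim simp
  ultimately show ?thesis by (rule S0_AE_cong)
qed

text \<open>The regularised positive part has a continuous derivative vanishing at \<open>0\<close>, so the level set \<open>u = g\<close>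
  needs no separate treatment when passing from test functions to \<open>u\<close>.\<close>
lemma S0_pos_part_diff:
  assumes S: "S0 u G" and g: "weak_grad \<Omega> g \<Gamma>" "Lp g" "Lp \<Gamma>" "AE x in M. 0 <= g x"
  shows "S0 (%x. max 0 (u x - g x)) (%x. if u x - g x > 0 then G x - \<Gamma> x else 0)"
proof -
  obtain \<psi> where \<psi>': "\<forall>k. test_fun \<Omega> (\<psi> k)"
      "(%k. mo (%x. \<psi> k x - u x)) ----> 0" "(%k. mo (%x. cgrad (\<psi> k) x - G x)) ----> 0"
    by (rule S0E[OF S])
  note Lu = S0D(1)[OF S] and LG = S0D(2)[OF S]
  obtain r where r: "strict_mono (r :: nat => nat)" "AE x in M. (%k. \<psi> (r k) x) ----> u x"
    using mo_tendsto_AE_subseq[OF Lp_test_fun(1)[OF \<psi>'(1)[rule_format]] Lu \<psi>'(2)] .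
  define \<phi> where "\<phi> k = \<psi> (r k)" for k
  have \<phi>: "!!k. test_fun \<Omega> (\<phi> k)" "(%k. mo (%x. \<phi> k x - u x)) ----> 0" "(%k. mo (%x. cgrad (\<phi> k) x - G x)) ----> 0"
    and AE\<phi>: "AE x in M. (%k. \<phi> k x) ----> u x"
    using \<psi>' r LIMSEQ_subseq_LIMSEQ[OF \<psi>'(2) r(1)] LIMSEQ_subseq_LIMSEQ[OF \<psi>'(3) r(1)] by (auto simp: \<phi>_def o_def)
  note L\<phi> = Lp_test_fun[OF \<phi>(1)]
  define v where "v e a x = pos_approx e (a x - g x)" for e a x
  define X where "X e a A x = pos_approx' e (a x - g x) *\<^sub>R (A x - \<Gamma> x)" for e a and A :: "real^'n => real^'n" and x
  have pm: "pos_approx e \<in> borel_measurable borel" "pos_approx' e \<in> borel_measurable borel" if "e > 0" for e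
  proof -
    have "continuous_on UNIV (pos_approx e)"
      using pos_approx_derivative[OF that] by (meson DERIV_isCont continuous_at_imp_continuous_on)
    then show "pos_approx e \<in> borel_measurable borel" "pos_approx' e \<in> borel_measurable borel"
      using pos_approx_props(1)[OF that] by (auto intro: borel_measurable_continuous_onI)
  qed
  have X_le: "norm (X e a A x) <= norm (A x - \<Gamma> x)" if "e > 0" for e a A x
    using mult_right_mono[OF pos_approx_props(2)[OF that], of "norm (A x - \<Gamma> x)"] by (simp add: X_def)
  have lip: "\<bar>v e a x - v e b x\<bar> <= \<bar>a x - b x\<bar>" if "e > 0" for e a b x
    using pos_approx_props(5)[OF that, of "a x - g x" "b x - g x"] by (simp add: v_def)
  have X_le': "norm (X e a A x - B) <= norm (2 *\<^sub>R (A x - \<Gamma> x))" if "e > 0" "norm B <= norm (A x - \<Gamma> x)" for e a A x B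
  proof -
    have "norm (X e a A x - B) <= norm (A x - \<Gamma> x) + norm (A x - \<Gamma> x)"
      by (rule norm_triangle_le_diff[OF add_mono[OF X_le[OF that(1)] that(2)]])
    then show ?thesis by simp
  qed
  have Lv: "Lp (v e a)" if "e > 0" "Lp a" for e a
  proof (rule Lp_le(1)[OF _ Lp_diff(1)[OF that(2) g(2)]])
    note [measurable] = pm[OF that(1)] Lp_measurable[OF that(2)] Lp_measurable[OF g(2)]
    show "v e a \<in> borel_measurable M" unfolding v_def[abs_def] by measurable
    show "AE x in M. norm (v e a x) <= norm (a x - g x)"
      using pos_approx_props(5)[OF that(1), of _ 0] pos_approx_props(3)[OF that(1)] by (simp add: v_def)
  qed
  have LX: "Lp (X e a A)" if "e > 0" "Lp a" "Lp A" for e a A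
  proof (rule Lp_le(1)[OF _ Lp_diff(1)[OF that(3) g(3)]])
    note [measurable] = pm[OF that(1)] Lp_measurable[OF that(2)] Lp_measurable[OF that(3)] Lp_measurable[OF g(2)] Lp_measurable[OF g(3)]
    show "X e a A \<in> borel_measurable M" unfolding X_def[abs_def] by measurable
    show "AE x in M. norm (X e a A x) <= norm (A x - \<Gamma> x)" by (intro AE_I2 X_le that(1))
  qed
  let ?X = "%e k. X e (\<phi> k) (cgrad (\<phi> k))"
  \<comment> \<open>Outside the support of \<open>\<phi> k\<close> the difference
    \<open>\<phi> k - g\<close> is nonpositive almost everywhere since \<open>g\<close> is
    nonnegative, so the regularised positive part and its gradient vanish there. The sign of
    \<open>g\<close> thus makes up for missing boundary values of \<open>g\<close>.\<close>
  have S\<phi>: "S0 (v e (\<phi> k)) (?X e k)" if "e > 0" for e k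
  proof -
    obtain K where K: "compact K" "K \<subseteq> \<Omega>" "!!x. x \<notin> K ==> \<phi> k x = 0" using test_fun_support[OF \<phi>(1)] by metis
    show ?thesis
    proof (rule S0_compact_support[OF _ Lv[OF that L\<phi>(1)] LX[OF that L\<phi>] K(1,2)])
      show "weak_grad \<Omega> (v e (\<phi> k)) (?X e k)"
        unfolding v_def[abs_def] X_def[abs_def]
        by (rule weak_grad_chain[OF weak_grad_diff[OF weak_grad_test_fun[OF \<phi>(1) open_\<Omega>] g(1)] open_\<Omega>
            pos_approx_derivative[OF that] pos_approx_props(1,2,3)[OF that]])
      show "AE x in M. x \<notin> K --> v e (\<phi> k) x = 0 & ?X e k x = 0"
        using g(4) by eventually_elim (use K(3) that in \<open>auto simp: v_def X_def pos_approx_def pos_approx'_def\<close>)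
    qed
  qed
  have Se: "S0 (v e u) (X e u G)" if "e > 0" for e
  proof (rule S0_limit[OF S\<phi>[OF that] Lv[OF that Lu] LX[OF that Lu LG]])
    have "mo (%x. v e (\<phi> k) x - v e u x) <= mo (%x. \<phi> k x - u x)" for k
      using lip[OF that] Lp_measurable[OF Lp_diff(1)[OF Lv[OF that L\<phi>(1)] Lv[OF that Lu]]]
      by (intro Lp_le(2) Lp_diff(1)[OF L\<phi>(1) Lu] AE_I2) auto
    then show "(%k. mo (%x. v e (\<phi> k) x - v e u x)) ----> 0"
      by (intro Lim_null_comparison[OF _ \<phi>(2)]) (auto simp: mo_nonneg)
    note LX' = LX[OF that L\<phi>(1) LG]
    \<comment> \<open>Only the coefficient changes here. The gradient is already the limit
      \<open>G\<close>, so a fixed majorant exists.\<close>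
    have 2: "(%k. mo (%x. X e (\<phi> k) G x - X e u G x)) ----> 0"
    proof (rule mo_dominated_convergence[OF Lp_measurable[OF Lp_diff(1)[OF LX' LX[OF that Lu LG]]] Lp_scaleR(1)[OF Lp_diff(1)[OF LG g(3)], of 2]])
      show "AE x in M. norm (X e (\<phi> k) G x - X e u G x) <= norm (2 *\<^sub>R (G x - \<Gamma> x))" for k
        by (intro AE_I2 X_le' X_le that)
      show "AE x in M. (%k. X e (\<phi> k) G x - X e u G x) ----> 0"
        using AE\<phi>
      proof eventually_elim
        case (elim x)
        have "(%k. pos_approx' e (\<phi> k x - g x)) ----> pos_approx' e (u x - g x)"
          by (rule continuous_on_tendsto_compose[OF pos_approx_props(1)[OF that]]) (auto intro!: tendsto_intros elim)
        then show ?case unfolding X_def by (intro LIM_zero tendsto_intros)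
      qed
    qed
    have le: "mo (%x. ?X e k x - X e u G x)
        <= 2 powr P * (mo (%x. cgrad (\<phi> k) x - G x) + mo (%x. X e (\<phi> k) G x - X e u G x))" for k
    proof -
      have "mo (%x. ?X e k x - X e (\<phi> k) G x) <= mo (%x. cgrad (\<phi> k) x - G x)"
      proof (intro Lp_le(2) Lp_diff(1)[OF L\<phi>(2) LG] Lp_measurable Lp_diff(1)[OF LX[OF that L\<phi>] LX'] AE_I2)
        fix x
        have "?X e k x - X e (\<phi> k) G x = pos_approx' e (\<phi> k x - g x) *\<^sub>R (cgrad (\<phi> k) x - G x)"
          by (simp add: X_def flip: scaleR_diff_right)
        then show "norm (?X e k x - X e (\<phi> k) G x) <= norm (cgrad (\<phi> k) x - G x)"
          using mult_right_mono[OF pos_approx_props(2)[OF that], of "norm (cgrad (\<phi> k) x - G x)"] by simp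
      qed
      then show ?thesis
        by (intro order.trans[OF mo_triangle[OF LX[OF that L\<phi>] LX' LX[OF that Lu LG]]] mult_left_mono add_mono) auto
    qed
    have lim: "(%k. 2 powr P * (mo (%x. cgrad (\<phi> k) x - G x) + mo (%x. X e (\<phi> k) G x - X e u G x))) ----> 0"
      using \<phi>(3) 2 by (auto intro!: tendsto_eq_intros)
    show "(%k. mo (%x. ?X e k x - X e u G x)) ----> 0"
      by (rule Lim_null_comparison[OF _ lim]) (use le in \<open>auto simp: mo_nonneg\<close>)
  qed
  \<comment> \<open>The second limit, in the regularisation: the coefficients tend to the indicator
    of \<open>u > g\<close>, with value zero where \<open>u = g\<close>.\<close>
  define e where "e k = inverse (real (Suc k))" for k
  have e: "e ----> 0" "!!k. e k > 0" "!!k. e k <= 1"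
    unfolding e_def using LIMSEQ_inverse_real_of_nat by (auto simp: divide_simps)
  let ?v = "%x. max 0 (u x - g x)" and ?V = "%x. if u x - g x > 0 then G x - \<Gamma> x else 0"
  have [measurable]: "u \<in> borel_measurable M" "g \<in> borel_measurable M" "G \<in> borel_measurable M" "\<Gamma> \<in> borel_measurable M"
    using Lu LG g(2,3) by (auto dest: Lp_measurable)
  have Lv': "Lp ?v" by (rule Lp_le(1)[OF _ Lp_diff(1)[OF Lu g(2)]]) auto
  have LV': "Lp ?V" by (rule Lp_le(1)[OF _ Lp_diff(1)[OF LG g(3)]]) auto
  show ?thesis
  proof (rule S0_limit[OF Se[OF e(2)] Lv' LV'])
    have le: "\<bar>v (e k) u x - ?v x\<bar> <= e k" for k x using pos_approx_props(4)[OF e(2)] by (simp add: v_def)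
    show "(%k. mo (%x. v (e k) u x - ?v x)) ----> 0"
    proof (rule mo_dominated_convergence[OF Lp_measurable[OF Lp_diff(1)[OF Lv[OF e(2) Lu] Lv']]])
      show "Lp (%_. 1 :: real)" by (rule Lp_bounded[of _ 1]) auto
      show "AE x in M. norm (v (e k) u x - ?v x) <= norm (1 :: real)" for k
        using order.trans[OF le e(3)] by (intro AE_I2) simp
      show "AE x in M. (%k. v (e k) u x - ?v x) ----> 0"
        using le by (intro AE_I2 Lim_null_comparison[OF _ e(1)]) auto
    qed
    show "(%k. mo (%x. X (e k) u G x - ?V x)) ----> 0"
    proof (rule mo_dominated_convergence[OF Lp_measurable[OF Lp_diff(1)[OF LX[OF e(2) Lu LG] LV']] Lp_scaleR(1)[OF Lp_diff(1)[OF LG g(3)], of 2]])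
      show "AE x in M. norm (X (e k) u G x - ?V x) <= norm (2 *\<^sub>R (G x - \<Gamma> x))" for k
        by (intro AE_I2 X_le' e(2)) simp
      show "AE x in M. (%k. X (e k) u G x - ?V x) ----> 0"
      proof (rule AE_I2, goal_cases)
        case (1 x)
        let ?t = "u x - g x"
        have "(%k. pos_approx' (e k) ?t) ----> (if ?t > 0 then 1 else 0)"
        proof (cases "?t > 0")
          case True
          have "(%k. 1 - (e k / (max 0 ?t + e k))\<^sup>2) ----> 1 - (0 / (max 0 ?t + 0))\<^sup>2"
            using True by (intro tendsto_intros e(1)) auto
          then show ?thesis using True by (simp add: pos_approx'_def)
        qed (use e(2) in \<open>simp add: pos_approx'_def max_def less_imp_neq[symmetric]\<close>)
        then have "(%k. X (e k) u G x) ----> (if ?t > 0 then 1 else 0) *\<^sub>R (G x - \<Gamma> x)"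
          unfolding X_def by (intro tendsto_intros)
        then show ?case by (auto intro: LIM_zero split: if_splits)
      qed
    qed
  qed
qed

end

section \<open>Translation estimates and cell averages\<close>

lemma L1_shift_add:
  assumes f: "integrable lborel f" and m: "f \<in> borel_measurable borel"
  shows "L1_shift f (z + w) <= L1_shift f z + L1_shift f w"
proof -
  note tr = integrable_lborel_translate[OF f]
  have "L1_shift f (z + w) <= (LINT x|lborel. \<bar>f ((x + z) + w) - f (x + z)\<bar> + \<bar>f (x + z) - f x\<bar>)"
    unfolding L1_shift_def using f tr[of z] tr[of "z + w"]
    by (intro integral_mono Bochner_Integration.integrable_add integrable_abs Bochner_Integration.integrable_diff)
      (auto simp: add.assoc)
  also have "... = (LINT x|lborel. \<bar>f ((x + z) + w) - f (x + z)\<bar>) + L1_shift f z"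
    unfolding L1_shift_def using f tr[of z] tr[of "z + w"]
    by (intro Bochner_Integration.integral_add integrable_abs Bochner_Integration.integrable_diff)
      (auto simp: add.assoc)
  also have "(LINT x|lborel. \<bar>f ((x + z) + w) - f (x + z)\<bar>) = L1_shift f w"
    unfolding L1_shift_def using integral_lborel_translate[of "%x. \<bar>f (x + w) - f x\<bar>" z] m by simp
  finally show ?thesis by simp
qed

lemma L1_shift_multiple:
  assumes f: "integrable lborel f" "f \<in> borel_measurable borel"
  shows "L1_shift f (real n *\<^sub>R z) <= real n * L1_shift f z"
proof (induction n)
  case (Suc n)
  have "L1_shift f (real (Suc n) *\<^sub>R z) = L1_shift f (real n *\<^sub>R z + z)" by (simp add: algebra_simps)
  also have "... <= L1_shift f (real n *\<^sub>R z) + L1_shift f z" by (rule L1_shift_add[OF f])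
  finally show ?case using Suc by (simp add: algebra_simps)
qed (simp add: L1_shift_def)

text \<open>Cut the displacement into \<open>Suc k\<close> equal steps. Subadditivity of
  \<open>L1_shift\<close> gives a bound by \<bar>t\<bar> times the L1 norm of a difference quotient,
  and this norm converges to that of the derivative.\<close>

lemma L1_shift_test_fun:
  fixes \<phi> :: "real^'n => real"
  assumes \<phi>: "test_fun \<Omega> \<phi>"
  shows "L1_shift \<phi> (t *\<^sub>R axis j 1) <= \<bar>t\<bar> * (LINT x|lborel. \<bar>pd \<phi> j x\<bar>)"
proof (cases "t = 0")
  case False
  let ?e = "axis j 1 :: real^'n"
  note i\<phi> = test_fun_integrable[OF \<phi>] and [measurable] = test_fun_measurable[OF \<phi>] test_fun_measurable[OF test_fun_pd[OF \<phi>]]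
  define T where "T k = t / real (Suc k)" for k
  have T: "T ----> 0" "!!k. T k ~= 0" "!!k. \<bar>T k\<bar> <= \<bar>t\<bar>"
  proof -
    have "(%k. t * inverse (real (Suc k))) ----> t * 0" by (intro tendsto_intros LIMSEQ_inverse_real_of_nat)
    then show "T ----> 0" by (simp add: T_def[abs_def] divide_inverse)
    show "\<bar>T k\<bar> <= \<bar>t\<bar>" for k by (simp add: T_def divide_simps mult_left_le) (simp add: algebra_simps)
  qed (use False in \<open>simp add: T_def\<close>)
  obtain B where B: "B > 0" "!!x t. \<bar>\<phi> (x + t *\<^sub>R ?e) - \<phi> x\<bar> <= B * \<bar>t\<bar>"
    using test_fun_difference_quotient[OF \<phi>] by metis
  obtain K where K: "compact K" "!!x. x \<notin> K ==> \<phi> x = 0" using test_fun_support[OF \<phi>] by metis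
  obtain r where r: "r > 0" "!!x. x \<in> K ==> norm x <= r" using compact_imp_bounded[OF K(1)] by (auto simp: bounded_pos)
  let ?C = "cball 0 (r + \<bar>t\<bar>) :: (real^'n) set"
  have "(%k. \<integral>x. \<bar>(\<phi> (x + T k *\<^sub>R ?e) - \<phi> x) / T k\<bar> \<partial>lborel) ----> (LINT x|lborel. \<bar>pd \<phi> j x\<bar>)"
  proof (rule integral_dominated_convergence[where w="%x. B * indicator ?C x"])
    have "emeasure lborel ?C < \<infinity>" by (rule emeasure_lborel_cball_finite)
    then show "integrable lborel (%x. B * indicator ?C x)" by (intro integrable_mult_right integrable_real_indicator) auto
    show "AE x in lborel. (%k. \<bar>(\<phi> (x + T k *\<^sub>R ?e) - \<phi> x) / T k\<bar>) ----> \<bar>pd \<phi> j x\<bar>"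
    proof (rule AE_I2, goal_cases)
      case (1 x)
      have "((%t. (\<phi> (x + t *\<^sub>R ?e) - \<phi> x) / t) \<longlongrightarrow> pd \<phi> j x) (at 0)"
        using test_fun_has_pd[OF \<phi>, of x j 0] by (simp add: has_field_derivative_iff)
      then have "(%k. (\<phi> (x + T k *\<^sub>R ?e) - \<phi> x) / T k) ----> pd \<phi> j x"
        using T by (auto simp: tendsto_at_iff_sequentially o_def)
      then show ?case by (rule tendsto_rabs)
    qed
    show "AE x in lborel. norm \<bar>(\<phi> (x + T k *\<^sub>R ?e) - \<phi> x) / T k\<bar> <= B * indicator ?C x" for k
    proof (rule AE_I2, goal_cases)
      case (1 x)
      show ?case
      proof (cases "x \<in> ?C")
        case True
        then show ?thesis using B(2)[of x "T k"] T(2)[of k] by (simp add: divide_simps)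
      next
        case False
        have "norm (x + T k *\<^sub>R ?e) >= norm x - norm (T k *\<^sub>R ?e)" by (rule norm_diff_ineq)
        moreover have "norm (T k *\<^sub>R ?e) <= \<bar>t\<bar>" using T(3)[of k] by (simp add: norm_axis_1)
        ultimately have "x \<notin> K" "x + T k *\<^sub>R ?e \<notin> K" using r(2)[of x] r(2)[of "x + T k *\<^sub>R ?e"] False by auto
        then show ?thesis using K(2) False by simp
      qed
    qed
  qed auto
  from tendsto_mult_left[OF this, of "\<bar>t\<bar>"]
  have lim: "(%k. \<bar>t\<bar> * (LINT x|lborel. \<bar>(\<phi> (x + T k *\<^sub>R ?e) - \<phi> x) / T k\<bar>)) ----> \<bar>t\<bar> * (LINT x|lborel. \<bar>pd \<phi> j x\<bar>)" .
  have "L1_shift \<phi> (t *\<^sub>R ?e) <= \<bar>t\<bar> * (LINT x|lborel. \<bar>(\<phi> (x + T k *\<^sub>R ?e) - \<phi> x) / T k\<bar>)" for k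
  proof -
    have t: "t *\<^sub>R ?e = real (Suc k) *\<^sub>R (T k *\<^sub>R ?e)" by (simp add: T_def)
    have "L1_shift \<phi> (t *\<^sub>R ?e) <= real (Suc k) * L1_shift \<phi> (T k *\<^sub>R ?e)"
      unfolding t by (rule L1_shift_multiple[OF i\<phi>]) simp
    also have "... = \<bar>t\<bar> * (LINT x|lborel. \<bar>(\<phi> (x + T k *\<^sub>R ?e) - \<phi> x) / T k\<bar>)"
    proof -
      have "(LINT x|lborel. \<bar>(\<phi> (x + T k *\<^sub>R ?e) - \<phi> x) / T k\<bar>) = L1_shift \<phi> (T k *\<^sub>R ?e) / \<bar>T k\<bar>"
        by (simp add: L1_shift_def abs_divide)
      moreover have "\<bar>t\<bar> = real (Suc k) * \<bar>T k\<bar>" by (simp add: T_def abs_divide)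
      ultimately show ?thesis using T(2)[of k] by simp
    qed
    finally show ?thesis .
  qed
  then show ?thesis using lim by (intro LIMSEQ_le_const) auto
qed (simp add: L1_shift_def)

lemma vec_sum_axis: "(\<Sum>j\<in>UNIV. z $ j *\<^sub>R axis j 1) = (z :: real^'n)"
  by (simp add: vec_eq_iff axis_def if_distrib cong: if_cong)

lemma abs_integral_diff_le:
  fixes f g :: "'a => 'b::euclidean_space"
  assumes "integrable M f" "integrable M g"
  shows "(LINT x|M. norm (f x)) <= (LINT x|M. norm (g x)) + (LINT x|M. norm (f x - g x))"
proof -
  have "(LINT x|M. norm (f x)) <= (LINT x|M. norm (g x) + norm (f x - g x))"
    using assms norm_triangle_sub by (intro integral_mono) auto
  also have "... = (LINT x|M. norm (g x)) + (LINT x|M. norm (f x - g x))" using assms by simp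
  finally show ?thesis .
qed

context sobolev
begin

lemma integral_pd_le:
  assumes \<phi>: "test_fun \<Omega> \<phi>"
  shows "(LINT x|lborel. \<bar>pd \<phi> j x\<bar>) <= (LINT x|M. norm (cgrad \<phi> x))"
proof -
  note t = test_fun_pd[OF \<phi>, of j]
  have "(LINT x|lborel. \<bar>pd \<phi> j x\<bar>) = (LINT x|lebesgue. \<bar>pd \<phi> j x\<bar>)"
    using test_fun_measurable[OF t] by (simp add: integral_completion)
  also have "... = (LINT x|M. \<bar>pd \<phi> j x\<bar>)"
    using test_fun_zero[OF t] by (intro lebesgue_on_zero_outside(1)[symmetric] \<Omega>_sets) auto
  also have "... <= (LINT x|M. norm (cgrad \<phi> x))"
    using integrable_test_fun_on[OF t \<Omega>_sets] Lp_integrable(1)[OF Lp_test_fun(2)[OF \<phi>]] component_le_norm_cart[of "cgrad \<phi> _" j]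
    by (intro integral_mono) auto
  finally show ?thesis .
qed

lemma S0_L1_approx:
  assumes S: "S0 u G" and u': "integrable lborel u'" "u' \<in> borel_measurable borel"
    "AE x in lebesgue. u' x = (if x \<in> \<Omega> then u x else 0)" and "0 < e"
  obtains \<phi> where "test_fun \<Omega> \<phi>" "(LINT x|lborel. \<bar>u' x - \<phi> x\<bar>) < e"
    "(LINT x|M. norm (cgrad \<phi> x)) < (LINT x|M. norm (G x)) + e" "(LINT x|M. \<bar>u x - \<phi> x\<bar>) < e"
proof -
  obtain \<phi> where \<phi>': "\<forall>k. test_fun \<Omega> (\<phi> k)"
      "(%k. mo (%x. \<phi> k x - u x)) ----> 0" "(%k. mo (%x. cgrad (\<phi> k) x - G x)) ----> 0"
    by (rule S0E[OF S])
  note \<phi> = \<phi>'(1)[rule_format] \<phi>'(2,3)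
  note L = Lp_diff(1)[OF Lp_test_fun(1)[OF \<phi>(1)] S0D(1)[OF S]] and LG = Lp_diff(1)[OF Lp_test_fun(2)[OF \<phi>(1)] S0D(2)[OF S]]
  have "\<forall>\<^sub>F k in sequentially. (LINT x|M. norm (\<phi> k x - u x)) < e & (LINT x|M. norm (cgrad (\<phi> k) x - G x)) < e"
    using mo_tendsto_0_L1[OF L \<phi>(2)] mo_tendsto_0_L1[OF LG \<phi>(3)] \<open>0 < e\<close>
    by (intro eventually_conj order_tendstoD(2)) auto
  from eventually_happens'[OF sequentially_bot this] obtain k where
    k: "(LINT x|M. \<bar>\<phi> k x - u x\<bar>) < e" "(LINT x|M. norm (cgrad (\<phi> k) x - G x)) < e" by auto
  have 1: "(LINT x|M. \<bar>u x - \<phi> k x\<bar>) < e" using k(1) by (simp add: abs_minus_commute)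
  have "(LINT x|lborel. \<bar>u' x - \<phi> k x\<bar>) = (LINT x|lebesgue. \<bar>u' x - \<phi> k x\<bar>)"
    using u'(2) test_fun_measurable[OF \<phi>(1)] by (simp add: integral_completion)
  also have "... = (LINT x|lebesgue. (if x \<in> \<Omega> then \<bar>u x - \<phi> k x\<bar> else 0))"
  proof (rule integral_cong_AE)
    show "AE x in lebesgue. \<bar>u' x - \<phi> k x\<bar> = (if x \<in> \<Omega> then \<bar>u x - \<phi> k x\<bar> else 0)"
      using u'(3) by eventually_elim (use test_fun_zero[OF \<phi>(1)] in auto)
    have "(%x. \<bar>u' x - \<phi> k x\<bar>) \<in> borel_measurable lborel" using u'(2) test_fun_measurable[OF \<phi>(1)] by simp
    then show "(%x. \<bar>u' x - \<phi> k x\<bar>) \<in> borel_measurable lebesgue" by (rule measurable_completion)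
    have "(%x. \<bar>u x - \<phi> k x\<bar>) \<in> borel_measurable M"
      using Lp_measurable[OF S0D(1)[OF S]] test_fun_measurable_on[OF \<phi>(1)] by auto
    then show "(%x. if x \<in> \<Omega> then \<bar>u x - \<phi> k x\<bar> else 0) \<in> borel_measurable lebesgue"
      using \<Omega>_sets by (simp add: borel_measurable_if)
  qed
  also have "... = (LINT x|M. \<bar>u x - \<phi> k x\<bar>)"
    by (intro lebesgue_on_zero_outside(1)[symmetric] \<Omega>_sets) auto
  finally have 2: "(LINT x|lborel. \<bar>u' x - \<phi> k x\<bar>) < e" using 1 by simp
  have "(LINT x|M. norm (cgrad (\<phi> k) x)) < (LINT x|M. norm (G x)) + e"
    using abs_integral_diff_le[OF Lp_integrable(1)[OF Lp_test_fun(2)[OF \<phi>(1)]] Lp_integrable(1)[OF S0D(2)[OF S]], of k] k(2)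
    by linarith
  with 1 2 \<phi>(1) show ?thesis by (intro that[of "\<phi> k"])
qed

text \<open>Test functions give the estimate along each axis, and subadditivity sums the axes. The
  shifted function is the extension by zero; zero boundary values enter here, in that no boundary
  term occurs.\<close>

lemma S0_shift:
  assumes S: "S0 u G" and u': "integrable lborel u'" "u' \<in> borel_measurable borel"
    "AE x in lebesgue. u' x = (if x \<in> \<Omega> then u x else 0)"
  shows "L1_shift u' z <= (\<Sum>j\<in>UNIV. \<bar>z $ j\<bar>) * (LINT x|M. norm (G x))"
proof -
  let ?I = "LINT x|M. norm (G x)"
  have axis: "L1_shift u' (t *\<^sub>R axis j 1) <= \<bar>t\<bar> * ?I" for t j
  proof (rule field_le_epsilon)
    fix e :: real assume "0 < e"
    \<comment> \<open>The error consists of \<open>\<bar>t\<bar> * e'\<close> from the gradient and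
      \<open>2 * e'\<close> from the function.\<close>
    define e' where "e' = e / (\<bar>t\<bar> + 2)"
    have e': "0 < e'" using \<open>0 < e\<close> by (simp add: e'_def)
    obtain \<phi> where \<phi>: "test_fun \<Omega> \<phi>" "(LINT x|lborel. \<bar>u' x - \<phi> x\<bar>) < e'" "(LINT x|M. norm (cgrad \<phi> x)) < ?I + e'"
      "(LINT x|M. \<bar>u x - \<phi> x\<bar>) < e'"
      by (rule S0_L1_approx[OF S u' e'])
    have "L1_shift u' (t *\<^sub>R axis j 1) <= L1_shift \<phi> (t *\<^sub>R axis j 1) + L1_shift (%x. u' x - \<phi> x) (t *\<^sub>R axis j 1)"
      using u'(1) test_fun_integrable[OF \<phi>(1)] by (intro L1_shift_triangle) auto
    also have "... <= \<bar>t\<bar> * (LINT x|lborel. \<bar>pd \<phi> j x\<bar>) + 2 * (LINT x|lborel. \<bar>u' x - \<phi> x\<bar>)"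
      using u'(1) test_fun_integrable[OF \<phi>(1)]
      by (intro add_mono L1_shift_test_fun[OF \<phi>(1)] L1_shift_le_norm) auto
    also have "... <= \<bar>t\<bar> * (?I + e') + 2 * e'"
      using integral_pd_le[OF \<phi>(1), of j] \<phi>(2,3) by (intro add_mono mult_left_mono) auto
    also have "... = \<bar>t\<bar> * ?I + e' * (\<bar>t\<bar> + 2)" by (simp add: algebra_simps)
    also have "e' * (\<bar>t\<bar> + 2) = e" by (simp add: e'_def)
    finally show "L1_shift u' (t *\<^sub>R axis j 1) <= \<bar>t\<bar> * ?I + e" .
  qed
  have "L1_shift u' (\<Sum>j\<in>A. z $ j *\<^sub>R axis j 1) <= (\<Sum>j\<in>A. \<bar>z $ j\<bar>) * ?I" if "finite A" for A
    using that
  proof induction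
    case empty then show ?case by (simp add: L1_shift_def)
  next
    case (insert j A)
    have "L1_shift u' (\<Sum>j\<in>insert j A. z $ j *\<^sub>R axis j 1) <= L1_shift u' (z $ j *\<^sub>R axis j 1) + L1_shift u' (\<Sum>j\<in>A. z $ j *\<^sub>R axis j 1)"
      using insert(1,2) L1_shift_add[OF u'(1,2)] by simp
    also have "... <= \<bar>z $ j\<bar> * ?I + (\<Sum>j\<in>A. \<bar>z $ j\<bar>) * ?I" by (intro add_mono axis insert.IH)
    finally show ?case using insert(1,2) by (simp add: algebra_simps)
  qed
  from this[of UNIV] show ?thesis by (simp add: vec_sum_axis)
qed

lemma S0_representative:
  assumes S: "S0 u G"
  obtains u' where "integrable lborel u'" "u' \<in> borel_measurable borel"
    "AE x in lebesgue. u' x = (if x \<in> \<Omega> then u x else 0)"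
proof -
  have "integrable lebesgue (%x. if x \<in> \<Omega> then u x else 0)"
    using Lp_integrable(1)[OF S0D(1)[OF S]] lebesgue_on_zero_outside(2)[OF \<Omega>_sets, of u "%x. if x \<in> \<Omega> then u x else 0"] by auto
  then obtain u' where u': "integrable lborel u'" "u' \<in> borel_measurable borel"
    "AE x in lebesgue. (if x \<in> \<Omega> then u x else 0) = u' x" by (rule borel_representative)
  have "AE x in lebesgue. u' x = (if x \<in> \<Omega> then u x else 0)" using u'(3) by eventually_elim simp
  with u'(1,2) show ?thesis by (rule that)
qed

text \<open>A translation longer than the diameter, here by \<open>2 * r + 1\<close>, separates a
  test function from its copy. The L1 shift is then twice the L1 norm, while
  \<open>L1_shift_test_fun\<close> bounds it by the gradient.\<close>

lemma poincare:
  assumes "bounded \<Omega>"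
  obtains C where "0 <= C" "!!u G. S0 u G ==> (LINT x|M. \<bar>u x\<bar>) <= C * (LINT x|M. norm (G x))"
proof -
  obtain r where r: "r > 0" "!!x. x \<in> \<Omega> ==> norm x <= r" using assms by (auto simp: bounded_pos)
  define t where "t = 2 * r + 1"
  obtain j :: 'n where True by blast
  let ?e = "axis j 1 :: real^'n"
  have test: "2 * (LINT x|M. \<bar>\<phi> x\<bar>) <= t * (LINT x|M. norm (cgrad \<phi> x))" if \<phi>: "test_fun \<Omega> \<phi>" for \<phi>
  proof -
    note i = test_fun_integrable[OF \<phi>] and m = test_fun_measurable[OF \<phi>]
    have sep: "\<bar>\<phi> (x + t *\<^sub>R ?e) - \<phi> x\<bar> = \<bar>\<phi> (x + t *\<^sub>R ?e)\<bar> + \<bar>\<phi> x\<bar>" for x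
    proof (cases "\<phi> x = 0")
      case False
      then have x: "norm x <= r" using test_fun_zero[OF \<phi>, of x] r(2) by blast
      have "norm (t *\<^sub>R ?e) - norm x <= norm (t *\<^sub>R ?e + x)" by (rule norm_diff_ineq)
      moreover have "norm (t *\<^sub>R ?e) = t" using r(1) by (simp add: norm_axis_1 t_def)
      ultimately have "r < norm (x + t *\<^sub>R ?e)" using x by (simp add: t_def add.commute)
      then have "\<phi> (x + t *\<^sub>R ?e) = 0" using test_fun_zero[OF \<phi>] r(2) by (meson not_le)
      then show ?thesis by simp
    qed simp
    have "L1_shift \<phi> (t *\<^sub>R ?e) = (LINT x|lborel. \<bar>\<phi> (x + t *\<^sub>R ?e)\<bar>) + (LINT x|lborel. \<bar>\<phi> x\<bar>)"
      unfolding L1_shift_def sep using i integrable_lborel_translate[OF i] by simp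
    also have "... = 2 * (LINT x|lborel. \<bar>\<phi> x\<bar>)"
      using integral_lborel_translate[of "%x. \<bar>\<phi> x\<bar>" "t *\<^sub>R ?e"] m by simp
    also have "(LINT x|lborel. \<bar>\<phi> x\<bar>) = (LINT x|M. \<bar>\<phi> x\<bar>)"
    proof -
      have "(LINT x|M. \<bar>\<phi> x\<bar>) = (LINT x|lebesgue. \<bar>\<phi> x\<bar>)"
        using test_fun_zero[OF \<phi>] by (intro lebesgue_on_zero_outside(1) \<Omega>_sets) auto
      then show ?thesis using m by (simp add: integral_completion)
    qed
    finally have "2 * (LINT x|M. \<bar>\<phi> x\<bar>) <= \<bar>t\<bar> * (LINT x|lborel. \<bar>pd \<phi> j x\<bar>)"
      using L1_shift_test_fun[OF \<phi>, of t j] by simp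
    also have "... <= t * (LINT x|M. norm (cgrad \<phi> x))"
      using r(1) integral_pd_le[OF \<phi>] by (auto simp: t_def intro!: mult_left_mono)
    finally show ?thesis .
  qed
  have "(LINT x|M. \<bar>u x\<bar>) <= t * (LINT x|M. norm (G x))" if S: "S0 u G" for u G
  proof (rule field_le_epsilon)
    let ?I = "LINT x|M. norm (G x)"
    fix e :: real assume "0 < e"
    \<comment> \<open>Chosen such that \<open>t * e' = e - e'\<close>, which leaves
      \<open>e'\<close> for the approximation error of \<open>u\<close>.\<close>
    define e' where "e' = e / (t + 1)"
    have t: "t > 0" using r(1) by (simp add: t_def)
    have e': "0 < e'" using \<open>0 < e\<close> t by (simp add: e'_def)
    obtain u' where u': "integrable lborel u'" "u' \<in> borel_measurable borel"
      "AE x in lebesgue. u' x = (if x \<in> \<Omega> then u x else 0)" using S0_representative[OF S] .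
    obtain \<phi> where \<phi>: "test_fun \<Omega> \<phi>" "(LINT x|lborel. \<bar>u' x - \<phi> x\<bar>) < e'" "(LINT x|M. norm (cgrad \<phi> x)) < ?I + e'"
      "(LINT x|M. \<bar>u x - \<phi> x\<bar>) < e'"
      by (rule S0_L1_approx[OF S u' e'])
    have "(LINT x|M. \<bar>u x\<bar>) <= (LINT x|M. \<bar>\<phi> x\<bar>) + (LINT x|M. \<bar>u x - \<phi> x\<bar>)"
      using abs_integral_diff_le[OF Lp_integrable(1)[OF S0D(1)[OF S]] Lp_integrable(1)[OF Lp_test_fun(1)[OF \<phi>(1)]]] by simp
    moreover have "0 <= (LINT x|M. \<bar>\<phi> x\<bar>)" by simp
    moreover have "t * (LINT x|M. norm (cgrad \<phi> x)) <= t * (?I + e')" using \<phi>(3) t by (intro mult_left_mono) auto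
    moreover have "t * (?I + e') = t * ?I + (e - e')" using t by (simp add: e'_def field_simps)
    moreover have arith: "U <= t * ?I + e" if "U <= P + Q" "0 <= P" "2 * P <= Y" "Y <= Z" "Z = t * ?I + (e - e')" "Q < e'" for U P Q Y Z
      using that by linarith
    ultimately show "(LINT x|M. \<bar>u x\<bar>) <= t * ?I + e" using arith[OF _ _ test[OF \<phi>(1)] _ _ \<phi>(4)] by blast
  qed
  with r(1) show ?thesis by (intro that[of t]) (auto simp: t_def)
qed

end

section \<open>Cell averages on a cubic grid\<close>

definition cell :: "real => ('n => int) => (real^'n) set" where
  "cell \<delta> z = {x. \<forall>j. \<lfloor>x $ j / \<delta>\<rfloor> = z j}"

lemma cell_sets [measurable]: "cell d z \<in> sets borel"
  unfolding cell_def by measurable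

lemma emeasure_cell:
  assumes "d > 0"
  shows "emeasure lborel (cell d z :: (real^'n) set) = ennreal (d ^ CARD('n))"
proof -
  let ?a = "(\<chi> j. of_int (z j) * d) :: real^'n" and ?b = "(\<chi> j. (of_int (z j) + 1) * d) :: real^'n"
  have 1: "box ?a ?b \<subseteq> cell d z" and 2: "cell d z \<subseteq> cbox ?a ?b"
    using assms by (auto simp: cell_def mem_box_cart floor_eq_iff divide_simps less_imp_le)
  have prod: "(\<Prod>b\<in>Basis. (?b - ?a) \<bullet> b) = d ^ CARD('n)"
  proof -
    have "(\<Prod>b\<in>Basis. (?b - ?a) \<bullet> b) = (\<Prod>b\<in>(Basis :: (real^'n) set). d)"
      by (rule prod.cong) (auto simp: Basis_vec_def inner_axis algebra_simps)
    then show ?thesis by simp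
  qed
  have le: "?a \<bullet> b <= ?b \<bullet> b" if "b \<in> Basis" for b
    using that assms by (auto simp: Basis_vec_def inner_axis algebra_simps)
  have "emeasure lborel (box ?a ?b) = ennreal (d ^ CARD('n))" "emeasure lborel (cbox ?a ?b) = ennreal (d ^ CARD('n))"
    using emeasure_lborel_box[OF le] emeasure_lborel_cbox[OF le] unfolding prod by blast+
  then show ?thesis
    using emeasure_mono[OF 1, of lborel] emeasure_mono[OF 2, of lborel] by (auto intro: antisym)
qed

lemma cell_near: "d > 0 ==> x \<in> cell d z ==> y \<in> cell d z ==> \<bar>(y - x) $ j\<bar> <= d"
proof -
  assume d: "d > 0" and xy: "x \<in> cell d z" "y \<in> cell d z"
  have "\<bar>y $ j / d - x $ j / d\<bar> <= 1"
    using xy floor_correct[of "x $ j / d"] floor_correct[of "y $ j / d"] by (auto simp: cell_def)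
  then have "\<bar>(y $ j - x $ j) / d\<bar> <= 1" by (simp add: diff_divide_distrib)
  then show ?thesis using d by (simp add: abs_divide divide_le_eq)
qed

text \<open>Cells cut by the boundary are divided by their full volume too, so this is the mean of
  the extension by zero and the translation estimate applies to all cells alike.\<close>

definition cell_average :: "real => (real^'n) set => (real^'n => real) => ('n => int) => real" where
  "cell_average \<delta> \<Omega> u z = (LINT x|lebesgue_on \<Omega>. indicator (cell \<delta> z) x * u x) / \<delta> ^ CARD('n)"

text \<open>Averaging over cells is an integral operator whose kernel, as a function of
  \<open>y - x\<close>, is dominated by the indicator of the cube with coordinates in
  \<open>{-d..d}\<close> divided by the volume of a cell. The factor \<open>2 ^ CARD('n)\<close> is
  the ratio of the two volumes.\<close>

lemma cell_average_error:
  fixes h :: "real^'n => real"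
  assumes h: "integrable lborel h" and [measurable]: "h \<in> borel_measurable borel" and "d > 0" "0 <= S"
    and S: "!!z. (!!j. \<bar>z $ j\<bar> <= d) ==> L1_shift h z <= S"
  shows "(\<integral>\<^sup>+x. ennreal \<bar>(LINT y|lborel. indicator (cell d (%j. \<lfloor>x $ j / d\<rfloor>)) y * h y) / d ^ CARD('n) - h x\<bar> \<partial>lborel)
     <= ennreal (2 ^ CARD('n) * S)"
proof -
  let ?N = "CARD('n)"
  let ?V = "d ^ ?N"
  let ?c = "%x. cell d (%j. \<lfloor>x $ j / d\<rfloor>) :: (real^'n) set"
  let ?k = "%x y. ennreal (indicator (?c x) y / ?V)"
  have V: "?V > 0" using \<open>d > 0\<close> by simp
  have mem: "y \<in> ?c x \<longleftrightarrow> (\<forall>j. \<lfloor>y $ j / d\<rfloor> = \<lfloor>x $ j / d\<rfloor>)" for x y by (simp add: cell_def)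
  have self: "x \<in> ?c x" for x by (simp add: mem)
  have bd: "ennreal \<bar>(LINT y|lborel. indicator (?c x) y * h y) / ?V - h x\<bar> <= (\<integral>\<^sup>+y. ?k x y * ennreal \<bar>h y - h x\<bar> \<partial>lborel)" for x
  proof -
    have e: "emeasure lborel (?c x) = ennreal ?V" by (rule emeasure_cell[OF \<open>d > 0\<close>])
    then have m: "measure lborel (?c x) = ?V" using V by (simp add: measure_def)
    have i1: "integrable lborel (%y. indicator (?c x) y * h y)"
      using integrable_mult_indicator[OF _ h, of "?c x"] by simp
    have i2: "integrable lborel (%y. indicator (?c x) y * h x)"
      using e by (intro integrable_mult_left integrable_real_indicator) auto
    have "(LINT y|lborel. indicator (?c x) y * h y) / ?V - h x
       = ((LINT y|lborel. indicator (?c x) y * h y) - (LINT y|lborel. indicator (?c x) y * h x)) / ?V"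
      using m V \<open>d > 0\<close> by (simp add: diff_divide_distrib)
    also have "... = (LINT y|lborel. (indicator (?c x) y * h y - indicator (?c x) y * h x) / ?V)"
      using i1 i2 by simp
    finally have eq: "(LINT y|lborel. indicator (?c x) y * h y) / ?V - h x = (LINT y|lborel. (indicator (?c x) y * h y - indicator (?c x) y * h x) / ?V)" .
    have "ennreal (norm (LINT y|lborel. (indicator (?c x) y * h y - indicator (?c x) y * h x) / ?V))
        <= (\<integral>\<^sup>+y. ennreal (norm ((indicator (?c x) y * h y - indicator (?c x) y * h x) / ?V)) \<partial>lborel)"
      using i1 i2 by (intro integral_norm_bound_ennreal) auto
    moreover have "ennreal (norm ((indicator (?c x) y * h y - indicator (?c x) y * h x) / ?V)) = ?k x y * ennreal \<bar>h y - h x\<bar>" for y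
      using V by (cases "y \<in> ?c x") (auto simp: ennreal_mult[symmetric])
    ultimately show ?thesis using eq by simp
  qed
  let ?Z = "cbox (\<chi> j. - d) (\<chi> j. d) :: (real^'n) set"
  have "(\<integral>\<^sup>+x. ennreal \<bar>(LINT y|lborel. indicator (?c x) y * h y) / ?V - h x\<bar> \<partial>lborel)
     <= (\<integral>\<^sup>+x. \<integral>\<^sup>+y. ?k x y * ennreal \<bar>h y - h x\<bar> \<partial>lborel \<partial>lborel)"
    by (intro nn_integral_mono bd)
  also have "... <= (\<integral>\<^sup>+z. ennreal (indicator ?Z z / ?V) \<partial>lborel) * ennreal S"
  proof (rule L1_kernel_estimate)
    have "(%(x, y). ?k x y) = (%(x, y). if \<forall>j. \<lfloor>y $ j / d\<rfloor> = \<lfloor>x $ j / d\<rfloor> then ennreal (1 / ?V) else 0)"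
      by (auto simp: fun_eq_iff mem indicator_def)
    moreover have "(%(x, y). if \<forall>j. \<lfloor>y $ j / d\<rfloor> = \<lfloor>x $ j / d\<rfloor> then ennreal (1 / ?V) else 0)
        \<in> borel_measurable ((borel :: (real^'n) measure) \<Otimes>\<^sub>M (borel :: (real^'n) measure))"
      by measurable
    ultimately show "(%(x, y). ?k x y) \<in> borel_measurable (borel \<Otimes>\<^sub>M borel)" by simp
    show "?k x y <= ennreal (indicator ?Z (y - x) / ?V)" for x y
    proof (cases "y \<in> ?c x")
      case True
      have "- d <= (y - x) $ j & (y - x) $ j <= d" for j
        using cell_near[OF \<open>d > 0\<close> self True, of j] by arith
      then have "y - x \<in> ?Z" by (simp add: mem_box_cart)
      then show ?thesis using V by (intro ennreal_leI) (auto split: split_indicator)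
    qed simp
    fix z assume "ennreal (indicator ?Z z / ?V) ~= 0"
    then have "\<bar>z $ j\<bar> <= d" for j by (cases "z \<in> ?Z") (auto simp: mem_box_cart abs_le_iff minus_le_iff)
    then have "L1_shift h z <= S" by (rule S)
    moreover have "(\<integral>\<^sup>+x. ennreal \<bar>h (x + z) - h x\<bar> \<partial>lborel) = ennreal (L1_shift h z)"
      unfolding L1_shift_def using h integrable_lborel_translate[OF h] by (intro nn_integral_eq_integral) auto
    ultimately show "(\<integral>\<^sup>+x. ennreal \<bar>h (x + z) - h x\<bar> \<partial>lborel) <= ennreal S" by (simp add: ennreal_leI)
  qed auto
  also have "(\<integral>\<^sup>+z. ennreal (indicator ?Z z / ?V) \<partial>lborel) = ennreal (2 ^ ?N)"
  proof -
    have le: "(\<chi> j. - d) \<bullet> b <= ((\<chi> j. d) :: real^'n) \<bullet> b" if "b \<in> Basis" for b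
      using that \<open>d > 0\<close> by (auto simp: Basis_vec_def inner_axis)
    have "(\<Prod>b\<in>Basis. ((\<chi> j. d) - (\<chi> j. - d) :: real^'n) \<bullet> b) = (\<Prod>b\<in>(Basis :: (real^'n) set). 2 * d)"
      by (rule prod.cong) (auto simp: Basis_vec_def inner_axis)
    then have e: "emeasure lborel ?Z = ennreal ((2 * d) ^ ?N)"
      using le by (simp add: emeasure_lborel_cbox)
    have "(\<integral>\<^sup>+z. ennreal (indicator ?Z z / ?V) \<partial>lborel) = (\<integral>\<^sup>+z. ennreal (1 / ?V) * indicator ?Z z \<partial>lborel)"
      by (intro nn_integral_cong) (auto simp: indicator_def)
    also have "... = ennreal (1 / ?V) * ennreal ((2 * d) ^ ?N)" using e by (simp add: nn_integral_cmult)
    also have "... = ennreal (2 ^ ?N)"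
      using V \<open>d > 0\<close> by (simp add: ennreal_mult[symmetric] power_mult_distrib)
    finally show ?thesis .
  qed
  also have "ennreal (2 ^ ?N) * ennreal S = ennreal (2 ^ ?N * S)" using \<open>0 <= S\<close> by (simp add: ennreal_mult)
  finally show ?thesis .
qed

lemma finite_cells:
  assumes "bounded \<Omega>" "d > 0"
  shows "finite ((%x j. \<lfloor>x $ j / d\<rfloor>) ` (\<Omega> :: (real^'n) set))"
proof -
  obtain r where r: "!!x. x \<in> \<Omega> ==> norm x <= r" using assms by (auto simp: bounded_iff)
  have "(%j. \<lfloor>x $ j / d\<rfloor>) \<in> (UNIV \<rightarrow>\<^sub>E {\<lfloor>- r / d\<rfloor>..\<lfloor>r / d\<rfloor>})" if "x \<in> \<Omega>" for x
  proof -
    have "\<bar>x $ j\<bar> <= r" for j using component_le_norm_cart[of x j] r[OF that] by linarith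
    then have "- r <= x $ j" "x $ j <= r" for j by (auto simp: abs_le_iff minus_le_iff)
    then have "\<lfloor>- r / d\<rfloor> <= \<lfloor>x $ j / d\<rfloor> & \<lfloor>x $ j / d\<rfloor> <= \<lfloor>r / d\<rfloor>" for j
      using assms(2) by (intro conjI floor_mono divide_right_mono) auto
    then show ?thesis by (simp only: PiE_UNIV_domain Pi_iff atLeastAtMost_iff) blast
  qed
  then have "(%x j. \<lfloor>x $ j / d\<rfloor>) ` \<Omega> \<subseteq> (UNIV \<rightarrow>\<^sub>E {\<lfloor>- r / d\<rfloor>..\<lfloor>r / d\<rfloor>})" by blast
  then show ?thesis by (rule finite_subset) (simp add: finite_PiE)
qed

lemma cell_average_bounded:
  fixes u :: "real^'n => real"
  assumes "open \<Omega>" "bounded \<Omega>" "u \<in> borel_measurable (lebesgue_on \<Omega>)" "AE x in lebesgue_on \<Omega>. \<bar>u x\<bar> <= C" "0 <= C" "d > 0"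
  shows "\<bar>cell_average d \<Omega> u z\<bar> <= C"
proof -
  let ?V = "d ^ CARD('n)"
  let ?I = "indicator (cell d z) :: real^'n => real"
  have s: "\<Omega> \<in> sets lebesgue" "\<Omega> \<in> lmeasurable" using assms(1,2) by (auto intro: lmeasurable_open)
  interpret finite_measure "lebesgue_on \<Omega>" using s(2) by (rule finite_measure_lebesgue_on)
  have mI: "?I \<in> borel_measurable (lebesgue_on \<Omega>)"
  proof -
    have "?I \<in> borel_measurable lborel" by simp
    then have "?I \<in> borel_measurable lebesgue" by (rule measurable_completion)
    then show ?thesis by (rule measurable_restrict_space1)
  qed
  have iI: "integrable (lebesgue_on \<Omega>) (%x. C * ?I x)"
    by (intro integrable_const_bound[where B=C]) (use mI \<open>0 <= C\<close> in \<open>auto split: split_indicator\<close>)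
  have V: "?V > 0" using \<open>d > 0\<close> by simp
  have "\<bar>\<integral>x. ?I x * u x \<partial>lebesgue_on \<Omega>\<bar> <= (LINT x|lebesgue_on \<Omega>. C * ?I x)"
  proof -
    have bd: "AE x in lebesgue_on \<Omega>. norm (?I x * u x) <= C * ?I x"
      using assms(4) by eventually_elim (auto simp: indicator_def)
    have "integrable (lebesgue_on \<Omega>) (%x. ?I x * u x)"
      by (rule Bochner_Integration.integrable_bound[OF iI]) (use bd mI assms(3) in \<open>auto elim!: eventually_mono\<close>)
    then show ?thesis using integral_norm_bound[of "lebesgue_on \<Omega>" "%x. ?I x * u x"] bd iI
      by (intro order.trans[OF _ integral_mono_AE[OF _ iI bd]]) auto
  qed
  also have "... = C * (LINT x|lebesgue_on \<Omega>. ?I x)" by simp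
  also have "... <= C * ?V"
  proof (rule mult_left_mono[OF _ \<open>0 <= C\<close>])
    have "emeasure lebesgue (cell d z :: (real^'n) set) = ennreal ?V" using emeasure_cell[OF \<open>d > 0\<close>, of z] by simp
    then have m: "measure lebesgue (cell d z :: (real^'n) set) = ?V" and i: "integrable lebesgue ?I"
      using V by (auto simp: measure_def intro!: integrable_real_indicator)
    have "(LINT x|lebesgue_on \<Omega>. ?I x) = (LINT x|lebesgue. indicator \<Omega> x *\<^sub>R ?I x)"
      using s by (intro integral_restrict_space) auto
    also have "... <= (LINT x|lebesgue. ?I x)"
      using s i by (intro integral_mono integrable_mult_indicator) (auto split: split_indicator)
    also have "... = ?V" using m by simp
    finally show "(LINT x|lebesgue_on \<Omega>. ?I x) <= ?V" .
  qed
  finally show ?thesis using V by (simp add: cell_average_def abs_divide divide_le_eq)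
qed

section \<open>Compactness and energy minimisers\<close>

lemma test_fun_zero_fun: "test_fun \<Omega> (%_ :: real^'n. 0)"
proof -
  have "Ck_on k UNIV (%_ :: real^'n. 0)" for k
    using Ck_on_mult_add[OF Ck_on_bump Ck_on_bump, of k 0 0] by simp
  then show ?thesis by (simp add: test_fun_def)
qed

locale bounded_sobolev = sobolev \<Omega> p pm P
  for \<Omega> :: "(real^'n) set" and p :: "real^'n => real" and pm P :: real +
  assumes bounded_\<Omega>: "bounded \<Omega>"
begin

abbreviation grid :: "real => real^'n => 'n => int" where
  "grid \<delta> x \<equiv> (%j. \<lfloor>x $ j / \<delta>\<rfloor>)"

definition step_fun :: "real => (('n => int) => real) => real^'n => real" where
  "step_fun \<delta> a x = (\<Sum>z\<in>grid \<delta> ` \<Omega>. a z * indicator (cell \<delta> z) x)"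

lemma finite_grid: "d > 0 ==> finite (grid d ` \<Omega>)"
  by (rule finite_cells[OF bounded_\<Omega>])

lemma step_fun_eval:
  assumes "d > 0" "x \<in> \<Omega>" shows "step_fun d a x = a (grid d x)"
proof -
  have "a z * indicator (cell d z) x = (if z = grid d x then a z else 0)" for z
    by (auto simp: cell_def indicator_def fun_eq_iff)
  then show ?thesis unfolding step_fun_def using finite_grid[OF assms(1)] assms(2) by (simp add: sum.delta)
qed

lemma step_fun_measurable: "step_fun d a \<in> borel_measurable M"
proof -
  have "step_fun d a \<in> borel_measurable lborel" unfolding step_fun_def[abs_def] by measurable
  then have "step_fun d a \<in> borel_measurable lebesgue" by (rule measurable_completion)
  then show ?thesis by (rule measurable_restrict_space1)
qed

lemma step_fun_error:
  assumes S: "S0 u G" and "d > 0"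
  shows "(LINT x|M. \<bar>step_fun d (cell_average d \<Omega> u) x - u x\<bar>) <= 2 ^ CARD('n) * (real CARD('n) * d * (LINT x|M. norm (G x)))"
proof -
  let ?S = "real CARD('n) * d * (LINT x|M. norm (G x))"
  obtain u' where u': "integrable lborel u'" "u' \<in> borel_measurable borel"
    "AE x in lebesgue. u' x = (if x \<in> \<Omega> then u x else 0)" using S0_representative[OF S] .
  have I0: "0 <= (LINT x|M. norm (G x))" by simp
  have S0': "0 <= ?S" using \<open>d > 0\<close> I0 by (intro mult_nonneg_nonneg) auto
  have sh: "L1_shift u' z <= ?S" if "!!j. \<bar>z $ j\<bar> <= d" for z
  proof -
    have "(\<Sum>j\<in>UNIV. \<bar>z $ j\<bar>) <= (\<Sum>j\<in>(UNIV :: 'n set). d)" using that by (intro sum_mono) auto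
    then have "(\<Sum>j\<in>UNIV. \<bar>z $ j\<bar>) * (LINT x|M. norm (G x)) <= (real CARD('n) * d) * (LINT x|M. norm (G x))"
      using I0 by (intro mult_right_mono) auto
    with S0_shift[OF S u', of z] show ?thesis by simp
  qed
  have av: "(LINT y|lborel. indicator (cell d z) y * u' y) / d ^ CARD('n) = cell_average d \<Omega> u z" for z
  proof -
    let ?I = "indicator (cell d z) :: real^'n => real"
    have "(LINT y|lborel. ?I y * u' y) = (LINT y|lebesgue. ?I y * u' y)"
      using u'(2) by (simp add: integral_completion)
    also have "... = (LINT y|lebesgue. (if y \<in> \<Omega> then ?I y * u y else 0))"
    proof (rule integral_cong_AE)
      show "AE y in lebesgue. ?I y * u' y = (if y \<in> \<Omega> then ?I y * u y else 0)"
        using u'(3) by eventually_elim auto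
      have "(%y. ?I y * u' y) \<in> borel_measurable lborel" using u'(2) by simp
      then show "(%y. ?I y * u' y) \<in> borel_measurable lebesgue" by (rule measurable_completion)
      have "?I \<in> borel_measurable lborel" by simp
      then have "?I \<in> borel_measurable M" by (intro measurable_restrict_space1 measurable_completion)
      then have "(%y. ?I y * u y) \<in> borel_measurable M" using Lp_measurable[OF S0D(1)[OF S]] by simp
      then show "(%y. if y \<in> \<Omega> then ?I y * u y else 0) \<in> borel_measurable lebesgue"
        using \<Omega>_sets by (simp add: borel_measurable_if)
    qed
    also have "... = (LINT y|M. ?I y * u y)" by (intro lebesgue_on_zero_outside(1)[symmetric] \<Omega>_sets) auto
    finally show ?thesis by (simp add: cell_average_def)
  qed
  have "(\<integral>\<^sup>+x. ennreal \<bar>step_fun d (cell_average d \<Omega> u) x - u x\<bar> \<partial>M)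
      = (\<integral>\<^sup>+x. ennreal \<bar>step_fun d (cell_average d \<Omega> u) x - u x\<bar> * indicator \<Omega> x \<partial>lebesgue)"
    using \<Omega>_sets by (intro nn_integral_restrict_space) auto
  also have "... <= (\<integral>\<^sup>+x. ennreal \<bar>cell_average d \<Omega> u (grid d x) - u' x\<bar> \<partial>lebesgue)"
  proof (rule nn_integral_mono_AE)
    show "AE x in lebesgue. ennreal \<bar>step_fun d (cell_average d \<Omega> u) x - u x\<bar> * indicator \<Omega> x
        <= ennreal \<bar>cell_average d \<Omega> u (grid d x) - u' x\<bar>"
      using u'(3) by eventually_elim (use step_fun_eval[OF \<open>d > 0\<close>] in \<open>auto split: split_indicator\<close>)
  qed
  also have "... = (\<integral>\<^sup>+x. ennreal \<bar>cell_average d \<Omega> u (grid d x) - u' x\<bar> \<partial>lborel)"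
    by (rule nn_integral_completion)
  also have "... <= ennreal (2 ^ CARD('n) * ?S)"
    using cell_average_error[OF u'(1,2) \<open>d > 0\<close> S0' sh] unfolding av by simp
  finally have nn: "(\<integral>\<^sup>+x. ennreal \<bar>step_fun d (cell_average d \<Omega> u) x - u x\<bar> \<partial>M) <= ennreal (2 ^ CARD('n) * ?S)" .
  show ?thesis
    by (rule integrable_of_nn_integral_le(2)[OF _ nn])
      (use step_fun_measurable Lp_measurable[OF S0D(1)[OF S]] S0' in auto)
qed

lemma step_fun_integrable: "d > 0 ==> integrable M (step_fun d a)"
proof -
  assume d: "d > 0"
  have "\<bar>step_fun d a x\<bar> <= (\<Sum>z\<in>grid d ` \<Omega>. \<bar>a z\<bar>)" for x
    unfolding step_fun_def by (rule order.trans[OF sum_abs sum_mono]) (auto split: split_indicator)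
  then show ?thesis by (intro integrable_const_bound[OF _ step_fun_measurable]) auto
qed

lemma step_fun_diff_le:
  assumes "d > 0"
  shows "(LINT x|M. \<bar>step_fun d a x - step_fun d b x\<bar>) <= (\<Sum>z\<in>grid d ` \<Omega>. \<bar>a z - b z\<bar>) * measure M (space M)"
proof -
  have "(LINT x|M. \<bar>step_fun d a x - step_fun d b x\<bar>) <= (LINT x|M. (\<Sum>z\<in>grid d ` \<Omega>. \<bar>a z - b z\<bar>))"
  proof (intro integral_mono)
    fix x
    have "step_fun d a x - step_fun d b x = (\<Sum>z\<in>grid d ` \<Omega>. (a z - b z) * indicator (cell d z) x)"
      by (simp add: step_fun_def left_diff_distrib sum_subtractf)
    also have "\<bar>...\<bar> <= (\<Sum>z\<in>grid d ` \<Omega>. \<bar>a z - b z\<bar>)"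
      by (rule order.trans[OF sum_abs sum_mono]) (auto split: split_indicator)
    finally show "\<bar>step_fun d a x - step_fun d b x\<bar> <= (\<Sum>z\<in>grid d ` \<Omega>. \<bar>a z - b z\<bar>)" .
  qed (use step_fun_integrable[OF assms] in auto)
  then show ?thesis by (simp add: mult.commute)
qed

text \<open>Rellich's theorem through step functions. The cell averages on all meshes are bounded
  numbers, so one diagonal subsequence makes all of them converge; the step functions differ from
  \<open>u k\<close> by a multiple of the mesh size, uniformly in \<open>k\<close>, so the
  subsequence is Cauchy in L1.\<close>

lemma S0_compactness:
  assumes S: "!!k. S0 (u k) (G k)" and R: "!!k. AE x in M. \<bar>u k x\<bar> <= R" "0 <= R"
    and I: "!!k. (LINT x|M. norm (G k x)) <= I"
  obtains r v where "strict_mono (r :: nat => nat)" "v \<in> borel_measurable M" "AE x in M. (%k. u (r k) x) ----> v x"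
proof -
  define d where "d m = inverse (real (Suc m))" for m
  have d: "!!m. d m > 0" "d ----> 0" unfolding d_def using LIMSEQ_inverse_real_of_nat by auto
  define Z where "Z m = grid (d m) ` \<Omega>" for m
  \<comment> \<open>A single index encodes mesh and cell. The enumeration of a finite set of cells
    by \<open>from_nat_into\<close> repeats cells, which is harmless.\<close>
  define a where "a k i = (case prod_decode i of (m, j) => cell_average (d m) \<Omega> (u k) (from_nat_into (Z m) j))" for k i
  have "\<bar>a k i\<bar> <= R" for k i
    unfolding a_def by (cases "prod_decode i")
      (auto intro!: cell_average_bounded[OF open_\<Omega> bounded_\<Omega> Lp_measurable[OF S0D(1)[OF S]] R] d)
  then obtain r where r: "strict_mono r" "!!i. convergent (%k. a (r k) i)"
    using bounded_diagonal_subsequence[of a "%_. R"] by blast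
  have conv: "convergent (%k. cell_average (d m) \<Omega> (u (r k)) z)" if "z \<in> Z m" for m z
  proof -
    have "countable (Z m)" unfolding Z_def by (rule countable_finite[OF finite_grid[OF d(1)]])
    from from_nat_into_surj[OF this that] obtain j where "from_nat_into (Z m) j = z" ..
    then show ?thesis using r(2)[of "prod_encode (m, j)"] by (simp add: a_def)
  qed
  define w where "w k = u (r k)" for k
  have Iw: "0 <= I" using I[of 0] by (rule order.trans[rotated]) simp
  have Lw: "Lp (w k)" for k unfolding w_def by (rule S0D(1)[OF S])
  have cauchy: "\<exists>N. \<forall>i\<ge>N. \<forall>j\<ge>N. (LINT x|M. norm (w i x - w j x)) < e" if "0 < e" for e :: real
  proof -
    define CN where "CN = 2 ^ CARD('n) * (real CARD('n) * I)"
    have "CN >= 0" using Iw by (simp add: CN_def)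
    have "(%m. CN * d m) ----> CN * 0" by (intro tendsto_intros d)
    then have "\<forall>\<^sub>F m in sequentially. CN * d m < e / 4" using \<open>0 < e\<close> by (intro order_tendstoD) auto
    from eventually_happens'[OF sequentially_bot this] obtain m where m: "CN * d m < e / 4" ..
    define A where "A k = cell_average (d m) \<Omega> (w k)" for k
    define L where "L z = lim (%k. A k z)" for z
    have "(%k. A k z) ----> L z" if "z \<in> Z m" for z
      using conv[OF that] by (simp add: A_def w_def L_def convergent_LIMSEQ_iff)
    then have "(%k. (\<Sum>z\<in>Z m. \<bar>A k z - L z\<bar>) * measure M (space M)) ----> (\<Sum>z\<in>Z m. \<bar>L z - L z\<bar>) * measure M (space M)"
      by (intro tendsto_intros) auto
    then have "\<forall>\<^sub>F k in sequentially. (\<Sum>z\<in>Z m. \<bar>A k z - L z\<bar>) * measure M (space M) < e / 4"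
      using \<open>0 < e\<close> by (intro order_tendstoD) auto
    then obtain N where N: "!!k. k >= N ==> (\<Sum>z\<in>Z m. \<bar>A k z - L z\<bar>) * measure M (space M) < e / 4"
      unfolding eventually_sequentially by blast
    have err: "(LINT x|M. norm (step_fun (d m) (A k) x - w k x)) < e / 4" for k
    proof -
      have "(LINT x|M. norm (step_fun (d m) (A k) x - w k x)) <= 2 ^ CARD('n) * (real CARD('n) * d m * (LINT x|M. norm (G (r k) x)))"
        using step_fun_error[OF S[of "r k"] d(1)[of m]] by (simp add: A_def w_def)
      also have "... <= 2 ^ CARD('n) * (real CARD('n) * d m * I)"
        using I[of "r k"] d(1)[of m] by (intro mult_left_mono) auto
      also have "... = CN * d m" by (simp add: CN_def)
      finally show ?thesis using m by simp
    qed
    have "(LINT x|M. norm (w i x - w j x)) < e" if ij: "i >= N" "j >= N" for i j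
    proof -
      let ?s = "%k. step_fun (d m) (A k)" and ?l = "step_fun (d m) L"
      note sti = step_fun_integrable[OF d(1)] and iw = Lp_integrable(1)[OF Lw]
      have sl: "(LINT x|M. norm (?s k x - ?l x)) < e / 4" if "k >= N" for k
        using step_fun_diff_le[OF d(1), of m "A k" L] N[OF that] by (simp add: Z_def)
      have "(LINT x|M. norm (w i x - w j x)) <= (LINT x|M. norm (?s i x - w i x) + norm (?s i x - ?l x) + norm (?s j x - ?l x) + norm (?s j x - w j x))"
        using sti iw by (intro integral_mono Bochner_Integration.integrable_add integrable_norm Bochner_Integration.integrable_diff) auto
      also have "... = (LINT x|M. norm (?s i x - w i x)) + (LINT x|M. norm (?s i x - ?l x)) + (LINT x|M. norm (?s j x - ?l x)) + (LINT x|M. norm (?s j x - w j x))"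
        using sti iw by (simp add: integral_add)
      finally show ?thesis using err[of i] err[of j] sl[OF ij(1)] sl[OF ij(2)] by linarith
    qed
    then show ?thesis by blast
  qed
  obtain s where s: "strict_mono (s :: nat => nat)" "AE x in M. Cauchy (%i. w (s i) x)"
    by (rule cauchy_L1_AE_cauchy_subseq[OF Lp_integrable(1)[OF Lw] cauchy])
  have [measurable]: "w k \<in> borel_measurable M" for k by (rule Lp_measurable[OF Lw])
  define v where "v x = lim (%i. w (s i) x)" for x
  have "v \<in> borel_measurable M" unfolding v_def[abs_def] by measurable
  moreover have "AE x in M. (%i. u (r (s i)) x) ----> v x"
    using s(2) by eventually_elim (simp add: v_def w_def convergent_LIMSEQ_iff Cauchy_convergent_iff)
  moreover have "strict_mono (%i. r (s i))" using r(1) s(1) by (simp add: strict_mono_def)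
  ultimately show ?thesis using that[of "%i. r (s i)" v] by simp
qed

section \<open>Energy minimisation under a sup bound\<close>

definition admissible :: "real => (real^'n => real) => (real^'n => real^'n) => bool" where
  "admissible R u G \<longleftrightarrow> S0 u G & (AE x in M. \<bar>u x\<bar> <= R)"

definition energy :: "(real^'n => real) => (real^'n => real) => (real^'n => real^'n) => real" where
  "energy h u G = (LINT x|M. norm (G x) powr p x / p x) - (LINT x|M. h x * u x)"

definition min_energy :: "real => (real^'n => real) => real" where
  "min_energy R h = Inf {energy h u G |u G. admissible R u G}"

lemma admissible_zero: "0 <= R ==> admissible R (%_. 0) (%_. 0)"
proof -
  have "cgrad (%_ :: real^'n. 0) = (%_. 0)"
    using pd_eqI[of "%_. 0" _ _ 0] by (auto simp: vec_eq_iff fun_eq_iff)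
  then show "0 <= R ==> ?thesis"
    using S0_test_fun[OF test_fun_zero_fun] by (simp add: admissible_def)
qed

lemma admissible_midpoint:
  assumes "admissible R u G" "admissible R v V"
  shows "admissible R (%x. (1/2) * u x + (1/2) * v x) (%x. (1/2) *\<^sub>R G x + (1/2) *\<^sub>R V x)"
proof -
  have "AE x in M. \<bar>u x\<bar> <= R" "AE x in M. \<bar>v x\<bar> <= R" using assms by (auto simp: admissible_def)
  then have "AE x in M. \<bar>(1/2) * u x + (1/2) * v x\<bar> <= R" by eventually_elim auto
  moreover have "S0 (%x. (1/2) * u x + (1/2) * v x) (%x. (1/2) *\<^sub>R G x + (1/2) *\<^sub>R V x)"
    using assms by (intro S0_mult_add) (auto simp: admissible_def)
  ultimately show ?thesis by (simp add: admissible_def)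
qed

lemma integrable_energy_density:
  assumes "Lp G" shows "integrable M (%x. norm (G x) powr p x / p x)" "mo G <= P * (LINT x|M. norm (G x) powr p x / p x)"
proof -
  have [measurable]: "G \<in> borel_measurable M" using assms by (rule Lp_measurable)
  show i: "integrable M (%x. norm (G x) powr p x / p x)"
  proof (rule Bochner_Integration.integrable_bound[OF Lp_integrable_powr[OF assms]])
    show "AE x in M. norm (norm (G x) powr p x / p x) <= norm (norm (G x) powr p x)"
    proof (rule AE_I2, goal_cases)
      case (1 x)
      then have "1 < p x" by (rule p_ge1)
      then have "norm (G x) powr p x / p x <= norm (G x) powr p x / 1" by (intro divide_left_mono) auto
      then show ?case using \<open>1 < p x\<close> by simp
    qed
  qed simp
  have "mo G <= (LINT x|M. P * (norm (G x) powr p x / p x))"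
    unfolding mo_def
  proof (rule integral_mono_AE[OF Lp_integrable_powr[OF assms]])
    show "AE x in M. norm (G x) powr p x <= P * (norm (G x) powr p x / p x)"
    proof (rule AE_I2, goal_cases)
      case (1 x)
      then have "1 < p x" "p x <= P" by (auto intro: p_ge1 p_le)
      then have "p x * (norm (G x) powr p x / p x) <= P * (norm (G x) powr p x / p x)" by (intro mult_right_mono) auto
      then show ?case using \<open>1 < p x\<close> by simp
    qed
  qed (rule integrable_mult_right[OF i])
  also have "... = P * (LINT x|M. norm (G x) powr p x / p x)" by (rule integral_mult_right_zero)
  finally show "mo G <= P * (LINT x|M. norm (G x) powr p x / p x)" .
qed

definition forcing :: "real => (real^'n => real) => bool" where
  "forcing H h \<longleftrightarrow> h \<in> borel_measurable M & (AE x in M. \<bar>h x\<bar> <= H)"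

lemma integrable_forcing_mult:
  assumes h: "forcing H h" and u: "integrable M u"
  shows "integrable M (%x. h x * u x)"
proof (rule Bochner_Integration.integrable_bound)
  show "integrable M (%x. H * u x)" using u by simp
  show "AE x in M. norm (h x * u x) <= norm (H * u x)"
    using h unfolding forcing_def by (auto elim!: eventually_mono simp: abs_mult intro!: mult_right_mono)
qed (use h u in \<open>auto simp: forcing_def\<close>)

lemma forcing_integral_bound:
  assumes h: "forcing H h" and u: "u \<in> borel_measurable M" "AE x in M. \<bar>u x\<bar> <= R" and "0 <= H" "0 <= R"
  shows "\<bar>\<integral>x. h x * u x \<partial>M\<bar> <= H * R * measure M (space M)"
proof -
  have i: "integrable M u" using Lp_integrable(1)[OF Lp_bounded[OF u(1), of R]] u(2) by simp
  have "\<bar>\<integral>x. h x * u x \<partial>M\<bar> <= (LINT x|M. \<bar>h x * u x\<bar>)"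
    using integral_norm_bound[of M "%x. h x * u x"] by simp
  also have "... <= (LINT x|M. H * R)"
  proof (rule integral_mono_AE)
    have "AE x in M. \<bar>h x\<bar> <= H" using h by (simp add: forcing_def)
    with u(2) show "AE x in M. \<bar>h x * u x\<bar> <= H * R"
      by eventually_elim (auto simp: abs_mult intro!: mult_mono \<open>0 <= H\<close>)
  qed (use integrable_forcing_mult[OF h i] in auto)
  finally show ?thesis by (simp add: mult.commute mult.left_commute)
qed

text \<open>The sup bound on \<open>u\<close> bounds the linear term, so the energy controls the
  modular of the gradient without a Sobolev inequality.\<close>

lemma energy_lower_bound:
  assumes h: "forcing H h" and a: "admissible R u G" and "0 <= H" "0 <= R"
  shows "mo G <= P * (energy h u G + H * R * measure M (space M))" "- (H * R * measure M (space M)) <= energy h u G"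
proof -
  have S: "S0 u G" and u: "AE x in M. \<bar>u x\<bar> <= R" using a by (auto simp: admissible_def)
  have b: "\<bar>\<integral>x. h x * u x \<partial>M\<bar> <= H * R * measure M (space M)"
    by (rule forcing_integral_bound[OF h Lp_measurable[OF S0D(1)[OF S]] u assms(3,4)])
  have "mo G <= P * (LINT x|M. norm (G x) powr p x / p x)" by (rule integrable_energy_density(2)[OF S0D(2)[OF S]])
  also have "... <= P * (energy h u G + H * R * measure M (space M))"
    using b P_gt1 by (intro mult_left_mono) (auto simp: energy_def)
  finally show "mo G <= P * (energy h u G + H * R * measure M (space M))" .
  have "0 <= (LINT x|M. norm (G x) powr p x / p x)"
    by (intro integral_nonneg_AE AE_I2) (use p_ge1 in \<open>fastforce intro: divide_nonneg_pos\<close>)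
  then show "- (H * R * measure M (space M)) <= energy h u G" using b by (simp add: energy_def)
qed

lemma min_energy_le:
  assumes "forcing H h" "admissible R u G" "0 <= H" "0 <= R"
  shows "min_energy R h <= energy h u G"
  unfolding min_energy_def
proof (rule cInf_lower)
  show "bdd_below {energy h u G |u G. admissible R u G}"
    using energy_lower_bound(2)[OF assms(1) _ assms(3,4)] by (intro bdd_belowI[of _ "- (H * R * measure M (space M))"]) blast
qed (use assms(2) in blast)

text \<open>Minimality is tested with the midpoint, where the linear terms cancel. Passing from the
  gap divided by \<open>p x\<close> to the gap itself costs the factor \<open>P\<close>.\<close>

lemma energy_gap:
  assumes h: "forcing H h" and u: "admissible R u G" and v: "admissible R v V" and "0 <= H" "0 <= R"
  shows "(LINT x|M. convexity_gap (p x) (G x) (V x)) <= P / 2 * (energy h u G + energy h v V - 2 * min_energy R h)"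
proof -
  let ?c = "%x. convexity_gap (p x) (G x) (V x)"
  have Su: "S0 u G" and Sv: "S0 v V" using u v by (auto simp: admissible_def)
  note LG = S0D(2)[OF Su] and LV = S0D(2)[OF Sv]
  let ?m = "%x. (1/2) *\<^sub>R G x + (1/2) *\<^sub>R V x"
  have Lm: "Lp ?m" by (intro Lp_add Lp_scaleR LG LV)
  note iG = integrable_energy_density(1)[OF LG] and iV = integrable_energy_density(1)[OF LV] and im = integrable_energy_density(1)[OF Lm]
  have iu: "integrable M (%x. h x * u x)" and iv: "integrable M (%x. h x * v x)"
    using integrable_forcing_mult[OF h] Lp_integrable(1) S0D(1)[OF Su] S0D(1)[OF Sv] by auto
  have "min_energy R h <= energy h (%x. (1/2) * u x + (1/2) * v x) ?m"
    by (rule min_energy_le[OF h admissible_midpoint[OF u v] assms(4,5)])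
  moreover have "(LINT x|M. h x * ((1/2) * u x + (1/2) * v x)) = ((LINT x|M. h x * u x) + (LINT x|M. h x * v x)) / 2"
  proof -
    have "(LINT x|M. h x * ((1/2) * u x + (1/2) * v x)) = (LINT x|M. (1/2) * (h x * u x) + (1/2) * (h x * v x))"
      by (simp add: algebra_simps)
    also have "... = (1/2) * (LINT x|M. h x * u x) + (1/2) * (LINT x|M. h x * v x)" using iu iv by simp
    finally show ?thesis by simp
  qed
  ultimately have "2 * ((LINT x|M. norm (G x) powr p x / p x) + (LINT x|M. norm (V x) powr p x / p x)) - 4 * (LINT x|M. norm (?m x) powr p x / p x)
     <= 2 * (energy h u G + energy h v V - 2 * min_energy R h)" by (simp add: energy_def)
  moreover have "4 * (LINT x|M. ?c x / p x)
     = 2 * ((LINT x|M. norm (G x) powr p x / p x) + (LINT x|M. norm (V x) powr p x / p x)) - 4 * (LINT x|M. norm (?m x) powr p x / p x)"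
  proof -
    have "(LINT x|M. ?c x / p x)
      = (LINT x|M. (1/2) * (norm (G x) powr p x / p x) + (1/2) * (norm (V x) powr p x / p x) - norm (?m x) powr p x / p x)"
      by (simp add: convexity_gap_def scaleR_add_right diff_divide_distrib add_divide_distrib)
    also have "... = (1/2) * (LINT x|M. norm (G x) powr p x / p x) + (1/2) * (LINT x|M. norm (V x) powr p x / p x) - (LINT x|M. norm (?m x) powr p x / p x)"
    proof -
      have "(LINT x|M. (1/2) * f x + (1/2) * g x - k x) = (1/2) * (LINT x|M. f x) + (1/2) * (LINT x|M. g x) - (LINT x|M. k x)"
        if "integrable M f" "integrable M g" "integrable M k" for f g k :: "real^'n => real"
        using that by simp
      from this[OF iG iV im] show ?thesis .
    qed
    finally show ?thesis by simp
  qed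
  moreover have "(LINT x|M. ?c x) <= P * (LINT x|M. ?c x / p x)"
  proof -
    have ic: "integrable M (%x. ?c x)" by (rule gap_integrable[OF LG LV])
    have ic': "integrable M (%x. ?c x / p x)"
    proof (rule Bochner_Integration.integrable_bound[OF ic])
      show "AE x in M. norm (?c x / p x) <= norm (?c x)"
      proof (rule AE_I2, goal_cases)
        case (1 x)
        then have "1 < p x" by (rule p_ge1)
        then show ?case
          using divide_left_mono[of 1 "p x" "\<bar>?c x\<bar>"] by (simp add: abs_divide)
      qed
    qed (use borel_measurable_integrable[OF ic] in simp)
    have "(LINT x|M. ?c x) <= (LINT x|M. P * (?c x / p x))"
    proof (rule integral_mono_AE[OF ic])
      show "AE x in M. ?c x <= P * (?c x / p x)"
      proof (rule AE_I2, goal_cases)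
        case x: (1 x)
        then have "1 < p x" "p x <= P" by (auto intro: p_ge1 p_le)
        then have "p x * (?c x / p x) <= P * (?c x / p x)"
          using convexity_gap_nonneg[of "p x" "G x" "V x"] by (intro mult_right_mono) auto
        then show ?case using \<open>1 < p x\<close> by simp
      qed
    qed (rule integrable_mult_right[OF ic'])
    also have "... = P * (LINT x|M. ?c x / p x)" by (rule integral_mult_right_zero)
    finally show ?thesis .
  qed
  moreover have "P * (LINT x|M. ?c x / p x) <= P * ((energy h u G + energy h v V - 2 * min_energy R h) / 2)"
    using calculation(1,2) P_gt1 by (intro mult_left_mono) auto
  ultimately show ?thesis by simp
qed

text \<open>The order of choices matters: \<open>B\<close> bounds the modulars of all near
  minimisers, \<delta> makes the term without the gap small, uniform convexity then yields
  \<open>c\<close>, and the tolerance \<open>d\<close> makes \<open>c\<close> times the gap small.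
  Closeness of the functions follows from the L1 Poincare inequality, upgraded to the modular by the
  sup bound.\<close>

lemma near_minimizers_close:
  assumes h: "forcing H h" and H: "0 <= H" and R: "0 <= R" and "0 < e"
  obtains d where "0 < d" "d <= 1" "!!u G v V. admissible R u G ==> admissible R v V ==> energy h u G < min_energy R h + d ==>
     energy h v V < min_energy R h + d ==> mo (%x. G x - V x) < e & mo (%x. u x - v x) < e"
proof -
  define B where "B = P * (\<bar>min_energy R h\<bar> + 1 + H * R * measure M (space M)) + 1"
  have B: "B > 0" using P_gt1 H R by (auto simp: B_def intro!: add_nonneg_pos mult_nonneg_nonneg)
  have moB: "mo G <= B" if "admissible R u G" "energy h u G < min_energy R h + 1" for u G
  proof -
    have "mo G <= P * (energy h u G + H * R * measure M (space M))" by (rule energy_lower_bound(1)[OF h that(1) H R])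
    also have "... <= P * (\<bar>min_energy R h\<bar> + 1 + H * R * measure M (space M))"
      using that(2) P_gt1 by (intro mult_left_mono) auto
    finally show ?thesis by (simp add: B_def)
  qed
  have G: "\<exists>d. 0 < d & d <= 1 & (\<forall>u G v V. admissible R u G --> admissible R v V --> energy h u G < min_energy R h + d \<longrightarrow>
     energy h v V < min_energy R h + d --> mo (%x. G x - V x) < e)" if "0 < e" for e
  proof -
    define K where "K = 2 powr P * (B + B)"
    have K: "K > 0" using B by (simp add: K_def)
    define \<delta> where "\<delta> = min 1 (e / (2 * (2 * K)))"
    have \<delta>: "0 < \<delta>" "\<delta> <= 1" using \<open>0 < e\<close> K by (auto simp: \<delta>_def)
    have "\<delta> * K <= e / (2 * (2 * K)) * K" using K by (intro mult_right_mono) (auto simp: \<delta>_def)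
    also have "... = e / 4" using K by simp
    finally have \<delta>K: "\<delta> * K <= e / 4" .
    obtain c where c: "0 < c" "!!a b :: real^'n => real^'n. Lp a ==> Lp b ==>
      mo (%x. a x - b x) <= \<delta> * 2 powr P * (mo a + mo b) + c * (LINT x|M. convexity_gap (p x) (a x) (b x))"
      by (rule mo_diff_le_gap[OF \<delta>, where 'b="real^'n"]) (rule that; blast)
    define d where "d = min 1 (e / (4 * (c * P)))"
    have d: "0 < d" "d <= 1" using \<open>0 < e\<close> c(1) P_gt1 by (auto simp: d_def)
    have "mo (%x. G x - V x) < e"
      if u: "admissible R u G" and v: "admissible R v V" and E: "energy h u G < min_energy R h + d" "energy h v V < min_energy R h + d" for u G v V
    proof -
      have L: "Lp G" "Lp V" using u v S0D(2) by (auto simp: admissible_def)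
      have "mo (%x. G x - V x) <= \<delta> * 2 powr P * (mo G + mo V) + c * (LINT x|M. convexity_gap (p x) (G x) (V x))"
        by (rule c(2)[OF L])
      also have "... <= \<delta> * K + c * (P / 2 * (2 * d))"
      proof (rule add_mono)
        have "\<delta> * 2 powr P * (mo G + mo V) <= \<delta> * 2 powr P * (B + B)"
          using moB[OF u] moB[OF v] E d \<delta> by (intro mult_left_mono add_mono) auto
        then show "\<delta> * 2 powr P * (mo G + mo V) <= \<delta> * K" by (simp add: K_def mult.assoc)
        have "(LINT x|M. convexity_gap (p x) (G x) (V x)) <= P / 2 * (energy h u G + energy h v V - 2 * min_energy R h)"
          by (rule energy_gap[OF h u v H R])
        also have "... <= P / 2 * (2 * d)" using E P_gt1 by (intro mult_left_mono) auto
        finally show "c * (LINT x|M. convexity_gap (p x) (G x) (V x)) <= c * (P / 2 * (2 * d))"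
          using c(1) by (intro mult_left_mono) auto
      qed
      also have "c * (P / 2 * (2 * d)) = (c * P) * d" by simp
      also have "(c * P) * d <= (c * P) * (e / (4 * (c * P)))" using c(1) P_gt1 by (intro mult_left_mono) (auto simp: d_def)
      also have "(c * P) * (e / (4 * (c * P))) = e / 4" using c(1) P_gt1 by simp
      finally show ?thesis using \<delta>K \<open>0 < e\<close> by linarith
    qed
    with d show ?thesis by blast
  qed
  obtain CP where CP: "0 <= CP" "!!u G. S0 u G ==> (LINT x|M. \<bar>u x\<bar>) <= CP * (LINT x|M. norm (G x))"
    using poincare[OF bounded_\<Omega>] by metis
  \<comment> \<open>A difference of admissible functions is bounded by \<open>2 * R\<close>, which
    gives the constant of \<open>mo_le_of_bounded\<close>; \<open>CP\<close> is the Poincare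
    constant.\<close>
  define Q where "Q = max 1 \<bar>2 * R\<bar> powr P * CP"
  have Q: "0 <= Q" using CP(1) by (simp add: Q_def)
  define e1 where "e1 = e / (Q + 1)"
  have "0 < e1" using \<open>0 < e\<close> Q by (simp add: e1_def)
  then obtain d1 where d1: "0 < d1" "!!f :: real^'n => real^'n. Lp f ==> mo f < d1 ==> (LINT x|M. norm (f x)) < e1"
    using integral_norm_small[where 'b="real^'n"] by metis
  obtain d where d: "0 < d" "d <= 1" "!!u G v V. admissible R u G ==> admissible R v V ==> energy h u G < min_energy R h + d ==>
     energy h v V < min_energy R h + d ==> mo (%x. G x - V x) < min e d1"
    using G[of "min e d1"] \<open>0 < e\<close> d1(1) by auto
  show ?thesis
  proof (rule that[OF d(1,2)])
    fix u G v V
    assume u: "admissible R u G" and v: "admissible R v V" and E: "energy h u G < min_energy R h + d" "energy h v V < min_energy R h + d"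
    have S: "S0 u G" "S0 v V" using u v by (auto simp: admissible_def)
    have mo: "mo (%x. G x - V x) < min e d1" by (rule d(3)[OF u v E])
    have Sd: "S0 (%x. u x - v x) (%x. G x - V x)" using S0_mult_add[OF S, of 1 "-1"] by simp
    have "AE x in M. \<bar>u x\<bar> <= R" "AE x in M. \<bar>v x\<bar> <= R" using u v by (auto simp: admissible_def)
    then have "AE x in M. norm (u x - v x) <= 2 * R" by eventually_elim auto
    from mo_le_of_bounded[OF Lp_measurable[OF S0D(1)[OF Sd]] this]
    have "mo (%x. u x - v x) <= max 1 \<bar>2 * R\<bar> powr P * (LINT x|M. norm (u x - v x))" .
    also have "... <= max 1 \<bar>2 * R\<bar> powr P * (CP * (LINT x|M. norm (G x - V x)))"
      using CP(2)[OF Sd] by (intro mult_left_mono) auto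
    also have "... = Q * (LINT x|M. norm (G x - V x))" by (simp add: Q_def)
    also have "... <= Q * e1" using d1(2)[OF S0D(2)[OF Sd]] mo Q by (intro mult_left_mono) auto
    also have "... < (Q + 1) * e1" using \<open>0 < e1\<close> by simp
    also have "... = e" using Q by (simp add: e1_def)
    finally show "mo (%x. G x - V x) < e & mo (%x. u x - v x) < e" using mo by simp
  qed
qed

text \<open>Minimising sequences are Cauchy by \<open>near_minimizers_close\<close>. Lower
  semicontinuity comes from the subgradient inequality at the limit \<open>V\<close>, whose
  right-hand side tends to zero along the sequence.\<close>

lemma minimizer_exists:
  assumes h: "forcing H h" and H: "0 <= H" and R: "0 <= R"
  obtains u G where "admissible R u G" "energy h u G = min_energy R h"
proof -
  let ?S = "{energy h u G |u G. admissible R u G}"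
  have "\<exists>u G. admissible R u G & energy h u G < min_energy R h + inverse (real (Suc k))" for k
  proof -
    have "?S ~= {}" using admissible_zero[OF R] by blast
    moreover have "Inf ?S < min_energy R h + inverse (real (Suc k))" by (simp add: min_energy_def)
    ultimately obtain y where "y \<in> ?S" "y < min_energy R h + inverse (real (Suc k))" by (rule cInf_lessD[THEN bexE])
    then show ?thesis by blast
  qed
  then have "\<forall>k. \<exists>z. admissible R (fst z) (snd z) & energy h (fst z) (snd z) < min_energy R h + inverse (real (Suc k))" by simp
  from choice[OF this] obtain z where z: "\<forall>k. admissible R (fst (z k)) (snd (z k)) & energy h (fst (z k)) (snd (z k)) < min_energy R h + inverse (real (Suc k))" ..
  define u where "u k = fst (z k)" for k
  define G where "G k = snd (z k)" for k
  have a: "admissible R (u k) (G k)" and E: "energy h (u k) (G k) < min_energy R h + inverse (real (Suc k))" for k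
    using z by (auto simp: u_def G_def)
  have S: "S0 (u k) (G k)" and uR: "AE x in M. \<bar>u k x\<bar> <= R" for k using a[of k] by (auto simp: admissible_def)
  note Lu = S0D(1)[OF S] and LG = S0D(2)[OF S]
  have C: "\<exists>N. \<forall>m\<ge>N. \<forall>n\<ge>N. mo (%x. G m x - G n x) < e & mo (%x. u m x - u n x) < e" if "0 < e" for e
  proof -
    obtain d where d: "0 < d" "d <= 1" "!!u G v V. admissible R u G ==> admissible R v V ==> energy h u G < min_energy R h + d ==>
     energy h v V < min_energy R h + d ==> mo (%x. G x - V x) < e & mo (%x. u x - v x) < e"
      by (rule near_minimizers_close[OF h H R \<open>0 < e\<close>]) (rule that; blast)
    obtain N where N: "!!k. k >= N ==> inverse (real (Suc k)) < d"
      using order_tendstoD(2)[OF LIMSEQ_inverse_real_of_nat d(1)] unfolding eventually_sequentially by blast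
    have "energy h (u k) (G k) < min_energy R h + d" if "k >= N" for k using E[of k] N[OF that] by linarith
    then show ?thesis using d(3)[OF a a] by blast
  qed
  obtain V where V: "Lp V" "(%k. mo (%x. G k x - V x)) ----> 0"
  proof (rule Lp_complete[OF LG])
    show "\<exists>N. \<forall>m\<ge>N. \<forall>n\<ge>N. mo (%x. G m x - G n x) < e" if "0 < e" for e using C[OF that] by blast
  qed
  obtain v where v: "Lp v" "(%k. mo (%x. u k x - v x)) ----> 0"
  proof (rule Lp_complete[OF Lu])
    show "\<exists>N. \<forall>m\<ge>N. \<forall>n\<ge>N. mo (%x. u m x - u n x) < e" if "0 < e" for e using C[OF that] by blast
  qed
  have Sv: "S0 v V" by (rule S0_limit[OF S v(1) V(1) v(2) V(2)])
  have "AE x in M. \<bar>v x\<bar> <= R"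
  proof -
    obtain r where r: "strict_mono (r :: nat => nat)" "AE x in M. (%k. u (r k) x) ----> v x"
      using mo_tendsto_AE_subseq[OF Lu v] .
    have "AE x in M. \<forall>k. \<bar>u k x\<bar> <= R" unfolding AE_all_countable using uR by blast
    with r(2) show ?thesis
    proof eventually_elim
      case (elim x)
      then show ?case by (intro LIMSEQ_le_const2[OF tendsto_rabs[OF elim(1)]]) auto
    qed
  qed
  with Sv have av: "admissible R v V" by (simp add: admissible_def)
  let ?J = "LINT x|M. plap (p x) (V x) \<bullet> V x" and ?J' = "%k. \<integral>x. plap (p x) (V x) \<bullet> G k x \<partial>M"
    and ?I = "%k. \<integral>x. h x * u k x \<partial>M" and ?I' = "LINT x|M. h x * v x" and ?m = "%k. min_energy R h + inverse (real (Suc k))"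
  have "energy h v V <= min_energy R h"
  proof (rule LIMSEQ_le_const)
    have "?I ----> ?I'"
    proof -
      have "(%k. (LINT x|M. u k x * h x) - (LINT x|M. v x * h x)) ----> 0"
      proof (rule tendsto_integral_mult_bounded[OF Lp_integrable(1)[OF Lu] Lp_integrable(1)[OF v(1)], where B=H])
        show "(%k. \<integral>x. \<bar>u k x - v x\<bar> \<partial>M) ----> 0" using mo_tendsto_0_L1[OF Lp_diff(1)[OF Lu v(1)] v(2)] by simp
      qed (use h in \<open>auto simp: forcing_def\<close>)
      then show ?thesis by (simp add: LIM_zero_iff mult.commute)
    qed
    moreover have "?J' ----> ?J"
      by (rule plap_integral_tendsto[OF V(1) LG V])
    ultimately have "(%k. ?m k + (?J - ?J' k)
        + (?I k - ?I')) ---->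
        min_energy R h + 0 + (?J - ?J)
        + (?I' - ?I')"
      by (intro tendsto_add tendsto_diff tendsto_const LIMSEQ_inverse_real_of_nat)
    then show "(%k. ?m k + (?J - ?J' k)
        + (?I k - ?I')) ----> min_energy R h" by simp
    have "energy h v V <= ?m k + (?J - ?J' k)
        + (?I k - ?I')" for k
    proof -
      have "(LINT x|M. norm (V x) powr p x / p x - norm (G k x) powr p x / p x) <= (LINT x|M. plap (p x) (V x) \<bullet> V x - plap (p x) (V x) \<bullet> G k x)"
      proof (rule integral_mono_AE)
        show "AE x in M. norm (V x) powr p x / p x - norm (G k x) powr p x / p x <= plap (p x) (V x) \<bullet> V x - plap (p x) (V x) \<bullet> G k x"
        proof (rule AE_I2, goal_cases)
          case (1 x)
          then have "1 < p x" by (rule p_ge1)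
          with plap_convex[OF this, of "V x" "G k x"]
          show ?case
            by (simp add: inner_diff_right flip: diff_divide_distrib) (simp add: divide_le_eq mult.commute)
        qed
      qed (intro Bochner_Integration.integrable_diff integrable_energy_density(1) Lp_plap_integrable(1) V(1) LG)+
      also have "(LINT x|M. norm (V x) powr p x / p x - norm (G k x) powr p x / p x) = (LINT x|M. norm (V x) powr p x / p x) - (LINT x|M. norm (G k x) powr p x / p x)"
        by (intro Bochner_Integration.integral_diff integrable_energy_density(1) V(1) LG)
      also have "(LINT x|M. plap (p x) (V x) \<bullet> V x - plap (p x) (V x) \<bullet> G k x) = ?J - ?J' k"
        by (intro Bochner_Integration.integral_diff Lp_plap_integrable(1) V(1) LG)
      finally show ?thesis using E[of k] by (simp add: energy_def)
    qed
    then show "\<exists>N. \<forall>k\<ge>N. energy h v V <= ?m k + (?J - ?J' k)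
        + (?I k - ?I')" by blast
  qed
  with min_energy_le[OF h av H R] have "energy h v V = min_energy R h" by simp
  with av show ?thesis by (rule that)
qed

end

context bounded_sobolev
begin

definition minimizes :: "real => (real^'n => real) => (real^'n => real) => (real^'n => real^'n) => bool" where
  "minimizes R h u G \<longleftrightarrow> admissible R u G & energy h u G = min_energy R h"

lemma minimizesD:
  assumes "minimizes R h u G"
  shows "admissible R u G" "energy h u G = min_energy R h" "S0 u G" "AE x in M. \<bar>u x\<bar> <= R"
  using assms by (auto simp: minimizes_def admissible_def)

lemma energy_forcing_diff:
  assumes a: "admissible R u G" and h: "forcing H h" and k: "forcing H k"
  shows "energy h u G <= energy k u G + R * (LINT x|M. \<bar>k x - h x\<bar>)"
proof -
  have S: "S0 u G" and u: "AE x in M. \<bar>u x\<bar> <= R" using a by (auto simp: admissible_def)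
  note iu = Lp_integrable(1)[OF S0D(1)[OF S]]
  have i: "integrable M h" "integrable M k"
    using h k by (auto simp: forcing_def intro!: integrable_const_bound[where B=H])
  have "(LINT x|M. k x * u x) - (LINT x|M. h x * u x) = (LINT x|M. k x * u x - h x * u x)"
    by (rule Bochner_Integration.integral_diff[symmetric, OF integrable_forcing_mult[OF k iu] integrable_forcing_mult[OF h iu]])
  also have "... <= (LINT x|M. R * \<bar>k x - h x\<bar>)"
  proof (rule integral_mono_AE)
    show "AE x in M. k x * u x - h x * u x <= R * \<bar>k x - h x\<bar>"
      using u
    proof eventually_elim
      case (elim x)
      have "(k x - h x) * u x <= \<bar>k x - h x\<bar> * \<bar>u x\<bar>" by (metis abs_ge_self abs_mult)
      also have "... <= \<bar>k x - h x\<bar> * R" using elim by (intro mult_left_mono) auto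
      finally show ?case by (simp add: algebra_simps)
    qed
  qed (use i integrable_forcing_mult[OF k iu] integrable_forcing_mult[OF h iu] in auto)
  finally show ?thesis by (simp add: energy_def)
qed

text \<open>Replacing \<open>g\<close> by \<open>h k\<close> changes the energy of an admissible
  function by at most \<open>R\<close> times their L1 distance. Used once for each of the two
  minimisers, this makes \<open>u k\<close> a near minimiser for \<open>g\<close> with excess at
  most twice that amount.\<close>

lemma minimizer_continuous:
  assumes hk: "!!k. forcing H (h k)" and g: "forcing H g" and H: "0 <= H" and R: "0 <= R"
    and lim: "(%k. \<integral>x. \<bar>h k x - g x\<bar> \<partial>M) ----> 0"
    and u: "!!k. minimizes R (h k) (u k) (G k)" and v: "minimizes R g v V"
  shows "(%k. mo (%x. u k x - v x)) ----> 0"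
proof (rule LIMSEQ_I)
  fix e :: real assume "0 < e"
  obtain d where d: "0 < d" "d <= 1" "!!u G v V. admissible R u G ==> admissible R v V ==> energy g u G < min_energy R g + d ==>
     energy g v V < min_energy R g + d ==> mo (%x. G x - V x) < e & mo (%x. u x - v x) < e"
    by (rule near_minimizers_close[OF g H R \<open>0 < e\<close>]) (rule that; blast)
  have "(%k. 2 * R * (LINT x|M. \<bar>h k x - g x\<bar>)) ----> 2 * R * 0" by (intro tendsto_intros lim)
  then have "\<forall>\<^sub>F k in sequentially. 2 * R * (LINT x|M. \<bar>h k x - g x\<bar>) < d" using d(1) by (intro order_tendstoD) auto
  then obtain N where N: "!!k. k >= N ==> 2 * R * (LINT x|M. \<bar>h k x - g x\<bar>) < d" unfolding eventually_sequentially by blast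
  have "norm (mo (%x. u k x - v x) - 0) < e" if "k >= N" for k
  proof -
    have "energy g (u k) (G k) <= energy (h k) (u k) (G k) + R * (LINT x|M. \<bar>h k x - g x\<bar>)"
      by (rule energy_forcing_diff[OF minimizesD(1)[OF u] g hk])
    also have "energy (h k) (u k) (G k) <= energy (h k) v V"
      unfolding minimizesD(2)[OF u] by (rule min_energy_le[OF hk minimizesD(1)[OF v] H R])
    also have "energy (h k) v V <= energy g v V + R * (LINT x|M. \<bar>g x - h k x\<bar>)"
      by (rule energy_forcing_diff[OF minimizesD(1)[OF v] hk g])
    also have "(LINT x|M. \<bar>g x - h k x\<bar>) = (LINT x|M. \<bar>h k x - g x\<bar>)" by (simp add: abs_minus_commute)
    finally have "energy g (u k) (G k) < min_energy R g + d" using N[OF that] minimizesD(2)[OF v] by linarith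
    moreover have "energy g v V < min_energy R g + d" using minimizesD(2)[OF v] d(1) by simp
    ultimately have "mo (%x. u k x - v x) < e" using d(3)[OF minimizesD(1)[OF u] minimizesD(1)[OF v]] by blast
    then show ?thesis using mo_nonneg[of "%x. u k x - v x"] by simp
  qed
  then show "\<exists>N. \<forall>k\<ge>N. norm (mo (%x. u k x - v x) - 0) < e" by blast
qed

lemma minimizer_L1_continuous:
  assumes "!!k. forcing H (h k)" "forcing H g" "0 <= H" "0 <= R" "(%k. \<integral>x. \<bar>h k x - g x\<bar> \<partial>M) ----> 0"
    and u: "!!k. minimizes R (h k) (u k) (G k)" and v: "minimizes R g v V"
  shows "(%k. \<integral>x. \<bar>u k x - v x\<bar> \<partial>M) ----> 0"
  using mo_tendsto_0_L1[OF Lp_diff(1)[OF S0D(1)[OF minimizesD(3)[OF u]] S0D(1)[OF minimizesD(3)[OF v]]] minimizer_continuous[OF assms]]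
  by simp

lemma minimizer_gradient_bound:
  assumes h: "forcing H h" and H: "0 <= H" and R: "0 <= R" and u: "minimizes R h u G"
  shows "(LINT x|M. norm (G x)) <= measure M (space M) + P * (H * R * measure M (space M))"
proof -
  have "energy h u G <= energy h (%_. 0) (%_. 0)"
    unfolding minimizesD(2)[OF u] by (rule min_energy_le[OF h admissible_zero[OF R] H R])
  also have "... = 0" by (simp add: energy_def)
  finally have E: "energy h u G <= 0" .
  have "mo G <= P * (energy h u G + H * R * measure M (space M))"
    by (rule energy_lower_bound(1)[OF h minimizesD(1)[OF u] H R])
  also have "... <= P * (H * R * measure M (space M))" using E P_gt1 by (intro mult_left_mono) auto
  finally show ?thesis using Lp_integrable(2)[OF S0D(2)[OF minimizesD(3)[OF u]], of 1] by simp
qed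

lemma minimizes_AE_cong:
  assumes u: "minimizes R h u G" and v: "AE x in M. u x = v x"
    and h: "h \<in> borel_measurable M"
  shows "minimizes R h v G"
proof -
  have S: "S0 v G" by (rule S0_AE_cong[OF minimizesD(3)[OF u] v]) simp
  have "AE x in M. \<bar>v x\<bar> <= R" using minimizesD(4)[OF u] v by eventually_elim simp
  moreover have "(LINT x|M. h x * v x) = (LINT x|M. h x * u x)"
    using h Lp_measurable[OF S0D(1)[OF S]] Lp_measurable[OF S0D(1)[OF minimizesD(3)[OF u]]] v
    by (intro integral_cong_AE) (auto elim!: eventually_mono)
  ultimately show ?thesis using S minimizesD(2)[OF u] by (simp add: minimizes_def admissible_def energy_def)
qed

text \<open>Moving from \<open>u\<close> towards \<open>u + \<phi>\<close> respects the sup bound by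
  convexity. The subgradient inequality is applied at the moved gradient \<open>w t\<close>, so no
  derivative of the energy is computed; continuity of \<open>plap\<close> lets \<open>t\<close> tend
  to zero.\<close>

lemma minimizer_variational_inequality:
  assumes h: "forcing H h" and H: "0 <= H" and R: "0 <= R" and u: "minimizes R h u G"
    and \<phi>: "S0 \<phi> \<Gamma>" "AE x in M. \<bar>u x + \<phi> x\<bar> <= R"
  shows "(LINT x|M. h x * \<phi> x) <= (LINT x|M. plap (p x) (G x) \<bullet> \<Gamma> x)"
proof -
  note Su = minimizesD(3)[OF u]
  note LG = S0D(2)[OF Su] and L\<Gamma> = S0D(2)[OF \<phi>(1)]
  define w where "w t x = G x + t *\<^sub>R \<Gamma> x" for t x
  have Lw: "Lp (w t)" for t unfolding w_def by (intro Lp_add Lp_scaleR LG L\<Gamma>)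
  have step: "(LINT x|M. h x * \<phi> x) <= (LINT x|M. plap (p x) (w t x) \<bullet> \<Gamma> x)" if t: "0 < t" "t <= 1" for t
  proof -
    have S: "S0 (%x. u x + t * \<phi> x) (w t)" unfolding w_def using S0_mult_add[OF Su \<phi>(1), of 1 t] by simp
    have "AE x in M. \<bar>u x + t * \<phi> x\<bar> <= R"
      using minimizesD(4)[OF u] \<phi>(2)
    proof eventually_elim
      case (elim x)
      have "u x + t * \<phi> x = (1 - t) * u x + t * (u x + \<phi> x)" by (simp add: algebra_simps)
      also have "\<bar>...\<bar> <= (1 - t) * \<bar>u x\<bar> + t * \<bar>u x + \<phi> x\<bar>"
        using abs_triangle_ineq[of "(1 - t) * u x" "t * (u x + \<phi> x)"] t by (simp add: abs_mult)
      also have "... <= (1 - t) * R + t * R" using elim t by (intro add_mono mult_left_mono) auto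
      finally show ?case by (simp add: algebra_simps)
    qed
    with S have "admissible R (%x. u x + t * \<phi> x) (w t)" by (simp add: admissible_def)
    from min_energy_le[OF h this H R]
    have le: "(LINT x|M. norm (G x) powr p x / p x) - (LINT x|M. h x * u x)
        <= (LINT x|M. norm (w t x) powr p x / p x) - (LINT x|M. h x * (u x + t * \<phi> x))"
      unfolding minimizesD(2)[OF u, symmetric] energy_def .
    have "(LINT x|M. norm (w t x) powr p x / p x) - (LINT x|M. norm (G x) powr p x / p x)
        = (LINT x|M. norm (w t x) powr p x / p x - norm (G x) powr p x / p x)"
      by (rule Bochner_Integration.integral_diff[symmetric, OF integrable_energy_density(1)[OF Lw] integrable_energy_density(1)[OF LG]])
    also have "... <= (LINT x|M. t * (plap (p x) (w t x) \<bullet> \<Gamma> x))"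
    proof (rule integral_mono_AE)
      show "AE x in M. norm (w t x) powr p x / p x - norm (G x) powr p x / p x <= t * (plap (p x) (w t x) \<bullet> \<Gamma> x)"
      proof (rule AE_I2, goal_cases)
        case (1 x)
        then have p: "1 < p x" by (rule p_ge1)
        have "norm (w t x) powr p x - norm (G x) powr p x <= p x * (t * (plap (p x) (w t x) \<bullet> \<Gamma> x))"
          using plap_convex[OF p, of "w t x" "G x"] by (simp add: w_def)
        then have "(norm (w t x) powr p x - norm (G x) powr p x) / p x <= t * (plap (p x) (w t x) \<bullet> \<Gamma> x)"
          using p by (simp add: divide_le_eq mult.commute)
        then show ?case
          by (simp add: diff_divide_distrib)
      qed
      show "integrable M (%x. t * (plap (p x) (w t x) \<bullet> \<Gamma> x))"
        by (rule integrable_mult_right[OF Lp_plap_integrable(1)[OF Lw L\<Gamma>]])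
      show "integrable M (%x. norm (w t x) powr p x / p x - norm (G x) powr p x / p x)"
        by (rule Bochner_Integration.integrable_diff[OF integrable_energy_density(1)[OF Lw] integrable_energy_density(1)[OF LG]])
    qed
    also have "... = t * (LINT x|M. plap (p x) (w t x) \<bullet> \<Gamma> x)" by simp
    finally have "(LINT x|M. h x * (u x + t * \<phi> x)) - (LINT x|M. h x * u x) <= t * (LINT x|M. plap (p x) (w t x) \<bullet> \<Gamma> x)"
      using le by linarith
    moreover have "(LINT x|M. h x * (u x + t * \<phi> x)) = (LINT x|M. h x * u x) + t * (LINT x|M. h x * \<phi> x)"
    proof -
      have "(LINT x|M. h x * (u x + t * \<phi> x)) = (LINT x|M. h x * u x + t * (h x * \<phi> x))" by (simp add: algebra_simps)
      also have "... = (LINT x|M. h x * u x) + (LINT x|M. t * (h x * \<phi> x))"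
        by (rule Bochner_Integration.integral_add[OF integrable_forcing_mult[OF h Lp_integrable(1)[OF S0D(1)[OF Su]]]
            integrable_mult_right[OF integrable_forcing_mult[OF h Lp_integrable(1)[OF S0D(1)[OF \<phi>(1)]]]]])
      finally show ?thesis by simp
    qed
    ultimately show ?thesis using t(1) by simp
  qed
  let ?t = "%n. inverse (real (Suc n))"
  have Ln: "Lp (%x. norm (G x) + norm (\<Gamma> x))"
  proof -
    have "Lp (%x. norm (G x))" "Lp (%x. norm (\<Gamma> x))" using LG L\<Gamma> by (auto simp: Lp_def)
    then show ?thesis by (rule Lp_add)
  qed
  have [measurable]: "w t \<in> borel_measurable M" "\<Gamma> \<in> borel_measurable M" "G \<in> borel_measurable M" for t
    using Lw L\<Gamma> LG by (auto intro: Lp_measurable)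
  have "(%n. \<integral>x. plap (p x) (w (?t n) x) \<bullet> \<Gamma> x \<partial>M) ----> (LINT x|M. plap (p x) (G x) \<bullet> \<Gamma> x)"
  proof (rule integral_dominated_convergence)
    show "integrable M (%x. norm (norm (G x) + norm (\<Gamma> x)) powr p x)" by (rule Lp_integrable_powr[OF Ln])
    show "AE x in M. (%n. plap (p x) (w (?t n) x) \<bullet> \<Gamma> x) ----> plap (p x) (G x) \<bullet> \<Gamma> x"
    proof (rule AE_I2, goal_cases)
      case (1 x)
      then have p: "1 < p x" by (rule p_ge1)
      have "(%n. w (?t n) x) ----> G x + 0 *\<^sub>R \<Gamma> x"
        unfolding w_def by (intro tendsto_add tendsto_scaleR tendsto_const LIMSEQ_inverse_real_of_nat)
      then have "(%n. w (?t n) x) ----> G x" by simp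
      from plap_tendsto[OF p this] show ?case
        by (intro tendsto_inner tendsto_const)
    qed
    show "AE x in M. norm (plap (p x) (w (?t n) x) \<bullet> \<Gamma> x) <= norm (norm (G x) + norm (\<Gamma> x)) powr p x" for n
    proof (rule AE_I2)
      fix x assume "x \<in> space M"
      then have p: "1 < p x" by (rule p_ge1)
      let ?s = "norm (G x) + norm (\<Gamma> x)"
      have t: "0 < ?t n" "?t n <= 1" by (auto simp: inverse_le_1_iff)
      have "norm (?t n *\<^sub>R \<Gamma> x) <= 1 * norm (\<Gamma> x)"
        unfolding norm_scaleR using t by (intro mult_right_mono) auto
      then have n: "norm (w (?t n) x) <= ?s"
        unfolding w_def using norm_triangle_ineq[of "G x" "?t n *\<^sub>R \<Gamma> x"] by simp
      have "\<bar>plap (p x) (w (?t n) x) \<bullet> \<Gamma> x\<bar> <= norm (w (?t n) x) powr (p x - 1) * norm (\<Gamma> x)" by (rule plap_inner_le)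
      also have "... <= ?s powr (p x - 1) * ?s" using n p by (intro mult_mono powr_mono2) auto
      also have "... = ?s powr p x"
      proof (cases "?s = 0")
        case False
        then have "?s > 0" by (simp add: add_nonneg_eq_0_iff less_le)
        then have "?s powr (p x - 1) * ?s powr 1 = ?s powr p x" unfolding powr_add[symmetric] by simp
        with \<open>?s > 0\<close> show ?thesis by simp
      qed simp
      finally show "norm (plap (p x) (w (?t n) x) \<bullet> \<Gamma> x) <= norm ?s powr p x" by simp
    qed
  qed (use borel_measurable_integrable[OF Lp_plap_integrable(1)[OF Lw L\<Gamma>]] borel_measurable_integrable[OF Lp_plap_integrable(1)[OF LG L\<Gamma>]] in auto)
  then show ?thesis by (rule LIMSEQ_le_const) (use step in \<open>auto simp: inverse_le_1_iff\<close>)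
qed

end

section \<open>Coupled minimisers\<close>

context bounded_sobolev
begin

text \<open>Minimisers are determined up to null sets only, so one is chosen. The choice does not
  affect continuity of the cell averages, because \<open>minimizer_L1_continuous\<close> holds for
  arbitrary minimisers.\<close>

definition solution :: "real => (real^'n => real) => real^'n => real" where
  "solution R h = (SOME u. \<exists>G. minimizes R h u G)"

lemma solution_minimizes:
  assumes "forcing H h" "0 <= H" "0 <= R"
  shows "\<exists>G. minimizes R h (solution R h) G"
proof -
  have "\<exists>u G. minimizes R h u G" by (rule minimizer_exists[OF assms]) (auto simp: minimizes_def)
  then show ?thesis unfolding solution_def by (rule someI_ex)
qed

lemma cell_average_tendsto:
  assumes u: "!!k. integrable M (u k)" and v: "integrable M v" and lim: "(%k. \<integral>x. \<bar>u k x - v x\<bar> \<partial>M) ----> 0" and "d > 0"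
  shows "(%k. cell_average d \<Omega> (u k) z) ----> cell_average d \<Omega> v z"
proof -
  let ?I = "indicator (cell d z) :: real^'n => real"
  have "?I \<in> borel_measurable lborel" by simp
  then have I: "?I \<in> borel_measurable M" by (intro measurable_restrict_space1 measurable_completion)
  have "(%k. (LINT x|M. u k x * ?I x) - (LINT x|M. v x * ?I x)) ----> 0"
    by (rule tendsto_integral_mult_bounded[OF u v lim I, where B=1]) (auto split: split_indicator)
  then have "(%k. (LINT x|M. ?I x * u k x)) ----> (LINT x|M. ?I x * v x)" by (simp add: LIM_zero_iff mult.commute)
  then show ?thesis unfolding cell_average_def using \<open>d > 0\<close> by (intro tendsto_intros) auto
qed

lemma cell_average_solution_tendsto:
  assumes h: "!!k. forcing H (h k)" "forcing H g" "0 <= H" "0 <= R" "(%k. \<integral>x. \<bar>h k x - g x\<bar> \<partial>M) ----> 0" and "d > 0"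
  shows "(%k. cell_average d \<Omega> (solution R (h k)) z) ----> cell_average d \<Omega> (solution R g) z"
proof -
  have "\<forall>k. \<exists>G. minimizes R (h k) (solution R (h k)) G" using solution_minimizes[OF h(1,3,4)] by blast
  from choice[OF this] obtain G where G: "\<forall>k. minimizes R (h k) (solution R (h k)) (G k)" ..
  obtain V where V: "minimizes R g (solution R g) V" using solution_minimizes[OF h(2-4)] by blast
  note S = minimizesD(3)[OF G[rule_format]] minimizesD(3)[OF V]
  show ?thesis
    by (rule cell_average_tendsto[OF Lp_integrable(1)[OF S0D(1)[OF S(1)]] Lp_integrable(1)[OF S0D(1)[OF S(2)]]
        minimizer_L1_continuous[OF h G[rule_format] V] \<open>d > 0\<close>])
qed

lemma cell_average_solution_bounded:
  assumes "forcing H h" "0 <= H" "0 <= R" "d > 0"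
  shows "\<bar>cell_average d \<Omega> (solution R h) z\<bar> <= R"
proof -
  obtain G where G: "minimizes R h (solution R h) G" using solution_minimizes[OF assms(1-3)] by blast
  show ?thesis
    by (rule cell_average_bounded[OF open_\<Omega> bounded_\<Omega> Lp_measurable[OF S0D(1)[OF minimizesD(3)[OF G]]] minimizesD(4)[OF G] assms(3,4)])
qed

text \<open>The gradients of the minimisers are bounded in L1 uniformly, so the averaging error is
  at most a multiple of the mesh size. Hence the minimisers and their step functions have the same
  limit along one subsequence.\<close>

lemma minimizers_subseq:
  assumes h: "!!k. forcing H (h k)" and H: "0 <= H" and R: "0 <= R" and u: "!!k. minimizes R (h k) (u k) (G k)"
    and d: "!!k. d k > 0" "d ----> 0"
  obtains r v where "strict_mono (r :: nat => nat)" "v \<in> borel_measurable M" "AE x in M. (%k. u (r k) x) ----> v x"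
    "AE x in M. (%k. step_fun (d (r k)) (cell_average (d (r k)) \<Omega> (u (r k))) x) ----> v x"
proof -
  define I where "I = measure M (space M) + P * (H * R * measure M (space M))"
  note S = minimizesD(3)[OF u]
  have I: "(LINT x|M. norm (G k x)) <= I" for k
    unfolding I_def by (rule minimizer_gradient_bound[OF h H R u])
  obtain r v where r: "strict_mono (r :: nat => nat)" and v: "v \<in> borel_measurable M" and lim: "AE x in M. (%k. u (r k) x) ----> v x"
    by (rule S0_compactness[OF S minimizesD(4)[OF u] R I])
  define w where "w k = step_fun (d k) (cell_average (d k) \<Omega> (u k))" for k
  have iu: "integrable M (u k)" for k by (rule Lp_integrable(1)[OF S0D(1)[OF S]])
  have iw: "integrable M (w k)" for k unfolding w_def by (rule step_fun_integrable[OF d(1)])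
  have le: "(LINT x|M. norm (w k x - u k x)) <= 2 ^ CARD('n) * (real CARD('n) * d k * I)" for k
  proof -
    have "(LINT x|M. \<bar>w k x - u k x\<bar>) <= 2 ^ CARD('n) * (real CARD('n) * d k * (LINT x|M. norm (G k x)))"
      unfolding w_def by (rule step_fun_error[OF S d(1)])
    also have "... <= 2 ^ CARD('n) * (real CARD('n) * d k * I)"
      using I[of k] d(1)[of k] by (intro mult_left_mono) auto
    finally show ?thesis by simp
  qed
  have "(%k. 2 ^ CARD('n) * (real CARD('n) * d k * I)) ----> 2 ^ CARD('n) * (real CARD('n) * 0 * I)"
    by (intro tendsto_intros d)
  then have "(%k. 2 ^ CARD('n) * (real CARD('n) * d k * I)) ----> 0" by simp
  then have "(%k. \<integral>x. norm (w k x - u k x) \<partial>M) ----> 0"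
    by (rule Lim_null_comparison[rotated]) (use le in auto)
  then have "(%k. \<integral>x. norm (w (r k) x - u (r k) x) \<partial>M) ----> 0"
    by (rule LIMSEQ_subseq_LIMSEQ[OF _ r, unfolded comp_def])
  then obtain s where s: "strict_mono (s :: nat => nat)" "AE x in M. (%k. w (r (s k)) x - u (r (s k)) x) ----> 0"
    using tendsto_L1_AE_subseq[of M "%k x. w (r k) x - u (r k) x"] iu iw by auto
  have lim': "AE x in M. (%k. u (r (s k)) x) ----> v x"
    using lim by eventually_elim (rule LIMSEQ_subseq_LIMSEQ[OF _ s(1), unfolded comp_def])
  show ?thesis
  proof (rule that[of "%k. r (s k)" v])
    show "strict_mono (%k. r (s k))" using r s(1) by (simp add: strict_mono_def)
    show "AE x in M. (%k. step_fun (d (r (s k))) (cell_average (d (r (s k))) \<Omega> (u (r (s k)))) x) ----> v x"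
      using s(2) lim'
    proof eventually_elim
      case (elim x)
      from tendsto_add[OF this] show ?case by (simp add: w_def)
    qed
  qed (use v lim' in auto)
qed

text \<open>No equation is passed to the limit: \<open>minimizer_continuous\<close> already says
  where the sequence must converge, and limits almost everywhere are unique.\<close>

lemma minimizers_limit:
  assumes h: "!!k. forcing H (h k)" "forcing H g" "0 <= H" "0 <= R" "(%k. \<integral>x. \<bar>h k x - g x\<bar> \<partial>M) ----> 0"
    and u: "!!k. minimizes R (h k) (u k) (G k)" and v: "AE x in M. (%k. u k x) ----> v x"
  shows "\<exists>V. minimizes R g v V"
proof -
  obtain Z where Z: "minimizes R g (solution R g) Z" using solution_minimizes[OF h(2-4)] by blast
  obtain r where r: "strict_mono (r :: nat => nat)" "AE x in M. (%k. u (r k) x) ----> solution R g x"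
    by (rule mo_tendsto_AE_subseq[OF S0D(1)[OF minimizesD(3)[OF u]] S0D(1)[OF minimizesD(3)[OF Z]] minimizer_continuous[OF h u Z]])
  have "AE x in M. solution R g x = v x"
    using r(2) v
  proof eventually_elim
    case (elim x)
    from LIMSEQ_unique[OF elim(1) LIMSEQ_subseq_LIMSEQ[OF elim(2) r(1), unfolded comp_def]] show ?case .
  qed
  with minimizes_AE_cong[OF Z] h(2) show ?thesis by (auto simp: forcing_def)
qed

end

text \<open>\<open>H1\<close> and \<open>H2\<close> stand for the truncated right-hand sides as
  operators on both unknowns. Truncation is what allows a bound for arbitrary measurable arguments;
  continuity is asked along sequences converging almost everywhere, the kind that
  \<open>S0_compactness\<close> provides.\<close>

locale sobolev_pair = E1: bounded_sobolev \<Omega> p1 pm1 P1 + E2: bounded_sobolev \<Omega> p2 pm2 P2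
  for \<Omega> :: "(real^'n) set" and p1 p2 :: "real^'n => real" and pm1 P1 pm2 P2 :: real +
  fixes H1 H2 :: "(real^'n => real) => (real^'n => real) => real^'n => real" and H R :: real
  assumes H: "0 <= H" and R: "0 < R"
    and H_forcing: "!!w1 w2. w1 \<in> borel_measurable (lebesgue_on \<Omega>) ==> w2 \<in> borel_measurable (lebesgue_on \<Omega>) ==>
      E1.forcing H (H1 w1 w2) & E1.forcing H (H2 w1 w2)"
    and H_continuous: "!!w1 w2 v1 v2. (!!k. w1 k \<in> borel_measurable (lebesgue_on \<Omega>)) ==> (!!k. w2 k \<in> borel_measurable (lebesgue_on \<Omega>)) ==>
      v1 \<in> borel_measurable (lebesgue_on \<Omega>) ==> v2 \<in> borel_measurable (lebesgue_on \<Omega>) ==>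
      AE x in lebesgue_on \<Omega>. (%k :: nat. w1 k x) ----> v1 x ==> AE x in lebesgue_on \<Omega>. (%k. w2 k x) ----> v2 x ==>
      (%k. \<integral>x. \<bar>H1 (w1 k) (w2 k) x - H1 v1 v2 x\<bar> \<partial>lebesgue_on \<Omega>) ----> 0 \<and>
      (%k. \<integral>x. \<bar>H2 (w1 k) (w2 k) x - H2 v1 v2 x\<bar> \<partial>lebesgue_on \<Omega>) ----> 0"
begin

abbreviation "average \<delta> u \<equiv> E1.step_fun \<delta> (cell_average \<delta> \<Omega> u)"

text \<open>Freezing the arguments of the nonlinearities to step functions makes the problem finite dimensional, so that
  Brouwer's theorem applies to the vector of cell averages.\<close>
lemma discrete_fixed_point:
  assumes d: "d > 0"
  shows "\<exists>u1 G1 u2 G2. E1.minimizes R (H1 (average d u1) (average d u2)) u1 G1 \<and>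
     E2.minimizes R (H2 (average d u1) (average d u2)) u2 G2"
proof -
  define Z where "Z = (%x j. \<lfloor>x $ j / d\<rfloor>) ` \<Omega>"
  define n where "n = card Z"
  have Z: "finite Z" unfolding Z_def by (rule E1.finite_grid[OF d])
  obtain e where e: "bij_betw e {..<n} Z" using ex_bij_betw_nat_finite[OF Z] by (auto simp: n_def atLeast0LessThan)
  define idx where "idx = inv_into {..<n} e"
  have idx: "idx z < n" "e (idx z) = z" if "z \<in> Z" for z
    using bij_betw_apply[OF bij_betw_inv_into[OF e] that] bij_betw_inv_into_right[OF e that] by (auto simp: idx_def)
  \<comment> \<open>The first \<open>n\<close> coordinates are the cell values of the first unknown,
    the next \<open>n\<close> those of the second.\<close>
  define w1 where "w1 c = E1.step_fun d (%z. c (idx z))" for c :: "nat => real"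
  define w2 where "w2 c = E1.step_fun d (%z. c (n + idx z))" for c :: "nat => real"
  have wm: "w1 c \<in> borel_measurable E1.M" "w2 c \<in> borel_measurable E1.M" for c
    unfolding w1_def w2_def by (rule E1.step_fun_measurable)+
  define s1 where "s1 c = E1.solution R (H1 (w1 c) (w2 c))" for c
  define s2 where "s2 c = E2.solution R (H2 (w1 c) (w2 c))" for c
  have f: "E1.forcing H (H1 (w1 c) (w2 c))" "E1.forcing H (H2 (w1 c) (w2 c))" for c
    using H_forcing[OF wm, of c c] by auto
  define \<Phi> where "\<Phi> c i = (if i < n then cell_average d \<Omega> (s1 c) (e i) else cell_average d \<Omega> (s2 c) (e (i - n)))" for c i
  obtain c where c: "\<forall>i<n + n. \<bar>c i\<bar> <= R" "\<forall>i<n + n. \<Phi> c i = c i"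
  proof (rule brouwer_symmetric_cube[OF R, of "n + n" \<Phi>])
    show "\<bar>\<Phi> c i\<bar> <= R" for c i
      using E1.cell_average_solution_bounded[OF f(1) H less_imp_le[OF R] d] E2.cell_average_solution_bounded[OF f(2) H less_imp_le[OF R] d]
      by (simp add: \<Phi>_def s1_def s2_def)
    fix C :: "nat => nat => real" and c :: "nat => real" and i assume lim: "\<forall>i<n + n. (%k. C k i) ----> c i"
    have l: "(%k. w1 (C k) x) ----> w1 c x" "(%k. w2 (C k) x) ----> w2 c x" for x
      unfolding w1_def w2_def E1.step_fun_def using idx lim by (auto simp: Z_def[symmetric] trans_less_add1 intro!: tendsto_sum tendsto_mult)
    have "(%k. \<integral>x. \<bar>H1 (w1 (C k)) (w2 (C k)) x - H1 (w1 c) (w2 c) x\<bar> \<partial>E1.M) ----> 0"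
      "(%k. \<integral>x. \<bar>H2 (w1 (C k)) (w2 (C k)) x - H2 (w1 c) (w2 c) x\<bar> \<partial>E1.M) ----> 0"
      using H_continuous[of "%k. w1 (C k)" "%k. w2 (C k)" "w1 c" "w2 c"] wm l by auto
    from E1.cell_average_solution_tendsto[OF f(1) f(1) H less_imp_le[OF R] this(1) d]
      E2.cell_average_solution_tendsto[OF f(2) f(2) H less_imp_le[OF R] this(2) d]
    show "(%k. \<Phi> (C k) i) ----> \<Phi> c i" by (simp add: \<Phi>_def s1_def s2_def)
  qed
  have "cell_average d \<Omega> (s1 c) z = c (idx z)" "cell_average d \<Omega> (s2 c) z = c (n + idx z)" if "z \<in> Z" for z
    using c(2)[rule_format, of "idx z"] c(2)[rule_format, of "n + idx z"] idx[OF that] by (auto simp: \<Phi>_def)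
  then have w: "average d (s1 c) = w1 c" "average d (s2 c) = w2 c"
    unfolding w1_def w2_def E1.step_fun_def by (auto simp: Z_def[symmetric] fun_eq_iff intro!: sum.cong)
  obtain G1 where "E1.minimizes R (H1 (w1 c) (w2 c)) (s1 c) G1"
    using E1.solution_minimizes[OF f(1) H less_imp_le[OF R]] by (auto simp: s1_def)
  moreover obtain G2 where "E2.minimizes R (H2 (w1 c) (w2 c)) (s2 c) G2"
    using E2.solution_minimizes[OF f(2) H less_imp_le[OF R]] by (auto simp: s2_def)
  ultimately show ?thesis using w by metis
qed

lemma coupled_minimizers_exist:
  obtains u1 G1 u2 G2 where "E1.minimizes R (H1 u1 u2) u1 G1" "E2.minimizes R (H2 u1 u2) u2 G2"
proof -
  define d where "d k = inverse (real (Suc k))" for k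
  have d: "d k > 0" "d ----> 0" for k unfolding d_def using LIMSEQ_inverse_real_of_nat by auto
  have "\<forall>k. \<exists>z. E1.minimizes R (H1 (average (d k) (fst (fst z))) (average (d k) (fst (snd z)))) (fst (fst z)) (snd (fst z)) \<and>
      E2.minimizes R (H2 (average (d k) (fst (fst z))) (average (d k) (fst (snd z)))) (fst (snd z)) (snd (snd z))"
    using discrete_fixed_point[OF d(1)] by (simp add: split_paired_Ex)
  from choice[OF this] obtain z where
    z: "\<forall>k. E1.minimizes R (H1 (average (d k) (fst (fst (z k)))) (average (d k) (fst (snd (z k))))) (fst (fst (z k))) (snd (fst (z k))) \<and>
      E2.minimizes R (H2 (average (d k) (fst (fst (z k)))) (average (d k) (fst (snd (z k))))) (fst (snd (z k))) (snd (snd (z k)))" ..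
  define u1 where "u1 k = fst (fst (z k))" for k
  define u2 where "u2 k = fst (snd (z k))" for k
  define G1 where "G1 k = snd (fst (z k))" for k
  define G2 where "G2 k = snd (snd (z k))" for k
  define w1 where "w1 k = average (d k) (u1 k)" for k
  define w2 where "w2 k = average (d k) (u2 k)" for k
  have m1: "E1.minimizes R (H1 (w1 k) (w2 k)) (u1 k) (G1 k)" and m2: "E2.minimizes R (H2 (w1 k) (w2 k)) (u2 k) (G2 k)" for k
    using z by (auto simp: u1_def u2_def G1_def G2_def w1_def w2_def)
  have wm: "w1 k \<in> borel_measurable E1.M" "w2 k \<in> borel_measurable E1.M" for k
    unfolding w1_def w2_def by (rule E1.step_fun_measurable)+
  have f: "E1.forcing H (H1 (w1 k) (w2 k))" "E1.forcing H (H2 (w1 k) (w2 k))" for k using H_forcing[OF wm, of k k] by auto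
  note R0 = less_imp_le[OF R]
  obtain r v1 where r: "strict_mono (r :: nat => nat)" and v1: "v1 \<in> borel_measurable E1.M"
    and u1: "AE x in E1.M. (%k. u1 (r k) x) ----> v1 x" and w1: "AE x in E1.M. (%k. w1 (r k) x) ----> v1 x"
    unfolding w1_def by (rule E1.minimizers_subseq[OF f(1) H R0 m1 d])
  have \<delta>r: "(%k. d (r k)) ----> 0" by (rule LIMSEQ_subseq_LIMSEQ[OF d(2) r, unfolded comp_def])
  \<comment> \<open>The second extraction runs along the first subsequence, whose mesh sizes
    \<open>d (r k)\<close> still tend to zero.\<close>
  obtain s v2 where s: "strict_mono (s :: nat => nat)" and v2: "v2 \<in> borel_measurable E1.M"
    and u2: "AE x in E1.M. (%k. u2 (r (s k)) x) ----> v2 x" and w2: "AE x in E1.M. (%k. w2 (r (s k)) x) ----> v2 x"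
    unfolding w2_def by (rule E2.minimizers_subseq[OF f(2) H R0 m2 d(1) \<delta>r])
  note sub = LIMSEQ_subseq_LIMSEQ[OF _ s, unfolded comp_def]
  have u1': "AE x in E1.M. (%k. u1 (r (s k)) x) ----> v1 x" using u1 by eventually_elim (rule sub)
  have w1': "AE x in E1.M. (%k. w1 (r (s k)) x) ----> v1 x" using w1 by eventually_elim (rule sub)
  have fv: "E1.forcing H (H1 v1 v2)" "E1.forcing H (H2 v1 v2)" using H_forcing[OF v1 v2] by auto
  have L: "(%k. \<integral>x. \<bar>H1 (w1 (r (s k))) (w2 (r (s k))) x - H1 v1 v2 x\<bar> \<partial>E1.M) ----> 0"
    "(%k. \<integral>x. \<bar>H2 (w1 (r (s k))) (w2 (r (s k))) x - H2 v1 v2 x\<bar> \<partial>E1.M) ----> 0"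
    using H_continuous[OF wm(1) wm(2) v1 v2 w1' w2] by auto
  obtain V1 where "E1.minimizes R (H1 v1 v2) v1 V1"
    using E1.minimizers_limit[OF f(1) fv(1) H R0 L(1) m1 u1'] by blast
  moreover obtain V2 where "E2.minimizes R (H2 v1 v2) v2 V2"
    using E2.minimizers_limit[OF f(2) fv(2) H R0 L(2) m2 u2] by blast
  ultimately show ?thesis by (rule that)
qed

end

section \<open>Luxemburg norms and nonlocal terms\<close>

lemma lux_le:
  assumes "0 < c" "modular \<Omega> q (%x. w x / c) <= 1"
  shows "lux \<Omega> q w <= c"
  unfolding lux_def using assms by (intro cInf_lower bdd_belowI[of _ 0]) auto

text \<open>The exponents of the nonlocal norms are merely measurable and bounded, and may equal 1,
  so the setting of \<open>var_exponent\<close> does not cover them. In return, the functions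
  inserted are bounded.\<close>

locale bounded_exponent =
  fixes \<Omega> :: "(real^'n) set" and q :: "real^'n => real" and Q :: real
  assumes \<Omega>: "\<Omega> \<in> lmeasurable"
    and q_measurable [measurable]: "q \<in> borel_measurable (lebesgue_on \<Omega>)"
    and q_bounds: "AE x in lebesgue_on \<Omega>. 1 <= q x & q x <= Q"
begin

abbreviation "L \<equiv> lebesgue_on \<Omega>"

sublocale finite_measure L using \<Omega> by (rule finite_measure_lebesgue_on)

lemma modular_mono:
  assumes "AE x in L. \<bar>v x\<bar> <= \<bar>w x\<bar>" "0 < c" "c <= d"
  shows "modular \<Omega> q (%x. v x / d) <= modular \<Omega> q (%x. w x / c)"
  unfolding modular_def
proof (rule nn_integral_mono_AE)
  show "AE x in L. ennreal (\<bar>v x / d\<bar> powr q x) <= ennreal (\<bar>w x / c\<bar> powr q x)"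
    using assms(1) q_bounds
  proof eventually_elim
    case (elim x)
    have "\<bar>v x / d\<bar> <= \<bar>w x / c\<bar>" using elim assms(2,3) by (simp add: abs_divide frac_le)
    then show ?case using elim by (intro ennreal_leI powr_mono2) auto
  qed
qed

lemma modular_scale:
  assumes [measurable]: "w \<in> borel_measurable L" and c: "0 < c" "c <= d"
  shows "modular \<Omega> q (%x. w x / d) <= ennreal (c / d) * modular \<Omega> q (%x. w x / c)"
proof -
  have "modular \<Omega> q (%x. w x / d) <= (\<integral>\<^sup>+x. ennreal (c / d) * ennreal (\<bar>w x / c\<bar> powr q x) \<partial>L)"
    unfolding modular_def
  proof (rule nn_integral_mono_AE)
    show "AE x in L. ennreal (\<bar>w x / d\<bar> powr q x) <= ennreal (c / d) * ennreal (\<bar>w x / c\<bar> powr q x)"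
      using q_bounds
    proof eventually_elim
      case (elim x)
      have "(c / d) powr q x <= (c / d) powr 1" using c elim by (intro powr_mono') auto
      then have le: "(c / d) powr q x <= c / d" using c by simp
      have eq: "\<bar>w x / d\<bar> = (c / d) * \<bar>w x / c\<bar>" using c by (simp add: abs_divide)
      have "\<bar>w x / d\<bar> powr q x = (c / d) powr q x * \<bar>w x / c\<bar> powr q x" unfolding eq using c by (subst powr_mult) auto
      also have "... <= (c / d) * \<bar>w x / c\<bar> powr q x" using le by (intro mult_right_mono) auto
      finally show ?case using c by (simp add: ennreal_mult[symmetric] ennreal_leI)
    qed
  qed
  also have "... = ennreal (c / d) * modular \<Omega> q (%x. w x / c)"
    unfolding modular_def by (rule nn_integral_cmult) measurable
  finally show ?thesis .
qed

text \<open>The scaled function is at most \<open>1 / (m + 1)\<close> in absolute value, a power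
  \<open>q x >= 1\<close> does not increase it, and \<open>m / (m + 1)\<close> is below 1.\<close>

lemma modular_le_1:
  assumes w: "AE x in L. \<bar>w x\<bar> <= C" and C: "0 < C"
  shows "modular \<Omega> q (%x. w x / (C * (measure L (space L) + 1))) <= 1"
proof -
  define m where "m = measure L (space L)"
  have m: "0 <= m" by (simp add: m_def)
  have c: "0 < C * (m + 1)" using C m by simp
  have "modular \<Omega> q (%x. w x / (C * (m + 1))) <= (\<integral>\<^sup>+x. ennreal (1 / (m + 1)) \<partial>L)"
    unfolding modular_def
  proof (rule nn_integral_mono_AE)
    show "AE x in L. ennreal (\<bar>w x / (C * (m + 1))\<bar> powr q x) <= ennreal (1 / (m + 1))"
      using w q_bounds
    proof eventually_elim
      case (elim x)
      have "\<bar>w x / (C * (m + 1))\<bar> = \<bar>w x\<bar> / (C * (m + 1))" using c by (simp only: abs_divide abs_of_pos)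
      also have "... <= C / (C * (m + 1))" using elim c by (intro divide_right_mono) auto
      also have "C / (C * (m + 1)) = 1 / (m + 1)" using C by simp
      finally have le: "\<bar>w x / (C * (m + 1))\<bar> <= 1 / (m + 1)" .
      also have "1 / (m + 1) <= 1" using m by simp
      finally have "\<bar>w x / (C * (m + 1))\<bar> powr q x <= \<bar>w x / (C * (m + 1))\<bar> powr 1" using elim by (intro powr_mono') auto
      then show ?case using le by (intro ennreal_leI) simp
    qed
  qed
  also have "... = ennreal (1 / (m + 1)) * ennreal m" unfolding m_def by (simp add: emeasure_eq_measure)
  also have "... = ennreal (1 / (m + 1) * m)" using m by (intro ennreal_mult[symmetric]) auto
  also have "... <= 1" using m by simp
  finally show ?thesis by (simp add: m_def)
qed

text \<open>Boundedness of \<open>w\<close> makes the set in the definition of \<open>lux\<close>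
  nonempty; the infimum of the empty set would carry no information.\<close>

lemma lux_ge:
  assumes w: "AE x in L. \<bar>w x\<bar> <= C" and le: "!!c. 0 < c ==> modular \<Omega> q (%x. w x / c) <= 1 ==> b <= c"
  shows "b <= lux \<Omega> q w"
  unfolding lux_def
proof (rule cInf_greatest)
  have "AE x in L. \<bar>w x\<bar> <= \<bar>C\<bar> + 1" using w by eventually_elim simp
  from modular_le_1[OF this] have "\<bar>C\<bar> + 1 > 0 ==> (\<bar>C\<bar> + 1) * (measure L (space L) + 1) \<in> {c. c > 0 & modular \<Omega> q (%x. w x / c) <= 1}"
    by (auto intro!: mult_pos_pos add_nonneg_pos)
  then show "{c. c > 0 & modular \<Omega> q (%x. w x / c) <= 1} ~= {}" by (metis abs_ge_zero add_nonneg_pos empty_iff zero_less_one)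
qed (use le in auto)

lemma lux_bounds:
  assumes w: "AE x in L. \<bar>w x\<bar> <= C" and C: "0 < C"
  shows "0 <= lux \<Omega> q w" "lux \<Omega> q w <= C * (measure L (space L) + 1)"
proof -
  show "0 <= lux \<Omega> q w" by (rule lux_ge[OF w]) simp
  have "0 < C * (measure L (space L) + 1)" using C by (intro mult_pos_pos add_nonneg_pos) auto
  then show "lux \<Omega> q w <= C * (measure L (space L) + 1)" using modular_le_1[OF w C] by (rule lux_le)
qed

lemma lux_mono:
  assumes "AE x in L. \<bar>v x\<bar> <= \<bar>w x\<bar>" and w: "AE x in L. \<bar>w x\<bar> <= C"
  shows "lux \<Omega> q v <= lux \<Omega> q w"
proof (rule lux_ge[OF w])
  fix c :: real assume c: "0 < c" "modular \<Omega> q (%x. w x / c) <= 1"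
  then show "lux \<Omega> q v <= c" using modular_mono[OF assms(1) c(1) order.refl] by (intro lux_le) auto
qed

text \<open>From \<open>t <= 1 + t powr q x\<close> for \<open>t >= 0\<close>, the L1 norm of
  \<open>w / c\<close> is at most the measure plus 1 for every admissible \<open>c\<close>, which
  gives an explicit positive lower bound.\<close>

lemma lux_pos:
  assumes w [measurable]: "w \<in> borel_measurable L" and C: "AE x in L. \<bar>w x\<bar> <= C" and pos: "AE x in L. 0 < w x"
    and \<mu>: "0 < measure L (space L)"
  shows "0 < lux \<Omega> q w"
proof -
  let ?\<mu> = "measure L (space L)"
  have i: "integrable L (%x. \<bar>w x\<bar>)" using C by (intro integrable_const_bound[where B=C]) auto
  have "(LINT x|L. \<bar>w x\<bar>) ~= 0"
  proof
    assume "(LINT x|L. \<bar>w x\<bar>) = 0"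
    then have "AE x in L. \<bar>w x\<bar> = 0" using i by (subst (asm) integral_nonneg_eq_0_iff_AE) auto
    with pos have "AE x in L. False" by eventually_elim simp
    then have "emeasure L (space L) = 0" by (subst (asm) AE_iff_measurable[OF sets.top]) auto
    with \<mu> show False by (simp add: measure_def)
  qed
  then have "0 < (LINT x|L. \<bar>w x\<bar>)" by (simp add: less_le)
  then have "0 < (LINT x|L. \<bar>w x\<bar>) / (?\<mu> + 1)" using \<mu> by simp
  also have "... <= lux \<Omega> q w"
  proof (rule lux_ge[OF C])
    fix c :: real assume c: "0 < c" "modular \<Omega> q (%x. w x / c) <= 1"
    have "ennreal (LINT x|L. \<bar>w x\<bar> / c) = (\<integral>\<^sup>+x. ennreal (\<bar>w x\<bar> / c) \<partial>L)"
      using i c by (intro nn_integral_eq_integral[symmetric]) auto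
    also have "... <= (\<integral>\<^sup>+x. 1 + ennreal (\<bar>w x / c\<bar> powr q x) \<partial>L)"
    proof (rule nn_integral_mono_AE)
      show "AE x in L. ennreal (\<bar>w x\<bar> / c) <= 1 + ennreal (\<bar>w x / c\<bar> powr q x)"
        using q_bounds
      proof eventually_elim
        case (elim x)
        have "\<bar>w x / c\<bar> <= 1 + \<bar>w x / c\<bar> powr q x"
        proof (cases "\<bar>w x / c\<bar> <= 1")
          case False
          then have "\<bar>w x / c\<bar> powr 1 <= \<bar>w x / c\<bar> powr q x" using elim by (intro powr_mono) auto
          then show ?thesis by simp
        qed (simp add: add_increasing2)
        then have "ennreal (\<bar>w x\<bar> / c) <= ennreal (1 + \<bar>w x / c\<bar> powr q x)" using c by (intro ennreal_leI) (simp add: abs_divide)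
        then show ?case by (simp add: ennreal_plus)
      qed
    qed
    also have "... = ennreal ?\<mu> + modular \<Omega> q (%x. w x / c)"
      by (simp add: nn_integral_add modular_def emeasure_eq_measure)
    also have "... <= ennreal ?\<mu> + 1" using c(2) by (rule add_left_mono)
    also have "... = ennreal (?\<mu> + 1)" by (simp add: ennreal_plus)
    finally have "(LINT x|L. \<bar>w x\<bar> / c) <= ?\<mu> + 1" using \<mu> by (subst (asm) ennreal_le_iff) auto
    then have "(LINT x|L. \<bar>w x\<bar>) / c <= ?\<mu> + 1" by simp
    then show "(LINT x|L. \<bar>w x\<bar>) / (?\<mu> + 1) <= c" using c(1) \<mu> by (simp add: divide_le_eq mult.commute)
  qed
  finally show ?thesis .
qed

lemma modular_tendsto:
  assumes w [measurable]: "!!k. w k \<in> borel_measurable L" "v \<in> borel_measurable L" and C: "!!k. AE x in L. \<bar>w k x\<bar> <= C"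
    and lim: "AE x in L. (%k. w k x) ----> v x" and c: "0 < c"
  shows "(%k. modular \<Omega> q (%x. w k x / c)) ----> modular \<Omega> q (%x. v x / c)"
  unfolding modular_def
proof (rule nn_integral_dominated_convergence)
  let ?B = "max 1 (C / c) powr Q"
  show "(\<integral>\<^sup>+x. ennreal ?B \<partial>L) < \<infinity>" by (simp add: emeasure_eq_measure ennreal_mult_less_top)
  show "AE x in L. ennreal (\<bar>w k x / c\<bar> powr q x) <= ennreal ?B" for k
    using C[of k] q_bounds
  proof eventually_elim
    case (elim x)
    have "\<bar>w k x / c\<bar> <= max 1 (C / c)" using elim c by (simp add: abs_divide divide_right_mono le_max_iff_disj)
    then have "\<bar>w k x / c\<bar> powr q x <= max 1 (C / c) powr q x" using elim by (intro powr_mono2) auto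
    also have "... <= ?B" using elim by (intro powr_mono) auto
    finally show ?case by (rule ennreal_leI)
  qed
  show "AE x in L. (%k. ennreal (\<bar>w k x / c\<bar> powr q x)) ----> ennreal (\<bar>v x / c\<bar> powr q x)"
    using lim q_bounds
  proof eventually_elim
    case (elim x)
    have "(%k. \<bar>w k x / c\<bar>) ----> \<bar>v x / c\<bar>" using elim c by (intro tendsto_intros) auto
    then have "(%k. \<bar>w k x / c\<bar> powr q x) ----> \<bar>v x / c\<bar> powr q x" using elim by (intro tendsto_powr2 tendsto_const) auto
    then show ?case by (rule tendsto_ennrealI)
  qed
qed measurable

text \<open>At a scale below the limit norm the modular exceeds 1, which persists along the
  sequence. Above it, a modular equal to 1 need not persist, so \<open>modular_scale\<close> first
  makes it strictly smaller by enlarging the scale.\<close>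

lemma lux_tendsto:
  assumes w: "!!k. w k \<in> borel_measurable L" "v \<in> borel_measurable L" and C: "!!k. AE x in L. \<bar>w k x\<bar> <= C"
    and v: "AE x in L. \<bar>v x\<bar> <= C" and lim: "AE x in L. (%k. w k x) ----> v x"
  shows "(%k. lux \<Omega> q (w k)) ----> lux \<Omega> q v"
proof (rule order_tendstoI)
  note mt = modular_tendsto[OF w C lim]
  have nonneg: "0 <= lux \<Omega> q u" if "AE x in L. \<bar>u x\<bar> <= C" for u by (rule lux_ge[OF that]) simp
  fix a
  show "\<forall>\<^sub>F k in sequentially. a < lux \<Omega> q (w k)" if a: "a < lux \<Omega> q v"
  proof (cases "a < 0")
    case True
    then show ?thesis using nonneg[OF C] by (intro always_eventually allI) (rule less_le_trans)
  next
    case False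
    define c where "c = (a + lux \<Omega> q v) / 2"
    have c: "0 < c" "a < c" "c < lux \<Omega> q v" using a False by (auto simp: c_def)
    have "1 < modular \<Omega> q (%x. v x / c)" using lux_le[OF c(1), of \<Omega> q v] c(3) by (meson not_le)
    from order_tendstoD(1)[OF mt[OF c(1)] this] show ?thesis
    proof eventually_elim
      case (elim k)
      have "c <= lux \<Omega> q (w k)"
      proof (rule lux_ge[OF C])
        fix d :: real assume d: "0 < d" "modular \<Omega> q (%x. w k x / d) <= 1"
        show "c <= d"
        proof (rule ccontr)
          assume "\<not> c <= d"
          then have "modular \<Omega> q (%x. w k x / c) <= modular \<Omega> q (%x. w k x / d)" using d(1) by (intro modular_mono) auto
          with d(2) elim show False by simp
        qed
      qed
      with c(2) show ?case by simp
    qed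
  qed
  show "\<forall>\<^sub>F k in sequentially. lux \<Omega> q (w k) < a" if a: "lux \<Omega> q v < a"
  proof -
    define d where "d = (lux \<Omega> q v + a) / 2"
    have d: "lux \<Omega> q v < d" "d < a" using a by (auto simp: d_def)
    have "0 < d" using d(1) nonneg[OF v] by simp
    have "\<not> (d <= lux \<Omega> q v)" using d(1) by simp
    then obtain c where c: "0 < c" "modular \<Omega> q (%x. v x / c) <= 1" "c < d"
      using lux_ge[OF v, of d] by (meson not_le)
    have "modular \<Omega> q (%x. v x / d) <= ennreal (c / d) * modular \<Omega> q (%x. v x / c)"
      using c by (intro modular_scale w) auto
    also have "... <= ennreal (c / d) * 1" using c(2) by (rule mult_left_mono) simp
    also have "... < 1" using c \<open>0 < d\<close> by (simp add: ennreal_less_one_iff)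
    finally have "modular \<Omega> q (%x. v x / d) < 1" .
    from order_tendstoD(2)[OF mt[OF \<open>0 < d\<close>] this] show ?thesis
    proof eventually_elim
      case (elim k)
      from lux_le[OF \<open>0 < d\<close> less_imp_le[OF this]] d(2) show ?case by simp
    qed
  qed
qed

end

section \<open>Superposition operators and the nonlocal term\<close>

lemma borel_measurable_superposition:
  fixes f :: "real^'n => real => real => real"
  assumes f: "continuous_on (closure \<Omega> \<times> UNIV \<times> UNIV) (%(x, t, s). f x t s)"
    and [measurable]: "u \<in> borel_measurable (lebesgue_on \<Omega>)" "v \<in> borel_measurable (lebesgue_on \<Omega>)"
  shows "(%x. f x (u x) (v x)) \<in> borel_measurable (lebesgue_on \<Omega>)"
proof -
  let ?S = "closure \<Omega> \<times> (UNIV :: real set) \<times> (UNIV :: real set)"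
  have "closed ?S" by (intro closed_Times) auto
  then have "?S \<in> sets borel" by (rule borel_closed)
  from borel_measurable_continuous_on_indicator[OF this f]
  have [measurable]: "(%z. indicator ?S z *\<^sub>R (case z of (x, t, s) => f x t s)) \<in> borel_measurable borel" .
  have [measurable]: "(%x. x) \<in> borel_measurable (lebesgue_on \<Omega>)"
    by (intro measurable_restrict_space1 measurable_completion) simp
  have "(%x. indicator ?S (x, u x, v x) *\<^sub>R (case (x, u x, v x) of (x, t, s) => f x t s)) \<in> borel_measurable (lebesgue_on \<Omega>)"
    by (rule measurable_compose[of "%x. (x, u x, v x)" _ borel]) measurable
  then show ?thesis
    by (rule measurable_cong[THEN iffD1, rotated]) (auto simp: space_restrict_space closure_subset[THEN subsetD])
qed

lemma AE_superposition_tendsto: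
  fixes f :: "real^'n => real => real => real"
  assumes f: "continuous_on (closure \<Omega> \<times> UNIV \<times> UNIV) (%(x, t, s). f x t s)" and "x \<in> \<Omega>"
    and "u ----> t" "v ----> s"
  shows "(%k. f x (u k) (v k)) ----> f x t s"
proof -
  have "x \<in> closure \<Omega>" using \<open>x \<in> \<Omega>\<close> closure_subset by blast
  moreover have "(%k. (x, u k, v k)) ----> (x, t, s)" by (intro tendsto_Pair tendsto_const assms(3,4))
  ultimately show ?thesis using continuous_on_tendsto_compose[OF f, of "%k. (x, u k, v k)" "(x, t, s)" sequentially] by simp
qed

lemma superposition_bounded:
  fixes f :: "real^'n => real => real => real"
  assumes f: "continuous_on (closure \<Omega> \<times> UNIV \<times> UNIV) (%(x, t, s). f x t s)" and "bounded \<Omega>"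
  obtains B where "0 <= B" "!!x t s. x \<in> \<Omega> ==> \<bar>t\<bar> <= C ==> \<bar>s\<bar> <= C ==> \<bar>f x t s\<bar> <= B"
proof -
  let ?K = "closure \<Omega> \<times> {- C..C} \<times> {- C..C}"
  have "compact ?K" using \<open>bounded \<Omega>\<close> by (intro compact_Times) auto
  then have "compact ((%(x, t, s). f x t s) ` ?K)"
    by (rule compact_continuous_image[rotated]) (rule continuous_on_subset[OF f]; auto)
  from compact_imp_bounded[OF this] obtain B where bd: "\<forall>y\<in>(%(x, t, s). f x t s) ` ?K. norm y <= B"
    unfolding bounded_iff ..
  have B: "norm (case z of (x, t, s) => f x t s) <= B" if "z \<in> ?K" for z
    by (rule bspec[OF bd imageI[OF that]])
  show ?thesis
  proof (rule that[of "\<bar>B\<bar>"])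
    fix x :: "real^'n" and t s :: real assume "x \<in> \<Omega>" "\<bar>t\<bar> <= C" "\<bar>s\<bar> <= C"
    then have "(x, t, s) \<in> ?K" using closure_subset by auto
    from B[OF this] show "\<bar>f x t s\<bar> <= \<bar>B\<bar>" by simp
  qed simp
qed

text \<open>\<open>Q\<close> bounds all exponents at once, \<open>C\<close> the arguments, and
  \<open>{\<sigma>1..\<sigma>2}\<close> is a range of norms on which \<open>A\<close> is positive.
  Positivity of \<open>\<sigma>1\<close> keeps the argument of \<open>A\<close> in its domain of
  continuity.\<close>

locale nonlocal_term =
  Lq: bounded_exponent \<Omega> q Q + Lr: bounded_exponent \<Omega> r Q + Ls: bounded_exponent \<Omega> s Q
  for \<Omega> :: "(real^'n) set" and q r s :: "real^'n => real" and Q :: real +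
  fixes \<alpha> \<gamma> :: "real^'n => real" and A :: "real^'n => real => real" and f g :: "real^'n => real => real => real" and C \<sigma>1 \<sigma>2 :: real
  assumes bounded: "bounded \<Omega>"
    and \<alpha>\<gamma>_measurable [measurable]: "\<alpha> \<in> borel_measurable (lebesgue_on \<Omega>)" "\<gamma> \<in> borel_measurable (lebesgue_on \<Omega>)"
    and \<alpha>\<gamma>_bounds: "AE x in lebesgue_on \<Omega>. 0 <= \<alpha> x & \<alpha> x <= Q & 0 <= \<gamma> x & \<gamma> x <= Q"
    and f: "continuous_on (closure \<Omega> \<times> UNIV \<times> UNIV) (%(x, t, s). f x t s)"
    and g: "continuous_on (closure \<Omega> \<times> UNIV \<times> UNIV) (%(x, t, s). g x t s)"
    and A: "continuous_on (closure \<Omega> \<times> {0<..}) (%(x, t). A x t)"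
    and A_pos: "!!x t. x \<in> closure \<Omega> ==> \<sigma>1 <= t ==> t <= \<sigma>2 ==> 0 < A x t"
    and \<sigma>1: "0 < \<sigma>1" and C: "0 < C" and \<mu>: "0 < measure (lebesgue_on \<Omega>) (space (lebesgue_on \<Omega>))"
begin

text \<open>The function \<open>b\<close> under the norms of the numerator is separate from
  \<open>v\<close>, as for sub- and supersolutions, where those norms are frozen while
  \<open>v\<close> runs through the order interval.\<close>

definition term_fun :: "(real^'n => real) => (real^'n => real) => (real^'n => real) => real^'n => real" where
  "term_fun u b v x = (f x (u x) (v x) * lux \<Omega> q b powr \<alpha> x + g x (u x) (v x) * lux \<Omega> s b powr \<gamma> x) / A x (lux \<Omega> r v)"

text \<open>Strict positivity makes the norms positive. The powers with exponents
  \<open>\<alpha> x\<close> and \<open>\<gamma> x\<close> are then continuous in the norm even where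
  the exponent is zero, although \<open>0 powr 0 = 0\<close>.\<close>

definition tame :: "(real^'n => real) => bool" where
  "tame v \<longleftrightarrow> v \<in> borel_measurable (lebesgue_on \<Omega>) & (AE x in lebesgue_on \<Omega>. 0 < v x & v x <= C) \<and>
     \<sigma>1 <= lux \<Omega> r v & lux \<Omega> r v <= \<sigma>2"

lemma tameD:
  assumes "tame v"
  shows "v \<in> borel_measurable (lebesgue_on \<Omega>)" "AE x in lebesgue_on \<Omega>. \<bar>v x\<bar> <= C" "0 < lux \<Omega> r v"
    "0 < lux \<Omega> q v" "0 < lux \<Omega> s v" "\<sigma>1 <= lux \<Omega> r v" "lux \<Omega> r v <= \<sigma>2"
proof -
  have pos: "AE x in lebesgue_on \<Omega>. 0 < v x" using assms by (auto simp: tame_def)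
  show m: "v \<in> borel_measurable (lebesgue_on \<Omega>)" and C: "AE x in lebesgue_on \<Omega>. \<bar>v x\<bar> <= C"
    using assms by (auto simp: tame_def)
  show "0 < lux \<Omega> q v" by (rule Lq.lux_pos[OF m C pos \<mu>])
  show "0 < lux \<Omega> s v" by (rule Ls.lux_pos[OF m C pos \<mu>])
  show "\<sigma>1 <= lux \<Omega> r v" "lux \<Omega> r v <= \<sigma>2" "0 < lux \<Omega> r v" using assms \<sigma>1 by (auto simp: tame_def)
qed

lemma A_measurable:
  assumes "0 < t" shows "(%x. A x t) \<in> borel_measurable (lebesgue_on \<Omega>)"
proof -
  have "continuous_on (closure \<Omega> \<times> UNIV \<times> UNIV) (%(x, a :: real, b :: real). A x t)"
    unfolding case_prod_beta
    by (rule continuous_on_compose2[OF A[unfolded case_prod_beta], of _ "%z. (fst z, t)", simplified])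
      (use \<open>0 < t\<close> in \<open>auto intro!: continuous_intros\<close>)
  from borel_measurable_superposition[OF this, of "%_. 0" "%_. 0"] show ?thesis by simp
qed

lemma term_fun_measurable:
  assumes u: "u \<in> borel_measurable (lebesgue_on \<Omega>)" and v: "tame v"
  shows "term_fun u b v \<in> borel_measurable (lebesgue_on \<Omega>)"
proof -
  note [measurable] = borel_measurable_superposition[OF f u tameD(1)[OF v]] borel_measurable_superposition[OF g u tameD(1)[OF v]]
    A_measurable[OF tameD(3)[OF v]]
  show ?thesis unfolding term_fun_def[abs_def] by measurable
qed

lemma term_fun_bounded:
  obtains H where "0 <= H" "!!u b v. AE x in lebesgue_on \<Omega>. \<bar>u x\<bar> <= C ==> tame b ==> tame v ==>
     AE x in lebesgue_on \<Omega>. \<bar>term_fun u b v x\<bar> <= H"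
proof -
  obtain F where F: "0 <= F" "!!x t s. x \<in> \<Omega> ==> \<bar>t\<bar> <= C ==> \<bar>s\<bar> <= C ==> \<bar>f x t s\<bar> <= F"
    by (rule superposition_bounded[OF f bounded, of C]) (rule that; blast)
  obtain G where G: "0 <= G" "!!x t s. x \<in> \<Omega> ==> \<bar>t\<bar> <= C ==> \<bar>s\<bar> <= C ==> \<bar>g x t s\<bar> <= G"
    by (rule superposition_bounded[OF g bounded, of C]) (rule that; blast)
  have "\<exists>a>0. \<forall>x\<in>\<Omega>. \<forall>t\<in>{\<sigma>1..\<sigma>2}. a <= A x t"
  proof (cases "closure \<Omega> \<times> {\<sigma>1..\<sigma>2} = {}")
    case True
    then show ?thesis using closure_subset[of \<Omega>] by (intro exI[of _ 1]) auto
  next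
    case False
    have "compact (closure \<Omega> \<times> {\<sigma>1..\<sigma>2})" using bounded by (intro compact_Times) auto
    moreover have "continuous_on (closure \<Omega> \<times> {\<sigma>1..\<sigma>2}) (%(x, t). A x t)"
      by (rule continuous_on_subset[OF A]) (use \<sigma>1 in auto)
    ultimately obtain z where z: "z \<in> closure \<Omega> \<times> {\<sigma>1..\<sigma>2}"
      "\<forall>y\<in>closure \<Omega> \<times> {\<sigma>1..\<sigma>2}. (case z of (x, t) => A x t) <= (case y of (x, t) => A x t)"
      using continuous_attains_inf False by blast
    show ?thesis
    proof (intro exI[of _ "A (fst z) (snd z)"] conjI ballI)
      show "0 < A (fst z) (snd z)" using z(1) by (intro A_pos) auto
      show "A (fst z) (snd z) <= A x t" if "x \<in> \<Omega>" "t \<in> {\<sigma>1..\<sigma>2}" for x t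
        using z(2)[rule_format, of "(x, t)"] that closure_subset by (auto simp: case_prod_beta)
    qed
  qed
  then obtain a where a: "0 < a" "!!x t. x \<in> \<Omega> ==> \<sigma>1 <= t ==> t <= \<sigma>2 ==> a <= A x t" by auto
  \<comment> \<open>At least 1, so that \<open>\<Lambda> powr e\<close> increases with
    \<open>e\<close> and \<open>\<Lambda> powr Q\<close> bounds every power of the norms that
    occurs.\<close>
  define \<Lambda> where "\<Lambda> = max 1 (C * (measure (lebesgue_on \<Omega>) (space (lebesgue_on \<Omega>)) + 1))"
  define H where "H = (F * \<Lambda> powr Q + G * \<Lambda> powr Q) / a"
  have pw: "l powr e <= \<Lambda> powr Q" if "0 < l" "l <= C * (measure (lebesgue_on \<Omega>) (space (lebesgue_on \<Omega>)) + 1)" "0 <= e" "e <= Q" for l e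
  proof -
    have "l powr e <= \<Lambda> powr e" using that by (intro powr_mono2) (auto simp: \<Lambda>_def)
    also have "... <= \<Lambda> powr Q" using that by (intro powr_mono) (auto simp: \<Lambda>_def)
    finally show ?thesis .
  qed
  show ?thesis
  proof (rule that[of H])
    show "0 <= H" using F(1) G(1) a(1) by (simp add: H_def)
    fix u b v assume u: "AE x in lebesgue_on \<Omega>. \<bar>u x\<bar> <= C" and b: "tame b" and v: "tame v"
    note b' = tameD[OF b] and v' = tameD[OF v]
    show "AE x in lebesgue_on \<Omega>. \<bar>term_fun u b v x\<bar> <= H"
      using u v'(2) \<alpha>\<gamma>_bounds AE_space
    proof eventually_elim
      case (elim x)
      then have x: "x \<in> \<Omega>" by (simp add: space_restrict_space)
      have ax: "a <= A x (lux \<Omega> r v)" using a(2)[OF x] v'(6,7) by simp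
      have "\<bar>f x (u x) (v x) * lux \<Omega> q b powr \<alpha> x\<bar> <= F * \<Lambda> powr Q"
        unfolding abs_mult using F elim x pw[OF b'(4) Lq.lux_bounds(2)[OF b'(2) C]] by (intro mult_mono) auto
      moreover have "\<bar>g x (u x) (v x) * lux \<Omega> s b powr \<gamma> x\<bar> <= G * \<Lambda> powr Q"
        unfolding abs_mult using G elim x pw[OF b'(5) Ls.lux_bounds(2)[OF b'(2) C]] by (intro mult_mono) auto
      ultimately have "\<bar>f x (u x) (v x) * lux \<Omega> q b powr \<alpha> x + g x (u x) (v x) * lux \<Omega> s b powr \<gamma> x\<bar> <= F * \<Lambda> powr Q + G * \<Lambda> powr Q"
        by linarith
      then show ?case using a(1) ax by (simp add: term_fun_def H_def abs_divide frac_le)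
    qed
  qed
qed

lemma term_fun_tendsto:
  assumes u: "AE x in lebesgue_on \<Omega>. (%k. u k x) ----> u' x" and v: "AE x in lebesgue_on \<Omega>. (%k. v k x) ----> v' x"
    and t: "!!k. tame (v k)" "tame v'"
  shows "AE x in lebesgue_on \<Omega>. (%k. term_fun (u k) (v k) (v k) x) ----> term_fun u' v' v' x"
proof -
  note tk = tameD[OF t(1)] and t' = tameD[OF t(2)]
  have l: "(%k. lux \<Omega> q (v k)) ----> lux \<Omega> q v'" "(%k. lux \<Omega> r (v k)) ----> lux \<Omega> r v'" "(%k. lux \<Omega> s (v k)) ----> lux \<Omega> s v'"
    by (rule Lq.lux_tendsto Lr.lux_tendsto Ls.lux_tendsto; fact tk(1) t'(1) tk(2) t'(2) v)+
  show ?thesis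
    using u v AE_space
  proof eventually_elim
    case (elim x)
    then have x: "x \<in> \<Omega>" by (simp add: space_restrict_space)
    then have xc: "x \<in> closure \<Omega>" using closure_subset by blast
    have "(%k. (x, lux \<Omega> r (v k))) ----> (x, lux \<Omega> r v')" by (intro tendsto_Pair tendsto_const l)
    then have "(%k. A x (lux \<Omega> r (v k))) ----> A x (lux \<Omega> r v')"
      using continuous_on_tendsto_compose[OF A, of "%k. (x, lux \<Omega> r (v k))" "(x, lux \<Omega> r v')" sequentially] xc t'(3) tk(3) by simp
    moreover have "A x (lux \<Omega> r v') ~= 0" using A_pos[OF xc t'(6,7)] by simp
    ultimately show ?case
      unfolding term_fun_def using t'(4,5)
      by (intro tendsto_divide tendsto_add tendsto_mult tendsto_powr tendsto_const l AE_superposition_tendsto[OF f x elim(1,2)]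
        AE_superposition_tendsto[OF g x elim(1,2)]) auto
  qed
qed

lemma term_fun_L1_tendsto:
  assumes u: "!!k. u k \<in> borel_measurable (lebesgue_on \<Omega>)" "!!k. AE x in lebesgue_on \<Omega>. \<bar>u k x\<bar> <= C"
    and u': "u' \<in> borel_measurable (lebesgue_on \<Omega>)" "AE x in lebesgue_on \<Omega>. \<bar>u' x\<bar> <= C"
    and lu: "AE x in lebesgue_on \<Omega>. (%k. u k x) ----> u' x" and lv: "AE x in lebesgue_on \<Omega>. (%k. v k x) ----> v' x"
    and t: "!!k. tame (v k)" "tame v'"
  shows "(%k. \<integral>x. \<bar>term_fun (u k) (v k) (v k) x - term_fun u' v' v' x\<bar> \<partial>lebesgue_on \<Omega>) ----> 0"
proof -
  obtain H where H: "0 <= H" "!!u b v. AE x in lebesgue_on \<Omega>. \<bar>u x\<bar> <= C ==> tame b ==> tame v ==>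
     AE x in lebesgue_on \<Omega>. \<bar>term_fun u b v x\<bar> <= H" by (rule term_fun_bounded) (rule that; blast)
  note [measurable] = term_fun_measurable[OF u(1) t(1)] term_fun_measurable[OF u'(1) t(2)]
  have "(%k. \<integral>x. \<bar>term_fun (u k) (v k) (v k) x - term_fun u' v' v' x\<bar> \<partial>lebesgue_on \<Omega>) ----> (LINT x|lebesgue_on \<Omega>. 0)"
  proof (rule integral_dominated_convergence)
    show "integrable (lebesgue_on \<Omega>) (%x. 2 * H)" by (rule Lq.integrable_const)
    show "AE x in lebesgue_on \<Omega>. (%k. \<bar>term_fun (u k) (v k) (v k) x - term_fun u' v' v' x\<bar>) ----> 0"
      using term_fun_tendsto[OF lu lv t] by eventually_elim (rule tendsto_rabs_zero[OF LIM_zero])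
    show "AE x in lebesgue_on \<Omega>. norm \<bar>term_fun (u k) (v k) (v k) x - term_fun u' v' v' x\<bar> <= 2 * H" for k
      using H(2)[OF u(2) t(1) t(1), of k k k] H(2)[OF u'(2) t(2) t(2)] by eventually_elim simp
  qed auto
  then show ?thesis by simp
qed

end

section \<open>Comparison with sub- and supersolutions\<close>

context bounded_sobolev
begin

text \<open>Monotonicity of \<open>plap\<close> makes the integrand of the difference nonnegative,
  so the hypothesis forces it to vanish. Strict monotonicity then kills the gradient of the positive
  part, and the Poincare inequality the positive part itself.\<close>

lemma comparison:
  assumes \<phi>: "S0 (%x. max 0 (a x - b x)) (%x. if a x - b x > 0 then X x - Y x else 0)"
    and L: "Lp X" "Lp Y"
    and le: "(LINT x|M. plap (p x) (X x) \<bullet> (if a x - b x > 0 then X x - Y x else 0))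
      <= (LINT x|M. plap (p x) (Y x) \<bullet> (if a x - b x > 0 then X x - Y x else 0))"
  shows "AE x in M. a x <= b x"
proof -
  let ?\<phi> = "%x. max 0 (a x - b x)" and ?\<Phi> = "%x. if a x - b x > 0 then X x - Y x else 0"
  note L\<Phi> = S0D(2)[OF \<phi>]
  let ?D = "%x. plap (p x) (X x) \<bullet> ?\<Phi> x - plap (p x) (Y x) \<bullet> ?\<Phi> x"
  note iX = Lp_plap_integrable(1)[OF L(1) L\<Phi>] and iY = Lp_plap_integrable(1)[OF L(2) L\<Phi>]
  have D: "?D x = (if a x - b x > 0 then (plap (p x) (X x) - plap (p x) (Y x)) \<bullet> (X x - Y x) else 0)" for x
    by (simp add: inner_diff_left)
  have nonneg: "AE x in M. 0 <= ?D x"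
    unfolding D by (rule AE_I2) (simp add: plap_monotone(1) p_ge1)
  have i: "integrable M ?D" by (rule Bochner_Integration.integrable_diff[OF iX iY])
  have "(LINT x|M. ?D x) = (LINT x|M. plap (p x) (X x) \<bullet> ?\<Phi> x) - (LINT x|M. plap (p x) (Y x) \<bullet> ?\<Phi> x)"
    by (rule Bochner_Integration.integral_diff[OF iX iY])
  then have "(LINT x|M. ?D x) = 0" using le integral_nonneg_AE[OF nonneg] by linarith
  then have "AE x in M. ?D x = 0" using integral_nonneg_eq_0_iff_AE[OF i nonneg] by simp
  then have \<Phi>0: "AE x in M. norm (?\<Phi> x) = 0"
    using AE_space
  proof eventually_elim
    case (elim x)
    show ?case
    proof (rule ccontr)
      assume "norm (?\<Phi> x) ~= 0"
      then have "a x - b x > 0" "X x ~= Y x" by (auto split: if_splits)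
      with plap_monotone(2)[OF p_ge1[OF elim(2)], of "X x" "Y x"] elim(1)[unfolded D] show False by simp
    qed
  qed
  obtain c where c: "0 <= c" "!!u G. S0 u G ==> (LINT x|M. \<bar>u x\<bar>) <= c * (LINT x|M. norm (G x))"
    by (rule poincare[OF bounded_\<Omega>]) (rule that; blast)
  have "(LINT x|M. norm (?\<Phi> x)) = (LINT x|M. 0)"
    using Lp_measurable[OF L\<Phi>] \<Phi>0 by (intro integral_cong_AE borel_measurable_norm) auto
  with c(2)[OF \<phi>] have "(LINT x|M. \<bar>?\<phi> x\<bar>) <= 0" by simp
  moreover have "0 <= (LINT x|M. \<bar>?\<phi> x\<bar>)" by simp
  ultimately have "(LINT x|M. \<bar>?\<phi> x\<bar>) = 0" by linarith
  then have "AE x in M. \<bar>?\<phi> x\<bar> = 0"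
    using integral_nonneg_eq_0_iff_AE[OF integrable_abs[OF Lp_integrable(1)[OF S0D(1)[OF \<phi>]]]] by simp
  then show ?thesis by eventually_elim (simp add: max_def split: if_splits)
qed

text \<open>Since \<open>C < R\<close> the obstacle \<open>\<bar>u\<bar> \<le> R\<close> is inactive, so the variational inequality can be tested with both signs.\<close>
lemma minimizer_equation:
  assumes h: "forcing H h" and H: "0 <= H" and u: "minimizes R h u G" and C: "AE x in M. \<bar>u x\<bar> <= C" "0 <= C" "C < R"
    and \<phi>: "S0 \<phi> \<Phi>"
  shows "(LINT x|M. plap (p x) (G x) \<bullet> \<Phi> x) = (LINT x|M. h x * \<phi> x)"
proof -
  have R: "0 <= R" using C by simp
  note LG = S0D(2)[OF minimizesD(3)[OF u]]
  have half: "(LINT x|M. h x * (t * \<psi> x)) <= (LINT x|M. plap (p x) (G x) \<bullet> (t *\<^sub>R cgrad \<psi> x))"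
    if \<psi>: "test_fun \<Omega> \<psi>" and t: "!!x. \<bar>t * \<psi> x\<bar> <= R - C" for \<psi> t
  proof (rule minimizer_variational_inequality[OF h H R u])
    show "S0 (%x. t * \<psi> x) (%x. t *\<^sub>R cgrad \<psi> x)"
      using S0_mult_add[OF S0_test_fun[OF \<psi>] S0_test_fun[OF \<psi>], of t 0] by simp
    show "AE x in M. \<bar>u x + t * \<psi> x\<bar> <= R"
      using C(1)
    proof eventually_elim
      case (elim x)
      with t[of x] show ?case by linarith
    qed
  qed
  have eq: "(LINT x|M. plap (p x) (G x) \<bullet> cgrad \<psi> x) = (LINT x|M. h x * \<psi> x)" if \<psi>: "test_fun \<Omega> \<psi>" for \<psi>
  proof -
    obtain B where B: "!!x. \<bar>\<psi> x\<bar> <= B" using test_fun_bounded[OF \<psi>] by blast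
    have B0: "0 <= B" using B[of 0] abs_ge_zero order_trans by blast
    \<comment> \<open>Scaled so that \<open>t * \<psi>\<close> fits into the gap between
      \<open>C\<close> and \<open>R\<close>; both signs are then admissible.\<close>
    define t where "t = (R - C) / (B + 1)"
    have t: "0 < t" using C B0 by (simp add: t_def)
    have "\<bar>t * \<psi> x\<bar> <= R - C" for x
    proof -
      have "t * \<bar>\<psi> x\<bar> <= t * (B + 1)" using B[of x] t by (intro mult_left_mono) auto
      also have "... = R - C" using B0 by (simp add: t_def)
      finally show ?thesis using t by (simp add: abs_mult)
    qed
    then have "(LINT x|M. h x * (t * \<psi> x)) <= (LINT x|M. plap (p x) (G x) \<bullet> (t *\<^sub>R cgrad \<psi> x))"
      "(LINT x|M. h x * (- t * \<psi> x)) <= (LINT x|M. plap (p x) (G x) \<bullet> (- t *\<^sub>R cgrad \<psi> x))"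
      by (intro half[OF \<psi>]; simp)+
    then have "t * (LINT x|M. h x * \<psi> x) <= t * (LINT x|M. plap (p x) (G x) \<bullet> cgrad \<psi> x)"
      "- t * (LINT x|M. h x * \<psi> x) <= - t * (LINT x|M. plap (p x) (G x) \<bullet> cgrad \<psi> x)"
      by (simp_all add: mult.left_commute)
    then show ?thesis using t by simp
  qed
  obtain \<psi> where \<psi>': "\<forall>k. test_fun \<Omega> (\<psi> k)"
    "(%k. mo (%x. \<psi> k x - \<phi> x)) ----> 0" "(%k. mo (%x. cgrad (\<psi> k) x - \<Phi> x)) ----> 0"
    by (rule S0E[OF \<phi>])
  note \<psi> = \<psi>'(1)[rule_format] and lim = \<psi>'(2,3)
  note L\<psi> = Lp_test_fun[OF \<psi>]
  have "(%k. \<integral>x. plap (p x) (G x) \<bullet> cgrad (\<psi> k) x \<partial>M) ----> (LINT x|M. plap (p x) (G x) \<bullet> \<Phi> x)"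
    by (rule plap_integral_tendsto[OF LG L\<psi>(2) S0D(2)[OF \<phi>] lim(2)])
  moreover have "(%k. \<integral>x. h x * \<psi> k x \<partial>M) ----> (LINT x|M. h x * \<phi> x)"
  proof -
    have "(%k. (LINT x|M. \<psi> k x * h x) - (LINT x|M. \<phi> x * h x)) ----> 0"
    proof (rule tendsto_integral_mult_bounded[OF Lp_integrable(1)[OF L\<psi>(1)] Lp_integrable(1)[OF S0D(1)[OF \<phi>]], where B=H])
      show "(%k. \<integral>x. \<bar>\<psi> k x - \<phi> x\<bar> \<partial>M) ----> 0"
        using mo_tendsto_0_L1[OF Lp_diff(1)[OF L\<psi>(1) S0D(1)[OF \<phi>]] lim(1)] by simp
    qed (use h in \<open>auto simp: forcing_def\<close>)
    then show ?thesis by (simp add: LIM_zero_iff mult.commute)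
  qed
  ultimately show ?thesis unfolding eq[OF \<psi>] by (rule LIMSEQ_unique)
qed

text \<open>Frees the form from the representatives picked by \<open>wgrad\<close>, which agree with
  any other weak gradient almost everywhere.\<close>

lemma plap_form_eq:
  assumes u: "weak_grad \<Omega> u G" "Lp G" and \<phi>: "weak_grad \<Omega> \<phi> \<Phi>" "Lp \<Phi>"
  shows "plap_form \<Omega> p u \<phi> = (LINT x|M. plap (p x) (G x) \<bullet> \<Phi> x)"
proof -
  have L: "Lp (wgrad \<Omega> v)" "AE x in M. wgrad \<Omega> v x = V x" if "weak_grad \<Omega> v V" "Lp V" for v V
  proof -
    have w: "weak_grad \<Omega> v (wgrad \<Omega> v)" unfolding wgrad_def using that(1) by (rule someI[where P="weak_grad \<Omega> v"])
    show e: "AE x in M. wgrad \<Omega> v x = V x" by (rule wgrad_AE[OF that(1)])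
    show "Lp (wgrad \<Omega> v)"
      by (rule Lp_AE_cong(1)[OF that(2) weak_grad_measurable(2)[OF w open_\<Omega>]]) (use e in \<open>eventually_elim; simp\<close>)
  qed
  have "plap_form \<Omega> p u \<phi> = (LINT x|M. plap (p x) (wgrad \<Omega> u x) \<bullet> wgrad \<Omega> \<phi> x)"
    by (simp add: plap_form_def plap_def)
  also have "... = (LINT x|M. plap (p x) (G x) \<bullet> \<Phi> x)"
  proof (rule integral_cong_AE)
    show "AE x in M. plap (p x) (wgrad \<Omega> u x) \<bullet> wgrad \<Omega> \<phi> x = plap (p x) (G x) \<bullet> \<Phi> x"
      using L(2)[OF u] L(2)[OF \<phi>] by eventually_elim simp
  qed (intro borel_measurable_integrable Lp_plap_integrable(1) L(1)[OF u] L(1)[OF \<phi>] u(2) \<phi>(2))+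
  finally show ?thesis .
qed

end

text \<open>One equation of the system; \<open>lo'\<close> and \<open>hi'\<close> bound the other unknown.\<close>
locale component =
  bounded_sobolev \<Omega> p pm P + N: nonlocal_term \<Omega> q r s Q \<alpha> \<gamma> A f g C \<sigma>1 \<sigma>2
  for \<Omega> :: "(real^'n) set" and p :: "real^'n => real" and pm P :: real and q r s :: "real^'n => real" and Q :: real
    and \<alpha> \<gamma> :: "real^'n => real" and A :: "real^'n => real => real" and f g :: "real^'n => real => real => real" and C \<sigma>1 \<sigma>2 :: real +
  fixes lo hi lo' hi' :: "real^'n => real"
  assumes lo: "lo \<in> W10 \<Omega> p" and hi: "hi \<in> W1 \<Omega> p"
    and measurable': "lo' \<in> borel_measurable (lebesgue_on \<Omega>)" "hi' \<in> borel_measurable (lebesgue_on \<Omega>)"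
    and range: "AE x in lebesgue_on \<Omega>. 0 < lo x & lo x <= hi x & hi x <= C"
    and range': "AE x in lebesgue_on \<Omega>. 0 < lo' x & lo' x <= hi' x & hi' x <= C"
    and fg_nonneg: "AE x in lebesgue_on \<Omega>. \<forall>t a. 0 <= t & t <= hi x & 0 <= a & a <= hi' x --> 0 <= f x t a & 0 <= g x t a"
    and \<sigma>: "\<sigma>1 <= lux \<Omega> r lo'" "lux \<Omega> r hi' <= \<sigma>2"
    and sub: "sub_ineq \<Omega> p q r s \<alpha> \<gamma> f g A lo lo' hi'"
    and super: "super_ineq \<Omega> p q r s \<alpha> \<gamma> f g A hi hi' lo'"
begin

lemma tame_between:
  assumes "v \<in> borel_measurable M" "AE x in M. lo' x <= v x & v x <= hi' x"
  shows "N.tame v"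
proof -
  have C: "AE x in M. 0 < v x & v x <= C" "AE x in M. \<bar>v x\<bar> <= C" "AE x in M. \<bar>hi' x\<bar> <= C"
    "AE x in M. \<bar>lo' x\<bar> <= \<bar>v x\<bar>" "AE x in M. \<bar>v x\<bar> <= \<bar>hi' x\<bar>"
    using assms(2) range' by (eventually_elim; simp)+
  have "\<sigma>1 <= lux \<Omega> r v" using \<sigma>(1) N.Lr.lux_mono[OF C(4,2)] by simp
  moreover have "lux \<Omega> r v <= \<sigma>2" using \<sigma>(2) N.Lr.lux_mono[OF C(5,3)] by simp
  ultimately show ?thesis using assms(1) C(1) by (simp add: N.tame_def)
qed

text \<open>Truncation to the order interval. It keeps the norms in the other equation within the
  range where \<open>A\<close> is positive, before any bound on \<open>u\<close> is known.\<close>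

definition clamp :: "(real^'n => real) => real^'n => real" where
  "clamp u x = min (max (u x) (lo x)) (hi x)"

lemma lo_hi_measurable: "lo \<in> borel_measurable M" "hi \<in> borel_measurable M"
  using lo hi by (auto simp: W10_iff W1_iff S0_def Lp_measurable)

lemma clamp_measurable: "u \<in> borel_measurable M ==> clamp u \<in> borel_measurable M"
  unfolding clamp_def[abs_def] using lo_hi_measurable by measurable

lemma clamp_range: "AE x in M. lo x <= clamp u x & clamp u x <= hi x"
  using range by eventually_elim (auto simp: clamp_def)

lemma clamp_bounded: "AE x in M. \<bar>clamp u x\<bar> <= C"
  using range clamp_range[of u] by eventually_elim auto

lemma clamp_tendsto:
  "AE x in M. (%k. u k x) ----> v x ==> AE x in M. (%k. clamp (u k) x) ----> clamp v x"
  unfolding clamp_def by (auto elim!: eventually_mono intro!: tendsto_min tendsto_max)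

lemma rhs_form_eq: "rhs_form \<Omega> q r s \<alpha> \<gamma> A (%x. f x (u x) (v x)) (%x. g x (u x) (v x)) b v \<phi> = (LINT x|M. N.term_fun u b v x * \<phi> x)"
  by (simp add: rhs_form_def N.term_fun_def)

lemma S0_zero: "S0 (%_. 0) (%_. 0)"
  using admissible_zero[of 1] by (simp add: admissible_def)

lemma term_fun_cong:
  assumes "AE x in M. u x = u' x" "AE x in M. v x = v' x"
  shows "AE x in M. N.term_fun u v v x = N.term_fun u' v' v' x"
proof -
  have "lux \<Omega> e v = lux \<Omega> e v'" for e by (rule lux_AE_cong) (use assms(2) in \<open>eventually_elim; simp\<close>)
  then show ?thesis using assms by (auto elim!: eventually_elim2 simp: N.term_fun_def)
qed

lemma integrable_term_mult:
  assumes "w \<in> borel_measurable M" "AE x in M. \<bar>w x\<bar> <= C" "N.tame b" "N.tame v" "S0 \<phi> \<Phi>"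
  shows "integrable M (%x. N.term_fun w b v x * \<phi> x)"
proof -
  obtain B where "0 <= B" "!!u b v. AE x in M. \<bar>u x\<bar> <= C ==> N.tame b ==> N.tame v ==> AE x in M. \<bar>N.term_fun u b v x\<bar> <= B"
    by (rule N.term_fun_bounded) (rule that; blast)
  with N.term_fun_measurable[OF assms(1,4)] assms have "forcing B (N.term_fun w b v)" by (simp add: forcing_def)
  then show ?thesis by (rule integrable_forcing_mult[OF _ Lp_integrable(1)[OF S0D(1)[OF assms(5)]]])
qed

text \<open>The monotonicity in the frozen norm \<open>b\<close> is what makes sub- and supersolutions comparable with the truncated problem.\<close>
lemma term_fun_mono:
  assumes b: "N.tame b" "N.tame b'" and le: "AE x in M. \<bar>b x\<bar> <= \<bar>b' x\<bar>"
    and w: "AE x in M. 0 <= w x & w x <= hi x" and v: "v \<in> borel_measurable M" "AE x in M. lo' x <= v x & v x <= hi' x"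
  shows "AE x in M. N.term_fun w b v x <= N.term_fun w b' v x"
proof -
  note b' = N.tameD[OF b(2)] and tv = N.tameD[OF tame_between[OF v]]
  have l: "lux \<Omega> q b <= lux \<Omega> q b'" "lux \<Omega> s b <= lux \<Omega> s b'"
    by (rule N.Lq.lux_mono[OF le b'(2)] N.Ls.lux_mono[OF le b'(2)])+
  show ?thesis
    using w v(2) range' fg_nonneg N.\<alpha>\<gamma>_bounds AE_space
  proof eventually_elim
    case (elim x)
    then have x: "x \<in> closure \<Omega>" using closure_subset by (auto simp: space_restrict_space)
    have "0 <= f x (w x) (v x)" "0 <= g x (w x) (v x)" using elim by auto
    moreover have "lux \<Omega> q b powr \<alpha> x <= lux \<Omega> q b' powr \<alpha> x" "lux \<Omega> s b powr \<gamma> x <= lux \<Omega> s b' powr \<gamma> x"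
      using l N.tameD(4,5)[OF b(1)] elim by (auto intro!: powr_mono2)
    ultimately show ?case
      unfolding N.term_fun_def using N.A_pos[OF x tv(6,7)] by (intro divide_right_mono add_mono mult_left_mono) auto
  qed
qed

lemma between_measurable_tame: "N.tame lo'" "N.tame hi'"
  by (rule tame_between; use measurable' range' in \<open>auto elim!: eventually_mono\<close>)+

text \<open>The test function is \<open>(lo - u)\<^sup>+\<close>, and where it is positive the
  truncated \<open>u\<close> equals \<open>lo\<close>. The subsolution inequality is used with
  \<open>w = v\<close>; replacing the norms of \<open>lo'\<close> by those of \<open>v\<close> can
  only increase the right-hand side.\<close>

lemma lower_bound:
  assumes v: "v \<in> borel_measurable M" "AE x in M. lo' x <= v x & v x <= hi' x"
    and H: "0 <= H" "forcing H (N.term_fun (clamp u) v v)"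
    and u: "minimizes (C + 1) (N.term_fun (clamp u) v v) u G"
  shows "AE x in M. lo x <= u x"
proof -
  note Su = minimizesD(3)[OF u] and um = Lp_measurable[OF S0D(1)[OF minimizesD(3)[OF u]]]
  obtain \<Gamma> where \<Gamma>: "S0 lo \<Gamma>" using lo by (auto simp: W10_iff)
  let ?\<phi> = "%x. max 0 (lo x - u x)" and ?\<Phi> = "%x. if lo x - u x > 0 then \<Gamma> x - G x else 0"
  have S: "S0 ?\<phi> ?\<Phi>"
  proof -
    have "S0 (%x. lo x - u x) (%x. \<Gamma> x - G x)" using S0_mult_add[OF \<Gamma> Su, of 1 "-1"] by simp
    from S0_pos_part_diff[OF this S0D(3)[OF S0_zero] S0D(1)[OF S0_zero] S0D(2)[OF S0_zero]] show ?thesis by (simp cong: if_cong)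
  qed
  have W: "?\<phi> \<in> W10 \<Omega> p" unfolding W10_iff by (rule exI) (rule S)
  have vi: "v \<in> ival \<Omega> lo' hi'" using v by (simp add: ival_def)
  note tv = tame_between[OF v]
  have lo_bd: "AE x in M. \<bar>lo x\<bar> <= C" "AE x in M. 0 <= lo x & lo x <= hi x" using range by (eventually_elim; simp)+
  have "(LINT x|M. plap (p x) (\<Gamma> x) \<bullet> ?\<Phi> x) = plap_form \<Omega> p lo ?\<phi>"
    by (rule plap_form_eq[symmetric, OF S0D(3)[OF \<Gamma>] S0D(2)[OF \<Gamma>] S0D(3)[OF S] S0D(2)[OF S]])
  also have "... <= (LINT x|M. N.term_fun lo lo' v x * ?\<phi> x)"
    by (rule sub[unfolded sub_ineq_def rhs_form_eq, rule_format, OF W _ vi]) simp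
  also have "... <= (LINT x|M. N.term_fun (clamp u) v v x * ?\<phi> x)"
  proof (rule integral_mono_AE)
    have "AE x in M. \<bar>lo' x\<bar> <= \<bar>v x\<bar>" using v(2) range' by eventually_elim simp
    from term_fun_mono[OF between_measurable_tame(1) tv this lo_bd(2) v]
    show "AE x in M. N.term_fun lo lo' v x * ?\<phi> x <= N.term_fun (clamp u) v v x * ?\<phi> x"
      using range
    proof eventually_elim
      case (elim x)
      show ?case
      proof (cases "lo x - u x > 0")
        case True
        then have "clamp u x = lo x" using elim by (simp add: clamp_def)
        then have "N.term_fun (clamp u) v v x = N.term_fun lo v v x" by (simp add: N.term_fun_def)
        then show ?thesis using elim by (simp add: mult_right_mono)
      qed simp
    qed
  qed (rule integrable_term_mult[OF lo_hi_measurable(1) lo_bd(1) between_measurable_tame(1) tv S]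
      integrable_term_mult[OF clamp_measurable[OF um] clamp_bounded tv tv S])+
  also have "... <= (LINT x|M. plap (p x) (G x) \<bullet> ?\<Phi> x)"
  proof (rule minimizer_variational_inequality[OF H(2,1) _ u S])
    show "0 <= C + 1" using N.C by simp
    \<comment> \<open>The sum is \<open>max (u x) (lo x)\<close>, so the sup bound is
      preserved.\<close>
    show "AE x in M. \<bar>u x + ?\<phi> x\<bar> <= C + 1" using lo_bd(1) minimizesD(4)[OF u] by eventually_elim (auto simp: max_def)
  qed
  finally show ?thesis by (rule comparison[OF S S0D(2)[OF \<Gamma>] S0D(2)[OF Su]])
qed

text \<open>The admissible direction is \<open>- (u - hi)\<^sup>+\<close>, which leads from
  \<open>u\<close> to the minimum of \<open>u\<close> and \<open>hi\<close>; the signs are reversed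
  afterwards. \<open>S0_pos_part_diff\<close> supplies the membership in the space with zero
  boundary values, as \<open>hi\<close> is nonnegative.\<close>

lemma upper_bound:
  assumes v: "v \<in> borel_measurable M" "AE x in M. lo' x <= v x & v x <= hi' x"
    and H: "0 <= H" "forcing H (N.term_fun (clamp u) v v)"
    and u: "minimizes (C + 1) (N.term_fun (clamp u) v v) u G"
  shows "AE x in M. u x <= hi x"
proof -
  note Su = minimizesD(3)[OF u] and um = Lp_measurable[OF S0D(1)[OF minimizesD(3)[OF u]]]
  obtain \<Gamma> where \<Gamma>: "weak_grad \<Omega> hi \<Gamma>" "Lp \<Gamma>" and Lhi: "Lp hi" using hi by (auto simp: W1_iff)
  let ?\<phi> = "%x. max 0 (u x - hi x)" and ?\<Phi> = "%x. if u x - hi x > 0 then G x - \<Gamma> x else 0"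
  have hi_bd: "AE x in M. \<bar>hi x\<bar> <= C" "AE x in M. 0 <= hi x & hi x <= hi x" "AE x in M. 0 <= hi x" using range by (eventually_elim; simp)+
  have S: "S0 ?\<phi> ?\<Phi>" by (rule S0_pos_part_diff[OF Su \<Gamma>(1) Lhi \<Gamma>(2) hi_bd(3)])
  have S': "S0 (%x. - ?\<phi> x) (%x. - ?\<Phi> x)" using S0_mult_add[OF S S, of "-1" 0] by simp
  have W: "?\<phi> \<in> W10 \<Omega> p" unfolding W10_iff by (rule exI) (rule S)
  have vi: "v \<in> ival \<Omega> lo' hi'" using v by (simp add: ival_def)
  note tv = tame_between[OF v]
  have "(LINT x|M. N.term_fun (clamp u) v v x * - ?\<phi> x) <= (LINT x|M. plap (p x) (G x) \<bullet> - ?\<Phi> x)"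
  proof (rule minimizer_variational_inequality[OF H(2,1) _ u S'])
    show "0 <= C + 1" using N.C by simp
    show "AE x in M. \<bar>u x + - ?\<phi> x\<bar> <= C + 1" using hi_bd(1) minimizesD(4)[OF u] by eventually_elim (auto simp: max_def)
  qed
  then have "(LINT x|M. plap (p x) (G x) \<bullet> ?\<Phi> x) <= (LINT x|M. N.term_fun (clamp u) v v x * ?\<phi> x)"
    by (simp only: inner_minus_right mult_minus_right integral_minus neg_le_iff_le)
  also have "... <= (LINT x|M. N.term_fun hi hi' v x * ?\<phi> x)"
  proof (rule integral_mono_AE)
    have "AE x in M. \<bar>v x\<bar> <= \<bar>hi' x\<bar>" using v(2) range' by eventually_elim simp
    from term_fun_mono[OF tv between_measurable_tame(2) this hi_bd(2) v]
    show "AE x in M. N.term_fun (clamp u) v v x * ?\<phi> x <= N.term_fun hi hi' v x * ?\<phi> x"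
      using range
    proof eventually_elim
      case (elim x)
      show ?case
      proof (cases "u x - hi x > 0")
        case True
        then have "clamp u x = hi x" using elim by (simp add: clamp_def)
        then have "N.term_fun (clamp u) v v x = N.term_fun hi v v x" by (simp add: N.term_fun_def)
        then show ?thesis using elim by (simp add: mult_right_mono)
      qed simp
    qed
  qed (rule integrable_term_mult[OF lo_hi_measurable(2) hi_bd(1) between_measurable_tame(2) tv S]
      integrable_term_mult[OF clamp_measurable[OF um] clamp_bounded tv tv S])+
  also have "... <= plap_form \<Omega> p hi ?\<phi>"
    by (rule super[unfolded super_ineq_def rhs_form_eq, rule_format, OF W _ vi]) simp
  also have "... = (LINT x|M. plap (p x) (\<Gamma> x) \<bullet> ?\<Phi> x)"
    by (rule plap_form_eq[OF \<Gamma>(1,2) S0D(3)[OF S] S0D(2)[OF S]])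
  finally show ?thesis by (rule comparison[OF S S0D(2)[OF Su] \<Gamma>(2)])
qed

text \<open>\<open>v\<close> is meant to be the truncated other unknown and \<open>v'\<close> the
  unknown itself. They agree almost everywhere once the other component has been bounded, so the
  truncation disappears from the arguments and from the norms.\<close>

lemma solves:
  assumes v: "v \<in> borel_measurable M" "AE x in M. lo' x <= v x & v x <= hi' x"
    and H: "0 <= H" "forcing H (N.term_fun (clamp u) v v)"
    and u: "minimizes (C + 1) (N.term_fun (clamp u) v v) u G"
    and v': "v' \<in> borel_measurable M" "AE x in M. v x = v' x" and \<phi>: "\<phi> \<in> W10 \<Omega> p"
  shows "plap_form \<Omega> p u \<phi> = rhs_form \<Omega> q r s \<alpha> \<gamma> A (%x. f x (u x) (v' x)) (%x. g x (u x) (v' x)) v' v' \<phi>"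
proof -
  note Su = minimizesD(3)[OF u] and um = Lp_measurable[OF S0D(1)[OF minimizesD(3)[OF u]]]
  obtain \<Phi> where \<Phi>: "S0 \<phi> \<Phi>" using \<phi> by (auto simp: W10_iff)
  have bds: "AE x in M. lo x <= u x" "AE x in M. u x <= hi x" by (rule lower_bound[OF v H u] upper_bound[OF v H u])+
  have uC: "AE x in M. \<bar>u x\<bar> <= C" and cu: "AE x in M. clamp u x = u x"
    using bds range by (eventually_elim; simp add: clamp_def)+
  have "AE x in M. lo' x <= v' x & v' x <= hi' x" using v(2) v'(2) by eventually_elim simp
  note tv' = tame_between[OF v'(1) this] and tv = tame_between[OF v]
  have "plap_form \<Omega> p u \<phi> = (LINT x|M. plap (p x) (G x) \<bullet> \<Phi> x)"
    by (rule plap_form_eq[OF S0D(3)[OF Su] S0D(2)[OF Su] S0D(3)[OF \<Phi>] S0D(2)[OF \<Phi>]])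
  also have "... = (LINT x|M. N.term_fun (clamp u) v v x * \<phi> x)"
    by (rule minimizer_equation[OF H(2,1) u uC _ _ \<Phi>]) (use N.C in auto)
  also have "... = (LINT x|M. N.term_fun u v' v' x * \<phi> x)"
  proof (rule integral_cong_AE)
    show "AE x in M. N.term_fun (clamp u) v v x * \<phi> x = N.term_fun u v' v' x * \<phi> x"
      using term_fun_cong[OF cu v'(2)] by eventually_elim simp
  qed (rule borel_measurable_integrable integrable_term_mult[OF clamp_measurable[OF um] clamp_bounded tv tv \<Phi>]
      integrable_term_mult[OF um uC tv' tv' \<Phi>])+
  finally show ?thesis unfolding rhs_form_eq .
qed

end

section \<open>Essential bounds and exponents of class \<open>C1\<close>\<close>

lemma AE_le_of_AE_le_add:
  fixes a b :: "'a => real"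
  assumes "!!n. AE x in M. a x <= b x + inverse (real (Suc n))"
  shows "AE x in M. a x <= b x"
proof -
  have "AE x in M. \<forall>n. a x <= b x + inverse (real (Suc n))" using assms by (simp add: AE_all_countable)
  then show ?thesis
  proof eventually_elim
    case (elim x)
    have "(%n. b x + inverse (real (Suc n))) ----> b x + 0" by (intro tendsto_add tendsto_const LIMSEQ_inverse_real_of_nat)
    then have "a x <= b x + 0" by (rule LIMSEQ_le_const) (use elim in auto)
    then show ?case by simp
  qed
qed

text \<open>The infimum is attained, because it is approached by countably many bounds that hold
  almost everywhere.\<close>

lemma AE_abs_le_Linf_norm:
  assumes "u \<in> Linf \<Omega>" shows "AE x in lebesgue_on \<Omega>. \<bar>u x\<bar> <= Linf_norm \<Omega> u"
proof (rule AE_le_of_AE_le_add)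
  fix n
  let ?S = "{C. AE x in lebesgue_on \<Omega>. \<bar>u x\<bar> <= C}"
  have "?S ~= {}" using assms by (auto simp: Linf_def)
  moreover have "Inf ?S < Linf_norm \<Omega> u + inverse (real (Suc n))" by (simp add: Linf_norm_def ess_sup_def)
  ultimately obtain C where "C \<in> ?S" "C < Linf_norm \<Omega> u + inverse (real (Suc n))" by (rule cInf_lessD[THEN bexE])
  then show "AE x in lebesgue_on \<Omega>. \<bar>u x\<bar> <= Linf_norm \<Omega> u + inverse (real (Suc n))" by (auto elim!: eventually_mono)
qed

lemma less_ess_infD:
  assumes "b < ess_inf \<Omega> m" "AE x in lebesgue_on \<Omega>. B <= m x"
  shows "\<exists>c>b. AE x in lebesgue_on \<Omega>. c <= m x"
proof -
  have "{c. AE x in lebesgue_on \<Omega>. c <= m x} ~= {}" using assms(2) by blast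
  from less_cSupD[OF this assms(1)[unfolded ess_inf_def]] show ?thesis by blast
qed

lemma AE_ge_of_ess_inf:
  assumes "m \<in> Linf \<Omega>" "b <= ess_inf \<Omega> m"
  shows "AE x in lebesgue_on \<Omega>. b <= m x"
proof (rule AE_le_of_AE_le_add)
  fix n
  obtain C where "AE x in lebesgue_on \<Omega>. \<bar>m x\<bar> <= C" using assms(1) by (auto simp: Linf_def)
  then have "AE x in lebesgue_on \<Omega>. - C <= m x" by eventually_elim simp
  moreover have "0 < inverse (real (Suc n))" by simp
  then have "b - inverse (real (Suc n)) < ess_inf \<Omega> m" using assms(2) by linarith
  ultimately obtain c where "b - inverse (real (Suc n)) < c" "AE x in lebesgue_on \<Omega>. c <= m x" using less_ess_infD by blast
  then show "AE x in lebesgue_on \<Omega>. b <= m x + inverse (real (Suc n))" by (auto elim!: eventually_mono)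
qed

lemma bounded_exponentI:
  assumes "open \<Omega>" "bounded \<Omega>" "q \<in> Linf \<Omega>" "1 <= ess_inf \<Omega> q" "Linf_norm \<Omega> q <= Q"
  shows "bounded_exponent \<Omega> q Q"
proof
  show "\<Omega> \<in> lmeasurable" using assms(1,2) by (rule lmeasurable_open[rotated])
  show "q \<in> borel_measurable (lebesgue_on \<Omega>)" using assms(3) by (simp add: Linf_def)
  show "AE x in lebesgue_on \<Omega>. 1 <= q x & q x <= Q"
    using AE_ge_of_ess_inf[OF assms(3,4)] AE_abs_le_Linf_norm[OF assms(3)] by eventually_elim (use assms(5) in auto)
qed

text \<open>A violation at one point would persist on a nonempty open set, and such a set is not
  negligible.\<close>

lemma AE_ge_continuous:
  fixes p :: "real^'n => real"
  assumes "open \<Omega>" "continuous_on \<Omega> p" "AE x in lebesgue_on \<Omega>. c <= p x" "x \<in> \<Omega>"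
  shows "c <= p x"
proof (rule ccontr)
  let ?U = "{x \<in> \<Omega>. p x < c}"
  assume "\<not> c <= p x"
  then have "?U ~= {}" using assms(4) by auto
  moreover have "open ?U"
  proof -
    have "?U = \<Omega> \<inter> p -` {..<c}" by auto
    then show ?thesis using continuous_open_preimage[OF assms(2,1) open_lessThan[of c]] by simp
  qed
  ultimately have "\<not> negligible ?U" by (rule open_not_negligible[rotated])
  have "AE x in lebesgue. x \<in> \<Omega> --> c <= p x" using assms(1,3) by (subst (asm) AE_restrict_space_iff) auto
  then have "AE x in lebesgue. x \<notin> ?U" by eventually_elim auto
  then have "?U \<in> null_sets lebesgue" using \<open>open ?U\<close> by (subst (asm) AE_iff_null_sets[symmetric]) auto
  with \<open>\<not> negligible ?U\<close> show False by (simp add: negligible_iff_null_sets)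
qed

text \<open>Only partial derivatives are at hand, so the coordinates are exchanged one at a time and
  the mean value inequality is applied on each axis-parallel segment.\<close>

lemma C1_loc_lipschitz:
  fixes p :: "real^'n => real"
  assumes p: "Ck_on 1 \<Omega> p" and "open \<Omega>" "compact K" "K \<subseteq> \<Omega>"
  shows "\<exists>L d. 0 <= L & 0 < d & (\<forall>x\<in>K. \<forall>y\<in>K. dist x y <= d --> \<bar>p x - p y\<bar> <= L * dist x y)"
proof -
  obtain d K' where d: "d > 0" and K': "compact K'" "K' \<subseteq> \<Omega>" "!!x. x \<in> K ==> cball x d \<subseteq> K'"
  proof (rule compact_in_open_nbhd[OF assms(3,2,4)])
    fix d K' assume "d > 0" "compact K'" "K' \<subseteq> \<Omega>" "!!x. x \<in> K ==> cball x d \<subseteq> K'"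
    then show thesis by (rule that)
  qed
  have p': "Ck_on (Suc 0) \<Omega> p" using p by simp
  have "\<exists>b. \<forall>z\<in>K'. \<bar>pd p j z\<bar> <= b" for j
  proof -
    have "continuous_on K' (pd p j)" using Ck_on_SucD(2)[OF p', of j] K'(2) by (auto intro: continuous_on_subset)
    from compact_imp_bounded[OF compact_continuous_image[OF this K'(1)]] show ?thesis by (simp add: bounded_iff)
  qed
  then have "\<forall>j. \<exists>b. \<forall>z\<in>K'. \<bar>pd p j z\<bar> <= b" by blast
  from choice[OF this] obtain b where b': "\<forall>j. \<forall>z\<in>K'. \<bar>pd p j z\<bar> <= b j" ..
  have b: "\<bar>pd p j z\<bar> <= b j" if "z \<in> K'" for j z using b' that by blast
  define B where "B = (\<Sum>j\<in>UNIV. \<bar>b j\<bar>)"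
  have B: "\<bar>pd p j z\<bar> <= B" if "z \<in> K'" for j z
  proof -
    have "\<bar>b j\<bar> <= B" unfolding B_def by (rule member_le_sum) auto
    with b[OF that, of j] show ?thesis by simp
  qed
  have B0: "0 <= B" by (simp add: B_def sum_nonneg)
  show ?thesis
  proof (rule exI[of _ "B * real CARD('n)"], rule exI[of _ d], intro conjI ballI impI)
    fix x y assume x: "x \<in> K" and xy: "dist x y <= d"
    \<comment> \<open>The point with the coordinates of \<open>y\<close> in \<open>S\<close> and
      those of \<open>x\<close> elsewhere. Along the whole path no coordinate is farther from
      \<open>x\<close> than that of \<open>y\<close>, so the path stays in the ball around
      \<open>x\<close> and hence in \<open>K'\<close>.\<close>
    define z where "z S = (\<chi> i. if i \<in> S then y $ i else x $ i)" for S
    have path: "\<bar>p (z S) - p x\<bar> <= B * (\<Sum>i\<in>S. \<bar>y $ i - x $ i\<bar>)" if "finite S" for S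
      using that
    proof (induction S)
      case empty
      have "z {} = x" by (simp add: z_def vec_eq_iff)
      then show ?case by simp
    next
      case (insert j S)
      let ?t = "y $ j - x $ j"
      define \<phi> where "\<phi> t = p (z S + t *\<^sub>R axis j 1)" for t
      have ins: "z (insert j S) = z S + ?t *\<^sub>R axis j 1"
        using insert.hyps(2) by (auto simp: z_def vec_eq_iff axis_def)
      have mem: "z S + t *\<^sub>R axis j 1 \<in> K'" if t: "t \<in> closed_segment 0 ?t" for t
      proof -
        have "\<bar>t\<bar> <= \<bar>?t\<bar>" using t by (auto simp: closed_segment_eq_real_ivl split: if_splits)
        then have "\<bar>(z S + t *\<^sub>R axis j 1 - x) $ i\<bar> <= \<bar>(y - x) $ i\<bar>" for i
          using insert.hyps(2) by (auto simp: z_def axis_def)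
        then have "norm (z S + t *\<^sub>R axis j 1 - x) <= norm (y - x)" by (intro norm_le_componentwise_cart) simp
        then have "z S + t *\<^sub>R axis j 1 \<in> cball x d" using xy by (simp add: dist_norm norm_minus_commute)
        with K'(3)[OF x] show ?thesis by blast
      qed
      have "norm (\<phi> ?t - \<phi> 0) <= B * norm (?t - 0)"
      proof (rule field_differentiable_bound[of "closed_segment 0 ?t" \<phi> "%t. pd p j (z S + t *\<^sub>R axis j 1)"])
        fix t assume t: "t \<in> closed_segment 0 ?t"
        from Ck_on_SucD(3)[OF p', of "z S + t *\<^sub>R axis j 1" j] mem[OF t] K'(2)
        have "((%h. p (z S + t *\<^sub>R axis j 1 + h *\<^sub>R axis j 1)) has_real_derivative pd p j (z S + t *\<^sub>R axis j 1)) (at 0)" by blast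
        then have "((%h. \<phi> (h + t)) has_real_derivative pd p j (z S + t *\<^sub>R axis j 1)) (at 0)"
          by (simp add: \<phi>_def scaleR_add_left algebra_simps)
        then have "(\<phi> has_real_derivative pd p j (z S + t *\<^sub>R axis j 1)) (at (0 + t))" by (simp only: DERIV_shift)
        then show "(\<phi> has_real_derivative pd p j (z S + t *\<^sub>R axis j 1)) (at t within closed_segment 0 ?t)"
          by (simp add: has_field_derivative_at_within)
        show "norm (pd p j (z S + t *\<^sub>R axis j 1)) <= B" using B[OF mem[OF t]] by simp
      qed auto
      then have "\<bar>p (z (insert j S)) - p (z S)\<bar> <= B * \<bar>?t\<bar>" by (simp add: \<phi>_def ins)
      then have "\<bar>p (z (insert j S)) - p x\<bar> <= B * \<bar>?t\<bar> + B * (\<Sum>i\<in>S. \<bar>y $ i - x $ i\<bar>)" using insert.IH by linarith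
      then show ?case using insert.hyps by (simp add: distrib_left)
    qed
    have "z UNIV = y" by (simp add: z_def vec_eq_iff)
    with path[of UNIV] have "\<bar>p y - p x\<bar> <= B * (\<Sum>i\<in>UNIV. \<bar>y $ i - x $ i\<bar>)" by simp
    also have "(\<Sum>i\<in>UNIV. \<bar>y $ i - x $ i\<bar>) <= (\<Sum>i\<in>(UNIV :: 'n set). dist x y)"
      using component_le_norm_cart[of "y - x"] by (intro sum_mono) (simp add: dist_norm norm_minus_commute)
    finally show "\<bar>p x - p y\<bar> <= B * real CARD('n) * dist x y" using B0 by (simp add: abs_minus_commute mult_left_mono)
  qed (use d B0 in auto)
qed

text \<open>Continuity up to the closure bounds the exponent. The strict inequality
  \<open>1 < ess_inf \<Omega> p\<close> leaves room for a lower bound \<open>c > 1\<close>, which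
  continuity extends from almost every point to every point.\<close>

lemma bounded_sobolevI:
  fixes \<Omega> :: "(real^'n) set"
  assumes \<Omega>: "open \<Omega>" "bounded \<Omega>" "\<Omega> ~= {}" and p: "C1_closure \<Omega> p" "1 < ess_inf \<Omega> p"
  obtains pm P where "bounded_sobolev \<Omega> p pm P"
proof -
  have cont: "continuous_on (closure \<Omega>) p" and C1: "Ck_on 1 \<Omega> p" using p(1) by (auto simp: C1_closure_def)
  have cont': "continuous_on \<Omega> p" by (rule continuous_on_subset[OF cont closure_subset])
  have "compact (p ` closure \<Omega>)" using cont \<Omega>(2) by (intro compact_continuous_image) auto
  from compact_imp_bounded[OF this] obtain P where P: "\<forall>y\<in>p ` closure \<Omega>. norm y <= P" unfolding bounded_iff ..
  have P': "\<bar>p x\<bar> <= P" if "x \<in> \<Omega>" for x using P that closure_subset[of \<Omega>] by (auto simp: subset_iff)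
  have "AE x in lebesgue_on \<Omega>. - P <= p x"
  proof (rule AE_I2)
    fix x assume "x \<in> space (lebesgue_on \<Omega>)"
    then have "x \<in> \<Omega>" by (simp add: space_restrict_space)
    from P'[OF this] show "- P <= p x" by simp
  qed
  from less_ess_infD[OF p(2) this] obtain c where c: "1 < c" "AE x in lebesgue_on \<Omega>. c <= p x" by blast
  have c': "c <= p x" if "x \<in> \<Omega>" for x by (rule AE_ge_continuous[OF \<Omega>(1) cont' c(2) that])
  obtain x0 where "x0 \<in> \<Omega>" using \<Omega>(3) by blast
  with c' P' have cP: "c <= P" by fastforce
  have m: "p \<in> borel_measurable (lebesgue_on \<Omega>)"
    using cont' \<Omega>(1) by (intro continuous_imp_measurable_on_sets_lebesgue) auto
  interpret finite_measure "lebesgue_on \<Omega>" using \<Omega>(1,2) by (intro finite_measure_lebesgue_on lmeasurable_open)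
  have "bounded_sobolev \<Omega> p c P"
  proof
    show "!!x. x \<in> space (lebesgue_on \<Omega>) ==> c <= p x & p x <= P"
      using c' P' by (auto simp: space_restrict_space abs_le_iff)
    show "!!K. compact K ==> K \<subseteq> \<Omega> ==> \<exists>L d. 0 <= L & 0 < d & (\<forall>x\<in>K. \<forall>y\<in>K. dist x y <= d --> \<bar>p x - p y\<bar> <= L * dist x y)"
      by (rule C1_loc_lipschitz[OF C1 \<Omega>(1)])
  qed (use m c(1) cP \<Omega> in auto)
  then show ?thesis by (rule that)
qed

theorem theorem1p1:
  fixes \<Omega> :: "(real^'n) set"
    and p1 p2 q1 q2 r1 r2 s1 s2 \<alpha>1 \<alpha>2 \<gamma>1 \<gamma>2 :: "real^'n \<Rightarrow> real"
    and f1 f2 g1 g2 :: "real^'n \<Rightarrow> real \<Rightarrow> real \<Rightarrow> real"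
    and A :: "real^'n \<Rightarrow> real \<Rightarrow> real"
    and lo1 hi1 lo2 hi2 :: "real^'n \<Rightarrow> real"
  assumes N: "CARD('n) > 1"
    and dom: "C2_domain \<Omega>"
    and p1: "C1_closure \<Omega> p1" "1 < ess_inf \<Omega> p1" "ess_sup \<Omega> p1 < real CARD('n)"
    and p2: "C1_closure \<Omega> p2" "1 < ess_inf \<Omega> p2" "ess_sup \<Omega> p2 < real CARD('n)"
    and rqs1: "r1 \<in> Linf \<Omega>" "q1 \<in> Linf \<Omega>" "s1 \<in> Linf \<Omega>"
              "ess_inf \<Omega> r1 \<ge> 1" "ess_inf \<Omega> q1 \<ge> 1" "ess_inf \<Omega> s1 \<ge> 1"
    and rqs2: "r2 \<in> Linf \<Omega>" "q2 \<in> Linf \<Omega>" "s2 \<in> Linf \<Omega>"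
              "ess_inf \<Omega> r2 \<ge> 1" "ess_inf \<Omega> q2 \<ge> 1" "ess_inf \<Omega> s2 \<ge> 1"
    and ag: "\<alpha>1 \<in> Linf \<Omega>" "\<alpha>2 \<in> Linf \<Omega>" "\<gamma>1 \<in> Linf \<Omega>" "\<gamma>2 \<in> Linf \<Omega>"
            "AE x in lebesgue_on \<Omega>. 0 \<le> \<alpha>1 x \<and> 0 \<le> \<alpha>2 x \<and> 0 \<le> \<gamma>1 x \<and> 0 \<le> \<gamma>2 x"
    and fg_cont: "continuous_on (closure \<Omega> \<times> UNIV \<times> UNIV) (\<lambda>(x, t, s). f1 x t s)"
                 "continuous_on (closure \<Omega> \<times> UNIV \<times> UNIV) (\<lambda>(x, t, s). f2 x t s)"
                 "continuous_on (closure \<Omega> \<times> UNIV \<times> UNIV) (\<lambda>(x, t, s). g1 x t s)"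
                 "continuous_on (closure \<Omega> \<times> UNIV \<times> UNIV) (\<lambda>(x, t, s). g2 x t s)"
    and ss: "sub_super \<Omega> p1 p2 q1 q2 r1 r2 s1 s2 \<alpha>1 \<alpha>2 \<gamma>1 \<gamma>2 f1 f2 g1 g2 A lo1 hi1 lo2 hi2"
    and lo_pos: "AE x in lebesgue_on \<Omega>. lo1 x > 0" "AE x in lebesgue_on \<Omega>. lo2 x > 0"
    and fg_nonneg: "\<forall>x\<in>closure \<Omega>. \<forall>t\<in>{0..Linf_norm \<Omega> hi1}. \<forall>s\<in>{0..Linf_norm \<Omega> hi2}.
                      f1 x t s \<ge> 0 \<and> f2 x t s \<ge> 0 \<and> g1 x t s \<ge> 0 \<and> g2 x t s \<ge> 0"
    and A_cont: "continuous_on (closure \<Omega> \<times> {0<..}) (\<lambda>(x, t). A x t)"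
    and A_pos: "\<forall>x\<in>closure \<Omega>. \<forall>t\<in>{min (lux \<Omega> r1 (\<lambda>x. min (lo1 x) (lo2 x))) (lux \<Omega> r2 (\<lambda>x. min (lo1 x) (lo2 x)))
                                  .. max (lux \<Omega> r1 (\<lambda>x. max (hi1 x) (hi2 x))) (lux \<Omega> r2 (\<lambda>x. max (hi1 x) (hi2 x)))}.
                  A x t > 0"
  shows "\<exists>u1 u2. weak_solution \<Omega> p1 p2 q1 q2 r1 r2 s1 s2 \<alpha>1 \<alpha>2 \<gamma>1 \<gamma>2 f1 f2 g1 g2 A u1 u2 \<and>
            (AE x in lebesgue_on \<Omega>. u1 x > 0 \<and> u2 x > 0) \<and>
            (AE x in lebesgue_on \<Omega>. lo1 x \<le> u1 x \<and> u1 x \<le> hi1 x \<and> lo2 x \<le> u2 x \<and> u2 x \<le> hi2 x)"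
proof -
  have \<Omega>: "open \<Omega>" "bounded \<Omega>" "\<Omega> ~= {}" using dom by (auto simp: C2_domain_def)
  have \<mu>: "0 < measure (lebesgue_on \<Omega>) (space (lebesgue_on \<Omega>))"
  proof -
    have "\<Omega> \<in> lmeasurable" using \<Omega> by (intro lmeasurable_open)
    moreover have "measure lebesgue \<Omega> ~= 0"
      using open_not_negligible[OF \<Omega>(1,3)] calculation by (simp add: negligible_iff_measure0)
    ultimately show ?thesis
      by (simp add: measure_restrict_space space_restrict_space less_le fmeasurableD)
  qed
  obtain pm1 P1 where E1: "bounded_sobolev \<Omega> p1 pm1 P1" by (rule bounded_sobolevI[OF \<Omega> p1(1,2)])
  obtain pm2 P2 where E2: "bounded_sobolev \<Omega> p2 pm2 P2" by (rule bounded_sobolevI[OF \<Omega> p2(1,2)])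
  interpret E1: bounded_sobolev \<Omega> p1 pm1 P1 by (rule E1)
  interpret E2: bounded_sobolev \<Omega> p2 pm2 P2 by (rule E2)
  define Q where "Q = Max (Linf_norm \<Omega> ` {q1, q2, r1, r2, s1, s2, \<alpha>1, \<alpha>2, \<gamma>1, \<gamma>2})"
  have Q: "Linf_norm \<Omega> e <= Q" if "e \<in> {q1, q2, r1, r2, s1, s2, \<alpha>1, \<alpha>2, \<gamma>1, \<gamma>2}" for e
    unfolding Q_def using that by (intro Max_ge) auto
  have be: "bounded_exponent \<Omega> q1 Q" "bounded_exponent \<Omega> r1 Q" "bounded_exponent \<Omega> s1 Q"
    "bounded_exponent \<Omega> q2 Q" "bounded_exponent \<Omega> r2 Q" "bounded_exponent \<Omega> s2 Q"
    using rqs1 rqs2 by (auto intro!: bounded_exponentI[OF \<Omega>(1,2)] Q)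
  have ag_meas: "\<alpha>1 \<in> borel_measurable E1.M" "\<gamma>1 \<in> borel_measurable E1.M"
    "\<alpha>2 \<in> borel_measurable E1.M" "\<gamma>2 \<in> borel_measurable E1.M"
    using ag(1-4) by (auto simp: Linf_def)
  have le: "AE x in E1.M. e x <= Q" if "e \<in> Linf \<Omega>" "e \<in> {q1, q2, r1, r2, s1, s2, \<alpha>1, \<alpha>2, \<gamma>1, \<gamma>2}" for e
    using AE_abs_le_Linf_norm[OF that(1)] by eventually_elim (use Q[OF that(2)] in auto)
  have ag_bounds: "AE x in E1.M. 0 <= \<alpha>1 x & \<alpha>1 x <= Q & 0 <= \<gamma>1 x & \<gamma>1 x <= Q"
    "AE x in E1.M. 0 <= \<alpha>2 x & \<alpha>2 x <= Q & 0 <= \<gamma>2 x & \<gamma>2 x <= Q"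
    using ag(5) le[OF ag(1)] le[OF ag(2)] le[OF ag(3)] le[OF ag(4)] by (auto elim!: eventually_elim2)
  \<comment> \<open>The second equation has the form of the first with the unknowns in exchanged
    roles, which swaps the last two arguments of its nonlinearities.\<close>
  have swap: "continuous_on (closure \<Omega> \<times> UNIV \<times> UNIV) (%(x, t, s). k x s t)"
    if "continuous_on (closure \<Omega> \<times> UNIV \<times> UNIV) (%(x, t, s). k x t s)" for k :: "real^'n => real => real => real"
  proof -
    have "continuous_on (closure \<Omega> \<times> UNIV \<times> UNIV) (%z. case (fst z, snd (snd z), fst (snd z)) of (x, t, s) => k x t s)"
      by (rule continuous_on_compose2[OF that]) (auto intro!: continuous_intros)
    then show ?thesis by (simp add: case_prod_beta)
  qed
  have W: "lo1 \<in> W10 \<Omega> p1" "lo1 \<in> Linf \<Omega>" "lo2 \<in> W10 \<Omega> p2" "lo2 \<in> Linf \<Omega>"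
    "hi1 \<in> W1 \<Omega> p1" "hi1 \<in> Linf \<Omega>" "hi2 \<in> W1 \<Omega> p2" "hi2 \<in> Linf \<Omega>"
    and ord: "AE x in E1.M. lo1 x <= hi1 x" "AE x in E1.M. lo2 x <= hi2 x"
    and ineqs: "sub_ineq \<Omega> p1 q1 r1 s1 \<alpha>1 \<gamma>1 f1 g1 A lo1 lo2 hi2" "super_ineq \<Omega> p1 q1 r1 s1 \<alpha>1 \<gamma>1 f1 g1 A hi1 hi2 lo2"
      "sub_ineq \<Omega> p2 q2 r2 s2 \<alpha>2 \<gamma>2 (%x t s. f2 x s t) (%x t s. g2 x s t) A lo2 lo1 hi1"
      "super_ineq \<Omega> p2 q2 r2 s2 \<alpha>2 \<gamma>2 (%x t s. f2 x s t) (%x t s. g2 x s t) A hi2 hi1 lo1"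
    using ss by (auto simp: sub_super_def)
  have m: "lo1 \<in> borel_measurable E1.M" "hi1 \<in> borel_measurable E1.M"
    "lo2 \<in> borel_measurable E1.M" "hi2 \<in> borel_measurable E1.M"
    using W by (auto simp: Linf_def)
  \<comment> \<open>The summand 1 makes \<open>C\<close> positive. The obstacle will be
    \<open>C + 1\<close>, strictly above both supersolutions.\<close>
  define C where "C = 1 + \<bar>Linf_norm \<Omega> hi1\<bar> + \<bar>Linf_norm \<Omega> hi2\<bar>"
  have C: "0 < C" by (simp add: C_def)
  note hb = AE_abs_le_Linf_norm[OF W(6)] AE_abs_le_Linf_norm[OF W(8)]
  have range: "AE x in E1.M. 0 < lo1 x & lo1 x <= hi1 x & hi1 x <= C"
    "AE x in E1.M. 0 < lo2 x & lo2 x <= hi2 x & hi2 x <= C"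
    using lo_pos ord hb by (eventually_elim; simp add: C_def)+
  let ?wlo = "%x. min (lo1 x) (lo2 x)" and ?whi = "%x. max (hi1 x) (hi2 x)"
  define \<sigma>1 where "\<sigma>1 = min (lux \<Omega> r1 ?wlo) (lux \<Omega> r2 ?wlo)"
  define \<sigma>2 where "\<sigma>2 = max (lux \<Omega> r1 ?whi) (lux \<Omega> r2 ?whi)"
  have wlo_meas: "?wlo \<in> borel_measurable E1.M" using m by measurable
  have w: "AE x in E1.M. \<bar>?wlo x\<bar> <= C" "AE x in E1.M. 0 < ?wlo x"
    "AE x in E1.M. \<bar>?wlo x\<bar> <= \<bar>lo1 x\<bar>" "AE x in E1.M. \<bar>?wlo x\<bar> <= \<bar>lo2 x\<bar>"
    "AE x in E1.M. \<bar>lo1 x\<bar> <= C" "AE x in E1.M. \<bar>lo2 x\<bar> <= C"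
    "AE x in E1.M. \<bar>hi1 x\<bar> <= \<bar>?whi x\<bar>" "AE x in E1.M. \<bar>hi2 x\<bar> <= \<bar>?whi x\<bar>"
    "AE x in E1.M. \<bar>?whi x\<bar> <= C"
    using range by (eventually_elim; auto)+
  \<comment> \<open>Rests on positivity of the smaller subsolution and on the positive measure of
    \<Omega>; it places the arguments of \<open>A\<close> in the half-line where \<open>A\<close> is
    continuous.\<close>
  have \<sigma>1: "0 < \<sigma>1"
    using bounded_exponent.lux_pos[OF be(2) wlo_meas w(1,2) \<mu>] bounded_exponent.lux_pos[OF be(5) wlo_meas w(1,2) \<mu>]
    by (simp add: \<sigma>1_def)
  have \<sigma>: "\<sigma>1 <= lux \<Omega> r1 lo2" "lux \<Omega> r1 hi2 <= \<sigma>2" "\<sigma>1 <= lux \<Omega> r2 lo1" "lux \<Omega> r2 hi1 <= \<sigma>2"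
    using bounded_exponent.lux_mono[OF be(2) w(4,6)] bounded_exponent.lux_mono[OF be(2) w(8,9)]
      bounded_exponent.lux_mono[OF be(5) w(3,5)] bounded_exponent.lux_mono[OF be(5) w(7,9)]
    by (auto simp: \<sigma>1_def \<sigma>2_def min_le_iff_disj le_max_iff_disj)
  have A_pos': "0 < A x t" if "x \<in> closure \<Omega>" "\<sigma>1 <= t" "t <= \<sigma>2" for x t
    using A_pos that by (auto simp: \<sigma>1_def \<sigma>2_def)
  have fg: "AE x in E1.M. \<forall>t a. 0 <= t & t <= hi1 x & 0 <= a & a <= hi2 x \<longrightarrow>
      0 <= f1 x t a & 0 <= f2 x t a & 0 <= g1 x t a & 0 <= g2 x t a"
    using hb AE_space
  proof eventually_elim
    case (elim x)
    then have "x \<in> closure \<Omega>" using closure_subset by (auto simp: space_restrict_space)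
    with fg_nonneg elim show ?case by auto
  qed
  have fg1: "AE x in E1.M. \<forall>t a. 0 <= t & t <= hi1 x & 0 <= a & a <= hi2 x --> 0 <= f1 x t a & 0 <= g1 x t a"
    and fg2: "AE x in E1.M. \<forall>t a. 0 <= t & t <= hi2 x & 0 <= a & a <= hi1 x --> 0 <= f2 x a t & 0 <= g2 x a t"
    using fg by (eventually_elim; blast)+
  have N1: "nonlocal_term \<Omega> q1 r1 s1 Q \<alpha>1 \<gamma>1 A f1 g1 C \<sigma>1 \<sigma>2"
    by (intro nonlocal_term.intro nonlocal_term_axioms.intro be)
      (fact \<Omega>(2) ag_meas ag_bounds fg_cont A_cont A_pos' \<sigma>1 C \<mu>)+
  have N2: "nonlocal_term \<Omega> q2 r2 s2 Q \<alpha>2 \<gamma>2 A (%x t s. f2 x s t) (%x t s. g2 x s t) C \<sigma>1 \<sigma>2"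
    by (intro nonlocal_term.intro nonlocal_term_axioms.intro be)
      (fact \<Omega>(2) ag_meas ag_bounds swap[OF fg_cont(2)] swap[OF fg_cont(4)] A_cont A_pos' \<sigma>1 C \<mu>)+
  have K1: "component \<Omega> p1 pm1 P1 q1 r1 s1 Q \<alpha>1 \<gamma>1 A f1 g1 C \<sigma>1 \<sigma>2 lo1 hi1 lo2 hi2"
    by (intro component.intro component_axioms.intro E1 N1) (fact W m range \<sigma> ineqs fg1)+
  have K2: "component \<Omega> p2 pm2 P2 q2 r2 s2 Q \<alpha>2 \<gamma>2 A (%x t s. f2 x s t) (%x t s. g2 x s t) C \<sigma>1 \<sigma>2 lo2 hi2 lo1 hi1"
    by (intro component.intro component_axioms.intro E2 N2) (fact W m range \<sigma> ineqs fg2)+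
  interpret K1: component \<Omega> p1 pm1 P1 q1 r1 s1 Q \<alpha>1 \<gamma>1 A f1 g1 C \<sigma>1 \<sigma>2 lo1 hi1 lo2 hi2 by (rule K1)
  interpret K2: component \<Omega> p2 pm2 P2 q2 r2 s2 Q \<alpha>2 \<gamma>2 A "%x t s. f2 x s t" "%x t s. g2 x s t" C \<sigma>1 \<sigma>2 lo2 hi2 lo1 hi1 by (rule K2)
  \<comment> \<open>Every occurrence of an unknown is truncated, also under the norms, so that the
    operators are bounded and continuous for arbitrary measurable arguments.\<close>
  define H1 where "H1 w1 w2 = K1.N.term_fun (K1.clamp w1) (K2.clamp w2) (K2.clamp w2)" for w1 w2
  define H2 where "H2 w1 w2 = K2.N.term_fun (K2.clamp w2) (K1.clamp w1) (K1.clamp w1)" for w1 w2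
  note tame1 = K1.tame_between[OF K2.clamp_measurable K2.clamp_range] and tame2 = K2.tame_between[OF K1.clamp_measurable K1.clamp_range]
  obtain B1 where B1: "0 <= B1" "!!u b v. AE x in E1.M. \<bar>u x\<bar> <= C ==> K1.N.tame b ==> K1.N.tame v ==>
      AE x in E1.M. \<bar>K1.N.term_fun u b v x\<bar> <= B1" by (rule K1.N.term_fun_bounded) (rule that; blast)
  obtain B2 where B2: "0 <= B2" "!!u b v. AE x in E1.M. \<bar>u x\<bar> <= C ==> K2.N.tame b ==> K2.N.tame v ==>
      AE x in E1.M. \<bar>K2.N.term_fun u b v x\<bar> <= B2" by (rule K2.N.term_fun_bounded) (rule that; blast)
  have forcing: "E1.forcing (max B1 B2) (H1 w1 w2) & E1.forcing (max B1 B2) (H2 w1 w2)"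
    if "w1 \<in> borel_measurable E1.M" "w2 \<in> borel_measurable E1.M" for w1 w2
  proof -
    have "AE x in E1.M. \<bar>H1 w1 w2 x\<bar> <= max B1 B2" "AE x in E1.M. \<bar>H2 w1 w2 x\<bar> <= max B1 B2"
      using B1(2)[OF K1.clamp_bounded tame1[OF that(2)] tame1[OF that(2)], of w1]
        B2(2)[OF K2.clamp_bounded tame2[OF that(1)] tame2[OF that(1)], of w2]
      unfolding H1_def H2_def by (eventually_elim; simp add: le_max_iff_disj)+
    moreover have "H1 w1 w2 \<in> borel_measurable E1.M" "H2 w1 w2 \<in> borel_measurable E1.M"
      unfolding H1_def H2_def
      by (rule K1.N.term_fun_measurable[OF K1.clamp_measurable[OF that(1)] tame1[OF that(2)]]
          K2.N.term_fun_measurable[OF K2.clamp_measurable[OF that(2)] tame2[OF that(1)]])+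
    ultimately show ?thesis by (simp add: E1.forcing_def)
  qed
  interpret S: sobolev_pair \<Omega> p1 p2 pm1 P1 pm2 P2 H1 H2 "max B1 B2" "C + 1"
  proof (intro sobolev_pair.intro sobolev_pair_axioms.intro E1 E2 forcing)
    fix w1 w2 :: "nat => real^'n => real" and v1 v2
    assume wm: "!!k. w1 k \<in> borel_measurable E1.M" "!!k. w2 k \<in> borel_measurable E1.M"
      and vm: "v1 \<in> borel_measurable E1.M" "v2 \<in> borel_measurable E1.M"
      and lim: "AE x in E1.M. (%k. w1 k x) ----> v1 x" "AE x in E1.M. (%k. w2 k x) ----> v2 x"
    note c1 = K1.clamp_measurable[OF wm(1)] K1.clamp_bounded K1.clamp_measurable[OF vm(1)] K1.clamp_bounded
      and c2 = K2.clamp_measurable[OF wm(2)] K2.clamp_bounded K2.clamp_measurable[OF vm(2)] K2.clamp_bounded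
      and l = K1.clamp_tendsto[OF lim(1)] K2.clamp_tendsto[OF lim(2)]
    show "(%k. \<integral>x. \<bar>H1 (w1 k) (w2 k) x - H1 v1 v2 x\<bar> \<partial>E1.M) ----> 0 \<and>
      (%k. \<integral>x. \<bar>H2 (w1 k) (w2 k) x - H2 v1 v2 x\<bar> \<partial>E1.M) ----> 0"
      unfolding H1_def H2_def
      using K1.N.term_fun_L1_tendsto[OF c1 l tame1[OF wm(2)] tame1[OF vm(2)]]
        K2.N.term_fun_L1_tendsto[OF c2 l(2,1) tame2[OF wm(1)] tame2[OF vm(1)]] by blast
  qed (use B1(1) C in auto)
  obtain u1 G1 u2 G2 where u: "E1.minimizes (C + 1) (H1 u1 u2) u1 G1" "E2.minimizes (C + 1) (H2 u1 u2) u2 G2"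
    by (rule S.coupled_minimizers_exist)
  have um: "u1 \<in> borel_measurable E1.M" "u2 \<in> borel_measurable E1.M"
    by (rule E1.Lp_measurable[OF E1.S0D(1)[OF E1.minimizesD(3)[OF u(1)]]] E2.Lp_measurable[OF E2.S0D(1)[OF E2.minimizesD(3)[OF u(2)]]])+
  have B: "0 <= max B1 B2" using B1(1) by simp
  have f: "E1.forcing (max B1 B2) (K1.N.term_fun (K1.clamp u1) (K2.clamp u2) (K2.clamp u2))"
    "E1.forcing (max B1 B2) (K2.N.term_fun (K2.clamp u2) (K1.clamp u1) (K1.clamp u1))"
    using forcing[OF um] by (auto simp: H1_def H2_def)
  note a1 = K2.clamp_measurable[OF um(2)] K2.clamp_range B f(1) u(1)[unfolded H1_def]
    and a2 = K1.clamp_measurable[OF um(1)] K1.clamp_range B f(2) u(2)[unfolded H2_def]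
  have b: "AE x in E1.M. lo1 x <= u1 x" "AE x in E1.M. u1 x <= hi1 x"
    "AE x in E1.M. lo2 x <= u2 x" "AE x in E1.M. u2 x <= hi2 x"
    by (rule K1.lower_bound[OF a1] K1.upper_bound[OF a1] K2.lower_bound[OF a2] K2.upper_bound[OF a2])+
  \<comment> \<open>With the bounds at hand the truncations act as the identity, so the truncated
    equations are the original ones.\<close>
  have cl: "AE x in E1.M. K1.clamp u1 x = u1 x" "AE x in E1.M. K2.clamp u2 x = u2 x"
    using b by (eventually_elim; simp add: K1.clamp_def K2.clamp_def)+
  have "u1 \<in> W10 \<Omega> p1 \<inter> Linf \<Omega>" "u2 \<in> W10 \<Omega> p2 \<inter> Linf \<Omega>"
    using E1.minimizesD(3,4)[OF u(1)] E2.minimizesD(3,4)[OF u(2)] um by (auto simp: E1.W10_iff E2.W10_iff Linf_def)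
  with K1.solves[OF a1 um(2) cl(2)] K2.solves[OF a2 um(1) cl(1)]
  have "weak_solution \<Omega> p1 p2 q1 q2 r1 r2 s1 s2 \<alpha>1 \<alpha>2 \<gamma>1 \<gamma>2 f1 f2 g1 g2 A u1 u2"
    unfolding weak_solution_def by blast
  moreover have "AE x in E1.M. u1 x > 0 & u2 x > 0"
    using b(1,3) lo_pos by eventually_elim simp
  moreover have "AE x in E1.M. lo1 x <= u1 x & u1 x <= hi1 x & lo2 x <= u2 x & u2 x <= hi2 x"
    using b by eventually_elim simp
  ultimately show ?thesis by blast
qed

end
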